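(* Let $B\to M$ be a vector bundle with dual bundle $B^*$, and let $(B,M,\rho_0,S)$ and $(B^*,M,\rho_1,T)$ be two left symmetric algebroids which are Lie-extendible. Then the vector bundle $\Phi(B)=B\oplus B^*$, with anchor $\rho_0\oplus\rho_1$ (i.e. $X+\alpha\mapsto\rho_0(X)+\rho_1(\alpha)$), bracket $$[X+\alpha,Y+\beta]_\phi=[X,Y]_S+[\alpha,\beta]_T+T_\alpha^*Y-T_\beta^*X+S_X^*\beta-S_Y^*\alpha,\qquad X,Y\in\Gamma(B),\ \alpha,\beta\in\Gamma(B^* ),$$ pseudo-Riemannian metric $\langle X+\alpha,Y+\beta\rangle_0=\prec\alpha,Y\succ+\prec\beta,X\succ$ and endomorphism $K_0(X+\alpha)=X-\alpha$, is a para-Kähler Lie algebroid. Moreover, all para-Kähler Lie algebroids are obtained in this way: for every para-Kähler Lie algebroid over $M$ there exist a vector bundle $B\to M$ and two Lie-extendible left symmetric algebroids $(B,M,\rho_0,S)$ and $(B^*,M,\rho_1,T)$ such that the given para-Kähler Lie algebroid is isomorphic (by a vector bundle isomorphism over $\mathrm{id}_M$ respecting anchors, brackets, metrics and the endomorphisms $K$) to $B\oplus B^*$ endowed with the anchor $\rho_0\oplus\rho_1$, the bracket $[\,,]_\phi$ determined by $S$ and $T$ through the displayed formula, the metric $\langle\,,\rangle_0$ and the endomorphism $K_0$.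
   Context: All objects are smooth and real; $\prec\cdot,\cdot\succ$ is the pairing between a bundle and its dual. An anchored vector bundle $(A,M,\rho)$ is a vector bundle $A\to M$ with a bundle map $\rho:A\to TM$ over the identity. A Lie algebroid is an anchored vector bundle with a Lie bracket $[\,,]_A$ on $\Gamma(A)$ such that $[a,fb]_A=f[a,b]_A+\rho(a)(f)b$. A right-anchored product on $(A,M,\rho)$ is an $\mathbb R$-bilinear map $T:\Gamma(A)\times\Gamma(A)\to\Gamma(A)$, $(a,b)\mapsto T_ab$, with $T_{fa}b=fT_ab$ and $T_a(fb)=fT_ab+\rho(a)(f)b$. Its bracket is $[a,b]_T=T_ab-T_ba$ and its curvature is $R^T(a,b)c=T_aT_bc-T_bT_ac-T_{[a,b]_T}c$. $(A,M,\rho,T)$ is a left symmetric algebroid if $R^T=0$ identically (then $[\,,]_T$ is a Lie algebroid bracket with anchor $\rho$). For a right-anchored product $S$ on $(B,M,\rho_0)$ and $T$ on $(B^*,M,\rho_1)$, the duals are given by $\prec S_X^*\beta,Y\succ=\rho_0(X).\prec\beta,Y\succ-\prec\beta,S_XY\succ$ and $\prec\beta,T_\alpha^*X\succ=\rho_1(\alpha).\prec\beta,X\succ-\prec T_\alpha\beta,X\succ$. On $(B\oplus B^*,M,\rho_0\oplus\rho_1)$ let $\nabla$ be the right-anchored product $\nabla_{X+\alpha}(Y+\beta)=S_XY+T_\alpha^*Y+S_X^*\beta+T_\alpha\beta$, with curvature $R^\nabla$. The left symmetric algebroids $(B,M,\rho_0,S)$ and $(B^*,M,\rho_1,T)$ are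 called Lie-extendible (or compatible) if for all $X,Y\in\Gamma(B)$, $\alpha,\beta\in\Gamma(B^* )$: $R^\nabla(X,\alpha)Y=R^\nabla(Y,\alpha)X$ and $R^\nabla(\alpha,X)\beta=R^\nabla(\beta,X)\alpha$. A pseudo-Riemannian Lie algebroid is a Lie algebroid $(A,M,\rho,[\,,]_A)$ with a smooth nondegenerate symmetric bilinear form $\langle\,,\rangle$ (of constant signature) on the fibers of $A$. Its Levi-Civita $A$-connection $\nabla$ is the unique map $\Gamma(A)\times\Gamma(A)\to\Gamma(A)$ which is $C^\infty(M)$-linear in the first argument, satisfies $\nabla_a(fb)=f\nabla_ab+\rho(a)(f)b$, and satisfies $\rho(a).\langle b,c\rangle=\langle\nabla_ab,c\rangle+\langle b,\nabla_ac\rangle$ and $\nabla_ab-\nabla_ba=[a,b]_A$. A para-Kähler Lie algebroid is a pseudo-Riemannian Lie algebroid with a bundle isomorphism $K:A\to A$ such that $K^2=\mathrm{Id}_A$, $K$ is skew-symmetric with respect to $\langle\,,\rangle$, and $\nabla K=0$, i.e. $\nabla_a(Kb)=K\nabla_ab$. *)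

theory Defs
  imports "HOL-Analysis.Analysis" "HOL-Library.Function_Algebras"
begin

text \<open>
  Functions into a real vector space form a real vector space pointwise. It is needed because
  covectors and tangent vectors are functions here, and so that sections can be added.
\<close>

instantiation "fun" :: (type, scaleR) scaleR
begin
definition scaleR_fun :: "real \<Rightarrow> ('a \<Rightarrow> 'b) \<Rightarrow> 'a \<Rightarrow> 'b"
  where "scaleR_fun c f = (\<lambda>x. c *\<^sub>R f x)"
instance ..
end

instance "fun" :: (type, real_vector) real_vector
  by standard
    (simp_all add: scaleR_fun_def plus_fun_def fun_eq_iff scaleR_add_right scaleR_add_left)

section \<open>Smooth manifolds\<close>

text \<open>Only meant for open \<open>S\<close>: all iterated directional derivatives exist and are continuous.\<close>

primrec Ck_on :: "nat \<Rightarrow> 'a::real_normed_vector set \<Rightarrow> ('a \<Rightarrow> 'b::real_normed_vector) \<Rightarrow> bool" where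
  "Ck_on 0 = (\<lambda>S f. continuous_on S f)"
| "Ck_on (Suc k) = (\<lambda>S f. (\<forall>x\<in>S. f differentiable (at x)) \<and>
     (\<forall>v. Ck_on k S (\<lambda>x. frechet_derivative f (at x) v)))"

definition smooth_on :: "'a::real_normed_vector set \<Rightarrow> ('a \<Rightarrow> 'b::real_normed_vector) \<Rightarrow> bool"
  where "smooth_on S f \<longleftrightarrow> (\<forall>k. Ck_on k S f)"

type_synonym ('m, 'e) chart = "'m set \<times> ('m \<Rightarrow> 'e)"

record ('m, 'e) mfd =
  mtop :: "'m topology"
  atlas :: "('m, 'e) chart set"

abbreviation pts :: "('m, 'e) mfd \<Rightarrow> 'm set"
  where "pts M \<equiv> topspace (mtop M)"

text \<open>
  The model space is a finite-dimensional inner product space. The class \<open>euclidean_space\<close> would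
  exclude manifolds of dimension 0, hence Lie algebroids over a point.
\<close>

definition smooth_manifold :: "('m, 'e::real_inner) mfd \<Rightarrow> bool" where
  "smooth_manifold M \<longleftrightarrow>
     Hausdorff_space (mtop M) \<and> second_countable (mtop M) \<and>
     (\<exists>b. finite b \<and> span b = (UNIV :: 'e set)) \<and>
     (\<Union>(U, \<phi>)\<in>atlas M. U) = pts M \<and>
     (\<forall>(U, \<phi>)\<in>atlas M. openin (mtop M) U \<and> open (\<phi> ` U) \<and>
        homeomorphic_map (subtopology (mtop M) U) (top_of_set (\<phi> ` U)) \<phi>) \<and>
     (\<forall>(U, \<phi>)\<in>atlas M. \<forall>(V, \<psi>)\<in>atlas M.
        smooth_on (\<phi> ` (U \<inter> V)) (\<psi> \<circ> inv_into U \<phi>))"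

text \<open>Smooth real functions on an open subset \<open>W\<close>; the values outside \<open>W\<close> are irrelevant.\<close>

definition smooth_fun_on :: "('m, 'e::real_inner) mfd \<Rightarrow> 'm set \<Rightarrow> ('m \<Rightarrow> real) \<Rightarrow> bool" where
  "smooth_fun_on M W f \<longleftrightarrow>
     (\<forall>(U, \<phi>)\<in>atlas M. smooth_on (\<phi> ` (U \<inter> W)) (f \<circ> inv_into U \<phi>))"

definition smooth_fun :: "('m, 'e::real_inner) mfd \<Rightarrow> ('m \<Rightarrow> real) \<Rightarrow> bool" where
  "smooth_fun M f \<longleftrightarrow> smooth_fun_on M (pts M) f"

section \<open>Vector bundles\<close>

text \<open>
  A vector bundle is a family of vector spaces, the fibres, given as subspaces of one ambient real
  vector space \<open>'v\<close>. The ambient space carries no topology and plays no role for smoothness: the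
  smooth structure is given by the local trivialisations \<open>(U, \<phi>)\<close>, where \<open>\<phi> x\<close> is for \<open>x \<in> U\<close> a
  linear isomorphism from the fibre at \<open>x\<close> onto \<open>coord_space r\<close>, i.e. the space of \<open>r\<close>-tuples of
  reals, and whose transition matrices are smooth. (Every family of vector spaces can be put in
  this form, e.g. inside the direct sum of its members.)
\<close>

type_synonym ('m, 'v) triv = "'m set \<times> ('m \<Rightarrow> 'v \<Rightarrow> nat \<Rightarrow> real)"

record ('m, 'v) vbundle =
  vrank :: nat
  fib :: "'m \<Rightarrow> 'v set"
  trivs :: "('m, 'v) triv set"

definition coord_space :: "nat \<Rightarrow> (nat \<Rightarrow> real) set"
  where "coord_space r = {c. \<forall>i\<ge>r. c i = 0}"

definition unit_coord :: "nat \<Rightarrow> nat \<Rightarrow> real"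
  where "unit_coord j = (\<lambda>i. if i = j then 1 else 0)"

definition lin_on :: "'v::real_vector set \<Rightarrow> ('v \<Rightarrow> 'w::real_vector) \<Rightarrow> bool" where
  "lin_on S f \<longleftrightarrow> (\<forall>u\<in>S. \<forall>v\<in>S. f (u + v) = f u + f v) \<and> (\<forall>c. \<forall>u\<in>S. f (c *\<^sub>R u) = c *\<^sub>R f u)"

definition frame :: "('m, 'v) vbundle \<Rightarrow> ('m \<Rightarrow> 'v \<Rightarrow> nat \<Rightarrow> real) \<Rightarrow> nat \<Rightarrow> 'm \<Rightarrow> 'v"
  where "frame E \<phi> j x = inv_into (fib E x) (\<phi> x) (unit_coord j)"

definition vector_bundle ::
  "('m, 'e::real_inner) mfd \<Rightarrow> ('m, 'v::real_vector) vbundle \<Rightarrow> bool" where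
  "vector_bundle M E \<longleftrightarrow>
     (\<forall>x\<in>pts M. subspace (fib E x)) \<and>
     (\<Union>(U, \<phi>)\<in>trivs E. U) = pts M \<and>
     (\<forall>(U, \<phi>)\<in>trivs E. openin (mtop M) U \<and>
        (\<forall>x\<in>U. lin_on (fib E x) (\<phi> x) \<and> bij_betw (\<phi> x) (fib E x) (coord_space (vrank E)))) \<and>
     (\<forall>(U, \<phi>)\<in>trivs E. \<forall>(V, \<psi>)\<in>trivs E. \<forall>i<vrank E. \<forall>j<vrank E.
        smooth_fun_on M (U \<inter> V) (\<lambda>x. \<psi> x (frame E \<phi> j x) i))"

text \<open>
  Sections vanish outside the manifold, so that two sections are equal as functions iff they
  agree at all points of the manifold.
\<close>

definition sections ::
  "('m, 'e::real_inner) mfd \<Rightarrow> ('m, 'v::real_vector) vbundle \<Rightarrow> ('m \<Rightarrow> 'v) set" where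
  "sections M E = {s. (\<forall>x\<in>pts M. s x \<in> fib E x) \<and> (\<forall>x. x \<notin> pts M \<longrightarrow> s x = 0) \<and>
     (\<forall>(U, \<phi>)\<in>trivs E. \<forall>i<vrank E. smooth_fun_on M U (\<lambda>x. \<phi> x (s x) i))}"

definition fmult :: "('m \<Rightarrow> real) \<Rightarrow> ('m \<Rightarrow> 'v::real_vector) \<Rightarrow> 'm \<Rightarrow> 'v"  (infixr "\<odot>" 75)
  where "f \<odot> s = (\<lambda>x. f x *\<^sub>R s x)"

text \<open>Bundle maps are over the identity.\<close>

definition bundle_map :: "('m, 'e::real_inner) mfd \<Rightarrow> ('m, 'v::real_vector) vbundle \<Rightarrow>
    ('m, 'w::real_vector) vbundle \<Rightarrow> ('m \<Rightarrow> 'v \<Rightarrow> 'w) \<Rightarrow> bool" where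
  "bundle_map M E F h \<longleftrightarrow>
     (\<forall>x\<in>pts M. lin_on (fib E x) (h x) \<and> h x ` fib E x \<subseteq> fib F x) \<and>
     (\<forall>(U, \<phi>)\<in>trivs E. \<forall>(V, \<psi>)\<in>trivs F. \<forall>i<vrank F. \<forall>j<vrank E.
        smooth_fun_on M (U \<inter> V) (\<lambda>x. \<psi> x (h x (frame E \<phi> j x)) i))"

definition bundle_iso :: "('m, 'e::real_inner) mfd \<Rightarrow> ('m, 'v::real_vector) vbundle \<Rightarrow>
    ('m, 'w::real_vector) vbundle \<Rightarrow> ('m \<Rightarrow> 'v \<Rightarrow> 'w) \<Rightarrow> bool" where
  "bundle_iso M E F h \<longleftrightarrow> bundle_map M E F h \<and>
     (\<exists>k. bundle_map M F E k \<and> (\<forall>x\<in>pts M. (\<forall>v\<in>fib E x. k x (h x v) = v) \<and>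
                                           (\<forall>w\<in>fib F x. h x (k x w) = w)))"

definition on_sections ::
  "('m, 'e) mfd \<Rightarrow> ('m \<Rightarrow> 'v \<Rightarrow> 'w::zero) \<Rightarrow> ('m \<Rightarrow> 'v) \<Rightarrow> 'm \<Rightarrow> 'w" where
  "on_sections M h s = (\<lambda>x. if x \<in> pts M then h x (s x) else 0)"

text \<open>A covector at \<open>x\<close> is extended by \<open>0\<close> outside the fibre; the pairing is application.\<close>

definition dual_bundle :: "('m, 'v::real_vector) vbundle \<Rightarrow> ('m, 'v \<Rightarrow> real) vbundle" where
  "dual_bundle E =
     \<lparr> vrank = vrank E,
       fib = (\<lambda>x. {\<beta>. lin_on (fib E x) \<beta> \<and> (\<forall>v. v \<notin> fib E x \<longrightarrow> \<beta> v = 0)}),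
       trivs = (\<lambda>(U, \<phi>). (U, \<lambda>x \<beta> i. if i < vrank E then \<beta> (frame E \<phi> i x) else 0)) ` trivs E \<rparr>"

definition sum_bundle ::
  "('m, 'v::real_vector) vbundle \<Rightarrow> ('m, 'w::real_vector) vbundle \<Rightarrow> ('m, 'v \<times> 'w) vbundle" where
  "sum_bundle E F =
     \<lparr> vrank = vrank E + vrank F,
       fib = (\<lambda>x. fib E x \<times> fib F x),
       trivs = (\<lambda>((U, \<phi>), (V, \<psi>)).
          (U \<inter> V, \<lambda>x (v, w) i. if i < vrank E then \<phi> x v i else \<psi> x w (i - vrank E)))
          ` (trivs E \<times> trivs F) \<rparr>"

subsection \<open>The tangent bundle\<close>

text \<open>
  A tangent vector at \<open>x\<close> is a directional derivative operator on smooth functions, with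
  respect to some chart around \<open>x\<close>; by convention its value on non-smooth functions is \<open>0\<close>.
  Every chart and every basis \<open>b\<close> of the model space give a trivialisation: the components of a
  tangent vector with respect to the coordinate vector fields.
\<close>

definition dir_deriv ::
  "('m, 'e::real_inner) mfd \<Rightarrow> ('m, 'e) chart \<Rightarrow> 'm \<Rightarrow> 'e \<Rightarrow> ('m \<Rightarrow> real) \<Rightarrow> real" where
  "dir_deriv M = (\<lambda>(U, \<phi>) x w f.
     if smooth_fun M f then frechet_derivative (f \<circ> inv_into U \<phi>) (at (\<phi> x)) w else 0)"

definition tangent_bundle ::
  "('m, 'e::real_inner) mfd \<Rightarrow> ('m, ('m \<Rightarrow> real) \<Rightarrow> real) vbundle" where
  "tangent_bundle M =
     (let n = dim (UNIV :: 'e set) in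
     \<lparr> vrank = n,
       fib = (\<lambda>x. {dir_deriv M (U, \<phi>) x w | U \<phi> w. (U, \<phi>) \<in> atlas M \<and> x \<in> U}),
       trivs = {(U, \<lambda>x. inv_into (coord_space n) (\<lambda>c. dir_deriv M (U, \<phi>) x (\<Sum>i<n. c i *\<^sub>R b i)))
         | U \<phi> b. (U, \<phi>) \<in> atlas M \<and> inj_on b {..<n} \<and>
             independent (b ` {..<n}) \<and> span (b ` {..<n}) = UNIV} \<rparr>)"

section \<open>Lie algebroids and left symmetric algebroids\<close>

text \<open>
  For an anchor \<open>\<rho>\<close> and a section \<open>a\<close>, the function \<open>\<rho>(a)(f)\<close> is \<open>\<lambda>x. \<rho> x (a x) f\<close>, as tangent
  vectors act on functions by application.
\<close>

type_synonym ('m, 'v) anchor = "'m \<Rightarrow> 'v \<Rightarrow> ('m \<Rightarrow> real) \<Rightarrow> real"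

type_synonym ('m, 'v) product = "('m \<Rightarrow> 'v) \<Rightarrow> ('m \<Rightarrow> 'v) \<Rightarrow> 'm \<Rightarrow> 'v"

definition act :: "('m, 'v) anchor \<Rightarrow> ('m \<Rightarrow> 'v) \<Rightarrow> ('m \<Rightarrow> real) \<Rightarrow> 'm \<Rightarrow> real"
  where "act \<rho> a f = (\<lambda>x. \<rho> x (a x) f)"

definition anchored_bundle ::
  "('m, 'e::real_inner) mfd \<Rightarrow> ('m, 'v::real_vector) vbundle \<Rightarrow> ('m, 'v) anchor \<Rightarrow> bool" where
  "anchored_bundle M A \<rho> \<longleftrightarrow> vector_bundle M A \<and> bundle_map M A (tangent_bundle M) \<rho>"

definition bilinear_product ::
  "('m, 'e::real_inner) mfd \<Rightarrow> ('m, 'v::real_vector) vbundle \<Rightarrow> ('m, 'v) product \<Rightarrow> bool" where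
  "bilinear_product M A T \<longleftrightarrow>
     (\<forall>a\<in>sections M A. \<forall>b\<in>sections M A. T a b \<in> sections M A) \<and>
     (\<forall>a\<in>sections M A. lin_on (sections M A) (\<lambda>b. T a b)) \<and>
     (\<forall>b\<in>sections M A. lin_on (sections M A) (\<lambda>a. T a b))"

definition lie_algebroid :: "('m, 'e::real_inner) mfd \<Rightarrow> ('m, 'v::real_vector) vbundle \<Rightarrow>
    ('m, 'v) anchor \<Rightarrow> ('m, 'v) product \<Rightarrow> bool" where
  "lie_algebroid M A \<rho> br \<longleftrightarrow>
     anchored_bundle M A \<rho> \<and> bilinear_product M A br \<and>
     (\<forall>a\<in>sections M A. br a a = 0) \<and>
     (\<forall>a\<in>sections M A. \<forall>b\<in>sections M A. \<forall>c\<in>sections M A.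
        br a (br b c) + br b (br c a) + br c (br a b) = 0) \<and>
     (\<forall>a\<in>sections M A. \<forall>b\<in>sections M A. \<forall>f. smooth_fun M f \<longrightarrow>
        br a (f \<odot> b) = f \<odot> br a b + act \<rho> a f \<odot> b)"

definition right_anchored_product :: "('m, 'e::real_inner) mfd \<Rightarrow>
    ('m, 'v::real_vector) vbundle \<Rightarrow> ('m, 'v) anchor \<Rightarrow> ('m, 'v) product \<Rightarrow> bool" where
  "right_anchored_product M A \<rho> T \<longleftrightarrow>
     bilinear_product M A T \<and>
     (\<forall>a\<in>sections M A. \<forall>b\<in>sections M A. \<forall>f. smooth_fun M f \<longrightarrow>
        T (f \<odot> a) b = f \<odot> T a b \<and>
        T a (f \<odot> b) = f \<odot> T a b + act \<rho> a f \<odot> b)"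

definition bracket_of :: "('m, 'v::real_vector) product \<Rightarrow> ('m, 'v) product"
  where "bracket_of T a b = T a b - T b a"

definition curvature :: "('m, 'v::real_vector) product \<Rightarrow>
    ('m \<Rightarrow> 'v) \<Rightarrow> ('m \<Rightarrow> 'v) \<Rightarrow> ('m \<Rightarrow> 'v) \<Rightarrow> 'm \<Rightarrow> 'v"
  where "curvature T a b c = T a (T b c) - T b (T a c) - T (bracket_of T a b) c"

definition left_symmetric_algebroid :: "('m, 'e::real_inner) mfd \<Rightarrow>
    ('m, 'v::real_vector) vbundle \<Rightarrow> ('m, 'v) anchor \<Rightarrow> ('m, 'v) product \<Rightarrow> bool" where
  "left_symmetric_algebroid M A \<rho> T \<longleftrightarrow>
     anchored_bundle M A \<rho> \<and> right_anchored_product M A \<rho> T \<and>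
     (\<forall>a\<in>sections M A. \<forall>b\<in>sections M A. \<forall>c\<in>sections M A. curvature T a b c = 0)"

subsection \<open>Dual products and Lie-extendibility\<close>

definition pairing :: "('m \<Rightarrow> 'v \<Rightarrow> real) \<Rightarrow> ('m \<Rightarrow> 'v) \<Rightarrow> 'm \<Rightarrow> real"
  where "pairing \<beta> Y = (\<lambda>x. \<beta> x (Y x))"

text \<open>
  \<open>dual_left M B \<rho>\<^sub>0 S X \<beta>\<close> is the section \<open>S\<^sup>*\<^sub>X \<beta>\<close> of the dual bundle and
  \<open>dual_right M B \<rho>\<^sub>1 T \<alpha> X\<close> is the section \<open>T\<^sup>*\<^sub>\<alpha> X\<close> of \<open>B\<close>.
\<close>

definition dual_left :: "('m, 'e::real_inner) mfd \<Rightarrow> ('m, 'v::real_vector) vbundle \<Rightarrow>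
    ('m, 'v) anchor \<Rightarrow> ('m, 'v) product \<Rightarrow>
    ('m \<Rightarrow> 'v) \<Rightarrow> ('m \<Rightarrow> 'v \<Rightarrow> real) \<Rightarrow> 'm \<Rightarrow> 'v \<Rightarrow> real" where
  "dual_left M B \<rho>\<^sub>0 S X \<beta> = (THE \<gamma>. \<gamma> \<in> sections M (dual_bundle B) \<and>
     (\<forall>Y\<in>sections M B. \<forall>x\<in>pts M.
        pairing \<gamma> Y x = act \<rho>\<^sub>0 X (pairing \<beta> Y) x - pairing \<beta> (S X Y) x))"

definition dual_right :: "('m, 'e::real_inner) mfd \<Rightarrow> ('m, 'v::real_vector) vbundle \<Rightarrow>
    ('m, 'v \<Rightarrow> real) anchor \<Rightarrow> ('m, 'v \<Rightarrow> real) product \<Rightarrow>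
    ('m \<Rightarrow> 'v \<Rightarrow> real) \<Rightarrow> ('m \<Rightarrow> 'v) \<Rightarrow> 'm \<Rightarrow> 'v" where
  "dual_right M B \<rho>\<^sub>1 T \<alpha> X = (THE Z. Z \<in> sections M B \<and>
     (\<forall>\<beta>\<in>sections M (dual_bundle B). \<forall>x\<in>pts M.
        pairing \<beta> Z x = act \<rho>\<^sub>1 \<alpha> (pairing \<beta> X) x - pairing (T \<alpha> \<beta>) X x))"

text \<open>The section \<open>X + \<alpha>\<close> of \<open>B \<oplus> B\<^sup>*\<close>.\<close>

definition join :: "('m \<Rightarrow> 'v) \<Rightarrow> ('m \<Rightarrow> 'w) \<Rightarrow> 'm \<Rightarrow> 'v \<times> 'w"
  where "join X \<alpha> = (\<lambda>x. (X x, \<alpha> x))"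

definition phi_bundle :: "('m, 'v::real_vector) vbundle \<Rightarrow> ('m, 'v \<times> ('v \<Rightarrow> real)) vbundle"
  where "phi_bundle B = sum_bundle B (dual_bundle B)"

definition phi_anchor ::
  "('m, 'v) anchor \<Rightarrow> ('m, 'v \<Rightarrow> real) anchor \<Rightarrow> ('m, 'v \<times> ('v \<Rightarrow> real)) anchor" where
  "phi_anchor \<rho>\<^sub>0 \<rho>\<^sub>1 x = (\<lambda>(v, \<alpha>). \<rho>\<^sub>0 x v + \<rho>\<^sub>1 x \<alpha>)"

definition phi_connection :: "('m, 'e::real_inner) mfd \<Rightarrow> ('m, 'v::real_vector) vbundle \<Rightarrow>
    ('m, 'v) anchor \<Rightarrow> ('m, 'v) product \<Rightarrow>
    ('m, 'v \<Rightarrow> real) anchor \<Rightarrow> ('m, 'v \<Rightarrow> real) product \<Rightarrow>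
    ('m, 'v \<times> ('v \<Rightarrow> real)) product" where
  "phi_connection M B \<rho>\<^sub>0 S \<rho>\<^sub>1 T s t =
     (let X = fst \<circ> s; \<alpha> = snd \<circ> s; Y = fst \<circ> t; \<beta> = snd \<circ> t in
      join (S X Y + dual_right M B \<rho>\<^sub>1 T \<alpha> Y) (dual_left M B \<rho>\<^sub>0 S X \<beta> + T \<alpha> \<beta>))"

definition phi_bracket :: "('m, 'e::real_inner) mfd \<Rightarrow> ('m, 'v::real_vector) vbundle \<Rightarrow>
    ('m, 'v) anchor \<Rightarrow> ('m, 'v) product \<Rightarrow>
    ('m, 'v \<Rightarrow> real) anchor \<Rightarrow> ('m, 'v \<Rightarrow> real) product \<Rightarrow>
    ('m, 'v \<times> ('v \<Rightarrow> real)) product" where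
  "phi_bracket M B \<rho>\<^sub>0 S \<rho>\<^sub>1 T s t =
     (let X = fst \<circ> s; \<alpha> = snd \<circ> s; Y = fst \<circ> t; \<beta> = snd \<circ> t in
      join (bracket_of S X Y + dual_right M B \<rho>\<^sub>1 T \<alpha> Y - dual_right M B \<rho>\<^sub>1 T \<beta> X)
           (bracket_of T \<alpha> \<beta> + dual_left M B \<rho>\<^sub>0 S X \<beta> - dual_left M B \<rho>\<^sub>0 S Y \<alpha>))"

definition phi_metric ::
  "'m \<Rightarrow> 'v \<times> ('v \<Rightarrow> real) \<Rightarrow> 'v \<times> ('v \<Rightarrow> real) \<Rightarrow> real" where
  "phi_metric x = (\<lambda>(v, \<alpha>) (w, \<beta>). \<alpha> w + \<beta> v)"

definition phi_K :: "'m \<Rightarrow> 'v \<times> ('v \<Rightarrow> real) \<Rightarrow> 'v \<times> ('v \<Rightarrow> real)" where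
  "phi_K x = (\<lambda>(v, \<alpha>). (v, - \<alpha>))"

definition lie_extendible :: "('m, 'e::real_inner) mfd \<Rightarrow> ('m, 'v::real_vector) vbundle \<Rightarrow>
    ('m, 'v) anchor \<Rightarrow> ('m, 'v) product \<Rightarrow>
    ('m, 'v \<Rightarrow> real) anchor \<Rightarrow> ('m, 'v \<Rightarrow> real) product \<Rightarrow> bool" where
  "lie_extendible M B \<rho>\<^sub>0 S \<rho>\<^sub>1 T \<longleftrightarrow>
     left_symmetric_algebroid M B \<rho>\<^sub>0 S \<and>
     left_symmetric_algebroid M (dual_bundle B) \<rho>\<^sub>1 T \<and>
     (let R = curvature (phi_connection M B \<rho>\<^sub>0 S \<rho>\<^sub>1 T) in
       (\<forall>X\<in>sections M B. \<forall>Y\<in>sections M B. \<forall>\<alpha>\<in>sections M (dual_bundle B).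
          R (join X 0) (join 0 \<alpha>) (join Y 0) = R (join Y 0) (join 0 \<alpha>) (join X 0)) \<and>
       (\<forall>X\<in>sections M B. \<forall>\<alpha>\<in>sections M (dual_bundle B). \<forall>\<beta>\<in>sections M (dual_bundle B).
          R (join 0 \<alpha>) (join X 0) (join 0 \<beta>) = R (join 0 \<beta>) (join X 0) (join 0 \<alpha>)))"

section \<open>Para-Kaehler Lie algebroids\<close>

text \<open>
  The last clause says that the signature is \<open>(p, r - p)\<close> at every point, \<open>r\<close> being the rank: the
  \<open>e i\<close> form an orthonormal basis of the fibre with \<open>p\<close> vectors of square \<open>1\<close>.
\<close>

definition pseudo_metric :: "('m, 'e::real_inner) mfd \<Rightarrow> ('m, 'v::real_vector) vbundle \<Rightarrow>
    ('m \<Rightarrow> 'v \<Rightarrow> 'v \<Rightarrow> real) \<Rightarrow> bool" where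
  "pseudo_metric M A g \<longleftrightarrow>
     (\<forall>x\<in>pts M.
        (\<forall>u\<in>fib A x. lin_on (fib A x) (g x u)) \<and>
        (\<forall>u\<in>fib A x. \<forall>v\<in>fib A x. g x u v = g x v u) \<and>
        (\<forall>u\<in>fib A x. (\<forall>v\<in>fib A x. g x u v = 0) \<longrightarrow> u = 0)) \<and>
     (\<forall>(U, \<phi>)\<in>trivs A. \<forall>i<vrank A. \<forall>j<vrank A.
        smooth_fun_on M U (\<lambda>x. g x (frame A \<phi> i x) (frame A \<phi> j x))) \<and>
     (\<exists>p\<le>vrank A. \<forall>x\<in>pts M. \<exists>e. (\<forall>i<vrank A. e i \<in> fib A x) \<and>
        (\<forall>i<vrank A. \<forall>j<vrank A.
           g x (e i) (e j) = (if i \<noteq> j then 0 else if i < p then 1 else - 1)))"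

definition levi_civita :: "('m, 'e::real_inner) mfd \<Rightarrow> ('m, 'v::real_vector) vbundle \<Rightarrow>
    ('m, 'v) anchor \<Rightarrow> ('m, 'v) product \<Rightarrow> ('m \<Rightarrow> 'v \<Rightarrow> 'v \<Rightarrow> real) \<Rightarrow>
    ('m, 'v) product \<Rightarrow> bool" where
  "levi_civita M A \<rho> br g D \<longleftrightarrow>
     right_anchored_product M A \<rho> D \<and>
     (\<forall>a\<in>sections M A. \<forall>b\<in>sections M A. \<forall>c\<in>sections M A. \<forall>x\<in>pts M.
        act \<rho> a (\<lambda>y. g y (b y) (c y)) x = g x (D a b x) (c x) + g x (b x) (D a c x)) \<and>
     (\<forall>a\<in>sections M A. \<forall>b\<in>sections M A. bracket_of D a b = br a b)"

text \<open>
  The predicate \<open>levi_civita\<close> determines \<open>D\<close> on sections only; the last clause below says that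
  the Levi-Civita connection, which exists and is unique on sections, makes \<open>K\<close> parallel.
\<close>

definition para_kaehler :: "('m, 'e::real_inner) mfd \<Rightarrow> ('m, 'v::real_vector) vbundle \<Rightarrow>
    ('m, 'v) anchor \<Rightarrow> ('m, 'v) product \<Rightarrow> ('m \<Rightarrow> 'v \<Rightarrow> 'v \<Rightarrow> real) \<Rightarrow>
    ('m \<Rightarrow> 'v \<Rightarrow> 'v) \<Rightarrow> bool" where
  "para_kaehler M A \<rho> br g K \<longleftrightarrow>
     lie_algebroid M A \<rho> br \<and> pseudo_metric M A g \<and> bundle_iso M A A K \<and>
     (\<forall>x\<in>pts M. (\<forall>u\<in>fib A x. K x (K x u) = u) \<and>
        (\<forall>u\<in>fib A x. \<forall>v\<in>fib A x. g x (K x u) v = - g x u (K x v))) \<and>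
     (\<exists>D. levi_civita M A \<rho> br g D \<and>
        (\<forall>a\<in>sections M A. \<forall>b\<in>sections M A.
           D a (on_sections M K b) = on_sections M K (D a b)))"

definition para_kaehler_iso :: "('m, 'e::real_inner) mfd \<Rightarrow>
    ('m, 'v::real_vector) vbundle \<Rightarrow> ('m, 'v) anchor \<Rightarrow> ('m, 'v) product \<Rightarrow>
    ('m \<Rightarrow> 'v \<Rightarrow> 'v \<Rightarrow> real) \<Rightarrow> ('m \<Rightarrow> 'v \<Rightarrow> 'v) \<Rightarrow>
    ('m, 'w::real_vector) vbundle \<Rightarrow> ('m, 'w) anchor \<Rightarrow> ('m, 'w) product \<Rightarrow>
    ('m \<Rightarrow> 'w \<Rightarrow> 'w \<Rightarrow> real) \<Rightarrow> ('m \<Rightarrow> 'w \<Rightarrow> 'w) \<Rightarrow> ('m \<Rightarrow> 'v \<Rightarrow> 'w) \<Rightarrow> bool" where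
  "para_kaehler_iso M A \<rho> br g K A' \<rho>' br' g' K' h \<longleftrightarrow>
     bundle_iso M A A' h \<and>
     (\<forall>x\<in>pts M. \<forall>u\<in>fib A x. \<rho>' x (h x u) = \<rho> x u) \<and>
     (\<forall>a\<in>sections M A. \<forall>b\<in>sections M A.
        on_sections M h (br a b) = br' (on_sections M h a) (on_sections M h b)) \<and>
     (\<forall>x\<in>pts M. \<forall>u\<in>fib A x. \<forall>v\<in>fib A x. g' x (h x u) (h x v) = g x u v) \<and>
     (\<forall>x\<in>pts M. \<forall>u\<in>fib A x. h x (K x u) = K' x (h x u))"

end

theory Submission
  imports Defs
begin

text \<open>
  The connection \<open>\<nabla>\<close> of a pair \<open>(S, T)\<close> is torsion-free for \<open>[\<cdot>,\<cdot>]\<^sub>\<phi>\<close> and preserves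
  \<open>\<langle>\<cdot>,\<cdot>\<rangle>\<^sub>0\<close> and \<open>K\<^sub>0\<close>, so it is the Levi-Civita connection as soon as the bracket satisfies the Jacobi
  identity. By the Bianchi identity the latter says that the cyclic sums of the curvature of \<open>\<nabla>\<close> vanish:
  those with arguments in one summand do because \<open>S\<close> and \<open>T\<close> are flat, the mixed ones because \<open>S\<^sup>*\<close> and
  \<open>T\<^sup>*\<close> are flat as well and because of compatibility.

  Conversely, let \<open>D\<close> be the Levi-Civita connection of a para-Kaehler Lie algebroid. The eigenbundles \<open>B\<close>
  and \<open>C\<close> of \<open>K\<close> for \<open>1\<close> and \<open>- 1\<close> are isotropic and preserved by \<open>D\<close>, and the metric identifies
  \<open>C\<close> with \<open>B\<^sup>*\<close>; \<open>S\<close> and \<open>T\<close> are the restrictions of \<open>D\<close>. For \<open>X, Y\<close> in \<open>B\<close> and \<open>\<alpha>\<close> in \<open>C\<close>, the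
  component in \<open>C\<close> of the Bianchi identity reads \<open>R(X, Y)\<alpha> = 0\<close>, its component in \<open>B\<close> is the compatibility
  condition, and \<open>R(X, Y)Z = 0\<close> follows as \<open>R(X, Y)\<close> is skew-symmetric.

  Tangent vectors and products act on global objects only. Bump functions extend local functions and
  frames, so that everything can be computed with global sections.
\<close>

section \<open>Calculus of \<open>C\<^sup>k\<close> functions\<close>

text \<open>The delicate point in both directions is that the curvature be skew for the metric.
  Differentiating <c, d> twice shows that R(a, b) is skew only up to the anchor defect rho(a) rho(b)
  f - rho(b) rho(a) f - rho([a, b]) f at f = <c, d>. For a Lie algebroid the defect is killed by
  Jacobi and Leibniz. For a Lie-extendible pair Jacobi is the goal, so the defect has to be removed
  by flatness itself, comparing R(a, b)(f c) with f R(a, b) c.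

  In the converse the eigenbundles of K must be shown to have constant rank over a base that need
  not be connected. Here the metric helps: both eigenspaces are isotropic and paired
  nondegenerately, so each has half the rank at every point.

  The duals of S and T are given by definite descriptions, so the sections they describe have to be
  produced: a function-linear functional on sections depends on values at single points only and
  hence comes from a section of the dual.\<close>

lemma Ck_on_SucI:
  fixes f :: "'a::real_normed_vector \<Rightarrow> 'b::real_normed_vector"
  assumes "open S" and "\<And>x. x \<in> S \<Longrightarrow> (f has_derivative D x) (at x)"
    and "\<And>v. Ck_on k S (\<lambda>x. D x v)"
    and cong: "\<And>f g :: 'a \<Rightarrow> 'b. (\<And>x. x \<in> S \<Longrightarrow> f x = g x) \<Longrightarrow> Ck_on k S f \<Longrightarrow> Ck_on k S g"
  shows "Ck_on (Suc k) S f"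
  unfolding Ck_on.simps
proof (intro conjI ballI allI)
  show "f differentiable at x" if "x \<in> S" for x
    using assms(2)[OF that] by (rule differentiableI)
  show "Ck_on k S (\<lambda>x. frechet_derivative f (at x) v)" for v
    by (rule cong[OF _ assms(3)[of v]]) (metis assms(2) frechet_derivative_at)
qed

text \<open>The derivatives of f and g agree on the open set S only, so the statement at level k is
  again required for them. It is handed to \<open>Ck_on_SucI\<close> as the hypothesis
  \<open>cong\<close>.\<close>

lemma Ck_on_cong:
  assumes "open S" "\<And>x. x \<in> S \<Longrightarrow> f x = g x" "Ck_on k S f"
  shows "Ck_on k S g"
  using assms(2,3)
proof (induction k arbitrary: f g)
  case 0
  then show ?case using continuous_on_cong[of S S f g] by simp
next
  case (Suc k)
  show ?case
  proof (rule Ck_on_SucI[OF \<open>open S\<close>, where D = "\<lambda>x. frechet_derivative f (at x)"])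
    fix x assume "x \<in> S"
    then have "(f has_derivative frechet_derivative f (at x)) (at x)"
      using Suc.prems(2) frechet_derivative_works by auto
    then show "(g has_derivative frechet_derivative f (at x)) (at x)"
      by (rule has_derivative_transform_within_open[OF _ \<open>open S\<close> \<open>x \<in> S\<close> Suc.prems(1)])
  qed (use Suc in auto)
qed

text \<open>The working form of the successor step: any explicit formula for the derivative on S may
  stand in for \<open>frechet_derivative\<close>.\<close>

lemma Ck_on_Suc_hasD:
  assumes "open S" and "\<And>x. x \<in> S \<Longrightarrow> (f has_derivative D x) (at x)"
    and "\<And>v. Ck_on k S (\<lambda>x. D x v)"
  shows "Ck_on (Suc k) S f"
  by (rule Ck_on_SucI[OF assms]) (use Ck_on_cong[OF \<open>open S\<close>] in blast)+

lemma Ck_on_SucD: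
  assumes "Ck_on (Suc k) S f" shows "Ck_on k S f"
  using assms
proof (induction k arbitrary: f)
  case 0
  then show ?case
    by (auto intro!: continuous_at_imp_continuous_on differentiable_imp_continuous_within)
qed simp

lemma Ck_on_subset:
  assumes "Ck_on k T f" "S \<subseteq> T" shows "Ck_on k S f"
  using assms by (induction k arbitrary: f) (auto intro: continuous_on_subset)

lemma Ck_on_local:
  assumes "\<And>x. x \<in> S \<Longrightarrow> \<exists>T. open T \<and> x \<in> T \<and> Ck_on k T f"
  shows "Ck_on k S f"
  using assms
proof (induction k arbitrary: f)
  case 0
  then show ?case
    by (auto intro!: continuous_at_imp_continuous_on) (metis continuous_on_eq_continuous_at)
next
  case (Suc k)
  then show ?case by simp metis
qed

lemma Ck_on_const: "Ck_on k S (\<lambda>x. c)"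
  by (induction k arbitrary: c) auto

lemma Ck_on_differentiable:
  assumes "Ck_on (Suc k) S f" "x \<in> S"
  shows "(f has_derivative frechet_derivative f (at x)) (at x)"
  using assms frechet_derivative_works by auto

lemma Ck_on_add:
  assumes "open S" "Ck_on k S f" "Ck_on k S g"
  shows "Ck_on k S (\<lambda>x. f x + g x)"
  using assms(2,3)
proof (induction k arbitrary: f g)
  case 0
  then show ?case by (simp add: continuous_on_add)
next
  case (Suc k)
  show ?case
    by (rule Ck_on_Suc_hasD[OF \<open>open S\<close>
          has_derivative_add[OF Ck_on_differentiable[OF Suc.prems(1)] Ck_on_differentiable[OF Suc.prems(2)]]])
      (use Suc in auto)
qed

lemma Ck_on_inner_const:
  assumes "open S" "Ck_on k S f"
  shows "Ck_on k S (\<lambda>x. f x \<bullet> b)"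
  using assms(2)
proof (induction k arbitrary: f)
  case 0
  then show ?case by (auto intro: continuous_intros)
next
  case (Suc k)
  show ?case
    by (rule Ck_on_Suc_hasD[OF \<open>open S\<close>
          has_derivative_inner_left[OF Ck_on_differentiable[OF Suc.prems(1)]]])
      (use Suc in auto)
qed

lemma Ck_on_mult:
  fixes f g :: "'a::real_normed_vector \<Rightarrow> real"
  assumes "open S" "Ck_on k S f" "Ck_on k S g"
  shows "Ck_on k S (\<lambda>x. f x * g x)"
  using assms(2,3)
proof (induction k arbitrary: f g)
  case 0
  then show ?case by (auto intro: continuous_intros)
next
  case (Suc k)
  show ?case
    by (rule Ck_on_Suc_hasD[OF \<open>open S\<close>
          has_derivative_mult[OF Ck_on_differentiable[OF Suc.prems(1)] Ck_on_differentiable[OF Suc.prems(2)]]])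
      (assumption, assumption, intro Ck_on_add[OF \<open>open S\<close>] Suc.IH Ck_on_SucD[OF Suc.prems(1)]
        Ck_on_SucD[OF Suc.prems(2)], use Suc.prems in auto)
qed

text \<open>The derivative of 1/f is - (1/f) f' (1/f), which involves the reciprocal of the same f
  one level lower; f therefore stays fixed in the induction.\<close>

lemma Ck_on_inverse:
  fixes f :: "'a::real_normed_vector \<Rightarrow> real"
  assumes "open S" "Ck_on k S f" "\<And>x. x \<in> S \<Longrightarrow> f x \<noteq> 0"
  shows "Ck_on k S (\<lambda>x. inverse (f x))"
  using assms(2)
proof (induction k)
  case 0
  then show ?case using assms(3) by (auto intro: continuous_intros)
next
  case (Suc k)
  have "((\<lambda>x. inverse (f x)) has_derivative
          (\<lambda>h. (- 1) * (inverse (f x) * frechet_derivative f (at x) h * inverse (f x)))) (at x)"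
    if "x \<in> S" for x
    using Deriv.has_derivative_inverse[OF _ Ck_on_differentiable[OF Suc.prems that]] assms(3)[OF that] by simp
  then show ?case
    by (rule Ck_on_Suc_hasD[OF \<open>open S\<close>])
      (assumption, intro Ck_on_mult[OF \<open>open S\<close>] Ck_on_const Suc.IH Ck_on_SucD[OF Suc.prems], use Suc.prems in auto)
qed

lemma Ck_on_sum:
  fixes f :: "'i \<Rightarrow> 'a::real_normed_vector \<Rightarrow> real"
  assumes "open S" "\<And>i. i \<in> I \<Longrightarrow> Ck_on k S (f i)"
  shows "Ck_on k S (\<lambda>x. \<Sum>i\<in>I. f i x)"
  using assms(2)
  by (induction I rule: infinite_finite_induct) (auto intro: Ck_on_const Ck_on_add[OF \<open>open S\<close>])

text \<open>The basis of the intermediate space writes the derivative of \<open>g \<circ> f\<close> as a finite sum of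
  products, which the induction on \<open>k\<close> can deal with.\<close>

lemma Ck_on_compose:
  fixes g :: "'b::real_inner \<Rightarrow> real"
  assumes bas: "finite Bs" "\<And>v::'b. v = (\<Sum>b\<in>Bs. (v \<bullet> b) *\<^sub>R b)"
    and "open S" "f ` S \<subseteq> T" "Ck_on k S f" "Ck_on k T g"
  shows "Ck_on k S (\<lambda>x. g (f x))"
  using assms(5,6)
proof (induction k arbitrary: g)
  case 0
  then show ?case using assms(4) by (auto intro: continuous_on_compose2)
next
  case (Suc k)
  let ?f' = "\<lambda>x. frechet_derivative f (at x)" and ?g' = "\<lambda>x. frechet_derivative g (at x)"
  have "((\<lambda>x. g (f x)) has_derivative (\<lambda>v. \<Sum>b\<in>Bs. (?f' x v \<bullet> b) * ?g' (f x) b)) (at x)"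
    if "x \<in> S" for x
  proof -
    have f: "(f has_derivative ?f' x) (at x)" and g: "(g has_derivative ?g' (f x)) (at (f x))"
      using Ck_on_differentiable[OF Suc.prems(1) that] Ck_on_differentiable[OF Suc.prems(2)]
        assms(4) that by auto
    have lin: "linear (?g' (f x))"
      using g by (rule has_derivative_linear)
    have eq: "?g' (f x) w = (\<Sum>b\<in>Bs. (w \<bullet> b) * ?g' (f x) b)" for w
    proof -
      have "?g' (f x) w = ?g' (f x) (\<Sum>b\<in>Bs. (w \<bullet> b) *\<^sub>R b)"
        by (rule arg_cong[OF bas(2)])
      also have "\<dots> = (\<Sum>b\<in>Bs. (w \<bullet> b) * ?g' (f x) b)"
        by (simp add: linear_sum[OF lin] linear_cmul[OF lin])
      finally show ?thesis .
    qed
    have *: "(\<lambda>v. ?g' (f x) (?f' x v)) = (\<lambda>v. \<Sum>b\<in>Bs. (?f' x v \<bullet> b) * ?g' (f x) b)"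
      by (rule ext) (rule eq)
    show ?thesis
      using has_derivative_compose[OF f g] by (simp only: *)
  qed
  then show ?case
  proof (rule Ck_on_Suc_hasD[OF \<open>open S\<close>])
    have fk: "Ck_on k S f" using Suc.prems(1) by (rule Ck_on_SucD)
    show "Ck_on k S (\<lambda>x. \<Sum>b\<in>Bs. (?f' x v \<bullet> b) * ?g' (f x) b)" for v
      by (intro Ck_on_sum Ck_on_mult Ck_on_inner_const \<open>open S\<close> Suc.IH fk) (use Suc.prems in auto)
  qed
qed

section \<open>Smooth functions on open sets of normed spaces\<close>

lemma smooth_on_compose:
  fixes g :: "'b::real_inner \<Rightarrow> real"
  assumes "finite Bs" "\<And>v::'b. v = (\<Sum>b\<in>Bs. (v \<bullet> b) *\<^sub>R b)"
    and "open S" "f ` S \<subseteq> T" "smooth_on S f" "smooth_on T g"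
  shows "smooth_on S (\<lambda>x. g (f x))"
  unfolding smooth_on_def
proof
  show "Ck_on k S (\<lambda>x. g (f x))" for k
    by (rule Ck_on_compose[OF assms(1-4)]) (use assms(5,6) smooth_on_def in blast)+
qed

lemma smooth_on_const: "smooth_on S (\<lambda>x. c)"
  by (simp add: smooth_on_def Ck_on_const)

lemma smooth_on_cong:
  assumes "open S" "\<And>x. x \<in> S \<Longrightarrow> f x = g x" "smooth_on S f"
  shows "smooth_on S g"
  using assms unfolding smooth_on_def by (meson Ck_on_cong)

lemma smooth_on_subset: "smooth_on T f \<Longrightarrow> S \<subseteq> T \<Longrightarrow> smooth_on S f"
  unfolding smooth_on_def by (meson Ck_on_subset)

lemma smooth_on_local:
  assumes "\<And>x. x \<in> S \<Longrightarrow> \<exists>T. open T \<and> x \<in> T \<and> smooth_on T f"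
  shows "smooth_on S f"
  using assms unfolding smooth_on_def by (meson Ck_on_local)

lemma smooth_on_add:
  "open S \<Longrightarrow> smooth_on S f \<Longrightarrow> smooth_on S g \<Longrightarrow> smooth_on S (\<lambda>x. f x + g x)"
  unfolding smooth_on_def by (simp add: Ck_on_add)

lemma smooth_on_mult:
  fixes f g :: "'a::real_normed_vector \<Rightarrow> real"
  shows "open S \<Longrightarrow> smooth_on S f \<Longrightarrow> smooth_on S g \<Longrightarrow> smooth_on S (\<lambda>x. f x * g x)"
  unfolding smooth_on_def by (simp add: Ck_on_mult)

lemma smooth_on_inverse:
  fixes f :: "'a::real_normed_vector \<Rightarrow> real"
  shows "open S \<Longrightarrow> smooth_on S f \<Longrightarrow> (\<And>x. x \<in> S \<Longrightarrow> f x \<noteq> 0) \<Longrightarrow> smooth_on S (\<lambda>x. inverse (f x))"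
  unfolding smooth_on_def by (simp add: Ck_on_inverse)

lemma smooth_on_derivative:
  "smooth_on S f \<Longrightarrow> smooth_on S (\<lambda>x. frechet_derivative f (at x) v)"
  unfolding smooth_on_def using Ck_on.simps(2) by metis

lemma smooth_on_has_derivative:
  "smooth_on S f \<Longrightarrow> x \<in> S \<Longrightarrow> (f has_derivative frechet_derivative f (at x)) (at x)"
  unfolding smooth_on_def using Ck_on_differentiable by metis

text \<open>A derivative of class k makes f of class k + 1; stepping down by one order treats k = 0
  like all other k.\<close>

lemma smooth_on_hasD:
  assumes "open S" and "\<And>x. x \<in> S \<Longrightarrow> (f has_derivative D x) (at x)"
    and "\<And>v. smooth_on S (\<lambda>x. D x v)"
  shows "smooth_on S f"
  unfolding smooth_on_def
proof
  fix k
  have D: "Ck_on k S (\<lambda>x. D x v)" for v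
    using assms(3) by (simp add: smooth_on_def)
  show "Ck_on k S f"
    by (rule Ck_on_SucD, rule Ck_on_Suc_hasD[OF assms(1,2) D])
qed

lemma smooth_on_inner: "open S \<Longrightarrow> smooth_on S (\<lambda>y. (y - y0) \<bullet> w)"
  by (rule smooth_on_hasD[where D = "\<lambda>_ v. v \<bullet> w"])
    (auto intro!: derivative_eq_intros smooth_on_const)

lemma smooth_on_norm_square:
  assumes "open S" shows "smooth_on S (\<lambda>y. (y - y0) \<bullet> (y - y0))"
proof (rule smooth_on_hasD[where D = "\<lambda>x v. 2 * ((x - y0) \<bullet> v)", OF assms])
  show "((\<lambda>y. (y - y0) \<bullet> (y - y0)) has_derivative (\<lambda>v. 2 * ((x - y0) \<bullet> v))) (at x)" for x
    by (auto intro!: derivative_eq_intros simp: inner_commute)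
  show "smooth_on S (\<lambda>x. 2 * ((x - y0) \<bullet> v))" for v
    by (intro smooth_on_mult smooth_on_const smooth_on_inner assms)
qed

subsection \<open>A smooth plateau function\<close>

text \<open>The family is closed under differentiation up to linear combinations, which makes all its
  members smooth by induction.\<close>

definition flat_fun :: "nat \<Rightarrow> real \<Rightarrow> real"
  where "flat_fun k t = (if t \<le> 0 then 0 else inverse t ^ k * exp (- inverse t))"

text \<open>With u = 1/t the limit from the right is the decay of u^k / exp u at infinity; from the
  left the function is constantly 0.\<close>

lemma flat_fun_tendsto_0: "(flat_fun k \<longlongrightarrow> 0) (at 0)"
proof -
  have "((\<lambda>u::real. u ^ k / exp u) \<longlongrightarrow> 0) at_top"
    by (rule tendsto_power_div_exp_0)
  then have "((\<lambda>t::real. inverse t ^ k / exp (inverse t)) \<longlongrightarrow> 0) (at_right 0)"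
    by (rule filterlim_compose[OF _ filterlim_inverse_at_top_right])
  then have "(flat_fun k \<longlongrightarrow> 0) (at_right 0)"
    by (rule Lim_transform_eventually)
      (auto simp: flat_fun_def exp_minus field_simps eventually_at_filter)
  moreover have "(flat_fun k \<longlongrightarrow> 0) (at_left 0)"
    by (rule Lim_transform_eventually[OF tendsto_const])
      (auto simp: flat_fun_def eventually_at_filter)
  ultimately show ?thesis
    by (simp add: filterlim_split_at)
qed

text \<open>Away from 0 this is ordinary calculus. At 0 the difference quotient of
  \<open>flat_fun k\<close> is \<open>flat_fun (k + 1)\<close>, which tends to 0 by the preceding
  lemma.\<close>

lemma flat_fun_DERIV:
  "(flat_fun k has_real_derivative flat_fun (k + 2) t - real k * flat_fun (k + 1) t) (at t)"
proof (cases t "0::real" rule: linorder_cases)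
  case less
  have "((\<lambda>_. 0) has_real_derivative 0) (at t)" by simp
  then have "(flat_fun k has_real_derivative 0) (at t)"
    by (rule has_field_derivative_transform_within_open[where S = "{..<0}"]) (use less in \<open>auto simp: flat_fun_def\<close>)
  then show ?thesis using less by (simp add: flat_fun_def)
next
  case equal
  have "flat_fun k h / h = flat_fun (k + 1) h" if "h \<noteq> 0" for h :: real
    using that by (simp add: flat_fun_def field_simps)
  then have "((\<lambda>h. flat_fun k h / h) \<longlongrightarrow> 0) (at 0)"
    using flat_fun_tendsto_0[of "k + 1"]
    by (elim Lim_transform_eventually) (auto simp: eventually_at_filter)
  then show ?thesis using equal by (simp add: DERIV_def flat_fun_def)
next
  case greater
  have "((\<lambda>t. inverse t ^ k * exp (- inverse t)) has_real_derivative
      flat_fun (k + 2) t - real k * flat_fun (k + 1) t) (at t)"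
    using greater
    by (cases k, auto intro!: derivative_eq_intros simp: flat_fun_def power2_eq_square algebra_simps)
      (metis power_eq_if One_nat_def)
  then show ?thesis
    by (rule has_field_derivative_transform_within_open[where S = "{0<..}"]) (use greater in \<open>auto simp: flat_fun_def\<close>)
qed

lemma smooth_on_flat_fun: "smooth_on UNIV (flat_fun 0)"
proof -
  have "Ck_on m UNIV (flat_fun k)" for m k
  proof (induction m arbitrary: k)
    case 0
    then show ?case
      by (auto intro!: continuous_at_imp_continuous_on DERIV_isCont flat_fun_DERIV)
  next
    case (Suc m)
    show ?case
    proof (rule Ck_on_Suc_hasD)
      show "(flat_fun k has_derivative
          (\<lambda>v. (flat_fun (k + 2) x + (- real k) * flat_fun (k + 1) x) * v)) (at x)" for x
        using flat_fun_DERIV[of k x] by (simp add: has_field_derivative_def)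
      show "Ck_on m UNIV (\<lambda>x. (flat_fun (k + 2) x + (- real k) * flat_fun (k + 1) x) * v)" for v
        by (intro Ck_on_mult Ck_on_add Ck_on_const open_UNIV Suc)
    qed simp
  qed
  then show ?thesis by (simp add: smooth_on_def)
qed

lemma smooth_on_flat_fun_comp:
  assumes "open S" "smooth_on S f" shows "smooth_on S (\<lambda>x. flat_fun 0 (f x))"
  by (rule smooth_on_compose[where Bs = "{1}", OF _ _ assms(1) _ assms(2) smooth_on_flat_fun]) auto

text \<open>The usual quotient of flat functions of the squared distance s: it is 1 for s < r^2 / 4
  and 0 for s at least r^2. The squared distance is smooth at the centre, unlike the norm.
  Differences are spelled as sums and products to match \<open>smooth_on_add\<close> and
  \<open>smooth_on_mult\<close>.\<close>

definition plateau :: "'e::real_inner \<Rightarrow> real \<Rightarrow> 'e \<Rightarrow> real" where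
  "plateau y0 r y = (let s = (y - y0) \<bullet> (y - y0) in
     flat_fun 0 (r\<^sup>2 + (- 1) * s) * inverse (flat_fun 0 (r\<^sup>2 + (- 1) * s) + flat_fun 0 (s + - (r\<^sup>2 / 4))))"

lemma smooth_on_plateau:
  assumes "r > 0" "open S" shows "smooth_on S (plateau y0 r)"
proof -
  \<comment> \<open>The two arguments add up to 3 r^2 / 4, so one of them is positive and the
    denominator never vanishes.\<close>
  have "flat_fun 0 (r\<^sup>2 + (- 1) * s) + flat_fun 0 (s + - (r\<^sup>2 / 4)) \<noteq> 0" for s
  proof -
    have "r\<^sup>2 > 0" using assms(1) by simp
    then have "r\<^sup>2 - s > 0 \<or> s - r\<^sup>2 / 4 > 0"
      by argo
    moreover have "flat_fun 0 t \<ge> 0" "t > 0 \<Longrightarrow> flat_fun 0 t > 0" for t by (auto simp: flat_fun_def)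
    ultimately show ?thesis
      by (smt (verit))
  qed
  then show ?thesis
    unfolding plateau_def Let_def
    by (intro smooth_on_mult smooth_on_inverse smooth_on_add smooth_on_flat_fun_comp
        smooth_on_norm_square smooth_on_const assms)
qed

lemma plateau_eq_1:
  assumes "norm (y - y0) < r / 2" shows "plateau y0 r y = 1"
proof -
  have "(norm (y - y0))\<^sup>2 < (r / 2)\<^sup>2"
    by (rule power_strict_mono) (use assms in auto)
  moreover have "(r / 2)\<^sup>2 = r\<^sup>2 / 4" by (simp add: power_divide)
  ultimately have *: "(y - y0) \<bullet> (y - y0) < r\<^sup>2 / 4" by (simp add: dot_square_norm)
  have "0 \<le> (y - y0) \<bullet> (y - y0)" by simp
  with * have "(y - y0) \<bullet> (y - y0) < r\<^sup>2" by linarith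
  with * show ?thesis by (simp add: plateau_def flat_fun_def Let_def)
qed

lemma plateau_eq_0:
  assumes "norm (y - y0) \<ge> r" "r > 0" shows "plateau y0 r y = 0"
proof -
  have "r\<^sup>2 \<le> (norm (y - y0))\<^sup>2"
    by (rule power_mono) (use assms in auto)
  then show ?thesis by (simp add: plateau_def flat_fun_def Let_def dot_square_norm)
qed

subsection \<open>Finite-dimensional inner product spaces\<close>

text \<open>Gram-Schmidt, with zero vectors discarded before normalising. The expansion formula is
  the form in which the basis is consumed, by the chain rule and by the compactness of balls; in
  dimension 0 the basis is empty.\<close>

lemma orthonormal_basis_exists:
  assumes "finite b" "span b = (UNIV :: 'e::real_inner set)"
  obtains Bs where "finite Bs" "\<And>v::'e. v = (\<Sum>b\<in>Bs. (v \<bullet> b) *\<^sub>R b)" "\<And>b. b \<in> Bs \<Longrightarrow> norm b = 1"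
proof -
  obtain C where C: "finite C" "span C = (UNIV :: 'e set)" "pairwise orthogonal C"
    using basis_orthogonal[OF assms(1)] assms(2) by auto
  define Bs where "Bs = (\<lambda>c. c /\<^sub>R norm c) ` (C - {0})"
  have fin: "finite Bs" using C(1) by (simp add: Bs_def)
  have nrm: "norm b = 1" if "b \<in> Bs" for b
  proof -
    obtain c where "b = c /\<^sub>R norm c" "c \<noteq> 0" using \<open>b \<in> Bs\<close> by (auto simp: Bs_def)
    then show ?thesis by simp
  qed
  have orth: "b \<bullet> b' = 0" if bb: "b \<in> Bs" "b' \<in> Bs" "b \<noteq> b'" for b b'
  proof -
    obtain c c' where c: "b = c /\<^sub>R norm c" "b' = c' /\<^sub>R norm c'" "c \<in> C" "c' \<in> C"
      using bb(1,2) by (auto simp: Bs_def)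
    then have "c \<noteq> c'" using bb(3) by auto
    then have "c \<bullet> c' = 0" using C(3) c(3,4) unfolding pairwise_def orthogonal_def by blast
    then show ?thesis using c by simp
  qed
  have "span Bs = UNIV"
  proof -
    have "c \<in> span Bs" if "c \<in> C" for c
    proof (cases "c = 0")
      case False
      then have "c /\<^sub>R norm c \<in> span Bs" using that by (auto simp: Bs_def intro: span_base)
      then have "norm c *\<^sub>R (c /\<^sub>R norm c) \<in> span Bs" by (rule span_scale)
      then show ?thesis using False by simp
    qed (simp add: span_zero)
    then have "span C \<subseteq> span Bs" by (intro span_minimal subsetI subspace_span)
    then show ?thesis using C(2) by auto
  qed
  have "v = (\<Sum>b\<in>Bs. (v \<bullet> b) *\<^sub>R b)" for v
  proof -
    have "v \<in> span Bs" using \<open>span Bs = UNIV\<close> by simp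
    then obtain u where u: "v = (\<Sum>b\<in>Bs. u b *\<^sub>R b)"
      using span_finite[OF fin] by auto
    have "v \<bullet> b = u b" if "b \<in> Bs" for b
    proof -
      have "v \<bullet> b = (\<Sum>b'\<in>Bs. u b' * (b' \<bullet> b))" by (simp add: u inner_sum_left)
      also have "\<dots> = (\<Sum>b'\<in>Bs. if b' = b then u b else 0)"
        by (rule sum.cong) (use orth that nrm[OF that] in \<open>auto simp: dot_square_norm\<close>)
      finally show ?thesis using that fin by simp
    qed
    then show ?thesis using u by simp
  qed
  with fin nrm show thesis by (intro that)
qed

text \<open>By Cauchy-Schwarz the coordinates of a vector in the ball are bounded by r, so the ball
  is a closed subset of a finite sum of compact segments. Compactness is what will make supports of
  bump functions closed in the manifold.\<close>

lemma compact_cball_finite_dim: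
  assumes Bs: "finite Bs" "\<And>v::'e::real_inner. v = (\<Sum>b\<in>Bs. (v \<bullet> b) *\<^sub>R b)"
    and nrm: "\<And>b. b \<in> Bs \<Longrightarrow> norm b = 1"
  shows "compact (cball (y0::'e) r)"
proof -
  have "compact {(\<Sum>b\<in>F. c b *\<^sub>R b) | c. \<forall>b\<in>F. \<bar>c b\<bar> \<le> r}" if "finite F" for F :: "'e set"
    using that
  proof (induction F)
    case empty
    have "{(\<Sum>b\<in>{}. c b *\<^sub>R b) | c. \<forall>b\<in>{}. \<bar>c b\<bar> \<le> r} = {0::'e}" by auto
    then show ?case by (simp only: compact_sing)
  next
    case (insert a F)
    let ?P = "{(\<Sum>b\<in>F. c b *\<^sub>R b) | c. \<forall>b\<in>F. \<bar>c b\<bar> \<le> r}"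
    have "compact ((\<lambda>t. t *\<^sub>R a) ` {-r..r})"
      by (intro compact_continuous_image continuous_intros compact_Icc)
    then have "compact {x + y | x y. x \<in> (\<lambda>t. t *\<^sub>R a) ` {-r..r} \<and> y \<in> ?P}"
      by (rule compact_sums[OF _ insert.IH])
    moreover have "{x + y | x y. x \<in> (\<lambda>t. t *\<^sub>R a) ` {-r..r} \<and> y \<in> ?P}
        = {(\<Sum>b\<in>insert a F. c b *\<^sub>R b) | c. \<forall>b\<in>insert a F. \<bar>c b\<bar> \<le> r}" (is "?L = ?R")
    proof (intro equalityI subsetI)
      fix z assume "z \<in> ?L"
      then obtain t c where "t \<in> {-r..r}" "\<forall>b\<in>F. \<bar>c b\<bar> \<le> r" "z = t *\<^sub>R a + (\<Sum>b\<in>F. c b *\<^sub>R b)"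
        by blast
      moreover have "(\<Sum>b\<in>F. (c(a := t)) b *\<^sub>R b) = (\<Sum>b\<in>F. c b *\<^sub>R b)"
        by (rule sum.cong) (use insert in auto)
      ultimately show "z \<in> ?R"
        using insert(1,2) by (intro CollectI exI[of _ "c(a := t)"]) (auto simp: abs_le_iff)
    next
      fix z assume "z \<in> ?R"
      then obtain c where "\<forall>b\<in>insert a F. \<bar>c b\<bar> \<le> r" "z = (\<Sum>b\<in>insert a F. c b *\<^sub>R b)" by auto
      then show "z \<in> ?L"
        using insert(1,2)
        by (intro CollectI exI[of _ "c a *\<^sub>R a"] exI[of _ "\<Sum>b\<in>F. c b *\<^sub>R b"]) (auto simp: abs_le_iff)
    qed
    ultimately show ?case by simp
  qed
  from this[OF Bs(1)] have "compact (cball 0 r \<inter> {(\<Sum>b\<in>Bs. c b *\<^sub>R b) | c. \<forall>b\<in>Bs. \<bar>c b\<bar> \<le> r})"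
    (is "compact (_ \<inter> ?P)")
    by (intro closed_Int_compact closed_cball)
  moreover have "cball 0 r \<subseteq> ?P"
  proof
    fix v :: 'e assume "v \<in> cball 0 r"
    then have "\<bar>v \<bullet> b\<bar> \<le> r" if "b \<in> Bs" for b
      using Cauchy_Schwarz_ineq2[of v b] nrm[OF that] by simp
    then show "v \<in> ?P"
      by (intro CollectI exI[of _ "\<lambda>b. v \<bullet> b"] conjI Bs(2)) auto
  qed
  ultimately have "compact (cball (0::'e) r)" by (simp add: inf.absorb1)
  then have "compact ((+) y0 ` cball 0 r)" by (rule compact_translation)
  then show ?thesis by (simp add: image_add_cball)
qed

section \<open>Smooth functions and tangent vectors\<close>

text \<open>A predicate that is unpacked by explicit rules only: the expansion equation has a bare
  variable on its left and would rewrite forever.\<close>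

definition unit_expansion_basis :: "'e::real_inner set \<Rightarrow> bool" where
  "unit_expansion_basis Bs \<longleftrightarrow>
     finite Bs \<and> (\<forall>v. v = (\<Sum>b\<in>Bs. (v \<bullet> b) *\<^sub>R b)) \<and> (\<forall>b\<in>Bs. norm b = 1)"

lemma unit_expansion_basisD:
  assumes "unit_expansion_basis Bs"
  shows "finite Bs" and "v = (\<Sum>b\<in>Bs. (v \<bullet> b) *\<^sub>R b)" and "b \<in> Bs \<Longrightarrow> norm b = 1"
proof -
  note d = assms[unfolded unit_expansion_basis_def]
  show "finite Bs" by (rule conjunct1[OF d])
  show "v = (\<Sum>b\<in>Bs. (v \<bullet> b) *\<^sub>R b)" by (rule spec[OF conjunct1[OF conjunct2[OF d]]])
  show "b \<in> Bs \<Longrightarrow> norm b = 1" by (rule bspec[OF conjunct2[OF conjunct2[OF d]]])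
qed

section \<open>Charts of a smooth manifold\<close>

locale manifold =
  fixes M :: "('m, 'e::real_inner) mfd"
  assumes smooth_manifold: "smooth_manifold M"
begin

lemma model_basis: "\<exists>Bs :: 'e set. unit_expansion_basis Bs"
proof -
  have "\<exists>b. finite b \<and> span b = (UNIV :: 'e set)"
    using smooth_manifold unfolding smooth_manifold_def by (elim conjE)
  then obtain b where "finite b" "span b = (UNIV :: 'e set)"
    by (elim exE conjE)
  then show ?thesis
  proof (rule orthonormal_basis_exists)
    fix Bs :: "'e set"
    assume a: "finite Bs" "\<And>v. v = (\<Sum>b\<in>Bs. (v \<bullet> b) *\<^sub>R b)" "\<And>b. b \<in> Bs \<Longrightarrow> norm b = 1"
    have "unit_expansion_basis Bs"
      unfolding unit_expansion_basis_def
    proof (intro conjI allI ballI)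
      show "v = (\<Sum>b\<in>Bs. (v \<bullet> b) *\<^sub>R b)" for v by (rule a(2))
    qed (rule a(1), rule a(3))
    then show ?thesis ..
  qed
qed

lemma Hausdorff: "Hausdorff_space (mtop M)"
  using smooth_manifold unfolding smooth_manifold_def by (elim conjE)

lemma chart_openin: "(U, \<phi>) \<in> atlas M \<Longrightarrow> openin (mtop M) U"
  and chart_homeo: "(U, \<phi>) \<in> atlas M \<Longrightarrow>
    homeomorphic_map (subtopology (mtop M) U) (top_of_set (\<phi> ` U)) \<phi>"
  and chart_open: "(U, \<phi>) \<in> atlas M \<Longrightarrow> open (\<phi> ` U)"
  and chart_transition: "(U, \<phi>) \<in> atlas M \<Longrightarrow> (V, \<psi>) \<in> atlas M \<Longrightarrow>
    smooth_on (\<phi> ` (U \<inter> V)) (\<psi> \<circ> inv_into U \<phi>)"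
  and chart_cover: "x \<in> pts M \<Longrightarrow> \<exists>U \<phi>. (U, \<phi>) \<in> atlas M \<and> x \<in> U"
  using smooth_manifold unfolding smooth_manifold_def by blast+

lemma chart_subset: "(U, \<phi>) \<in> atlas M \<Longrightarrow> U \<subseteq> pts M"
  using chart_openin openin_subset by blast

lemma chart_inj: assumes "(U, \<phi>) \<in> atlas M" shows "inj_on \<phi> U"
  using homeomorphic_imp_injective_map[OF chart_homeo[OF assms]] chart_subset[OF assms]
  by (simp add: inf.absorb2)

lemma chart_inv [simp]: "(U, \<phi>) \<in> atlas M \<Longrightarrow> x \<in> U \<Longrightarrow> inv_into U \<phi> (\<phi> x) = x"
  by (simp add: chart_inj)

lemma chart_open_image:
  assumes "(U, \<phi>) \<in> atlas M" "openin (mtop M) W" shows "open (\<phi> ` (U \<inter> W))"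
proof -
  have "openin (subtopology (mtop M) U) (U \<inter> W)"
    using assms(2) openin_subtopology_Int2 by blast
  then have "openin (top_of_set (\<phi> ` U)) (\<phi> ` (U \<inter> W))"
    using homeomorphic_imp_open_map[OF chart_homeo[OF assms(1)]] unfolding open_map_def by blast
  then show ?thesis using chart_open[OF assms(1)] openin_open_trans by blast
qed

lemma chart_open_preimage:
  assumes "(U, \<phi>) \<in> atlas M" "open Q" shows "openin (mtop M) {x \<in> U. \<phi> x \<in> Q}"
proof -
  have "openin (top_of_set (\<phi> ` U)) (\<phi> ` U \<inter> Q)" using assms(2) openin_open_Int by blast
  from openin_continuous_map_preimage[OF
      homeomorphic_imp_continuous_map[OF chart_homeo[OF assms(1)]] this]
  have "openin (subtopology (mtop M) U) {x \<in> topspace (subtopology (mtop M) U). \<phi> x \<in> \<phi> ` U \<inter> Q}" .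
  moreover have "{x \<in> topspace (subtopology (mtop M) U). \<phi> x \<in> \<phi> ` U \<inter> Q} = {x \<in> U. \<phi> x \<in> Q}"
    using chart_subset[OF assms(1)] by auto
  ultimately show ?thesis using chart_openin[OF assms(1)] openin_trans_full by metis
qed

subsection \<open>Algebra of smooth functions\<close>

lemma smooth_fun_onD:
  "smooth_fun_on M W f \<Longrightarrow> (U, \<phi>) \<in> atlas M \<Longrightarrow> smooth_on (\<phi> ` (U \<inter> W)) (f \<circ> inv_into U \<phi>)"
  unfolding smooth_fun_on_def by blast

lemma smooth_fun_onI:
  "(\<And>U \<phi>. (U, \<phi>) \<in> atlas M \<Longrightarrow> smooth_on (\<phi> ` (U \<inter> W)) (f \<circ> inv_into U \<phi>)) \<Longrightarrow> smooth_fun_on M W f"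
  unfolding smooth_fun_on_def by blast

lemma smooth_fun_on_cong:
  assumes "openin (mtop M) W" "\<And>x. x \<in> W \<Longrightarrow> f x = g x" "smooth_fun_on M W f"
  shows "smooth_fun_on M W g"
proof (rule smooth_fun_onI)
  fix U \<phi> assume c: "(U, \<phi>) \<in> atlas M"
  show "smooth_on (\<phi> ` (U \<inter> W)) (g \<circ> inv_into U \<phi>)"
    by (rule smooth_on_cong[OF chart_open_image[OF c assms(1)] _ smooth_fun_onD[OF assms(3) c]])
      (use c assms(2) in auto)
qed

lemma smooth_fun_on_subset: "smooth_fun_on M W f \<Longrightarrow> V \<subseteq> W \<Longrightarrow> smooth_fun_on M V f"
  by (rule smooth_fun_onI) (erule smooth_on_subset[OF smooth_fun_onD], auto)

lemma smooth_fun_on_local: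
  assumes "\<And>x. x \<in> W \<Longrightarrow> \<exists>N. openin (mtop M) N \<and> x \<in> N \<and> smooth_fun_on M N f"
  shows "smooth_fun_on M W f"
proof (rule smooth_fun_onI, rule smooth_on_local)
  fix U \<phi> y assume c: "(U, \<phi>) \<in> atlas M" and "y \<in> \<phi> ` (U \<inter> W)"
  then obtain x where x: "x \<in> U" "x \<in> W" "y = \<phi> x" by auto
  then obtain N where N: "openin (mtop M) N" "x \<in> N" "smooth_fun_on M N f" using assms by blast
  then show "\<exists>T. open T \<and> y \<in> T \<and> smooth_on T (f \<circ> inv_into U \<phi>)"
    using x chart_open_image[OF c N(1)] smooth_fun_onD[OF N(3) c]
    by (intro exI[of _ "\<phi> ` (U \<inter> N)"]) auto
qed

lemma smooth_fun_on_const: "smooth_fun_on M W (\<lambda>x. c)"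
  by (rule smooth_fun_onI) (simp add: o_def smooth_on_const)

lemma smooth_fun_on_add:
  "openin (mtop M) W \<Longrightarrow> smooth_fun_on M W f \<Longrightarrow> smooth_fun_on M W g \<Longrightarrow> smooth_fun_on M W (\<lambda>x. f x + g x)"
  using smooth_on_add[OF chart_open_image] unfolding smooth_fun_on_def o_def by blast

lemma smooth_fun_on_mult:
  "openin (mtop M) W \<Longrightarrow> smooth_fun_on M W f \<Longrightarrow> smooth_fun_on M W g \<Longrightarrow> smooth_fun_on M W (\<lambda>x. f x * g x)"
  using smooth_on_mult[OF chart_open_image] unfolding smooth_fun_on_def o_def by blast

lemma smooth_fun_on_inverse:
  assumes "openin (mtop M) W" "smooth_fun_on M W f" "\<And>x. x \<in> W \<Longrightarrow> f x \<noteq> 0"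
  shows "smooth_fun_on M W (\<lambda>x. inverse (f x))"
proof (rule smooth_fun_onI)
  fix U \<phi> assume c: "(U, \<phi>) \<in> atlas M"
  have "smooth_on (\<phi> ` (U \<inter> W)) (\<lambda>y. inverse ((f \<circ> inv_into U \<phi>) y))"
    by (rule smooth_on_inverse[OF chart_open_image[OF c assms(1)] smooth_fun_onD[OF assms(2) c]])
      (use c assms(3) in auto)
  then show "smooth_on (\<phi> ` (U \<inter> W)) ((\<lambda>x. inverse (f x)) \<circ> inv_into U \<phi>)"
    by (simp add: o_def)
qed

lemma smooth_fun_on_minus:
  "openin (mtop M) W \<Longrightarrow> smooth_fun_on M W f \<Longrightarrow> smooth_fun_on M W (\<lambda>x. - f x)"
  using smooth_fun_on_mult[OF _ smooth_fun_on_const[of _ "-1"], of W f] by simp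

lemma smooth_fun_on_diff:
  "openin (mtop M) W \<Longrightarrow> smooth_fun_on M W f \<Longrightarrow> smooth_fun_on M W g \<Longrightarrow> smooth_fun_on M W (\<lambda>x. f x - g x)"
  using smooth_fun_on_add[OF _ _ smooth_fun_on_minus, of W f g] by simp

lemma smooth_fun_on_sum:
  assumes "openin (mtop M) W" "\<And>i. i \<in> I \<Longrightarrow> smooth_fun_on M W (f i)"
  shows "smooth_fun_on M W (\<lambda>x. \<Sum>i\<in>I. f i x)"
  using assms(2)
  by (induction I rule: infinite_finite_induct)
    (auto intro: smooth_fun_on_const smooth_fun_on_add[OF assms(1)])

lemma smooth_fun_cong:
  "(\<And>x. x \<in> pts M \<Longrightarrow> f x = g x) \<Longrightarrow> smooth_fun M f \<Longrightarrow> smooth_fun M g"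
  unfolding smooth_fun_def by (rule smooth_fun_on_cong) auto

lemma smooth_fun_const: "smooth_fun M (\<lambda>x. c)"
  and smooth_fun_add: "smooth_fun M f \<Longrightarrow> smooth_fun M g \<Longrightarrow> smooth_fun M (\<lambda>x. f x + g x)"
  and smooth_fun_mult: "smooth_fun M f \<Longrightarrow> smooth_fun M g \<Longrightarrow> smooth_fun M (\<lambda>x. f x * g x)"
  and smooth_fun_minus: "smooth_fun M f \<Longrightarrow> smooth_fun M (\<lambda>x. - f x)"
  and smooth_fun_diff: "smooth_fun M f \<Longrightarrow> smooth_fun M g \<Longrightarrow> smooth_fun M (\<lambda>x. f x - g x)"
  unfolding smooth_fun_def
  by (auto intro: smooth_fun_on_const smooth_fun_on_add smooth_fun_on_mult smooth_fun_on_minus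
      smooth_fun_on_diff)

lemma smooth_fun_imp_on: "smooth_fun M f \<Longrightarrow> W \<subseteq> pts M \<Longrightarrow> smooth_fun_on M W f"
  unfolding smooth_fun_def by (rule smooth_fun_on_subset)

lemma smooth_fun_on_near:
  assumes "openin (mtop M) W"
    and "\<And>x. x \<in> W \<Longrightarrow> \<exists>N g. openin (mtop M) N \<and> x \<in> N \<and> smooth_fun_on M N g \<and> (\<forall>y\<in>N. f y = g y)"
  shows "smooth_fun_on M W f"
  by (rule smooth_fun_on_local) (metis assms(2) smooth_fun_on_cong)

text \<open>In any other chart the local expression is the given one composed with a transition map,
  so the chain rule applies.\<close>

lemma smooth_fun_on_chartI:
  assumes c: "(V, \<psi>) \<in> atlas M" and W: "openin (mtop M) W" "W \<subseteq> V"
    and f: "smooth_on (\<psi> ` W) (f \<circ> inv_into V \<psi>)"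
  shows "smooth_fun_on M W f"
proof (rule smooth_fun_onI)
  fix U \<phi> assume c': "(U, \<phi>) \<in> atlas M"
  obtain Bs :: "'e set" where "unit_expansion_basis Bs" using model_basis by blast
  note Bs = unit_expansion_basisD[OF this]
  let ?S = "\<phi> ` (U \<inter> W)" and ?t = "\<psi> \<circ> inv_into U \<phi>"
  have op: "open ?S" using chart_open_image[OF c' W(1)] .
  have 1: "smooth_on ?S ?t"
    by (rule smooth_on_subset[OF chart_transition[OF c' c]]) (use W(2) in auto)
  have 2: "?t ` ?S \<subseteq> \<psi> ` W" using c' by auto
  have "smooth_on ?S (\<lambda>y. (f \<circ> inv_into V \<psi>) (?t y))"
    by (rule smooth_on_compose[OF Bs(1,2) op 2 1 f])
  then show "smooth_on ?S (f \<circ> inv_into U \<phi>)"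
    by (rule smooth_on_cong[OF op, rotated]) (use c c' W(2) in auto)
qed

subsection \<open>Plateau functions and extensions\<close>

text \<open>The plateau function is supported in the preimage \<open>C\<close> of a closed ball that
  lies inside a chart image. \<open>C\<close> is compact, hence closed in the whole Hausdorff space
  and not merely in the chart domain; this is what makes the extension by 0 smooth.\<close>

lemma plateau_exists:
  assumes "openin (mtop M) W" "x0 \<in> W"
  obtains \<eta> C N where "smooth_fun M \<eta>" "closedin (mtop M) C" "C \<subseteq> W" "openin (mtop M) N" "x0 \<in> N"
    "N \<subseteq> W" "\<And>x. x \<in> N \<Longrightarrow> \<eta> x = 1" "\<And>x. x \<notin> C \<Longrightarrow> \<eta> x = (0::real)"
proof -
  have "x0 \<in> pts M" using assms openin_subset by blast
  then obtain U \<phi> where c: "(U, \<phi>) \<in> atlas M" and x0: "x0 \<in> U" using chart_cover by blast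
  have op: "open (\<phi> ` (U \<inter> W))" using chart_open_image[OF c assms(1)] .
  moreover have "\<phi> x0 \<in> \<phi> ` (U \<inter> W)" using x0 assms(2) by blast
  ultimately obtain r where r: "r > 0" "cball (\<phi> x0) r \<subseteq> \<phi> ` (U \<inter> W)"
    using open_contains_cball by blast
  obtain Bs :: "'e set" where "unit_expansion_basis Bs" using model_basis by blast
  note Bs = unit_expansion_basisD[OF this]
  define C where "C = {x \<in> U. \<phi> x \<in> cball (\<phi> x0) r}"
  define \<eta> where "\<eta> x = (if x \<in> U then plateau (\<phi> x0) r (\<phi> x) else 0)" for x
  define N where "N = {x \<in> U. \<phi> x \<in> ball (\<phi> x0) (r / 2)}"
  have \<phi>C: "\<phi> ` C = cball (\<phi> x0) r" using r(2) by (auto simp: C_def)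
  have CW: "C \<subseteq> W"
  proof
    fix x assume "x \<in> C"
    then have "x \<in> U" "\<phi> x \<in> \<phi> ` (U \<inter> W)" using r(2) by (auto simp: C_def)
    then show "x \<in> W" using chart_inj[OF c] by (auto simp: inj_on_def)
  qed
  have "compactin (top_of_set (\<phi> ` U)) (\<phi> ` C)"
    using compact_cball_finite_dim[OF Bs] r(2) by (auto simp: \<phi>C compactin_subtopology)
  then have "compactin (subtopology (mtop M) U) C"
    using homeomorphic_map_compactness[OF chart_homeo[OF c], of C] chart_subset[OF c]
    by (auto simp: C_def)
  then have "compactin (mtop M) C" by (simp add: compactin_subtopology)
  then have cl: "closedin (mtop M) C"
    using Hausdorff compactin_imp_closedin by blast
  have zero: "\<eta> x = 0" if "x \<notin> C" for x
    using that plateau_eq_0[OF _ r(1), of "\<phi> x" "\<phi> x0"]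
    by (auto simp: \<eta>_def C_def dist_norm norm_minus_commute[of "\<phi> x0"])
  have on_U: "smooth_fun_on M U \<eta>"
  proof (rule smooth_fun_on_chartI[OF c chart_openin[OF c] subset_refl])
    show "smooth_on (\<phi> ` U) (\<eta> \<circ> inv_into U \<phi>)"
      by (rule smooth_on_cong[OF chart_open[OF c] _ smooth_on_plateau[OF r(1) chart_open[OF c]]])
        (use c in \<open>auto simp: \<eta>_def\<close>)
  qed
  have "smooth_fun M \<eta>" unfolding smooth_fun_def
  proof (rule smooth_fun_on_local)
    fix x assume x: "x \<in> pts M"
    show "\<exists>N. openin (mtop M) N \<and> x \<in> N \<and> smooth_fun_on M N \<eta>"
    proof (cases "x \<in> U")
      case True
      then show ?thesis using on_U chart_openin[OF c] by blast
    next
      case False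
      have op: "openin (mtop M) (pts M - C)" using cl by (simp add: openin_diff)
      have "smooth_fun_on M (pts M - C) \<eta>"
        by (rule smooth_fun_on_cong[OF op _ smooth_fun_on_const[of _ 0]]) (use zero in auto)
      then show ?thesis using op x False by (intro exI[of _ "pts M - C"]) (auto simp: C_def)
    qed
  qed
  moreover have "openin (mtop M) N" unfolding N_def by (rule chart_open_preimage[OF c open_ball])
  moreover have "x0 \<in> N" using x0 r(1) by (simp add: N_def)
  moreover have "N \<subseteq> W" using CW r(1) by (auto simp: N_def C_def)
  moreover have "\<eta> x = 1" if "x \<in> N" for x
    using that by (auto simp: N_def \<eta>_def dist_norm norm_minus_commute intro!: plateau_eq_1)
  ultimately show thesis using that cl CW zero by blast
qed

text \<open>The open sets V Int W and V - C cover V, and f is zero on the second one.\<close>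

lemma smooth_fun_on_closed_support:
  assumes W: "openin (mtop M) W" and C: "closedin (mtop M) C" "C \<subseteq> W"
    and V: "openin (mtop M) V"
    and f: "smooth_fun_on M (V \<inter> W) f" "\<And>x. x \<in> V - C \<Longrightarrow> f x = 0"
  shows "smooth_fun_on M V f"
proof (rule smooth_fun_on_local)
  fix x assume x: "x \<in> V"
  show "\<exists>N. openin (mtop M) N \<and> x \<in> N \<and> smooth_fun_on M N f"
  proof (cases "x \<in> W")
    case True
    then show ?thesis using f(1) x W V by (intro exI[of _ "V \<inter> W"]) auto
  next
    case False
    have op: "openin (mtop M) (V - C)" using V C by (simp add: openin_diff)
    have "smooth_fun_on M (V - C) f"
      by (rule smooth_fun_on_cong[OF op _ smooth_fun_on_const[of _ 0]]) (use f(2) in auto)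
    then show ?thesis using op x False C by (intro exI[of _ "V - C"]) auto
  qed
qed

lemma smooth_fun_extend:
  assumes W: "openin (mtop M) W" "x0 \<in> W" and f: "smooth_fun_on M W f"
  obtains F N where "smooth_fun M F" "openin (mtop M) N" "x0 \<in> N" "N \<subseteq> W"
    "\<And>x. x \<in> N \<Longrightarrow> F x = f x"
proof -
  obtain \<eta> C N where \<eta>: "smooth_fun M \<eta>" "closedin (mtop M) C" "C \<subseteq> W" "openin (mtop M) N" "x0 \<in> N"
    "N \<subseteq> W" "\<And>x. x \<in> N \<Longrightarrow> \<eta> x = 1" "\<And>x. x \<notin> C \<Longrightarrow> \<eta> x = (0::real)"
    using plateau_exists[OF W] by blast
  have "smooth_fun_on M (pts M) (\<lambda>x. \<eta> x * f x)"
  proof (rule smooth_fun_on_closed_support[OF W(1) \<eta>(2,3)])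
    have "smooth_fun_on M W (\<lambda>x. \<eta> x * f x)"
      using smooth_fun_on_mult[OF W(1) smooth_fun_imp_on[OF \<eta>(1)] f] openin_subset[OF W(1)] .
    then show "smooth_fun_on M (pts M \<inter> W) (\<lambda>x. \<eta> x * f x)"
      by (rule smooth_fun_on_subset) auto
  qed (use \<eta>(8) in auto)
  then have "smooth_fun M (\<lambda>x. \<eta> x * f x)" by (simp add: smooth_fun_def)
  then show thesis
    by (rule that[OF _ \<eta>(4,5,6)]) (simp add: \<eta>(7))
qed

subsection \<open>Tangent vectors\<close>

lemma chart_has_derivative:
  assumes "(U, \<phi>) \<in> atlas M" "x \<in> U" "smooth_fun M f"
  shows "(f \<circ> inv_into U \<phi> has_derivative (\<lambda>w. dir_deriv M (U, \<phi>) x w f)) (at (\<phi> x))"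
proof -
  have "smooth_on (\<phi> ` (U \<inter> pts M)) (f \<circ> inv_into U \<phi>)"
    using assms smooth_fun_onD unfolding smooth_fun_def by blast
  moreover have "\<phi> x \<in> \<phi> ` (U \<inter> pts M)" using assms chart_subset by blast
  ultimately show ?thesis
    using smooth_on_has_derivative assms(3) by (auto simp: dir_deriv_def)
qed

lemma dir_deriv_eqI:
  assumes "(U, \<phi>) \<in> atlas M" "x \<in> U" "smooth_fun M f" "(f \<circ> inv_into U \<phi> has_derivative D) (at (\<phi> x))"
  shows "dir_deriv M (U, \<phi>) x w f = D w"
  using has_derivative_unique[OF chart_has_derivative[OF assms(1-3)] assms(4)] by (rule fun_cong)

lemma dir_deriv_nonsmooth: "\<not> smooth_fun M f \<Longrightarrow> dir_deriv M c x w f = 0"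
  by (cases c) (simp add: dir_deriv_def)

lemma dir_deriv_lin:
  assumes "(U, \<phi>) \<in> atlas M" "x \<in> U"
  shows dir_deriv_add: "dir_deriv M (U, \<phi>) x (w + w') = dir_deriv M (U, \<phi>) x w + dir_deriv M (U, \<phi>) x w'"
    and dir_deriv_scaleR: "dir_deriv M (U, \<phi>) x (c *\<^sub>R w) = c *\<^sub>R dir_deriv M (U, \<phi>) x w"
proof -
  have "dir_deriv M (U, \<phi>) x (w + w') f = dir_deriv M (U, \<phi>) x w f + dir_deriv M (U, \<phi>) x w' f \<and>
    dir_deriv M (U, \<phi>) x (c *\<^sub>R w) f = c * dir_deriv M (U, \<phi>) x w f" for f
  proof (cases "smooth_fun M f")
    case True
    then have "linear (\<lambda>w. dir_deriv M (U, \<phi>) x w f)"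
      using chart_has_derivative[OF assms] has_derivative_linear by blast
    then show ?thesis by (simp add: linear_iff)
  qed (simp add: dir_deriv_nonsmooth)
  then show "dir_deriv M (U, \<phi>) x (w + w') = dir_deriv M (U, \<phi>) x w + dir_deriv M (U, \<phi>) x w'"
    "dir_deriv M (U, \<phi>) x (c *\<^sub>R w) = c *\<^sub>R dir_deriv M (U, \<phi>) x w"
    by (auto simp: fun_eq_iff scaleR_fun_def)
qed

lemma dir_deriv_zero: "(U, \<phi>) \<in> atlas M \<Longrightarrow> x \<in> U \<Longrightarrow> dir_deriv M (U, \<phi>) x 0 = 0"
  using dir_deriv_scaleR[of U \<phi> x 0 0] by simp

lemma dir_deriv_sum:
  assumes "(U, \<phi>) \<in> atlas M" "x \<in> U"
  shows "dir_deriv M (U, \<phi>) x (\<Sum>i\<in>I. c i *\<^sub>R b i) f = (\<Sum>i\<in>I. c i * dir_deriv M (U, \<phi>) x (b i) f)"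
  by (induction I rule: infinite_finite_induct)
    (simp_all add: dir_deriv_zero[OF assms] dir_deriv_add[OF assms] dir_deriv_scaleR[OF assms] scaleR_fun_def)

text \<open>The chain rule for the transition map. It lets every tangent vector at x be written in
  any prescribed chart around x, although the fibre is defined as a union over charts.\<close>

lemma dir_deriv_change:
  assumes c: "(U, \<phi>) \<in> atlas M" "x \<in> U" and c': "(V, \<psi>) \<in> atlas M" "x \<in> V"
  shows "dir_deriv M (U, \<phi>) x w =
    dir_deriv M (V, \<psi>) x (frechet_derivative (\<psi> \<circ> inv_into U \<phi>) (at (\<phi> x)) w)"
proof
  fix f
  let ?t = "\<psi> \<circ> inv_into U \<phi>"
  show "dir_deriv M (U, \<phi>) x w f = dir_deriv M (V, \<psi>) x (frechet_derivative ?t (at (\<phi> x)) w) f"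
  proof (cases "smooth_fun M f")
    case True
    have op: "open (\<phi> ` (U \<inter> V))" using chart_open_image[OF c(1) chart_openin[OF c'(1)]] .
    have x: "\<phi> x \<in> \<phi> ` (U \<inter> V)" using c(2) c'(2) by blast
    have t: "(?t has_derivative frechet_derivative ?t (at (\<phi> x))) (at (\<phi> x))"
      using smooth_on_has_derivative[OF chart_transition[OF c(1) c'(1)] x] .
    have "?t (\<phi> x) = \<psi> x" using c by simp
    then have "(f \<circ> inv_into V \<psi> has_derivative (\<lambda>w. dir_deriv M (V, \<psi>) x w f)) (at (?t (\<phi> x)))"
      using chart_has_derivative[OF c' True] by simp
    from diff_chain_at[OF t this]
    have "((f \<circ> inv_into V \<psi>) \<circ> ?t has_derivative
      (\<lambda>w. dir_deriv M (V, \<psi>) x w f) \<circ> frechet_derivative ?t (at (\<phi> x))) (at (\<phi> x))" .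
    then have "(f \<circ> inv_into U \<phi> has_derivative
      (\<lambda>w. dir_deriv M (V, \<psi>) x w f) \<circ> frechet_derivative ?t (at (\<phi> x))) (at (\<phi> x))"
      by (rule has_derivative_transform_within_open[OF _ op x]) (use c c' in auto)
    from dir_deriv_eqI[OF c True this] show ?thesis by simp
  qed (simp add: dir_deriv_nonsmooth)
qed

lemma tangent_fib: "fib (tangent_bundle M) x =
    {dir_deriv M (U, \<phi>) x w | U \<phi> w. (U, \<phi>) \<in> atlas M \<and> x \<in> U}"
  by (simp add: tangent_bundle_def Let_def)

lemma tangent_fib_chart:
  assumes "u \<in> fib (tangent_bundle M) x" "(U, \<phi>) \<in> atlas M" "x \<in> U"
  obtains w where "u = dir_deriv M (U, \<phi>) x w"
  using assms dir_deriv_change unfolding tangent_fib by blast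

lemma tangent_cases:
  assumes "u \<in> fib (tangent_bundle M) x"
  obtains U \<phi> w where "(U, \<phi>) \<in> atlas M" "x \<in> U" "u = dir_deriv M (U, \<phi>) x w"
  using assms unfolding tangent_fib by blast

lemma tangent_add:
  assumes "u \<in> fib (tangent_bundle M) x" "smooth_fun M f" "smooth_fun M g"
  shows "u (\<lambda>y. f y + g y) = u f + u g"
proof -
  obtain U \<phi> w where c: "(U, \<phi>) \<in> atlas M" "x \<in> U" and u: "u = dir_deriv M (U, \<phi>) x w"
    using tangent_cases[OF assms(1)] .
  have "((\<lambda>y. f y + g y) \<circ> inv_into U \<phi> has_derivative
      (\<lambda>w. dir_deriv M (U, \<phi>) x w f + dir_deriv M (U, \<phi>) x w g)) (at (\<phi> x))"
    using has_derivative_add[OF chart_has_derivative[OF c assms(2)] chart_has_derivative[OF c assms(3)]]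
    by (simp add: o_def)
  from dir_deriv_eqI[OF c smooth_fun_add[OF assms(2,3)] this] show ?thesis by (simp add: u)
qed

lemma tangent_mult:
  assumes "u \<in> fib (tangent_bundle M) x" "smooth_fun M f" "smooth_fun M g"
  shows "u (\<lambda>y. f y * g y) = f x * u g + u f * g x"
proof -
  obtain U \<phi> w where c: "(U, \<phi>) \<in> atlas M" "x \<in> U" and u: "u = dir_deriv M (U, \<phi>) x w"
    using tangent_cases[OF assms(1)] .
  have "((\<lambda>y. f y * g y) \<circ> inv_into U \<phi> has_derivative
      (\<lambda>w. f x * dir_deriv M (U, \<phi>) x w g + dir_deriv M (U, \<phi>) x w f * g x)) (at (\<phi> x))"
    using has_derivative_mult[OF chart_has_derivative[OF c assms(2)] chart_has_derivative[OF c assms(3)]] c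
    by (simp add: o_def)
  from dir_deriv_eqI[OF c smooth_fun_mult[OF assms(2,3)] this] show ?thesis by (simp add: u)
qed

lemma tangent_local:
  assumes "u \<in> fib (tangent_bundle M) x" "smooth_fun M f" "smooth_fun M g"
    and N: "openin (mtop M) N" "x \<in> N" "\<And>y. y \<in> N \<Longrightarrow> f y = g y"
  shows "u f = u g"
proof -
  obtain U \<phi> w where c: "(U, \<phi>) \<in> atlas M" "x \<in> U" and u: "u = dir_deriv M (U, \<phi>) x w"
    using tangent_cases[OF assms(1)] .
  have x: "\<phi> x \<in> \<phi> ` (U \<inter> N)" using c(2) N(2) by blast
  have "(f \<circ> inv_into U \<phi> has_derivative (\<lambda>w. dir_deriv M (U, \<phi>) x w g)) (at (\<phi> x))"
    by (rule has_derivative_transform_within_open[OF chart_has_derivative[OF c assms(3)]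
          chart_open_image[OF c(1) N(1)] x]) (use c N(3) in auto)
  from dir_deriv_eqI[OF c assms(2) this] show ?thesis by (simp add: u)
qed

lemma tangent_const:
  assumes "u \<in> fib (tangent_bundle M) x" shows "u (\<lambda>y. c) = 0"
proof -
  obtain U \<phi> w where c: "(U, \<phi>) \<in> atlas M" "x \<in> U" and u: "u = dir_deriv M (U, \<phi>) x w"
    using tangent_cases[OF assms(1)] .
  have "((\<lambda>y. c) \<circ> inv_into U \<phi> has_derivative (\<lambda>w. 0)) (at (\<phi> x))" by (simp add: o_def)
  from dir_deriv_eqI[OF c smooth_fun_const this] show ?thesis by (simp add: u)
qed

lemma tangent_subspace:
  assumes "x \<in> pts M" shows "subspace (fib (tangent_bundle M) x)"
proof -
  obtain U \<phi> where c: "(U, \<phi>) \<in> atlas M" "x \<in> U" using chart_cover[OF assms] by blast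
  have mem: "dir_deriv M (U, \<phi>) x w \<in> fib (tangent_bundle M) x" for w
    using c unfolding tangent_fib by blast
  show ?thesis
  proof (rule subspaceI)
    show "0 \<in> fib (tangent_bundle M) x" using mem[of 0] by (simp only: dir_deriv_zero[OF c])
  next
    fix u v assume "u \<in> fib (tangent_bundle M) x" "v \<in> fib (tangent_bundle M) x"
    then obtain w w' where "u = dir_deriv M (U, \<phi>) x w" "v = dir_deriv M (U, \<phi>) x w'"
      using tangent_fib_chart[OF _ c] by metis
    then show "u + v \<in> fib (tangent_bundle M) x"
      using mem[of "w + w'"] by (simp only: dir_deriv_add[OF c])
  next
    fix k u assume "u \<in> fib (tangent_bundle M) x"
    then obtain w where "u = dir_deriv M (U, \<phi>) x w"
      using tangent_fib_chart[OF _ c] by metis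
    then show "k *\<^sub>R u \<in> fib (tangent_bundle M) x"
      using mem[of "k *\<^sub>R w"] by (simp only: dir_deriv_scaleR[OF c])
  qed
qed

text \<open>Tangent vectors act on global functions only, so separating them takes a global extension of a
  linear coordinate.\<close>

lemma dir_deriv_inj:
  assumes c: "(U, \<phi>) \<in> atlas M" "x \<in> U" and eq: "dir_deriv M (U, \<phi>) x w = dir_deriv M (U, \<phi>) x w'"
  shows "w = w'"
proof -
  let ?l = "\<lambda>y. (\<phi> y - \<phi> x) \<bullet> (w - w')"
  have "smooth_fun_on M U ?l"
  proof (rule smooth_fun_on_chartI[OF c(1) chart_openin[OF c(1)] subset_refl])
    show "smooth_on (\<phi> ` U) (?l \<circ> inv_into U \<phi>)"
      by (rule smooth_on_cong[OF chart_open[OF c(1)] _ smooth_on_inner[OF chart_open[OF c(1)], of "\<phi> x" "w - w'"]])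
        (use c in auto)
  qed
  then obtain F N where F: "smooth_fun M F" "openin (mtop M) N" "x \<in> N" "N \<subseteq> U"
    "\<And>y. y \<in> N \<Longrightarrow> F y = ?l y"
    by (rule smooth_fun_extend[OF chart_openin[OF c(1)] c(2)]) blast
  have x: "\<phi> x \<in> \<phi> ` (U \<inter> N)" using c(2) F(3) by blast
  have "((\<lambda>y. (y - \<phi> x) \<bullet> (w - w')) has_derivative (\<lambda>v. v \<bullet> (w - w'))) (at (\<phi> x))"
    by (auto intro!: derivative_eq_intros)
  then have "(F \<circ> inv_into U \<phi> has_derivative (\<lambda>v. v \<bullet> (w - w'))) (at (\<phi> x))"
    by (rule has_derivative_transform_within_open[OF _ chart_open_image[OF c(1) F(2)] x])
      (use c F(5) in auto)
  from dir_deriv_eqI[OF c F(1) this] have "v \<bullet> (w - w') = dir_deriv M (U, \<phi>) x v F" for v by simp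
  from this[of w] this[of w'] eq have "(w - w') \<bullet> (w - w') = 0" by (simp add: inner_diff_left)
  then show ?thesis by simp
qed

text \<open>A trivialisation of \<open>tangent_bundle\<close> is defined as an inverse of the map
  from coefficients to directional derivatives. That map is bijective onto the fibre by
  \<open>dir_deriv_inj\<close> and the independence of the basis, so the inverse really returns
  components, and does so linearly.\<close>

lemma tangent_triv_expansion:
  assumes "(U, \<tau>) \<in> trivs (tangent_bundle M)"
  shows "\<exists>\<phi> b. (U, \<phi>) \<in> atlas M \<and> (\<forall>x\<in>U. lin_on (fib (tangent_bundle M) x) (\<tau> x)) \<and>
    (\<forall>x\<in>U. \<forall>u\<in>fib (tangent_bundle M) x.
      u = dir_deriv M (U, \<phi>) x (\<Sum>i<vrank (tangent_bundle M). \<tau> x u i *\<^sub>R b i))"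
proof -
  define n where "n = dim (UNIV :: 'e set)"
  obtain \<phi> b where c: "(U, \<phi>) \<in> atlas M" and b: "inj_on b {..<n}" "independent (b ` {..<n})"
      "span (b ` {..<n}) = (UNIV :: 'e set)"
    and \<tau>: "\<tau> = (\<lambda>x. inv_into (coord_space n) (\<lambda>c. dir_deriv M (U, \<phi>) x (\<Sum>i<n. c i *\<^sub>R b i)))"
    using assms unfolding tangent_bundle_def Let_def n_def by auto
  define L where "L x c = dir_deriv M (U, \<phi>) x (\<Sum>i<n. c i *\<^sub>R b i)" for x c
  have uniq: "c i = c' i" if "(\<Sum>i<n. c i *\<^sub>R b i) = (\<Sum>i<n. c' i *\<^sub>R b i)" "i < n" for c c' i
  proof -
    \<comment> \<open>Coefficients are indexed by numbers here, but by the vectors themselves in the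
      notion of independence; injectivity of \<open>b\<close> translates between the two.\<close>
    let ?u = "\<lambda>v. c (inv_into {..<n} b v) - c' (inv_into {..<n} b v)"
    have "(\<Sum>v\<in>b ` {..<n}. ?u v *\<^sub>R v) = (\<Sum>i<n. (c i - c' i) *\<^sub>R b i)"
      using b(1) by (simp add: sum.reindex)
    also have "\<dots> = 0" using that(1) by (simp add: scaleR_diff_left sum_subtractf)
    finally have "?u (b i) = 0"
      by (intro independentD[OF b(2), of "b ` {..<n}" ?u "b i"]) (use that(2) in auto)
    then show ?thesis using b(1) that(2) by simp
  qed
  have bij: "bij_betw (L x) (coord_space n) (fib (tangent_bundle M) x)" if x: "x \<in> U" for x
  proof (rule bij_betwI')
    fix c c' assume cc: "c \<in> coord_space n" "c' \<in> coord_space n"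
    show "(L x c = L x c') = (c = c')"
    proof
      assume "L x c = L x c'"
      then have "(\<Sum>i<n. c i *\<^sub>R b i) = (\<Sum>i<n. c' i *\<^sub>R b i)"
        unfolding L_def by (rule dir_deriv_inj[OF \<open>(U, \<phi>) \<in> atlas M\<close> x])
      from uniq[OF this] cc show "c = c'"
        unfolding coord_space_def by (auto simp: fun_eq_iff) (metis not_le)
    qed simp
  next
    fix c assume "c \<in> coord_space n"
    then show "L x c \<in> fib (tangent_bundle M) x" using \<open>(U, \<phi>) \<in> atlas M\<close> x
      unfolding tangent_fib L_def by blast
  next
    fix u assume "u \<in> fib (tangent_bundle M) x"
    then obtain w where w: "u = dir_deriv M (U, \<phi>) x w" using tangent_fib_chart c x by blast
    have "w \<in> span (b ` {..<n})" using b(3) by simp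
    then obtain a where a: "w = (\<Sum>v\<in>b ` {..<n}. a v *\<^sub>R v)" using span_finite[of "b ` {..<n}"] by auto
    let ?c = "\<lambda>i. if i < n then a (b i) else 0"
    have "w = (\<Sum>i<n. ?c i *\<^sub>R b i)" using b(1) by (simp add: a sum.reindex)
    then show "\<exists>c\<in>coord_space n. u = L x c"
      by (intro bexI[of _ ?c]) (auto simp: w L_def coord_space_def)
  qed
  have \<tau>': "\<tau> x = inv_into (coord_space n) (L x)" for x by (simp add: \<tau> L_def[abs_def])
  have L\<tau>: "L x (\<tau> x u) = u" if "x \<in> U" "u \<in> fib (tangent_bundle M) x" for x u
    unfolding \<tau>' using bij[OF that(1)] that(2) by (simp add: bij_betw_inv_into_right)
  have \<tau>L: "\<tau> x (L x c) = c" if "x \<in> U" "c \<in> coord_space n" for x c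
    unfolding \<tau>' using bij[OF that(1)] that(2) by (simp add: bij_betw_inv_into_left)
  have \<tau>c: "\<tau> x u \<in> coord_space n" if "x \<in> U" "u \<in> fib (tangent_bundle M) x" for x u
    unfolding \<tau>' using bij[OF that(1)] that(2) by (metis bij_betw_def inv_into_into)
  have Ladd: "L x (c + c') = L x c + L x c'" if "x \<in> U" for x c c'
    by (simp add: L_def scaleR_add_left sum.distrib dir_deriv_add[OF c that])
  have Lsc: "L x (k *\<^sub>R c) = k *\<^sub>R L x c" if "x \<in> U" for x k c
  proof -
    have "(\<Sum>i<n. (k *\<^sub>R c) i *\<^sub>R b i) = k *\<^sub>R (\<Sum>i<n. c i *\<^sub>R b i)"
      by (simp add: scaleR_fun_def scaleR_sum_right)
    then show ?thesis
      unfolding L_def by (simp only: dir_deriv_scaleR[OF \<open>(U, \<phi>) \<in> atlas M\<close> that])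
  qed
  show ?thesis
  proof (intro exI conjI ballI)
    show "(U, \<phi>) \<in> atlas M" by (rule c)
  next
    fix x assume x: "x \<in> U"
    show "lin_on (fib (tangent_bundle M) x) (\<tau> x)"
      unfolding lin_on_def
    proof (intro conjI ballI allI)
      fix u v assume u: "u \<in> fib (tangent_bundle M) x" and v: "v \<in> fib (tangent_bundle M) x"
      have "L x (\<tau> x u + \<tau> x v) = u + v" by (simp add: Ladd x L\<tau> u v)
      moreover have "\<tau> x u + \<tau> x v \<in> coord_space n"
        using \<tau>c[OF x u] \<tau>c[OF x v] by (simp add: coord_space_def)
      ultimately show "\<tau> x (u + v) = \<tau> x u + \<tau> x v" using \<tau>L[OF x] by metis
    next
      fix k u assume u: "u \<in> fib (tangent_bundle M) x"
      have "L x (k *\<^sub>R \<tau> x u) = k *\<^sub>R u" by (simp add: Lsc x L\<tau> u)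
      moreover have "k *\<^sub>R \<tau> x u \<in> coord_space n"
        using \<tau>c[OF x u] by (simp add: coord_space_def scaleR_fun_def)
      ultimately show "\<tau> x (k *\<^sub>R u) = k *\<^sub>R \<tau> x u" using \<tau>L[OF x] by metis
    qed
  next
    fix x u assume "x \<in> U" "u \<in> fib (tangent_bundle M) x"
    from L\<tau>[OF this]
    show "u = dir_deriv M (U, \<phi>) x (\<Sum>i<vrank (tangent_bundle M). \<tau> x u i *\<^sub>R b i)"
      by (simp add: L_def n_def tangent_bundle_def Let_def)
  qed
qed

lemma tangent_triv_cover:
  assumes "x \<in> pts M" obtains U \<tau> where "(U, \<tau>) \<in> trivs (tangent_bundle M)" "x \<in> U"
proof -
  obtain U \<phi> where c: "(U, \<phi>) \<in> atlas M" "x \<in> U" using chart_cover[OF assms] by blast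
  obtain B :: "'e set" where B: "independent B" "UNIV \<subseteq> span B" "card B = dim (UNIV :: 'e set)"
    using basis_exists[of UNIV] by metis
  obtain b0 where b0: "finite b0" "span b0 = (UNIV :: 'e set)"
    using smooth_manifold unfolding smooth_manifold_def by (elim conjE exE)
  have "finite B" using independent_span_bound[OF b0(1) B(1)] b0(2) by simp
  then obtain b where b: "bij_betw b {0..<card B} B" using ex_bij_betw_nat_finite by blast
  then have "inj_on b {..<dim (UNIV :: 'e set)}" "b ` {..<dim (UNIV :: 'e set)} = B"
    using B(3) by (auto simp: bij_betw_def lessThan_atLeast0)
  then have "\<exists>\<tau>. (U, \<tau>) \<in> trivs (tangent_bundle M)"
    using c(1) B unfolding tangent_bundle_def Let_def by auto
  then show thesis using that c(2) by blast
qed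

text \<open>Over a chart the function is the sum of the smooth components of s times the partial
  derivatives of f. This is the reason why rho(a)(f) is smooth.\<close>

lemma tangent_section_smooth:
  assumes s: "s \<in> sections M (tangent_bundle M)" and f: "smooth_fun M f"
  shows "smooth_fun M (\<lambda>x. s x f)"
  unfolding smooth_fun_def
proof (rule smooth_fun_on_near)
  fix x assume "x \<in> pts M"
  then obtain U \<tau> where U: "(U, \<tau>) \<in> trivs (tangent_bundle M)" "x \<in> U" using tangent_triv_cover by blast
  obtain \<phi> b where c: "(U, \<phi>) \<in> atlas M"
    and exp: "\<forall>x\<in>U. \<forall>u\<in>fib (tangent_bundle M) x.
      u = dir_deriv M (U, \<phi>) x (\<Sum>i<vrank (tangent_bundle M). \<tau> x u i *\<^sub>R b i)"
    using tangent_triv_expansion[OF U(1)] by (elim exE conjE)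
  have D: "smooth_fun_on M U (\<lambda>x. dir_deriv M (U, \<phi>) x v f)" for v
  proof (rule smooth_fun_on_chartI[OF c chart_openin[OF c] subset_refl])
    have "smooth_on (\<phi> ` U) (f \<circ> inv_into U \<phi>)"
      using smooth_fun_onD[OF smooth_fun_imp_on[OF f chart_subset[OF c]] c] by simp
    then have "smooth_on (\<phi> ` U) (\<lambda>y. frechet_derivative (f \<circ> inv_into U \<phi>) (at y) v)"
      by (rule smooth_on_derivative)
    then show "smooth_on (\<phi> ` U) ((\<lambda>x. dir_deriv M (U, \<phi>) x v f) \<circ> inv_into U \<phi>)"
      by (rule smooth_on_cong[OF chart_open[OF c], rotated]) (use c f in \<open>auto simp: dir_deriv_def\<close>)
  qed
  have S: "smooth_fun_on M U (\<lambda>x. \<tau> x (s x) i)" if "i < vrank (tangent_bundle M)" for i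
    using s U(1) that unfolding sections_def by fast
  have "smooth_fun_on M U (\<lambda>x. \<Sum>i<vrank (tangent_bundle M). \<tau> x (s x) i * dir_deriv M (U, \<phi>) x (b i) f)"
    by (intro smooth_fun_on_sum smooth_fun_on_mult chart_openin[OF c] S D) auto
  moreover have "s y f = (\<Sum>i<vrank (tangent_bundle M). \<tau> y (s y) i * dir_deriv M (U, \<phi>) y (b i) f)"
    if y: "y \<in> U" for y
  proof -
    have "s y \<in> fib (tangent_bundle M) y" using s chart_subset[OF c] y unfolding sections_def by blast
    from arg_cong[OF exp[rule_format, OF y this], of "\<lambda>u. u f"] show ?thesis
      by (simp add: dir_deriv_sum[OF c y])
  qed
  ultimately show "\<exists>N g. openin (mtop M) N \<and> x \<in> N \<and> smooth_fun_on M N g \<and> (\<forall>y\<in>N. s y f = g y)"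
    using chart_openin[OF c] U(2) by blast
qed simp

end

section \<open>Vector bundles and their sections\<close>

lemma sum_fun_apply: "(\<Sum>i\<in>I. f i) x = (\<Sum>i\<in>I. f i x)"
  by (induction I rule: infinite_finite_induct) simp_all

lemma lin_onD:
  assumes "lin_on S f"
  shows lin_on_add: "u \<in> S \<Longrightarrow> v \<in> S \<Longrightarrow> f (u + v) = f u + f v"
    and lin_on_scale: "u \<in> S \<Longrightarrow> f (c *\<^sub>R u) = c *\<^sub>R f u"
  using assms unfolding lin_on_def by blast+

lemma lin_onI:
  assumes "\<And>u v. u \<in> S \<Longrightarrow> v \<in> S \<Longrightarrow> f (u + v) = f u + f v"
    and "\<And>c u. u \<in> S \<Longrightarrow> f (c *\<^sub>R u) = c *\<^sub>R f u"
  shows "lin_on S f"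
  using assms unfolding lin_on_def by blast

lemma lin_on_zero: "lin_on S f \<Longrightarrow> subspace S \<Longrightarrow> f 0 = 0"
  using lin_on_scale[of S f 0 0] subspace_0 by auto

lemma lin_on_minus: "lin_on S f \<Longrightarrow> u \<in> S \<Longrightarrow> f (- u) = - f u"
  using lin_on_scale[of S f u "-1"] by simp

lemma lin_on_diff: "lin_on S f \<Longrightarrow> subspace S \<Longrightarrow> u \<in> S \<Longrightarrow> v \<in> S \<Longrightarrow> f (u - v) = f u - f v"
  using lin_on_add[of S f u "- v"] lin_on_minus[of S f v] subspace_neg[of S v] by simp

lemma lin_on_sum:
  assumes "lin_on S f" "subspace S" "\<And>i. i \<in> I \<Longrightarrow> v i \<in> S"
  shows "f (\<Sum>i\<in>I. c i *\<^sub>R v i) = (\<Sum>i\<in>I. c i *\<^sub>R f (v i))"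
  using assms(3)
proof (induction I rule: infinite_finite_induct)
  case (insert a I)
  then show ?case
    by (simp add: lin_on_add[OF assms(1)] lin_on_scale[OF assms(1)] subspace_scale[OF assms(2)]
        subspace_sum[OF assms(2)])
qed (simp_all add: lin_on_zero[OF assms(1,2)])

lemma unit_coord_in: "j < r \<Longrightarrow> unit_coord j \<in> coord_space r"
  by (simp add: unit_coord_def coord_space_def)

lemma coord_expand:
  assumes "c \<in> coord_space r" shows "(\<Sum>j<r. c j *\<^sub>R unit_coord j) = c"
proof
  fix i
  have "(\<Sum>j<r. c j *\<^sub>R unit_coord j) i = (\<Sum>j<r. if j = i then c i else 0)"
    unfolding sum_fun_apply by (rule sum.cong) (auto simp: scaleR_fun_def unit_coord_def)
  also have "\<dots> = c i" using assms by (auto simp: coord_space_def)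
  finally show "(\<Sum>j<r. c j *\<^sub>R unit_coord j) i = c i" .
qed

context manifold
begin

text \<open>What the module structure of sections rests on. It serves for the tangent bundle, which
  occurs as the target of anchors.\<close>

definition prebundle :: "('m, 'v::real_vector) vbundle \<Rightarrow> bool" where
  "prebundle E \<longleftrightarrow> (\<forall>x\<in>pts M. subspace (fib E x)) \<and>
     (\<forall>(U, \<phi>)\<in>trivs E. openin (mtop M) U \<and> (\<forall>x\<in>U. lin_on (fib E x) (\<phi> x)))"

lemma prebundleD:
  assumes "prebundle E"
  shows "x \<in> pts M \<Longrightarrow> subspace (fib E x)"
    and "(U, \<phi>) \<in> trivs E \<Longrightarrow> openin (mtop M) U"
    and "(U, \<phi>) \<in> trivs E \<Longrightarrow> x \<in> U \<Longrightarrow> lin_on (fib E x) (\<phi> x)"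
    and "(U, \<phi>) \<in> trivs E \<Longrightarrow> x \<in> U \<Longrightarrow> x \<in> pts M"
proof -
  note a = assms[unfolded prebundle_def]
  note t = bspec[OF conjunct2[OF a], of "(U, \<phi>)", simplified]
  show "x \<in> pts M \<Longrightarrow> subspace (fib E x)" by (rule bspec[OF conjunct1[OF a]])
  show "(U, \<phi>) \<in> trivs E \<Longrightarrow> openin (mtop M) U" using t by simp
  show "(U, \<phi>) \<in> trivs E \<Longrightarrow> x \<in> U \<Longrightarrow> lin_on (fib E x) (\<phi> x)" using t by simp
  show "(U, \<phi>) \<in> trivs E \<Longrightarrow> x \<in> U \<Longrightarrow> x \<in> pts M" using t openin_subset[of "mtop M" U] by auto
qed

lemma prebundle_tangent: "prebundle (tangent_bundle M)"
  unfolding prebundle_def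
proof (intro conjI ballI, goal_cases)
  case (1 x)
  then show ?case by (rule tangent_subspace)
next
  case (2 c)
  obtain U \<tau> where [simp]: "c = (U, \<tau>)" by (cases c)
  obtain \<phi> b where c: "(U, \<phi>) \<in> atlas M" and l: "\<forall>x\<in>U. lin_on (fib (tangent_bundle M) x) (\<tau> x)"
    using tangent_triv_expansion[of U \<tau>] 2 by auto
  then show ?case using chart_openin by auto
qed

lemma vbD:
  assumes "vector_bundle M E"
  shows "x \<in> pts M \<Longrightarrow> subspace (fib E x)"
    and "x \<in> pts M \<Longrightarrow> \<exists>U \<phi>. (U, \<phi>) \<in> trivs E \<and> x \<in> U"
    and "(U, \<phi>) \<in> trivs E \<Longrightarrow> openin (mtop M) U"
    and "(U, \<phi>) \<in> trivs E \<Longrightarrow> x \<in> U \<Longrightarrow> lin_on (fib E x) (\<phi> x)"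
    and "(U, \<phi>) \<in> trivs E \<Longrightarrow> x \<in> U \<Longrightarrow> bij_betw (\<phi> x) (fib E x) (coord_space (vrank E))"
    and "(U, \<phi>) \<in> trivs E \<Longrightarrow> (V, \<psi>) \<in> trivs E \<Longrightarrow> i < vrank E \<Longrightarrow> j < vrank E \<Longrightarrow>
      smooth_fun_on M (U \<inter> V) (\<lambda>x. \<psi> x (frame E \<phi> j x) i)"
proof -
  note a = assms[unfolded vector_bundle_def]
  note 1 = conjunct1[OF a] note 2 = conjunct1[OF conjunct2[OF a]]
  note 3 = conjunct1[OF conjunct2[OF conjunct2[OF a]]]
  note 4 = conjunct2[OF conjunct2[OF conjunct2[OF a]]]
  note t = bspec[OF 3, of "(U, \<phi>)", simplified]
  show "x \<in> pts M \<Longrightarrow> subspace (fib E x)" by (rule bspec[OF 1])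
  show "x \<in> pts M \<Longrightarrow> \<exists>U \<phi>. (U, \<phi>) \<in> trivs E \<and> x \<in> U"
    by (subst (asm) 2[symmetric]) auto
  show "(U, \<phi>) \<in> trivs E \<Longrightarrow> openin (mtop M) U"
    and "(U, \<phi>) \<in> trivs E \<Longrightarrow> x \<in> U \<Longrightarrow> lin_on (fib E x) (\<phi> x)"
    and "(U, \<phi>) \<in> trivs E \<Longrightarrow> x \<in> U \<Longrightarrow> bij_betw (\<phi> x) (fib E x) (coord_space (vrank E))"
    using t by simp_all
  show "(U, \<phi>) \<in> trivs E \<Longrightarrow> (V, \<psi>) \<in> trivs E \<Longrightarrow> i < vrank E \<Longrightarrow> j < vrank E \<Longrightarrow>
      smooth_fun_on M (U \<inter> V) (\<lambda>x. \<psi> x (frame E \<phi> j x) i)"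
    using bspec[OF bspec[OF 4, of "(U, \<phi>)", simplified], of "(V, \<psi>)"] by simp
qed

lemma vb_subset: "vector_bundle M E \<Longrightarrow> (U, \<phi>) \<in> trivs E \<Longrightarrow> x \<in> U \<Longrightarrow> x \<in> pts M"
  using vbD(3) openin_subset by blast

lemma prebundle_vb: "vector_bundle M E \<Longrightarrow> prebundle E"
  unfolding prebundle_def using vbD(1,3,4) by fast

subsection \<open>Frames\<close>

context
  fixes E :: "('m, 'v::real_vector) vbundle" and U \<phi>
  assumes vb: "vector_bundle M E" and triv: "(U, \<phi>) \<in> trivs E"
begin

lemma frame_in: "x \<in> U \<Longrightarrow> j < vrank E \<Longrightarrow> frame E \<phi> j x \<in> fib E x"
  using vbD(5)[OF vb triv] unit_coord_in unfolding frame_def bij_betw_def by (metis inv_into_into)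

lemma triv_frame: "x \<in> U \<Longrightarrow> j < vrank E \<Longrightarrow> \<phi> x (frame E \<phi> j x) = unit_coord j"
  using bij_betw_inv_into_right[OF vbD(5)[OF vb triv]] unit_coord_in unfolding frame_def by blast

lemma triv_in: "x \<in> U \<Longrightarrow> v \<in> fib E x \<Longrightarrow> \<phi> x v \<in> coord_space (vrank E)"
  using vbD(5)[OF vb triv] bij_betwE by blast

lemma triv_inj: "x \<in> U \<Longrightarrow> u \<in> fib E x \<Longrightarrow> v \<in> fib E x \<Longrightarrow> \<phi> x u = \<phi> x v \<Longrightarrow> u = v"
  using vbD(5)[OF vb triv] unfolding bij_betw_def inj_on_def by blast

lemma triv_sum_frame:
  assumes "x \<in> U"
  shows "\<phi> x (\<Sum>j<vrank E. c j *\<^sub>R frame E \<phi> j x) = (\<Sum>j<vrank E. c j *\<^sub>R unit_coord j)"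
proof -
  have "x \<in> pts M" using vb_subset[OF vb triv assms] .
  then show ?thesis
    using lin_on_sum[OF vbD(4)[OF vb triv assms] vbD(1)[OF vb], where I = "{..<vrank E}"]
      frame_in[OF assms] triv_frame[OF assms] by simp
qed

lemma sum_frame_in: "x \<in> U \<Longrightarrow> (\<Sum>j<vrank E. c j *\<^sub>R frame E \<phi> j x) \<in> fib E x"
  by (intro subspace_sum subspace_scale vbD(1)[OF vb] vb_subset[OF vb triv] frame_in) auto

lemma triv_expand:
  assumes "x \<in> U" "v \<in> fib E x"
  shows "(\<Sum>j<vrank E. \<phi> x v j *\<^sub>R frame E \<phi> j x) = v"
  by (rule triv_inj[OF assms(1) sum_frame_in[OF assms(1)] assms(2)])
    (simp only: triv_sum_frame[OF assms(1)] coord_expand[OF triv_in[OF assms]])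

lemma lin_on_frame_expand:
  assumes "x \<in> U" "v \<in> fib E x" "lin_on (fib E x) f"
  shows "f v = (\<Sum>j<vrank E. \<phi> x v j *\<^sub>R f (frame E \<phi> j x))"
proof -
  have "f v = f (\<Sum>j<vrank E. \<phi> x v j *\<^sub>R frame E \<phi> j x)" by (simp only: triv_expand[OF assms(1,2)])
  also have "\<dots> = (\<Sum>j<vrank E. \<phi> x v j *\<^sub>R f (frame E \<phi> j x))"
    by (rule lin_on_sum[OF assms(3) vbD(1)[OF vb vb_subset[OF vb triv assms(1)]]])
      (use frame_in[OF assms(1)] in auto)
  finally show ?thesis .
qed

end

subsection \<open>The module of sections\<close>

lemma sectionsD:
  assumes "s \<in> sections M E"
  shows "x \<in> pts M \<Longrightarrow> s x \<in> fib E x"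
    and "x \<notin> pts M \<Longrightarrow> s x = 0"
    and "(U, \<phi>) \<in> trivs E \<Longrightarrow> i < vrank E \<Longrightarrow> smooth_fun_on M U (\<lambda>x. \<phi> x (s x) i)"
  using assms unfolding sections_def by auto

lemma sectionsI:
  assumes "\<And>x. x \<in> pts M \<Longrightarrow> s x \<in> fib E x" "\<And>x. x \<notin> pts M \<Longrightarrow> s x = 0"
    and "\<And>U \<phi> i. (U, \<phi>) \<in> trivs E \<Longrightarrow> i < vrank E \<Longrightarrow> smooth_fun_on M U (\<lambda>x. \<phi> x (s x) i)"
  shows "s \<in> sections M E"
  using assms unfolding sections_def by auto

lemma section_eqI:
  "s \<in> sections M E \<Longrightarrow> t \<in> sections M E \<Longrightarrow> (\<And>x. x \<in> pts M \<Longrightarrow> s x = t x) \<Longrightarrow> s = t"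
  by (rule ext) (metis sectionsD(2))

lemma sections_near:
  assumes pre: "prebundle E"
    and "\<And>x. x \<in> pts M \<Longrightarrow> s x \<in> fib E x" "\<And>x. x \<notin> pts M \<Longrightarrow> s x = 0"
    and near: "\<And>x. x \<in> pts M \<Longrightarrow> \<exists>N t. openin (mtop M) N \<and> x \<in> N \<and> t \<in> sections M E \<and> (\<forall>y\<in>N. s y = t y)"
  shows "s \<in> sections M E"
proof (rule sectionsI)
  fix U \<phi> i assume U: "(U, \<phi>) \<in> trivs E" "i < vrank E"
  have op: "openin (mtop M) U" using prebundleD(2)[OF pre U(1)] .
  show "smooth_fun_on M U (\<lambda>x. \<phi> x (s x) i)"
  proof (rule smooth_fun_on_near[OF op])
    fix x assume x: "x \<in> U"
    then have "x \<in> pts M" using openin_subset[OF op] by auto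
    from near[OF this] obtain N t where N: "openin (mtop M) N" "x \<in> N" "t \<in> sections M E" "\<forall>y\<in>N. s y = t y"
      by (elim exE conjE)
    have "smooth_fun_on M (U \<inter> N) (\<lambda>x. \<phi> x (t x) i)"
      by (rule smooth_fun_on_subset[OF sectionsD(3)[OF N(3) U]]) auto
    then show "\<exists>N g. openin (mtop M) N \<and> x \<in> N \<and> smooth_fun_on M N g \<and> (\<forall>y\<in>N. \<phi> y (s y) i = g y)"
      using x op N by (intro exI[of _ "U \<inter> N"] exI[of _ "\<lambda>x. \<phi> x (t x) i"]) auto
  qed
qed (use assms in auto)

lemma sections_add:
  assumes pre: "prebundle E" and s: "s \<in> sections M E" "t \<in> sections M E"
  shows "s + t \<in> sections M E"
proof (rule sectionsI)
  fix U \<phi> i assume U: "(U, \<phi>) \<in> trivs E" "i < vrank E"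
  have op: "openin (mtop M) U" using prebundleD(2)[OF pre U(1)] .
  show "smooth_fun_on M U (\<lambda>x. \<phi> x ((s + t) x) i)"
    by (rule smooth_fun_on_cong[OF op _ smooth_fun_on_add[OF op sectionsD(3)[OF s(1) U] sectionsD(3)[OF s(2) U]]])
      (use lin_on_add[OF prebundleD(3)[OF pre U(1)]] sectionsD(1)[OF s(1)] sectionsD(1)[OF s(2)]
        prebundleD(4)[OF pre U(1)] in simp)
next
  fix x assume "x \<in> pts M"
  then show "(s + t) x \<in> fib E x"
    using subspace_add[OF prebundleD(1)[OF pre] sectionsD(1)[OF s(1)] sectionsD(1)[OF s(2)]] by simp
next
  fix x assume "x \<notin> pts M"
  then show "(s + t) x = 0" using sectionsD(2)[OF s(1)] sectionsD(2)[OF s(2)] by simp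
qed

lemma sections_fmult:
  assumes pre: "prebundle E" and s: "s \<in> sections M E" and f: "smooth_fun M f"
  shows "f \<odot> s \<in> sections M E"
proof (rule sectionsI)
  fix U \<phi> i assume U: "(U, \<phi>) \<in> trivs E" "i < vrank E"
  have op: "openin (mtop M) U" using prebundleD(2)[OF pre U(1)] .
  have "smooth_fun_on M U f" using smooth_fun_imp_on[OF f openin_subset[OF op]] .
  from smooth_fun_on_mult[OF op this sectionsD(3)[OF s U]]
  show "smooth_fun_on M U (\<lambda>x. \<phi> x ((f \<odot> s) x) i)"
    by (rule smooth_fun_on_cong[OF op, rotated])
      (use lin_on_scale[OF prebundleD(3)[OF pre U(1)]] sectionsD(1)[OF s]
        prebundleD(4)[OF pre U(1)] in \<open>simp add: fmult_def scaleR_fun_def\<close>)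
next
  fix x assume "x \<in> pts M"
  then show "(f \<odot> s) x \<in> fib E x"
    using subspace_scale[OF prebundleD(1)[OF pre] sectionsD(1)[OF s]] by (simp add: fmult_def)
next
  fix x assume "x \<notin> pts M"
  then show "(f \<odot> s) x = 0" using sectionsD(2)[OF s] by (simp add: fmult_def)
qed

lemma scaleR_eq_fmult: "c *\<^sub>R s = (\<lambda>_. c) \<odot> s"
  by (simp add: fmult_def scaleR_fun_def)

lemma sections_zero: assumes "prebundle E" shows "0 \<in> sections M E"
proof (rule sectionsI)
  fix U \<phi> i assume U: "(U, \<phi>) \<in> trivs E" "i < vrank E"
  have op: "openin (mtop M) U" using prebundleD(2)[OF assms U(1)] .
  have "\<phi> x 0 = 0" if "x \<in> U" for x
    by (rule lin_on_zero[OF prebundleD(3)[OF assms U(1) that]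
          prebundleD(1)[OF assms prebundleD(4)[OF assms U(1) that]]])
  then show "smooth_fun_on M U (\<lambda>x. \<phi> x (0 x) i)"
    by (intro smooth_fun_on_cong[OF op _ smooth_fun_on_const[of _ 0]]) simp
qed (use prebundleD(1)[OF assms] subspace_0 in auto)

lemma sections_scaleR: "prebundle E \<Longrightarrow> s \<in> sections M E \<Longrightarrow> c *\<^sub>R s \<in> sections M E"
  unfolding scaleR_eq_fmult by (rule sections_fmult) (auto intro: smooth_fun_const)

lemma sections_minus: "prebundle E \<Longrightarrow> s \<in> sections M E \<Longrightarrow> - s \<in> sections M E"
  using sections_scaleR[of E s "-1"] by simp

lemma sections_diff: "prebundle E \<Longrightarrow> s \<in> sections M E \<Longrightarrow> t \<in> sections M E \<Longrightarrow> s - t \<in> sections M E"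
  using sections_add[of E s "- t"] sections_minus[of E t] by simp

lemma sections_sum: "prebundle E \<Longrightarrow> (\<And>i. i \<in> I \<Longrightarrow> s i \<in> sections M E) \<Longrightarrow> (\<Sum>i\<in>I. s i) \<in> sections M E"
  by (induction I rule: infinite_finite_induct) (auto intro: sections_zero sections_add)

text \<open>The whole frame is multiplied by one plateau function, so a single neighbourhood N works
  for all its members. This is how local computations are carried out with global sections.\<close>

lemma frame_extend:
  fixes E :: "('m, 'v::real_vector) vbundle"
  assumes vb: "vector_bundle M E" and triv: "(U, \<phi>) \<in> trivs E" and x0: "x0 \<in> U"
  shows "\<exists>s N. (\<forall>j<vrank E. s j \<in> sections M E) \<and>
    (\<forall>j<vrank E. \<forall>x\<in>N. s j x = frame E \<phi> j x) \<and> openin (mtop M) N \<and> x0 \<in> N \<and> N \<subseteq> U"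
proof -
  have op: "openin (mtop M) U" using vbD(3)[OF vb triv] .
  obtain \<eta> C N where \<eta>: "smooth_fun M \<eta>" "closedin (mtop M) C" "C \<subseteq> U" "openin (mtop M) N" "x0 \<in> N"
    "N \<subseteq> U" "\<And>x. x \<in> N \<Longrightarrow> \<eta> x = 1" "\<And>x. x \<notin> C \<Longrightarrow> \<eta> x = (0::real)"
    using plateau_exists[OF op x0] by blast
  define s where "s j x = (if x \<in> U then \<eta> x *\<^sub>R frame E \<phi> j x else 0)" for j x
  have "s j \<in> sections M E" if j: "j < vrank E" for j
  proof (rule sectionsI)
    fix x assume "x \<in> pts M"
    then show "s j x \<in> fib E x"
      using vbD(1)[OF vb] frame_in[OF vb triv _ j] by (auto simp: s_def subspace_scale subspace_0)
  next
    fix x assume "x \<notin> pts M"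
    then show "s j x = 0" using vb_subset[OF vb triv] by (auto simp: s_def)
  next
    fix V \<psi> i assume V: "(V, \<psi>) \<in> trivs E" "i < vrank E"
    have opV: "openin (mtop M) V" using vbD(3)[OF vb V(1)] .
    show "smooth_fun_on M V (\<lambda>x. \<psi> x (s j x) i)"
    proof (rule smooth_fun_on_closed_support[OF op \<eta>(2,3) opV])
      have op': "openin (mtop M) (V \<inter> U)" using op opV by (rule openin_Int[rotated])
      have "smooth_fun_on M (V \<inter> U) \<eta>"
        using smooth_fun_imp_on[OF \<eta>(1) openin_subset[OF op']] .
      moreover have "smooth_fun_on M (V \<inter> U) (\<lambda>x. \<psi> x (frame E \<phi> j x) i)"
        using vbD(6)[OF vb triv V j] by (simp add: Int_commute)
      ultimately have "smooth_fun_on M (V \<inter> U) (\<lambda>x. \<eta> x * \<psi> x (frame E \<phi> j x) i)"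
        by (rule smooth_fun_on_mult[OF op'])
      then show "smooth_fun_on M (V \<inter> U) (\<lambda>x. \<psi> x (s j x) i)"
        by (rule smooth_fun_on_cong[OF op', rotated])
          (use lin_on_scale[OF vbD(4)[OF vb V(1)]] frame_in[OF vb triv _ j] in
            \<open>auto simp: s_def scaleR_fun_def\<close>)
    next
      fix x assume x: "x \<in> V - C"
      then have "s j x = 0" using \<eta>(8) by (simp add: s_def)
      then show "\<psi> x (s j x) i = 0"
        using x lin_on_zero[OF vbD(4)[OF vb V(1)] vbD(1)[OF vb vb_subset[OF vb V(1)]]] by auto
    qed
  qed
  then show ?thesis
    using \<eta> by (intro exI[of _ s] exI[of _ N]) (auto simp: s_def)
qed

lemma section_through:
  assumes vb: "vector_bundle M E" and x: "x \<in> pts M" "v \<in> fib E x"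
  shows "\<exists>s\<in>sections M E. s x = v"
proof -
  obtain U \<phi> where U: "(U, \<phi>) \<in> trivs E" "x \<in> U" using vbD(2)[OF vb x(1)] by blast
  obtain s N where s: "\<forall>j<vrank E. s j \<in> sections M E"
    "\<forall>j<vrank E. \<forall>y\<in>N. s j y = frame E \<phi> j y" "x \<in> N"
    using frame_extend[OF vb U] by (elim exE conjE)
  let ?s = "\<Sum>j<vrank E. \<phi> x v j *\<^sub>R s j"
  have "?s \<in> sections M E"
    using s(1) by (intro sections_sum sections_scaleR prebundle_vb vb) auto
  moreover have "?s x = v"
    using triv_expand[OF vb U x(2)] s by (simp add: sum_fun_apply scaleR_fun_def)
  ultimately show ?thesis by blast
qed

subsection \<open>Bundle maps\<close>

lemma on_sections_apply [simp]: "x \<in> pts M \<Longrightarrow> on_sections M h s x = h x (s x)"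
  by (simp add: on_sections_def)

text \<open>Near each point a local frame is the restriction of global sections, so the matrix
  entries of h are smooth once h sends sections to sections. All concrete bundle maps below are
  verified by this criterion.\<close>

lemma bundle_mapI:
  assumes vb: "vector_bundle M E" and pre: "prebundle F"
    and lin: "\<And>x. x \<in> pts M \<Longrightarrow> lin_on (fib E x) (h x)"
    and im: "\<And>x v. x \<in> pts M \<Longrightarrow> v \<in> fib E x \<Longrightarrow> h x v \<in> fib F x"
    and sec: "\<And>s. s \<in> sections M E \<Longrightarrow> on_sections M h s \<in> sections M F"
  shows "bundle_map M E F h"
proof -
  have "smooth_fun_on M (U \<inter> V) (\<lambda>x. \<psi> x (h x (frame E \<phi> j x)) i)"
    if U: "(U, \<phi>) \<in> trivs E" and V: "(V, \<psi>) \<in> trivs F" and ij: "i < vrank F" "j < vrank E"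
    for U \<phi> V \<psi> i j
  proof (rule smooth_fun_on_near)
    have opV: "openin (mtop M) V" using prebundleD(2)[OF pre V] .
    show "openin (mtop M) (U \<inter> V)" using vbD(3)[OF vb U] opV by (rule openin_Int)
    fix x assume x: "x \<in> U \<inter> V"
    then have "x \<in> U" by simp
    from frame_extend[OF vb U this] obtain s N where s0: "\<forall>j<vrank E. s j \<in> sections M E"
      "\<forall>j<vrank E. \<forall>y\<in>N. s j y = frame E \<phi> j y" and N: "openin (mtop M) N" "x \<in> N" "N \<subseteq> U"
      by (elim exE conjE)
    then have s: "s j \<in> sections M E" "\<forall>y\<in>N. s j y = frame E \<phi> j y" using ij(2) by auto
    have "smooth_fun_on M (N \<inter> V) (\<lambda>y. \<psi> y (on_sections M h (s j) y) i)"
      by (rule smooth_fun_on_subset[OF sectionsD(3)[OF sec[OF s(1)] V ij(1)]]) auto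
    then show "\<exists>N g. openin (mtop M) N \<and> x \<in> N \<and> smooth_fun_on M N g \<and>
        (\<forall>y\<in>N. \<psi> y (h y (frame E \<phi> j y)) i = g y)"
      using s(2) N x openin_Int[OF N(1) opV] openin_subset[OF opV]
      by (intro exI[of _ "N \<inter> V"] exI[of _ "\<lambda>y. \<psi> y (on_sections M h (s j) y) i"]) (auto simp: subset_iff)
  qed
  then show ?thesis unfolding bundle_map_def using lin im by auto
qed

lemma bundle_mapD:
  assumes "bundle_map M E F h"
  shows "x \<in> pts M \<Longrightarrow> lin_on (fib E x) (h x)"
    and "x \<in> pts M \<Longrightarrow> v \<in> fib E x \<Longrightarrow> h x v \<in> fib F x"
    and "(U, \<phi>) \<in> trivs E \<Longrightarrow> (V, \<psi>) \<in> trivs F \<Longrightarrow> i < vrank F \<Longrightarrow> j < vrank E \<Longrightarrow>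
      smooth_fun_on M (U \<inter> V) (\<lambda>x. \<psi> x (h x (frame E \<phi> j x)) i)"
proof -
  note a = assms[unfolded bundle_map_def]
  show "x \<in> pts M \<Longrightarrow> lin_on (fib E x) (h x)" and "x \<in> pts M \<Longrightarrow> v \<in> fib E x \<Longrightarrow> h x v \<in> fib F x"
    using bspec[OF conjunct1[OF a], of x] by auto
  show "(U, \<phi>) \<in> trivs E \<Longrightarrow> (V, \<psi>) \<in> trivs F \<Longrightarrow> i < vrank F \<Longrightarrow> j < vrank E \<Longrightarrow>
      smooth_fun_on M (U \<inter> V) (\<lambda>x. \<psi> x (h x (frame E \<phi> j x)) i)"
    using bspec[OF bspec[OF conjunct2[OF a], of "(U, \<phi>)", simplified], of "(V, \<psi>)"] by simp
qed

text \<open>The converse of \<open>bundle_mapI\<close>: expand s in a local frame and apply the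
  matrix of h.\<close>

lemma bundle_map_sections:
  assumes vb: "vector_bundle M E" and pre: "prebundle F" and h: "bundle_map M E F h"
    and s: "s \<in> sections M E"
  shows "on_sections M h s \<in> sections M F"
proof (rule sectionsI)
  fix V \<psi> i assume V: "(V, \<psi>) \<in> trivs F" "i < vrank F"
  have opV: "openin (mtop M) V" using prebundleD(2)[OF pre V(1)] .
  show "smooth_fun_on M V (\<lambda>x. \<psi> x (on_sections M h s x) i)"
  proof (rule smooth_fun_on_near[OF opV])
    fix x assume x: "x \<in> V"
    then have "x \<in> pts M" using opV openin_subset by blast
    then obtain U \<phi> where U: "(U, \<phi>) \<in> trivs E" "x \<in> U" using vbD(2)[OF vb] by blast
    have op: "openin (mtop M) (U \<inter> V)" using vbD(3)[OF vb U(1)] opV by (rule openin_Int)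
    have "smooth_fun_on M (U \<inter> V) (\<lambda>y. \<Sum>j<vrank E. \<phi> y (s y) j * \<psi> y (h y (frame E \<phi> j y)) i)"
      by (intro smooth_fun_on_sum smooth_fun_on_mult op bundle_mapD(3)[OF h U(1) V]
          smooth_fun_on_subset[OF sectionsD(3)[OF s U(1)]]) auto
    moreover have "\<psi> y (on_sections M h s y) i = (\<Sum>j<vrank E. \<phi> y (s y) j * \<psi> y (h y (frame E \<phi> j y)) i)"
      if y: "y \<in> U \<inter> V" for y
    proof -
      have yU: "y \<in> U" and yV: "y \<in> V" and yM: "y \<in> pts M" using y vb_subset[OF vb U(1)] by auto
      have "h y (s y) = (\<Sum>j<vrank E. \<phi> y (s y) j *\<^sub>R h y (frame E \<phi> j y))"
        by (rule lin_on_frame_expand[OF vb U(1) yU sectionsD(1)[OF s yM] bundle_mapD(1)[OF h yM]])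
      then have "\<psi> y (h y (s y)) = (\<Sum>j<vrank E. \<phi> y (s y) j *\<^sub>R \<psi> y (h y (frame E \<phi> j y)))"
        using lin_on_sum[OF prebundleD(3)[OF pre V(1) yV] prebundleD(1)[OF pre yM],
            where I = "{..<vrank E}" and v = "\<lambda>j. h y (frame E \<phi> j y)"]
          bundle_mapD(2)[OF h yM frame_in[OF vb U(1) yU]] by simp
      then show ?thesis using yM by (simp add: sum_fun_apply scaleR_fun_def)
    qed
    ultimately show "\<exists>N g. openin (mtop M) N \<and> x \<in> N \<and> smooth_fun_on M N g \<and>
        (\<forall>y\<in>N. \<psi> y (on_sections M h s y) i = g y)"
      using op x U(2) by (intro exI[of _ "U \<inter> V"] exI[of _
            "\<lambda>y. \<Sum>j<vrank E. \<phi> y (s y) j * \<psi> y (h y (frame E \<phi> j y)) i"]) auto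
  qed
qed (use sectionsD(1)[OF s] bundle_mapD(2)[OF h] in \<open>auto simp: on_sections_def\<close>)

end

section \<open>Dual bundles and tensorial functionals\<close>

lemma vrank_dual [simp]: "vrank (dual_bundle E) = vrank E"
  by (simp add: dual_bundle_def)

lemma fib_dual: "fib (dual_bundle E) x = {\<beta>. lin_on (fib E x) \<beta> \<and> (\<forall>v. v \<notin> fib E x \<longrightarrow> \<beta> v = 0)}"
  by (simp add: dual_bundle_def)

lemma trivs_dual: "trivs (dual_bundle E) =
    (\<lambda>(U, \<phi>). (U, \<lambda>x \<beta> i. if i < vrank E then \<beta> (frame E \<phi> i x) else 0)) ` trivs E"
  by (simp add: dual_bundle_def)

lemma trivs_dualE:
  assumes "(U, \<tau>) \<in> trivs (dual_bundle E)"
  obtains \<phi> where "(U, \<phi>) \<in> trivs E"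
    "\<tau> = (\<lambda>x \<beta> i. if i < vrank E then \<beta> (frame E \<phi> i x) else 0)"
  using assms unfolding trivs_dual by auto

lemma trivs_dualI: "(U, \<phi>) \<in> trivs E \<Longrightarrow>
    (U, \<lambda>x \<beta> i. if i < vrank E then \<beta> (frame E \<phi> i x) else 0) \<in> trivs (dual_bundle E)"
  unfolding trivs_dual by force

lemma dual_fibD:
  assumes "\<beta> \<in> fib (dual_bundle E) x"
  shows "lin_on (fib E x) \<beta>" and "v \<notin> fib E x \<Longrightarrow> \<beta> v = 0"
  using assms by (auto simp: fib_dual)

lemma dual_fib_eqI:
  assumes "\<beta> \<in> fib (dual_bundle E) x" "\<gamma> \<in> fib (dual_bundle E) x"
    "\<And>v. v \<in> fib E x \<Longrightarrow> \<beta> v = \<gamma> v"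
  shows "\<beta> = \<gamma>"
proof
  fix v show "\<beta> v = \<gamma> v"
    using assms(3) dual_fibD(2)[OF assms(1)] dual_fibD(2)[OF assms(2)] by (cases "v \<in> fib E x") auto
qed

text \<open>The dual basis of a frame, cut off outside the fibre because covectors vanish there by
  convention.\<close>

definition coframe :: "('m, 'v) vbundle \<Rightarrow> ('m \<Rightarrow> 'v \<Rightarrow> nat \<Rightarrow> real) \<Rightarrow> nat \<Rightarrow> 'm \<Rightarrow> 'v \<Rightarrow> real"
  where "coframe E \<phi> j x v = (if v \<in> fib E x then \<phi> x v j else 0)"

lemma subspace_dual_fib:
  assumes "subspace (fib E x)" shows "subspace (fib (dual_bundle E) x)"
  unfolding fib_dual
  by (rule subspaceI) (auto simp: lin_on_def scaleR_fun_def algebra_simps)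

context manifold
begin

context
  fixes E :: "('m, 'v::real_vector) vbundle" and U \<phi>
  assumes vb: "vector_bundle M E" and triv: "(U, \<phi>) \<in> trivs E"
begin

private abbreviation "\<tau> \<equiv> \<lambda>x \<beta> i. if i < vrank E then \<beta> (frame E \<phi> i x) else (0::real)"

lemma coframe_in:
  assumes "x \<in> U" shows "coframe E \<phi> j x \<in> fib (dual_bundle E) x"
proof -
  have sub: "subspace (fib E x)" using vbD(1)[OF vb vb_subset[OF vb triv assms]] .
  show ?thesis
    unfolding fib_dual
    by (auto intro!: lin_onI simp: coframe_def subspace_add[OF sub] subspace_scale[OF sub]
        lin_on_add[OF vbD(4)[OF vb triv assms]] lin_on_scale[OF vbD(4)[OF vb triv assms]] scaleR_fun_def)
qed

lemma coframe_frame: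
  "x \<in> U \<Longrightarrow> i < vrank E \<Longrightarrow> coframe E \<phi> j x (frame E \<phi> i x) = (if i = j then 1 else 0)"
  using frame_in[OF vb triv] triv_frame[OF vb triv] by (auto simp: coframe_def unit_coord_def)

lemma dual_expand:
  assumes "x \<in> U" "\<beta> \<in> fib (dual_bundle E) x" "v \<in> fib E x"
  shows "\<beta> v = (\<Sum>j<vrank E. \<phi> x v j * \<beta> (frame E \<phi> j x))"
  using lin_on_frame_expand[OF vb triv assms(1,3) dual_fibD(1)[OF assms(2)]] by simp

lemma dual_triv_bij:
  assumes x: "x \<in> U"
  shows "bij_betw (\<tau> x) (fib (dual_bundle E) x) (coord_space (vrank E))"
proof (rule bij_betwI')
  fix \<beta> \<gamma> assume b: "\<beta> \<in> fib (dual_bundle E) x" and c: "\<gamma> \<in> fib (dual_bundle E) x"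
  show "(\<tau> x \<beta> = \<tau> x \<gamma>) = (\<beta> = \<gamma>)"
  proof
    assume eq: "\<tau> x \<beta> = \<tau> x \<gamma>"
    have "\<beta> (frame E \<phi> j x) = \<gamma> (frame E \<phi> j x)" if "j < vrank E" for j
      using fun_cong[OF eq, of j] that by simp
    then show "\<beta> = \<gamma>"
      by (intro dual_fib_eqI[OF b c]) (simp add: dual_expand[OF x b] dual_expand[OF x c])
  next
    assume "\<beta> = \<gamma>" then show "\<tau> x \<beta> = \<tau> x \<gamma>" by (rule arg_cong)
  qed
next
  fix \<beta> show "\<tau> x \<beta> \<in> coord_space (vrank E)" by (simp add: coord_space_def)
next
  fix c assume c: "c \<in> coord_space (vrank E)"
  let ?\<beta> = "\<Sum>j<vrank E. c j *\<^sub>R coframe E \<phi> j x"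
  have "?\<beta> \<in> fib (dual_bundle E) x"
    by (intro subspace_sum subspace_scale subspace_dual_fib coframe_in x
        vbD(1)[OF vb vb_subset[OF vb triv x]])
  moreover have "\<tau> x ?\<beta> = c"
  proof
    fix i
    show "\<tau> x ?\<beta> i = c i"
    proof (cases "i < vrank E")
      case True
      then have "?\<beta> (frame E \<phi> i x) = (\<Sum>j<vrank E. if i = j then c j else 0)"
        unfolding sum_fun_apply by (intro sum.cong) (auto simp: scaleR_fun_def coframe_frame[OF x])
      then show ?thesis using True by simp
    qed (use c in \<open>auto simp: coord_space_def\<close>)
  qed
  ultimately show "\<exists>\<beta>\<in>fib (dual_bundle E) x. c = \<tau> x \<beta>" by metis
qed

lemma dual_frame:
  assumes "x \<in> U" "j < vrank E"
  shows "frame (dual_bundle E) \<tau> j x = coframe E \<phi> j x"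
  unfolding frame_def[of "dual_bundle E"]
proof (rule inv_into_f_eq)
  show "inj_on (\<tau> x) (fib (dual_bundle E) x)" using dual_triv_bij[OF assms(1)] by (simp add: bij_betw_def)
  show "coframe E \<phi> j x \<in> fib (dual_bundle E) x" by (rule coframe_in[OF assms(1)])
  show "\<tau> x (coframe E \<phi> j x) = unit_coord j"
    using assms by (auto simp: unit_coord_def coframe_frame[OF assms(1)] fun_eq_iff)
qed

end

text \<open>The transition matrix of the dual is the transpose of the one of E in the opposite
  direction, so its entries are smooth by the clause for E with the two trivialisations
  exchanged.\<close>

lemma vector_bundle_dual:
  assumes vb: "vector_bundle M E" shows "vector_bundle M (dual_bundle E)"
proof -
  have 1: "subspace (fib (dual_bundle E) x)" if "x \<in> pts M" for x
    by (rule subspace_dual_fib[OF vbD(1)[OF vb that]])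
  have 2: "(\<Union>(U, \<phi>)\<in>trivs (dual_bundle E). U) = pts M"
  proof -
    have "(\<Union>(U, \<phi>)\<in>trivs E. U) = pts M" using vb unfolding vector_bundle_def by (elim conjE)
    then show ?thesis by (simp add: trivs_dual split_beta)
  qed
  have 3: "openin (mtop M) U \<and> (\<forall>x\<in>U. lin_on (fib (dual_bundle E) x) (\<tau> x) \<and>
      bij_betw (\<tau> x) (fib (dual_bundle E) x) (coord_space (vrank (dual_bundle E))))"
    if "(U, \<tau>) \<in> trivs (dual_bundle E)" for U \<tau>
  proof -
    obtain \<phi> where U: "(U, \<phi>) \<in> trivs E"
      and \<tau>: "\<tau> = (\<lambda>x \<beta> i. if i < vrank E then \<beta> (frame E \<phi> i x) else 0)"
      using trivs_dualE[OF \<open>(U, \<tau>) \<in> trivs (dual_bundle E)\<close>] .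
    show ?thesis
      using vbD(3)[OF vb U] dual_triv_bij[OF vb U]
      by (auto simp: \<tau> lin_on_def fun_eq_iff scaleR_fun_def)
  qed
  have 4: "smooth_fun_on M (U \<inter> V) (\<lambda>x. \<sigma> x (frame (dual_bundle E) \<tau> j x) i)"
    if U: "(U, \<tau>) \<in> trivs (dual_bundle E)" and V: "(V, \<sigma>) \<in> trivs (dual_bundle E)"
      and ij: "i < vrank E" "j < vrank E" for U \<tau> V \<sigma> i j
  proof -
    obtain \<phi> where U: "(U, \<phi>) \<in> trivs E"
      and \<tau>: "\<tau> = (\<lambda>x \<beta> i. if i < vrank E then \<beta> (frame E \<phi> i x) else 0)"
      using trivs_dualE[OF U] .
    obtain \<psi> where V: "(V, \<psi>) \<in> trivs E"
      and \<sigma>: "\<sigma> = (\<lambda>x \<beta> i. if i < vrank E then \<beta> (frame E \<psi> i x) else 0)"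
      using trivs_dualE[OF V] .
    have op: "openin (mtop M) (U \<inter> V)" using vbD(3)[OF vb U] vbD(3)[OF vb V] by (rule openin_Int)
    show ?thesis
    proof (rule smooth_fun_on_cong[OF op])
      show "smooth_fun_on M (U \<inter> V) (\<lambda>x. \<phi> x (frame E \<psi> i x) j)"
        using vbD(6)[OF vb V U ij(2,1)] by (simp add: Int_commute)
      fix x assume x: "x \<in> U \<inter> V"
      then have "frame (dual_bundle E) \<tau> j x = coframe E \<phi> j x"
        unfolding \<tau> by (intro dual_frame[OF vb U] ij) auto
      then show "\<phi> x (frame E \<psi> i x) j = \<sigma> x (frame (dual_bundle E) \<tau> j x) i"
        using frame_in[OF vb V _ ij(1)] x ij by (simp add: \<sigma> coframe_def)
    qed
  qed
  show ?thesis unfolding vector_bundle_def using 1 2 3 4 by auto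
qed

lemma dual_section_frame_smooth:
  assumes "\<beta> \<in> sections M (dual_bundle E)" "(U, \<phi>) \<in> trivs E" "i < vrank E"
  shows "smooth_fun_on M U (\<lambda>x. \<beta> x (frame E \<phi> i x))"
  using sectionsD(3)[OF assms(1) trivs_dualI[OF assms(2)]] assms(3) by simp

lemma pairing_smooth:
  assumes vb: "vector_bundle M E" and b: "\<beta> \<in> sections M (dual_bundle E)" and Y: "Y \<in> sections M E"
  shows "smooth_fun M (pairing \<beta> Y)"
  unfolding smooth_fun_def
proof (rule smooth_fun_on_near)
  fix x assume "x \<in> pts M"
  then obtain U \<phi> where U: "(U, \<phi>) \<in> trivs E" "x \<in> U" using vbD(2)[OF vb] by blast
  have op: "openin (mtop M) U" using vbD(3)[OF vb U(1)] .
  have "smooth_fun_on M U (\<lambda>y. \<Sum>j<vrank E. \<phi> y (Y y) j * \<beta> y (frame E \<phi> j y))"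
    by (intro smooth_fun_on_sum smooth_fun_on_mult op sectionsD(3)[OF Y U(1)]
        dual_section_frame_smooth[OF b U(1)]) auto
  moreover have "pairing \<beta> Y y = (\<Sum>j<vrank E. \<phi> y (Y y) j * \<beta> y (frame E \<phi> j y))" if "y \<in> U" for y
    using dual_expand[OF vb U(1) that] sectionsD(1)[OF b] sectionsD(1)[OF Y] vb_subset[OF vb U(1) that]
    by (simp add: pairing_def)
  ultimately show "\<exists>N g. openin (mtop M) N \<and> x \<in> N \<and> smooth_fun_on M N g \<and> (\<forall>y\<in>N. pairing \<beta> Y y = g y)"
    using op U(2) by (intro exI[of _ U] exI[of _ "\<lambda>y. \<Sum>j<vrank E. \<phi> y (Y y) j * \<beta> y (frame E \<phi> j y)"]) auto
qed simp

lemma dual_section_eqI: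
  assumes vb: "vector_bundle M E"
    and b: "\<beta> \<in> sections M (dual_bundle E)" and c: "\<gamma> \<in> sections M (dual_bundle E)"
    and eq: "\<And>Y x. Y \<in> sections M E \<Longrightarrow> x \<in> pts M \<Longrightarrow> pairing \<beta> Y x = pairing \<gamma> Y x"
  shows "\<beta> = \<gamma>"
proof (rule section_eqI[OF b c])
  fix x assume x: "x \<in> pts M"
  show "\<beta> x = \<gamma> x"
  proof (rule dual_fib_eqI[OF sectionsD(1)[OF b x] sectionsD(1)[OF c x]])
    fix v assume "v \<in> fib E x"
    then obtain Y where "Y \<in> sections M E" "Y x = v" using section_through[OF vb x] by auto
    then show "\<beta> x v = \<gamma> x v" using eq[of Y x] x by (simp add: pairing_def)
  qed
qed

lemma fib_eqI:
  assumes vb: "vector_bundle M E" and x: "x \<in> pts M" and v: "v \<in> fib E x" and w: "w \<in> fib E x"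
    and eq: "\<And>\<beta>. \<beta> \<in> fib (dual_bundle E) x \<Longrightarrow> \<beta> v = \<beta> w"
  shows "v = w"
proof -
  obtain U \<phi> where U: "(U, \<phi>) \<in> trivs E" "x \<in> U" using vbD(2)[OF vb x] by blast
  have "\<phi> x v j = \<phi> x w j" for j
    using eq[OF coframe_in[OF vb U, of j]] v w by (simp add: coframe_def)
  then show ?thesis by (intro triv_inj[OF vb U v w]) auto
qed

lemma section_eq_pairingI:
  assumes vb: "vector_bundle M E" and Y: "Y \<in> sections M E" and Z: "Z \<in> sections M E"
    and eq: "\<And>\<beta> x. \<beta> \<in> sections M (dual_bundle E) \<Longrightarrow> x \<in> pts M \<Longrightarrow> pairing \<beta> Y x = pairing \<beta> Z x"
  shows "Y = Z"
proof (rule section_eqI[OF Y Z])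
  fix x assume x: "x \<in> pts M"
  show "Y x = Z x"
  proof (rule fib_eqI[OF vb x sectionsD(1)[OF Y x] sectionsD(1)[OF Z x]])
    fix b assume "b \<in> fib (dual_bundle E) x"
    then obtain \<beta> where "\<beta> \<in> sections M (dual_bundle E)" "\<beta> x = b"
      using section_through[OF vector_bundle_dual[OF vb] x] by auto
    then show "b (Y x) = b (Z x)" using eq[of \<beta> x] x by (simp add: pairing_def)
  qed
qed

subsection \<open>Function-linear functionals are given by sections of the dual\<close>

definition tensorial :: "('m, 'v::real_vector) vbundle \<Rightarrow> (('m \<Rightarrow> 'v) \<Rightarrow> 'm \<Rightarrow> real) \<Rightarrow> bool" where
  "tensorial E F \<longleftrightarrow> (\<forall>Y\<in>sections M E. smooth_fun M (F Y)) \<and>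
     (\<forall>Y\<in>sections M E. \<forall>Z\<in>sections M E. \<forall>x\<in>pts M. F (Y + Z) x = F Y x + F Z x) \<and>
     (\<forall>f. \<forall>Y\<in>sections M E. \<forall>x\<in>pts M. smooth_fun M f \<longrightarrow> F (f \<odot> Y) x = f x * F Y x)"

lemma tensorialD:
  assumes "tensorial E F"
  shows "Y \<in> sections M E \<Longrightarrow> smooth_fun M (F Y)"
    and "Y \<in> sections M E \<Longrightarrow> Z \<in> sections M E \<Longrightarrow> x \<in> pts M \<Longrightarrow> F (Y + Z) x = F Y x + F Z x"
    and "smooth_fun M f \<Longrightarrow> Y \<in> sections M E \<Longrightarrow> x \<in> pts M \<Longrightarrow> F (f \<odot> Y) x = f x * F Y x"
  using assms unfolding tensorial_def by auto

context
  fixes E :: "('m, 'v::real_vector) vbundle" and F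
  assumes vb: "vector_bundle M E" and F: "tensorial E F"
begin

lemma tensorial_zero: "x \<in> pts M \<Longrightarrow> F 0 x = 0"
  using tensorialD(3)[OF F smooth_fun_const[of 0] sections_zero[OF prebundle_vb[OF vb]]]
  by (simp add: fmult_def zero_fun_def)

lemma tensorial_scaleR: "Y \<in> sections M E \<Longrightarrow> x \<in> pts M \<Longrightarrow> F (c *\<^sub>R Y) x = c * F Y x"
  unfolding scaleR_eq_fmult by (rule tensorialD(3)[OF F smooth_fun_const])

lemma tensorial_diff: "Y \<in> sections M E \<Longrightarrow> Z \<in> sections M E \<Longrightarrow> x \<in> pts M \<Longrightarrow> F (Y - Z) x = F Y x - F Z x"
  using tensorialD(2)[OF F, of Y "(-1) *\<^sub>R Z"] tensorial_scaleR[of Z x "-1"]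
    sections_scaleR[OF prebundle_vb[OF vb], of Z "-1"] by simp

lemma tensorial_sum_zero:
  assumes "x \<in> pts M" "\<And>i. i \<in> I \<Longrightarrow> Y i \<in> sections M E" "\<And>i. i \<in> I \<Longrightarrow> F (Y i) x = 0"
  shows "F (\<Sum>i\<in>I. Y i) x = 0"
  using assms(2,3)
proof (induction I rule: infinite_finite_induct)
  case (insert a I)
  have "F (Y a + (\<Sum>i\<in>I. Y i)) x = F (Y a) x + F (\<Sum>i\<in>I. Y i) x"
    by (rule tensorialD(2)[OF F _ sections_sum[OF prebundle_vb[OF vb]] assms(1)]) (use insert in auto)
  also have "\<dots> = 0" using insert by simp
  finally show ?case unfolding sum.insert[OF insert(1,2)] .
qed (simp_all add: tensorial_zero assms(1))

text \<open>A plateau function with value 1 at x and support in N annihilates Y - Z; pulling it out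
  of F gives the claim at x.\<close>

lemma tensorial_near:
  assumes Y: "Y \<in> sections M E" and Z: "Z \<in> sections M E"
    and N: "openin (mtop M) N" "x \<in> N" "\<And>y. y \<in> N \<Longrightarrow> Y y = Z y"
  shows "F Y x = F Z x"
proof -
  have x: "x \<in> pts M" using N openin_subset by blast
  obtain \<eta> C N' where \<eta>: "smooth_fun M \<eta>" "closedin (mtop M) C" "C \<subseteq> N" "openin (mtop M) N'" "x \<in> N'"
    "N' \<subseteq> N" "\<And>x. x \<in> N' \<Longrightarrow> \<eta> x = 1" "\<And>x. x \<notin> C \<Longrightarrow> \<eta> x = (0::real)"
    using plateau_exists[OF N(1,2)] by blast
  have "\<eta> \<odot> (Y - Z) = 0"
  proof
    fix y show "(\<eta> \<odot> (Y - Z)) y = 0 y"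
      using \<eta>(3,8) N(3)[of y] by (cases "y \<in> C") (auto simp: fmult_def)
  qed
  moreover have "F (\<eta> \<odot> (Y - Z)) x = \<eta> x * F (Y - Z) x"
    by (rule tensorialD(3)[OF F \<eta>(1) sections_diff[OF prebundle_vb[OF vb] Y Z] x])
  ultimately have "F (Y - Z) x = 0" using \<eta>(5,7) tensorial_zero[OF x] by simp
  then show ?thesis using tensorial_diff[OF Y Z x] by simp
qed

text \<open>Near x, Y is a combination of global sections with global coefficient functions that
  vanish at x, and F lets these functions out.\<close>

lemma tensorial_vanish:
  assumes Y: "Y \<in> sections M E" and x: "x \<in> pts M" "Y x = 0"
  shows "F Y x = 0"
proof -
  obtain U \<phi> where U: "(U, \<phi>) \<in> trivs E" "x \<in> U" using vbD(2)[OF vb x(1)] by blast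
  have op: "openin (mtop M) U" using vbD(3)[OF vb U(1)] .
  obtain s N where s: "\<forall>j<vrank E. s j \<in> sections M E"
    "\<forall>j<vrank E. \<forall>y\<in>N. s j y = frame E \<phi> j y" and N: "openin (mtop M) N" "x \<in> N" "N \<subseteq> U"
    using frame_extend[OF vb U] by (elim exE conjE)
  have "\<forall>j\<in>{..<vrank E}. \<exists>c N'. smooth_fun M c \<and> openin (mtop M) N' \<and> x \<in> N' \<and> (\<forall>y\<in>N'. c y = \<phi> y (Y y) j)"
  proof
    fix j assume "j \<in> {..<vrank E}"
    then have "smooth_fun_on M U (\<lambda>y. \<phi> y (Y y) j)" using sectionsD(3)[OF Y U(1)] by simp
    from smooth_fun_extend[OF op U(2) this]
    obtain c N' where "smooth_fun M c" "openin (mtop M) N'" "x \<in> N'" "N' \<subseteq> U" "\<And>y. y \<in> N' \<Longrightarrow> c y = \<phi> y (Y y) j"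
      by blast
    then show "\<exists>c N'. smooth_fun M c \<and> openin (mtop M) N' \<and> x \<in> N' \<and> (\<forall>y\<in>N'. c y = \<phi> y (Y y) j)"
      by (intro exI[of _ c] exI[of _ N']) auto
  qed
  from bchoice[OF this] obtain c where "\<forall>j\<in>{..<vrank E}. \<exists>N'. smooth_fun M (c j) \<and> openin (mtop M) N' \<and>
      x \<in> N' \<and> (\<forall>y\<in>N'. c j y = \<phi> y (Y y) j)"
    by (elim exE)
  from bchoice[OF this] obtain N' where c: "\<forall>j\<in>{..<vrank E}. smooth_fun M (c j) \<and> openin (mtop M) (N' j) \<and>
      x \<in> N' j \<and> (\<forall>y\<in>N' j. c j y = \<phi> y (Y y) j)"
    by (elim exE)
  \<comment> \<open>The factor \<open>pts M\<close> keeps the set open in rank 0, where the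
    intersection over the empty index set is the whole type.\<close>
  define W where "W = N \<inter> ((\<Inter>j\<in>{..<vrank E}. N' j) \<inter> pts M)"
  have W: "openin (mtop M) W" "x \<in> W"
    using N c x by (auto simp: W_def intro!: openin_Int openin_INT)
  let ?Z = "\<Sum>j<vrank E. c j \<odot> s j"
  have cs: "c j \<odot> s j \<in> sections M E" if "j \<in> {..<vrank E}" for j
    using c s that by (intro sections_fmult prebundle_vb vb) auto
  have Z: "?Z \<in> sections M E" by (rule sections_sum[OF prebundle_vb[OF vb] cs])
  have "F Y x = F ?Z x"
  proof (rule tensorial_near[OF Y Z W])
    fix y assume y: "y \<in> W"
    then have yU: "y \<in> U" and yM: "y \<in> pts M" using N(3) by (auto simp: W_def)
    have "?Z y = (\<Sum>j<vrank E. \<phi> y (Y y) j *\<^sub>R frame E \<phi> j y)"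
      unfolding sum_fun_apply by (rule sum.cong) (use y c s in \<open>auto simp: W_def fmult_def\<close>)
    also have "\<dots> = Y y" by (rule triv_expand[OF vb U(1) yU sectionsD(1)[OF Y yM]])
    finally show "Y y = ?Z y" by simp
  qed
  also have "\<dots> = 0"
  proof (rule tensorial_sum_zero[OF x(1) cs])
    fix j assume j: "j \<in> {..<vrank E}"
    have "\<phi> x 0 = 0" by (rule lin_on_zero[OF vbD(4)[OF vb U] vbD(1)[OF vb x(1)]])
    then have "c j x = 0" using c j x(2) by simp
    then show "F (c j \<odot> s j) x = 0" using tensorialD(3)[OF F, of "c j" "s j" x] c s j x(1) by simp
  qed
  finally show ?thesis .
qed

lemma tensorial_pointwise:
  assumes "Y \<in> sections M E" "Z \<in> sections M E" "x \<in> pts M" "Y x = Z x"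
  shows "F Y x = F Z x"
  using tensorial_vanish[OF sections_diff[OF prebundle_vb[OF vb] assms(1,2)] assms(3)] assms(4)
    tensorial_diff[OF assms(1-3)] by simp

text \<open>The covector at x sends v to the value of F at a section through v. The choice is
  irrelevant by \<open>tensorial_pointwise\<close>, which also yields linearity, and the components
  are the smooth functions F (s i) for sections s i extending a frame. The dual products of S exist
  for this reason.\<close>

lemma tensorial_representation:
  "\<exists>\<gamma>\<in>sections M (dual_bundle E). \<forall>Y\<in>sections M E. \<forall>x\<in>pts M. pairing \<gamma> Y x = F Y x"
proof -
  define ext where "ext x v = (SOME Y. Y \<in> sections M E \<and> Y x = v)" for x v
  have ext: "ext x v \<in> sections M E" "ext x v x = v" if "x \<in> pts M" "v \<in> fib E x" for x v
  proof -
    have "\<exists>Y. Y \<in> sections M E \<and> Y x = v" using section_through[OF vb that] by (elim bexE) auto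
    from someI_ex[OF this] show "ext x v \<in> sections M E" "ext x v x = v" by (auto simp: ext_def)
  qed
  define \<gamma> where "\<gamma> x v = (if x \<in> pts M \<and> v \<in> fib E x then F (ext x v) x else 0)" for x v
  have \<gamma>: "\<gamma> x (Y x) = F Y x" if "Y \<in> sections M E" "x \<in> pts M" for Y x
    using tensorial_pointwise[OF ext(1) that(1) that(2) ext(2)] sectionsD(1)[OF that] that(2)
    by (simp add: \<gamma>_def)
  have "\<gamma> \<in> sections M (dual_bundle E)"
  proof (rule sectionsI)
    fix x assume x: "x \<in> pts M"
    have "lin_on (fib E x) (\<gamma> x)"
    proof (rule lin_onI)
      fix u v assume u: "u \<in> fib E x" and v: "v \<in> fib E x"
      show "\<gamma> x (u + v) = \<gamma> x u + \<gamma> x v"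
        using \<gamma>[OF sections_add[OF prebundle_vb[OF vb] ext(1)[OF x u] ext(1)[OF x v]] x]
          tensorialD(2)[OF F ext(1)[OF x u] ext(1)[OF x v] x] \<gamma>[OF ext(1)[OF x u] x] \<gamma>[OF ext(1)[OF x v] x]
        by (simp add: ext(2)[OF x u] ext(2)[OF x v])
    next
      fix c u assume u: "u \<in> fib E x"
      show "\<gamma> x (c *\<^sub>R u) = c *\<^sub>R \<gamma> x u"
        using \<gamma>[OF sections_scaleR[OF prebundle_vb[OF vb] ext(1)[OF x u]] x]
          tensorial_scaleR[OF ext(1)[OF x u] x] \<gamma>[OF ext(1)[OF x u] x]
        by (simp add: ext(2)[OF x u] scaleR_fun_def)
    qed
    then show "\<gamma> x \<in> fib (dual_bundle E) x" by (simp add: fib_dual \<gamma>_def)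
  next
    fix x assume "x \<notin> pts M"
    then show "\<gamma> x = 0" by (auto simp: \<gamma>_def fun_eq_iff)
  next
    fix U \<tau> i assume U: "(U, \<tau>) \<in> trivs (dual_bundle E)" and i: "i < vrank (dual_bundle E)"
    obtain \<phi> where U: "(U, \<phi>) \<in> trivs E"
      and \<tau>: "\<tau> = (\<lambda>x \<beta> i. if i < vrank E then \<beta> (frame E \<phi> i x) else 0)"
      using trivs_dualE[OF U] .
    have op: "openin (mtop M) U" using vbD(3)[OF vb U] .
    show "smooth_fun_on M U (\<lambda>x. \<tau> x (\<gamma> x) i)"
    proof (rule smooth_fun_on_near[OF op])
      fix x assume x: "x \<in> U"
      obtain s N where s0: "\<forall>j<vrank E. s j \<in> sections M E"
        "\<forall>j<vrank E. \<forall>y\<in>N. s j y = frame E \<phi> j y" and N: "openin (mtop M) N" "x \<in> N" "N \<subseteq> U"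
        using frame_extend[OF vb U x] by (elim exE conjE)
      have s: "s i \<in> sections M E" "\<forall>y\<in>N. s i y = frame E \<phi> i y" using s0 i by auto
      have "\<tau> y (\<gamma> y) i = F (s i) y" if "y \<in> N" for y
        using \<gamma>[OF s(1), of y] s(2) that i openin_subset[OF N(1)] by (auto simp: \<tau>)
      moreover have "smooth_fun_on M N (F (s i))"
        using smooth_fun_imp_on[OF tensorialD(1)[OF F s(1)] openin_subset[OF N(1)]] .
      ultimately show "\<exists>N g. openin (mtop M) N \<and> x \<in> N \<and> smooth_fun_on M N g \<and> (\<forall>y\<in>N. \<tau> y (\<gamma> y) i = g y)"
        using N by (intro exI[of _ N] exI[of _ "F (s i)"]) auto
    qed
  qed
  then show ?thesis using \<gamma> by (intro bexI[of _ \<gamma>]) (auto simp: pairing_def)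
qed

end

text \<open>Reflexivity of bundles of finite rank: a covector on the dual fibre is evaluation at the
  sum of its values on the coframe times the frame. That formula depends on a trivialisation, the
  property of the vector does not, hence the choice by \<open>SOME\<close>. The coordinates of Z are
  the values on the coframe, so they are smooth.\<close>

lemma tensorial_representation_dual:
  assumes vb: "vector_bundle M E" and F: "tensorial (dual_bundle E) F"
  shows "\<exists>Z\<in>sections M E. \<forall>\<beta>\<in>sections M (dual_bundle E). \<forall>x\<in>pts M. pairing \<beta> Z x = F \<beta> x"
proof -
  note vbd = vector_bundle_dual[OF vb]
  obtain \<gamma> where \<gamma>: "\<gamma> \<in> sections M (dual_bundle (dual_bundle E))"
    and \<gamma>F: "\<forall>\<beta>\<in>sections M (dual_bundle E). \<forall>x\<in>pts M. pairing \<gamma> \<beta> x = F \<beta> x"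
    using tensorial_representation[OF vbd F] by (elim bexE)
  have ex: "\<exists>z. z \<in> fib E x \<and> (\<forall>\<beta>\<in>fib (dual_bundle E) x. \<beta> z = \<gamma> x \<beta>)" if x: "x \<in> pts M" for x
  proof -
    obtain U \<phi> where U: "(U, \<phi>) \<in> trivs E" "x \<in> U" using vbD(2)[OF vb x] by blast
    note \<tau> = trivs_dualI[OF U(1)]
    let ?z = "\<Sum>j<vrank E. \<gamma> x (coframe E \<phi> j x) *\<^sub>R frame E \<phi> j x"
    have "\<beta> ?z = \<gamma> x \<beta>" if b: "\<beta> \<in> fib (dual_bundle E) x" for \<beta>
    proof -
      have "\<beta> ?z = (\<Sum>j<vrank E. \<gamma> x (coframe E \<phi> j x) * \<beta> (frame E \<phi> j x))"
        using lin_on_sum[OF dual_fibD(1)[OF b] vbD(1)[OF vb x], where I = "{..<vrank E}"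
            and v = "\<lambda>j. frame E \<phi> j x"] frame_in[OF vb U] by simp
      also have "\<dots> = (\<Sum>j<vrank E. \<beta> (frame E \<phi> j x) * \<gamma> x (coframe E \<phi> j x))"
        by (simp add: mult.commute)
      also have "\<dots> = \<gamma> x \<beta>"
        using dual_expand[OF vbd \<tau> U(2) sectionsD(1)[OF \<gamma> x] b] dual_frame[OF vb U] by simp
      finally show ?thesis .
    qed
    then have "\<forall>\<beta>\<in>fib (dual_bundle E) x. \<beta> ?z = \<gamma> x \<beta>" by (rule ballI)
    then show ?thesis by (intro exI[of _ ?z] conjI sum_frame_in[OF vb U])
  qed
  define Z where "Z x = (if x \<in> pts M then SOME z. z \<in> fib E x \<and> (\<forall>\<beta>\<in>fib (dual_bundle E) x. \<beta> z = \<gamma> x \<beta>) else 0)" for x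
  have Z: "Z x \<in> fib E x" "\<beta> \<in> fib (dual_bundle E) x \<Longrightarrow> \<beta> (Z x) = \<gamma> x \<beta>" if "x \<in> pts M" for x \<beta>
    using someI_ex[OF ex[OF that]] that by (auto simp: Z_def)
  have "Z \<in> sections M E"
  proof (rule sectionsI)
    fix U \<phi> i assume U: "(U, \<phi>) \<in> trivs E" and i: "i < vrank E"
    have "smooth_fun_on M U (\<lambda>x. \<gamma> x (frame (dual_bundle E) (\<lambda>x \<beta> i. if i < vrank E then \<beta> (frame E \<phi> i x) else 0) i x))"
      using dual_section_frame_smooth[OF \<gamma> trivs_dualI[OF U]] i by simp
    then show "smooth_fun_on M U (\<lambda>x. \<phi> x (Z x) i)"
    proof (rule smooth_fun_on_cong[OF vbD(3)[OF vb U], rotated])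
      fix x assume x: "x \<in> U"
      note xM = vb_subset[OF vb U x]
      have "coframe E \<phi> i x (Z x) = \<gamma> x (coframe E \<phi> i x)" by (rule Z(2)[OF xM coframe_in[OF vb U x]])
      then show "\<gamma> x (frame (dual_bundle E) (\<lambda>x \<beta> i. if i < vrank E then \<beta> (frame E \<phi> i x) else 0) i x) = \<phi> x (Z x) i"
        using dual_frame[OF vb U x i] Z(1)[OF xM] by (simp add: coframe_def)
    qed
  qed (use Z in \<open>auto simp: Z_def\<close>)
  moreover have "pairing \<beta> Z x = F \<beta> x" if b: "\<beta> \<in> sections M (dual_bundle E)" and x: "x \<in> pts M" for \<beta> x
    using Z(2)[OF x sectionsD(1)[OF b x]] \<gamma>F b x by (simp add: pairing_def)
  ultimately show ?thesis by (intro bexI[of _ Z] ballI)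
qed

end

section \<open>Sums of bundles, anchors and metrics\<close>

lemma vrank_sum [simp]: "vrank (sum_bundle E F) = vrank E + vrank F"
  by (simp add: sum_bundle_def)

lemma fib_sum [simp]: "fib (sum_bundle E F) x = fib E x \<times> fib F x"
  by (simp add: sum_bundle_def)

text \<open>The trivialisation of \<open>sum_bundle\<close> with projections instead of a pattern on
  pairs, so that it can be named and applied to variables.\<close>

definition sum_triv :: "('m, 'v) vbundle \<Rightarrow> ('m \<Rightarrow> 'v \<Rightarrow> nat \<Rightarrow> real) \<Rightarrow> ('m \<Rightarrow> 'w \<Rightarrow> nat \<Rightarrow> real) \<Rightarrow>
    'm \<Rightarrow> 'v \<times> 'w \<Rightarrow> nat \<Rightarrow> real"
  where "sum_triv E \<phi> \<psi> x p i = (if i < vrank E then \<phi> x (fst p) i else \<psi> x (snd p) (i - vrank E))"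

lemma sum_triv_eq: "(\<lambda>x (v, w) i. if i < vrank E then \<phi> x v i else \<psi> x w (i - vrank E)) = sum_triv E \<phi> \<psi>"
  by (auto simp: sum_triv_def fun_eq_iff)

lemma trivs_sumE:
  assumes "(W, \<tau>) \<in> trivs (sum_bundle E F)"
  obtains U \<phi> V \<psi> where "(U, \<phi>) \<in> trivs E" "(V, \<psi>) \<in> trivs F" "W = U \<inter> V" "\<tau> = sum_triv E \<phi> \<psi>"
  using assms unfolding sum_bundle_def by (auto simp: sum_triv_eq)

lemma trivs_sumI:
  assumes "(U, \<phi>) \<in> trivs E" "(V, \<psi>) \<in> trivs F"
  shows "(U \<inter> V, sum_triv E \<phi> \<psi>) \<in> trivs (sum_bundle E F)"
proof -
  have "(U \<inter> V, sum_triv E \<phi> \<psi>) = (\<lambda>((U, \<phi>), (V, \<psi>)).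
          (U \<inter> V, \<lambda>x (v, w) i. if i < vrank E then \<phi> x v i else \<psi> x w (i - vrank E))) ((U, \<phi>), (V, \<psi>))"
    by (simp add: sum_triv_eq)
  then show ?thesis unfolding sum_bundle_def using assms by (simp only: vbundle.simps) (rule image_eqI[OF refl], simp)
qed

context manifold
begin

context
  fixes E :: "('m, 'v::real_vector) vbundle" and F :: "('m, 'w::real_vector) vbundle" and U V \<phi> \<psi>
  assumes vb: "vector_bundle M E" "vector_bundle M F"
    and triv: "(U, \<phi>) \<in> trivs E" "(V, \<psi>) \<in> trivs F"
begin

lemma sum_triv_lin:
  assumes "x \<in> U" "x \<in> V" shows "lin_on (fib E x \<times> fib F x) (sum_triv E \<phi> \<psi> x)"
proof (rule lin_onI)
  fix p q assume "p \<in> fib E x \<times> fib F x" "q \<in> fib E x \<times> fib F x"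
  then show "sum_triv E \<phi> \<psi> x (p + q) = sum_triv E \<phi> \<psi> x p + sum_triv E \<phi> \<psi> x q"
    using lin_on_add[OF vbD(4)[OF vb(1) triv(1) assms(1)]] lin_on_add[OF vbD(4)[OF vb(2) triv(2) assms(2)]]
    by (auto simp: sum_triv_def fun_eq_iff)
next
  fix c p assume "p \<in> fib E x \<times> fib F x"
  then show "sum_triv E \<phi> \<psi> x (c *\<^sub>R p) = c *\<^sub>R sum_triv E \<phi> \<psi> x p"
    using lin_on_scale[OF vbD(4)[OF vb(1) triv(1) assms(1)]] lin_on_scale[OF vbD(4)[OF vb(2) triv(2) assms(2)]]
    by (auto simp: sum_triv_def fun_eq_iff scaleR_fun_def)
qed

lemma sum_triv_bij:
  assumes x: "x \<in> U" "x \<in> V"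
  shows "bij_betw (sum_triv E \<phi> \<psi> x) (fib E x \<times> fib F x) (coord_space (vrank E + vrank F))"
proof (rule bij_betwI')
  fix p q assume p: "p \<in> fib E x \<times> fib F x" and q: "q \<in> fib E x \<times> fib F x"
  show "(sum_triv E \<phi> \<psi> x p = sum_triv E \<phi> \<psi> x q) = (p = q)"
  proof
    assume eq: "sum_triv E \<phi> \<psi> x p = sum_triv E \<phi> \<psi> x q"
    have "\<phi> x (fst p) = \<phi> x (fst q)"
    proof
      fix i show "\<phi> x (fst p) i = \<phi> x (fst q) i"
        using fun_cong[OF eq, of i] triv_in[OF vb(1) triv(1) x(1)] p q
        by (cases "i < vrank E") (auto simp: sum_triv_def coord_space_def)
    qed
    moreover have "\<psi> x (snd p) = \<psi> x (snd q)"
    proof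
      fix i show "\<psi> x (snd p) i = \<psi> x (snd q) i"
        using fun_cong[OF eq, of "i + vrank E"] by (simp add: sum_triv_def)
    qed
    ultimately show "p = q"
      using p q triv_inj[OF vb(1) triv(1) x(1)] triv_inj[OF vb(2) triv(2) x(2)] by (intro prod_eqI) auto
  next
    assume "p = q" then show "sum_triv E \<phi> \<psi> x p = sum_triv E \<phi> \<psi> x q" by (rule arg_cong)
  qed
next
  fix p assume p: "p \<in> fib E x \<times> fib F x"
  then show "sum_triv E \<phi> \<psi> x p \<in> coord_space (vrank E + vrank F)"
    using triv_in[OF vb(2) triv(2) x(2), of "snd p"] by (auto simp: sum_triv_def coord_space_def)
next
  fix c assume c: "c \<in> coord_space (vrank E + vrank F)"
  let ?c1 = "\<lambda>i. if i < vrank E then c i else 0" and ?c2 = "\<lambda>i. c (i + vrank E)"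
  have c1: "?c1 \<in> coord_space (vrank E)" and c2: "?c2 \<in> coord_space (vrank F)"
    using c by (auto simp: coord_space_def)
  have "?c1 \<in> \<phi> x ` fib E x"
    unfolding bij_betw_imp_surj_on[OF vbD(5)[OF vb(1) triv(1) x(1)]] by (rule c1)
  then obtain v where v: "?c1 = \<phi> x v" "v \<in> fib E x" by (elim imageE)
  have "?c2 \<in> \<psi> x ` fib F x"
    unfolding bij_betw_imp_surj_on[OF vbD(5)[OF vb(2) triv(2) x(2)]] by (rule c2)
  then obtain w where w: "?c2 = \<psi> x w" "w \<in> fib F x" by (elim imageE)
  have "c i = sum_triv E \<phi> \<psi> x (v, w) i" for i
    using fun_cong[OF v(1), of i] fun_cong[OF w(1), of "i - vrank E"] by (simp add: sum_triv_def split: if_splits)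
  then have "c = sum_triv E \<phi> \<psi> x (v, w)" by (rule ext)
  then show "\<exists>p\<in>fib E x \<times> fib F x. c = sum_triv E \<phi> \<psi> x p"
    by (rule bexI) (use v w in simp)
qed

lemma sum_frame:
  assumes x: "x \<in> U" "x \<in> V" and j: "j < vrank E + vrank F"
  shows "frame (sum_bundle E F) (sum_triv E \<phi> \<psi>) j x =
    (if j < vrank E then (frame E \<phi> j x, 0) else (0, frame F \<psi> (j - vrank E) x))" (is "_ = ?p")
  unfolding frame_def[of "sum_bundle E F"]
proof (rule inv_into_f_eq)
  have xM: "x \<in> pts M" using vb_subset[OF vb(1) triv(1) x(1)] .
  note s = vbD(1)[OF vb(1) xM] vbD(1)[OF vb(2) xM]
  show "inj_on (sum_triv E \<phi> \<psi> x) (fib (sum_bundle E F) x)"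
    using sum_triv_bij[OF x] by (simp add: bij_betw_def)
  show "?p \<in> fib (sum_bundle E F) x"
    using frame_in[OF vb(1) triv(1) x(1)] frame_in[OF vb(2) triv(2) x(2)] j subspace_0[OF s(1)] subspace_0[OF s(2)] by auto
  have z: "\<phi> x 0 = 0" "\<psi> x 0 = 0"
    using lin_on_zero[OF vbD(4)[OF vb(1) triv(1) x(1)] s(1)]
      lin_on_zero[OF vbD(4)[OF vb(2) triv(2) x(2)] s(2)] .
  show "sum_triv E \<phi> \<psi> x ?p = unit_coord j"
    using j triv_frame[OF vb(1) triv(1) x(1), of j] triv_frame[OF vb(2) triv(2) x(2), of "j - vrank E"]
    by (auto simp: sum_triv_def fun_eq_iff z unit_coord_def)
qed

end

lemma vector_bundle_sum:
  fixes E :: "('m, 'v::real_vector) vbundle" and F :: "('m, 'w::real_vector) vbundle"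
  assumes vb: "vector_bundle M E" "vector_bundle M F"
  shows "vector_bundle M (sum_bundle E F)"
proof -
  have 1: "subspace (fib (sum_bundle E F) x)" if "x \<in> pts M" for x
    using subspace_Times[OF vbD(1)[OF vb(1) that] vbD(1)[OF vb(2) that]] by simp
  have 3: "openin (mtop M) W \<and> (\<forall>x\<in>W. lin_on (fib (sum_bundle E F) x) (\<tau> x) \<and>
      bij_betw (\<tau> x) (fib (sum_bundle E F) x) (coord_space (vrank (sum_bundle E F))))"
    if W: "(W, \<tau>) \<in> trivs (sum_bundle E F)" for W \<tau>
  proof -
    obtain U \<phi> V \<psi> where t: "(U, \<phi>) \<in> trivs E" "(V, \<psi>) \<in> trivs F" and eq: "W = U \<inter> V" "\<tau> = sum_triv E \<phi> \<psi>"
      using trivs_sumE[OF W] .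
    show ?thesis
      using sum_triv_lin[OF vb t] sum_triv_bij[OF vb t] openin_Int[OF vbD(3)[OF vb(1) t(1)] vbD(3)[OF vb(2) t(2)]]
      by (auto simp: eq)
  qed
  have 2: "(\<Union>(W, \<tau>)\<in>trivs (sum_bundle E F). W) = pts M"
  proof (intro equalityI subsetI)
    fix x assume "x \<in> (\<Union>(W, \<tau>)\<in>trivs (sum_bundle E F). W)"
    then obtain W \<tau> where "(W, \<tau>) \<in> trivs (sum_bundle E F)" "x \<in> W" by auto
    then show "x \<in> pts M" using 3 openin_subset by blast
  next
    fix x assume x: "x \<in> pts M"
    obtain U \<phi> where U: "(U, \<phi>) \<in> trivs E" "x \<in> U" using vbD(2)[OF vb(1) x] by blast
    obtain V \<psi> where V: "(V, \<psi>) \<in> trivs F" "x \<in> V" using vbD(2)[OF vb(2) x] by blast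
    show "x \<in> (\<Union>(W, \<tau>)\<in>trivs (sum_bundle E F). W)"
      by (rule UN_I[OF trivs_sumI[OF U(1) V(1)]]) (use U V in auto)
  qed
  have 4: "smooth_fun_on M (W \<inter> W') (\<lambda>x. \<tau>' x (frame (sum_bundle E F) \<tau> j x) i)"
    if W: "(W, \<tau>) \<in> trivs (sum_bundle E F)" and W': "(W', \<tau>') \<in> trivs (sum_bundle E F)"
      and ij: "i < vrank E + vrank F" "j < vrank E + vrank F" for W \<tau> W' \<tau>' i j
  proof -
    obtain U \<phi> V \<psi> where t: "(U, \<phi>) \<in> trivs E" "(V, \<psi>) \<in> trivs F" and eq: "W = U \<inter> V" "\<tau> = sum_triv E \<phi> \<psi>"
      using trivs_sumE[OF W] .
    obtain U' \<phi>' V' \<psi>' where t': "(U', \<phi>') \<in> trivs E" "(V', \<psi>') \<in> trivs F"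
      and eq': "W' = U' \<inter> V'" "\<tau>' = sum_triv E \<phi>' \<psi>'"
      using trivs_sumE[OF W'] .
    have op: "openin (mtop M) (W \<inter> W')"
      using 3[OF W] 3[OF W'] by (simp add: openin_Int)
    have fr: "frame (sum_bundle E F) \<tau> j x =
        (if j < vrank E then (frame E \<phi> j x, 0) else (0, frame F \<psi> (j - vrank E) x))" if "x \<in> W" for x
      using sum_frame[OF vb t _ _ ij(2)] that by (simp add: eq)
    have z: "\<phi>' x 0 = 0" "\<psi>' x 0 = 0" if "x \<in> W'" for x
    proof -
      have x: "x \<in> U'" "x \<in> V'" using that by (auto simp: eq')
      show "\<phi>' x 0 = 0" "\<psi>' x 0 = 0"
        using lin_on_zero[OF vbD(4)[OF vb(1) t'(1) x(1)] vbD(1)[OF vb(1) vb_subset[OF vb(1) t'(1) x(1)]]]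
          lin_on_zero[OF vbD(4)[OF vb(2) t'(2) x(2)] vbD(1)[OF vb(2) vb_subset[OF vb(2) t'(2) x(2)]]] .
    qed
    \<comment> \<open>The transition matrix of a sum is block diagonal.\<close>
    let ?g = "\<lambda>x. if i < vrank E \<and> j < vrank E then \<phi>' x (frame E \<phi> j x) i
      else if \<not> i < vrank E \<and> \<not> j < vrank E then \<psi>' x (frame F \<psi> (j - vrank E) x) (i - vrank E) else 0"
    have a: "smooth_fun_on M (W \<inter> W') (\<lambda>x. \<phi>' x (frame E \<phi> j x) i)" if "i < vrank E" "j < vrank E"
      by (rule smooth_fun_on_subset[OF vbD(6)[OF vb(1) t(1) t'(1) that]]) (auto simp: eq eq')
    have b: "smooth_fun_on M (W \<inter> W') (\<lambda>x. \<psi>' x (frame F \<psi> (j - vrank E) x) (i - vrank E))"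
      if "\<not> i < vrank E" "\<not> j < vrank E"
      by (rule smooth_fun_on_subset[OF vbD(6)[OF vb(2) t(2) t'(2)]]) (use ij that in \<open>auto simp: eq eq'\<close>)
    have "smooth_fun_on M (W \<inter> W') ?g"
      using a b smooth_fun_on_const[of "W \<inter> W'" 0] by (cases "i < vrank E"; cases "j < vrank E") auto
    then show ?thesis
      by (rule smooth_fun_on_cong[OF op, rotated]) (use fr z in \<open>auto simp: eq'(2) sum_triv_def\<close>)
  qed
  show ?thesis unfolding vector_bundle_def using 1 2 3 4 by auto
qed

lemma sections_sum_iff:
  fixes E :: "('m, 'v::real_vector) vbundle" and F :: "('m, 'w::real_vector) vbundle"
  assumes vb: "vector_bundle M E" "vector_bundle M F"
  shows "s \<in> sections M (sum_bundle E F) \<longleftrightarrow> fst \<circ> s \<in> sections M E \<and> snd \<circ> s \<in> sections M F"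
proof
  assume s: "s \<in> sections M (sum_bundle E F)"
  have sx: "fst (s x) \<in> fib E x" "snd (s x) \<in> fib F x" if "x \<in> pts M" for x
    using sectionsD(1)[OF s that] by (auto simp: mem_Times_iff)
  have so: "s x = 0" if "x \<notin> pts M" for x using sectionsD(2)[OF s that] .
  have "fst \<circ> s \<in> sections M E"
  proof (rule sectionsI)
    fix U \<phi> i assume U: "(U, \<phi>) \<in> trivs E" and i: "i < vrank E"
    show "smooth_fun_on M U (\<lambda>x. \<phi> x ((fst \<circ> s) x) i)"
    proof (rule smooth_fun_on_near[OF vbD(3)[OF vb(1) U]])
      fix x assume x: "x \<in> U"
      obtain V \<psi> where V: "(V, \<psi>) \<in> trivs F" "x \<in> V" using vbD(2)[OF vb(2) vb_subset[OF vb(1) U x]] by blast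
      show "\<exists>N g. openin (mtop M) N \<and> x \<in> N \<and> smooth_fun_on M N g \<and> (\<forall>y\<in>N. \<phi> y ((fst \<circ> s) y) i = g y)"
        using sectionsD(3)[OF s trivs_sumI[OF U V(1)], of i] i x V(2)
          openin_Int[OF vbD(3)[OF vb(1) U] vbD(3)[OF vb(2) V(1)]]
        by (intro exI[of _ "U \<inter> V"] exI[of _ "\<lambda>y. sum_triv E \<phi> \<psi> y (s y) i"]) (auto simp: sum_triv_def)
    qed
  qed (use sx so in auto)
  moreover have "snd \<circ> s \<in> sections M F"
  proof (rule sectionsI)
    fix V \<psi> i assume V: "(V, \<psi>) \<in> trivs F" and i: "i < vrank F"
    show "smooth_fun_on M V (\<lambda>x. \<psi> x ((snd \<circ> s) x) i)"
    proof (rule smooth_fun_on_near[OF vbD(3)[OF vb(2) V]])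
      fix x assume x: "x \<in> V"
      obtain U \<phi> where U: "(U, \<phi>) \<in> trivs E" "x \<in> U" using vbD(2)[OF vb(1) vb_subset[OF vb(2) V x]] by blast
      show "\<exists>N g. openin (mtop M) N \<and> x \<in> N \<and> smooth_fun_on M N g \<and> (\<forall>y\<in>N. \<psi> y ((snd \<circ> s) y) i = g y)"
        using sectionsD(3)[OF s trivs_sumI[OF U(1) V], of "i + vrank E"] i x U(2)
          openin_Int[OF vbD(3)[OF vb(1) U(1)] vbD(3)[OF vb(2) V]]
        by (intro exI[of _ "U \<inter> V"] exI[of _ "\<lambda>y. sum_triv E \<phi> \<psi> y (s y) (i + vrank E)"])
          (auto simp: sum_triv_def)
    qed
  qed (use sx so in auto)
  ultimately show "fst \<circ> s \<in> sections M E \<and> snd \<circ> s \<in> sections M F" ..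
next
  assume s: "fst \<circ> s \<in> sections M E \<and> snd \<circ> s \<in> sections M F"
  note s1 = conjunct1[OF s] and s2 = conjunct2[OF s]
  show "s \<in> sections M (sum_bundle E F)"
  proof (rule sectionsI)
    fix x assume "x \<in> pts M"
    then show "s x \<in> fib (sum_bundle E F) x"
      using sectionsD(1)[OF s1] sectionsD(1)[OF s2] by (simp add: mem_Times_iff)
  next
    fix x assume "x \<notin> pts M"
    then show "s x = 0"
      using sectionsD(2)[OF s1] sectionsD(2)[OF s2] by (intro prod_eqI) auto
  next
    fix W \<tau> i assume W: "(W, \<tau>) \<in> trivs (sum_bundle E F)" and i: "i < vrank (sum_bundle E F)"
    obtain U \<phi> V \<psi> where t: "(U, \<phi>) \<in> trivs E" "(V, \<psi>) \<in> trivs F" and eq: "W = U \<inter> V" "\<tau> = sum_triv E \<phi> \<psi>"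
      using trivs_sumE[OF W] .
    show "smooth_fun_on M W (\<lambda>x. \<tau> x (s x) i)"
    proof (cases "i < vrank E")
      case True
      have "smooth_fun_on M W (\<lambda>x. \<phi> x ((fst \<circ> s) x) i)"
        by (rule smooth_fun_on_subset[OF sectionsD(3)[OF s1 t(1) True]]) (auto simp: eq)
      then show ?thesis using True by (simp add: eq sum_triv_def)
    next
      case False
      have "i - vrank E < vrank F" using i False by simp
      then have "smooth_fun_on M W (\<lambda>x. \<psi> x ((snd \<circ> s) x) (i - vrank E))"
        by (rule smooth_fun_on_subset[OF sectionsD(3)[OF s2 t(2)]]) (auto simp: eq)
      then show ?thesis using False by (simp add: eq sum_triv_def)
    qed
  qed
qed

subsection \<open>Anchors\<close>

lemma anchoredD:
  assumes "anchored_bundle M A \<rho>"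
  shows "vector_bundle M A" and "bundle_map M A (tangent_bundle M) \<rho>"
  using assms by (auto simp: anchored_bundle_def)

context
  fixes A :: "('m, 'v::real_vector) vbundle" and \<rho>
  assumes anc: "anchored_bundle M A \<rho>"
begin

lemma anchor_tangent: "a \<in> sections M A \<Longrightarrow> x \<in> pts M \<Longrightarrow> \<rho> x (a x) \<in> fib (tangent_bundle M) x"
  using bundle_mapD(2)[OF anchoredD(2)[OF anc]] sectionsD(1) by blast

lemma act_smooth:
  assumes a: "a \<in> sections M A" and f: "smooth_fun M f"
  shows "smooth_fun M (act \<rho> a f)"
proof (rule smooth_fun_cong)
  show "smooth_fun M (\<lambda>x. on_sections M \<rho> a x f)"
    by (rule tangent_section_smooth[OF bundle_map_sections[OF anchoredD(1)[OF anc] prebundle_tangent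
            anchoredD(2)[OF anc] a] f])
qed (simp add: act_def)

lemma act_add: "a \<in> sections M A \<Longrightarrow> x \<in> pts M \<Longrightarrow> smooth_fun M f \<Longrightarrow> smooth_fun M g \<Longrightarrow>
    act \<rho> a (\<lambda>y. f y + g y) x = act \<rho> a f x + act \<rho> a g x"
  unfolding act_def by (rule tangent_add[OF anchor_tangent])

lemma act_mult: "a \<in> sections M A \<Longrightarrow> x \<in> pts M \<Longrightarrow> smooth_fun M f \<Longrightarrow> smooth_fun M g \<Longrightarrow>
    act \<rho> a (\<lambda>y. f y * g y) x = f x * act \<rho> a g x + act \<rho> a f x * g x"
  unfolding act_def by (rule tangent_mult[OF anchor_tangent])

lemma act_const: "a \<in> sections M A \<Longrightarrow> x \<in> pts M \<Longrightarrow> act \<rho> a (\<lambda>y. c) x = 0"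
  unfolding act_def by (rule tangent_const[OF anchor_tangent])

text \<open>Tangent vectors are operators on functions of the whole type. Functions that agree on M
  may differ elsewhere and are then different arguments; locality on the open set
  \<open>pts M\<close> identifies their derivatives.\<close>

lemma act_cong: "a \<in> sections M A \<Longrightarrow> x \<in> pts M \<Longrightarrow> smooth_fun M f \<Longrightarrow>
    (\<And>y. y \<in> pts M \<Longrightarrow> f y = g y) \<Longrightarrow> act \<rho> a f x = act \<rho> a g x"
  unfolding act_def
  by (rule tangent_local[OF anchor_tangent _ _ openin_topspace]) (auto intro: smooth_fun_cong)

lemma act_add_section: "a \<in> sections M A \<Longrightarrow> b \<in> sections M A \<Longrightarrow> x \<in> pts M \<Longrightarrow>
    act \<rho> (a + b) f x = act \<rho> a f x + act \<rho> b f x"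
  using lin_on_add[OF bundle_mapD(1)[OF anchoredD(2)[OF anc]]] sectionsD(1)[where E = A] by (simp add: act_def)

lemma act_fmult_section: "a \<in> sections M A \<Longrightarrow> x \<in> pts M \<Longrightarrow> act \<rho> (h \<odot> a) f x = h x * act \<rho> a f x"
  using lin_on_scale[OF bundle_mapD(1)[OF anchoredD(2)[OF anc]]] sectionsD(1)[where E = A]
  by (simp add: act_def fmult_def scaleR_fun_def)

end

subsection \<open>Metrics\<close>

lemma pseudo_metricD:
  assumes "pseudo_metric M A g"
  shows "x \<in> pts M \<Longrightarrow> u \<in> fib A x \<Longrightarrow> lin_on (fib A x) (g x u)"
    and "x \<in> pts M \<Longrightarrow> u \<in> fib A x \<Longrightarrow> v \<in> fib A x \<Longrightarrow> g x u v = g x v u"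
    and "x \<in> pts M \<Longrightarrow> u \<in> fib A x \<Longrightarrow> (\<And>v. v \<in> fib A x \<Longrightarrow> g x u v = 0) \<Longrightarrow> u = 0"
    and "(U, \<phi>) \<in> trivs A \<Longrightarrow> i < vrank A \<Longrightarrow> j < vrank A \<Longrightarrow>
      smooth_fun_on M U (\<lambda>x. g x (frame A \<phi> i x) (frame A \<phi> j x))"
proof -
  note a = assms[unfolded pseudo_metric_def]
  note p = bspec[OF conjunct1[OF a], of x]
  show "x \<in> pts M \<Longrightarrow> u \<in> fib A x \<Longrightarrow> lin_on (fib A x) (g x u)" using p by simp
  show "x \<in> pts M \<Longrightarrow> u \<in> fib A x \<Longrightarrow> v \<in> fib A x \<Longrightarrow> g x u v = g x v u"
    using conjunct1[OF conjunct2[OF p]] by blast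
  show "x \<in> pts M \<Longrightarrow> u \<in> fib A x \<Longrightarrow> (\<And>v. v \<in> fib A x \<Longrightarrow> g x u v = 0) \<Longrightarrow> u = 0"
    using conjunct2[OF conjunct2[OF p]] by simp
  show "(U, \<phi>) \<in> trivs A \<Longrightarrow> i < vrank A \<Longrightarrow> j < vrank A \<Longrightarrow>
      smooth_fun_on M U (\<lambda>x. g x (frame A \<phi> i x) (frame A \<phi> j x))"
    using bspec[OF conjunct1[OF conjunct2[OF a]], of "(U, \<phi>)"] by simp
qed

lemma metric_lin_left:
  assumes g: "pseudo_metric M A g" and vb: "vector_bundle M A" and x: "x \<in> pts M" and v: "v \<in> fib A x"
  shows "lin_on (fib A x) (\<lambda>u. g x u v)"
proof (rule lin_onI)
  note s = vbD(1)[OF vb x]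
  fix u u' assume u: "u \<in> fib A x" and u': "u' \<in> fib A x"
  have "g x (u + u') v = g x v (u + u')" by (rule pseudo_metricD(2)[OF g x subspace_add[OF s u u'] v])
  also have "\<dots> = g x v u + g x v u'" by (rule lin_on_add[OF pseudo_metricD(1)[OF g x v] u u'])
  finally show "g x (u + u') v = g x u v + g x u' v"
    by (simp add: pseudo_metricD(2)[OF g x u v] pseudo_metricD(2)[OF g x u' v])
next
  note s = vbD(1)[OF vb x]
  fix c u assume u: "u \<in> fib A x"
  have "g x (c *\<^sub>R u) v = g x v (c *\<^sub>R u)" by (rule pseudo_metricD(2)[OF g x subspace_scale[OF s u] v])
  also have "\<dots> = c *\<^sub>R g x v u" by (rule lin_on_scale[OF pseudo_metricD(1)[OF g x v] u])
  finally show "g x (c *\<^sub>R u) v = c *\<^sub>R g x u v" by (simp add: pseudo_metricD(2)[OF g x u v])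
qed

lemma metric_smooth:
  assumes g: "pseudo_metric M A g" and vb: "vector_bundle M A"
    and a: "a \<in> sections M A" and b: "b \<in> sections M A"
  shows "smooth_fun M (\<lambda>x. g x (a x) (b x))"
  unfolding smooth_fun_def
proof (rule smooth_fun_on_near)
  fix x assume "x \<in> pts M"
  then obtain U \<phi> where U: "(U, \<phi>) \<in> trivs A" "x \<in> U" using vbD(2)[OF vb] by blast
  have op: "openin (mtop M) U" using vbD(3)[OF vb U(1)] .
  let ?h = "\<lambda>y. \<Sum>j<vrank A. \<phi> y (a y) j * (\<Sum>k<vrank A. \<phi> y (b y) k * g y (frame A \<phi> j y) (frame A \<phi> k y))"
  have "smooth_fun_on M U ?h"
    by (intro smooth_fun_on_sum smooth_fun_on_mult op sectionsD(3)[OF a U(1)] sectionsD(3)[OF b U(1)]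
        pseudo_metricD(4)[OF g U(1)]) auto
  moreover have "g y (a y) (b y) = ?h y" if y: "y \<in> U" for y
  proof -
    note yM = vb_subset[OF vb U(1) y]
    note ay = sectionsD(1)[OF a yM] and bY = sectionsD(1)[OF b yM]
    have "g y (a y) (b y) = (\<Sum>j<vrank A. \<phi> y (a y) j * g y (frame A \<phi> j y) (b y))"
      using lin_on_frame_expand[OF vb U(1) y ay metric_lin_left[OF g vb yM bY]] by simp
    also have "\<dots> = ?h y"
    proof (rule sum.cong[OF refl])
      fix j assume "j \<in> {..<vrank A}"
      then have "frame A \<phi> j y \<in> fib A y" using frame_in[OF vb U(1) y] by simp
      from lin_on_frame_expand[OF vb U(1) y bY pseudo_metricD(1)[OF g yM this]]
      show "\<phi> y (a y) j * g y (frame A \<phi> j y) (b y) =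
        \<phi> y (a y) j * (\<Sum>k<vrank A. \<phi> y (b y) k * g y (frame A \<phi> j y) (frame A \<phi> k y))" by simp
    qed
    finally show ?thesis .
  qed
  ultimately show "\<exists>N h. openin (mtop M) N \<and> x \<in> N \<and> smooth_fun_on M N h \<and> (\<forall>y\<in>N. g y (a y) (b y) = h y)"
    using op U(2) by (intro exI[of _ U] exI[of _ ?h]) auto
qed simp

end

section \<open>Right-anchored products\<close>

lemma fmult_apply [simp]: "(f \<odot> s) x = f x *\<^sub>R s x"
  by (simp add: fmult_def)

lemma pairing_add_left: "pairing (\<beta> + \<gamma>) Y = (\<lambda>x. pairing \<beta> Y x + pairing \<gamma> Y x)"
  and pairing_fmult_left: "pairing (f \<odot> \<beta>) Y = (\<lambda>x. f x * pairing \<beta> Y x)"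
  by (auto simp: pairing_def fun_eq_iff scaleR_fun_def)

context manifold
begin

lemma subspace_sections: "prebundle E \<Longrightarrow> subspace (sections M E)"
  by (intro subspaceI sections_zero sections_add sections_scaleR)

lemma pairing_right:
  assumes "vector_bundle M E" "\<beta> \<in> sections M (dual_bundle E)" "x \<in> pts M" "Y \<in> sections M E"
  shows pairing_add_right: "Z \<in> sections M E \<Longrightarrow> pairing \<beta> (Y + Z) x = pairing \<beta> Y x + pairing \<beta> Z x"
    and pairing_fmult_right: "pairing \<beta> (f \<odot> Y) x = f x * pairing \<beta> Y x"
  using lin_on_add[OF dual_fibD(1)[OF sectionsD(1)[OF assms(2,3)]] sectionsD(1)[OF assms(4,3)] sectionsD(1)[OF _ assms(3)]]
    lin_on_scale[OF dual_fibD(1)[OF sectionsD(1)[OF assms(2,3)]] sectionsD(1)[OF assms(4,3)]]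
  by (auto simp: pairing_def)

subsection \<open>Curvature\<close>

text \<open>The failure of the anchor to be a homomorphism into vector fields, tested on f. The
  bracket is a parameter that need not be known to satisfy the Jacobi identity.\<close>

definition anchor_defect :: "('m, 'v) anchor \<Rightarrow> ('m, 'v) product \<Rightarrow> ('m \<Rightarrow> 'v) \<Rightarrow> ('m \<Rightarrow> 'v) \<Rightarrow>
    ('m \<Rightarrow> real) \<Rightarrow> 'm \<Rightarrow> real"
  where "anchor_defect \<rho> br a b f x = act \<rho> a (act \<rho> b f) x - act \<rho> b (act \<rho> a f) x - act \<rho> (br a b) f x"

lemma rapD:
  assumes "right_anchored_product M A \<rho> D"
  shows rap_in: "a \<in> sections M A \<Longrightarrow> b \<in> sections M A \<Longrightarrow> D a b \<in> sections M A"
    and rap_lin_right: "a \<in> sections M A \<Longrightarrow> lin_on (sections M A) (D a)"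
    and rap_lin_left: "b \<in> sections M A \<Longrightarrow> lin_on (sections M A) (\<lambda>a. D a b)"
    and rap_fmult_left: "a \<in> sections M A \<Longrightarrow> b \<in> sections M A \<Longrightarrow> smooth_fun M f \<Longrightarrow>
      D (f \<odot> a) b = f \<odot> D a b"
    and rap_fmult_right: "a \<in> sections M A \<Longrightarrow> b \<in> sections M A \<Longrightarrow> smooth_fun M f \<Longrightarrow>
      D a (f \<odot> b) = f \<odot> D a b + act \<rho> a f \<odot> b"
  using assms unfolding right_anchored_product_def bilinear_product_def by simp_all

text \<open>Homogeneity over the reals is the case of constant functions, in the second argument
  because anchors annihilate constants.\<close>

lemma right_anchored_productI:
  assumes anc: "anchored_bundle M A \<rho>"
    and cl: "\<And>a b. a \<in> sections M A \<Longrightarrow> b \<in> sections M A \<Longrightarrow> D a b \<in> sections M A"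
    and al: "\<And>a a' b. a \<in> sections M A \<Longrightarrow> a' \<in> sections M A \<Longrightarrow> b \<in> sections M A \<Longrightarrow>
      D (a + a') b = D a b + D a' b"
    and ar: "\<And>a b b'. a \<in> sections M A \<Longrightarrow> b \<in> sections M A \<Longrightarrow> b' \<in> sections M A \<Longrightarrow>
      D a (b + b') = D a b + D a b'"
    and fl: "\<And>a b f. a \<in> sections M A \<Longrightarrow> b \<in> sections M A \<Longrightarrow> smooth_fun M f \<Longrightarrow>
      D (f \<odot> a) b = f \<odot> D a b"
    and fr: "\<And>a b f. a \<in> sections M A \<Longrightarrow> b \<in> sections M A \<Longrightarrow> smooth_fun M f \<Longrightarrow>
      D a (f \<odot> b) = f \<odot> D a b + act \<rho> a f \<odot> b"
  shows "right_anchored_product M A \<rho> D"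
proof -
  have "D a (c *\<^sub>R b) = c *\<^sub>R D a b" if a: "a \<in> sections M A" and b: "b \<in> sections M A" for a b c
  proof -
    have "act \<rho> a (\<lambda>_. c) \<odot> b = 0"
    proof
      fix x show "(act \<rho> a (\<lambda>_. c) \<odot> b) x = 0 x"
        using act_const[OF anc a, of x c] sectionsD(2)[OF b, of x] by (cases "x \<in> pts M") auto
    qed
    then show ?thesis using fr[OF a b smooth_fun_const[of c]] by (simp add: scaleR_eq_fmult)
  qed
  moreover have "D (c *\<^sub>R a) b = c *\<^sub>R D a b" if "a \<in> sections M A" "b \<in> sections M A" for a b c
    using fl[OF that smooth_fun_const[of c]] by (simp add: scaleR_eq_fmult)
  ultimately show ?thesis
    unfolding right_anchored_product_def bilinear_product_def lin_on_def
    using cl al ar fl fr by simp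
qed

lemma bilinear_bracket_of:
  assumes "prebundle A" "bilinear_product M A D"
  shows "bilinear_product M A (bracket_of D)"
proof -
  have cl: "D a b \<in> sections M A" if "a \<in> sections M A" "b \<in> sections M A" for a b
    using assms(2) that unfolding bilinear_product_def by simp
  have r: "lin_on (sections M A) (D a)" and l: "lin_on (sections M A) (\<lambda>b. D b a)" if "a \<in> sections M A" for a
    using assms(2) that unfolding bilinear_product_def by simp_all
  show ?thesis
    unfolding bilinear_product_def
  proof (intro conjI ballI)
    fix a b assume "a \<in> sections M A" "b \<in> sections M A"
    then show "bracket_of D a b \<in> sections M A"
      unfolding bracket_of_def by (intro sections_diff assms cl)
  next
    fix a assume a: "a \<in> sections M A"
    show "lin_on (sections M A) (bracket_of D a)" "lin_on (sections M A) (\<lambda>b. bracket_of D b a)"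
      unfolding bracket_of_def
      by (auto intro!: lin_onI simp: lin_on_add[OF r[OF a]] lin_on_add[OF l[OF a]]
          lin_on_scale[OF r[OF a]] lin_on_scale[OF l[OF a]] algebra_simps)
  qed
qed

context
  fixes A :: "('m, 'v::real_vector) vbundle" and \<rho> D
  assumes anc: "anchored_bundle M A \<rho>" and rap: "right_anchored_product M A \<rho> D"
begin

private lemma pre: "prebundle A"
  using prebundle_vb[OF anchoredD(1)[OF anc]] .

lemma bracket_of_in: "a \<in> sections M A \<Longrightarrow> b \<in> sections M A \<Longrightarrow> bracket_of D a b \<in> sections M A"
  unfolding bracket_of_def by (intro sections_diff pre rap_in[OF rap])

lemma rap_diff_right: "a \<in> sections M A \<Longrightarrow> b \<in> sections M A \<Longrightarrow> c \<in> sections M A \<Longrightarrow>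
    D a (b - c) = D a b - D a c"
  by (rule lin_on_diff[OF rap_lin_right[OF rap] subspace_sections[OF pre]])

lemma rap_diff_left: "a \<in> sections M A \<Longrightarrow> b \<in> sections M A \<Longrightarrow> c \<in> sections M A \<Longrightarrow>
    D (a - b) c = D a c - D b c"
  by (rule lin_on_diff[OF rap_lin_left[OF rap] subspace_sections[OF pre]])

lemma rap_zero: "a \<in> sections M A \<Longrightarrow> D 0 a = 0" "a \<in> sections M A \<Longrightarrow> D a 0 = 0"
  by (rule lin_on_zero[OF rap_lin_left[OF rap] subspace_sections[OF pre]], assumption,
      rule lin_on_zero[OF rap_lin_right[OF rap] subspace_sections[OF pre]])

lemma curvature_in: "a \<in> sections M A \<Longrightarrow> b \<in> sections M A \<Longrightarrow> c \<in> sections M A \<Longrightarrow>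
    curvature D a b c \<in> sections M A"
  unfolding curvature_def by (intro sections_diff pre rap_in[OF rap] bracket_of_in)

lemma curvature_skew:
  assumes "a \<in> sections M A" "b \<in> sections M A" "c \<in> sections M A"
  shows "curvature D b a c = - curvature D a b c"
proof -
  have "bracket_of D b a = - bracket_of D a b" by (simp add: bracket_of_def)
  moreover have "D (- bracket_of D a b) c = - D (bracket_of D a b) c"
    by (rule lin_on_minus[OF rap_lin_left[OF rap assms(3)] bracket_of_in[OF assms(1,2)]])
  ultimately show ?thesis by (simp add: curvature_def)
qed

text \<open>Purely algebraic: the bracket is the commutator of D, so there is no torsion term, and
  all terms that are not iterated brackets cancel in the cyclic sum.\<close>

lemma bianchi:
  assumes "a \<in> sections M A" "b \<in> sections M A" "c \<in> sections M A"
  shows "curvature D a b c + curvature D b c a + curvature D c a b =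
    bracket_of D a (bracket_of D b c) + bracket_of D b (bracket_of D c a) + bracket_of D c (bracket_of D a b)"
  unfolding curvature_def bracket_of_def
  using assms by (simp add: rap_diff_right rap_diff_left rap_in[OF rap] sections_diff[OF pre] algebra_simps)

text \<open>The terms with one derivative of f are symmetric in a and b up to the one absorbed by
  the bracket expression, so only second derivatives and the derivative along the bracket survive;
  they form the anchor defect.\<close>

lemma curvature_fmult:
  assumes a: "a \<in> sections M A" and b: "b \<in> sections M A" and c: "c \<in> sections M A" and f: "smooth_fun M f"
  shows "curvature D a b (f \<odot> c) = f \<odot> curvature D a b c + anchor_defect \<rho> (bracket_of D) a b f \<odot> c"
proof -
  note in_D = rap_in[OF rap] and s = act_smooth[OF anc]
  have 1: "D a (D b (f \<odot> c)) = f \<odot> D a (D b c) + act \<rho> a f \<odot> D b c + act \<rho> b f \<odot> D a c + act \<rho> a (act \<rho> b f) \<odot> c"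
    if a: "a \<in> sections M A" and b: "b \<in> sections M A" for a b
  proof -
    have "D a (D b (f \<odot> c)) = D a (f \<odot> D b c) + D a (act \<rho> b f \<odot> c)"
      unfolding rap_fmult_right[OF rap b c f]
      by (rule lin_on_add[OF rap_lin_right[OF rap a]]) (intro sections_fmult pre in_D s a b c f)+
    also have "\<dots> = f \<odot> D a (D b c) + act \<rho> a f \<odot> D b c + (act \<rho> b f \<odot> D a c + act \<rho> a (act \<rho> b f) \<odot> c)"
      by (simp only: rap_fmult_right[OF rap a in_D[OF b c] f] rap_fmult_right[OF rap a c s[OF b f]])
    finally show ?thesis by (simp add: add.assoc)
  qed
  show ?thesis
    unfolding curvature_def 1[OF a b] 1[OF b a] rap_fmult_right[OF rap bracket_of_in[OF a b] c f]
    by (rule ext) (simp add: anchor_defect_def algebra_simps)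
qed

end

subsection \<open>Metric products\<close>

text \<open>The metric clause of \<open>levi_civita\<close> on its own, with no reference to a
  bracket.\<close>

definition metric_product :: "('m, 'v) vbundle \<Rightarrow> ('m, 'v::real_vector) anchor \<Rightarrow> ('m, 'v) product \<Rightarrow>
    ('m \<Rightarrow> 'v \<Rightarrow> 'v \<Rightarrow> real) \<Rightarrow> bool"
  where "metric_product A \<rho> D g \<longleftrightarrow>
     (\<forall>a\<in>sections M A. \<forall>b\<in>sections M A. \<forall>c\<in>sections M A. \<forall>x\<in>pts M.
        act \<rho> a (\<lambda>y. g y (b y) (c y)) x = g x (D a b x) (c x) + g x (b x) (D a c x))"

context
  fixes A :: "('m, 'v::real_vector) vbundle" and \<rho> D g
  assumes anc: "anchored_bundle M A \<rho>" and rap: "right_anchored_product M A \<rho> D"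
    and g: "pseudo_metric M A g" and mp: "metric_product A \<rho> D g"
begin

private lemma mvb: "vector_bundle M A"
  using anchoredD(1)[OF anc] .

private lemma mpD: "a \<in> sections M A \<Longrightarrow> b \<in> sections M A \<Longrightarrow> c \<in> sections M A \<Longrightarrow> x \<in> pts M \<Longrightarrow>
    act \<rho> a (\<lambda>y. g y (b y) (c y)) x = g x (D a b x) (c x) + g x (b x) (D a c x)"
  using mp unfolding metric_product_def by blast

lemma metric_diff:
  assumes "u \<in> fib A x" "v \<in> fib A x" "w \<in> fib A x" "x \<in> pts M"
  shows "g x (u - v) w = g x u w - g x v w" "g x w (u - v) = g x w u - g x w v"
  using lin_on_diff[OF metric_lin_left[OF g mvb assms(4,3)] vbD(1)[OF mvb assms(4)] assms(1,2)]
    lin_on_diff[OF pseudo_metricD(1)[OF g assms(4,3)] vbD(1)[OF mvb assms(4)] assms(1,2)] .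

text \<open>Differentiate <c, d> along b and a and antisymmetrise: the mixed terms <D_a c, D_b d>
  and <D_b c, D_a d> cancel.\<close>

lemma curvature_metric:
  assumes a: "a \<in> sections M A" and b: "b \<in> sections M A" and c: "c \<in> sections M A" and d: "d \<in> sections M A"
    and x: "x \<in> pts M"
  shows "g x (curvature D a b c x) (d x) + g x (c x) (curvature D a b d x) =
    anchor_defect \<rho> (bracket_of D) a b (\<lambda>y. g y (c y) (d y)) x"
proof -
  note in_D = rap_in[OF rap]
  let ?G = "\<lambda>c d y. g y (c y) (d y)"
  have 1: "act \<rho> a (act \<rho> b (?G c d)) x =
      ?G (D a (D b c)) d x + ?G (D b c) (D a d) x + (?G (D a c) (D b d) x + ?G c (D a (D b d)) x)"
    if a: "a \<in> sections M A" and b: "b \<in> sections M A" for a b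
  proof -
    have "act \<rho> a (act \<rho> b (?G c d)) x = act \<rho> a (\<lambda>y. ?G (D b c) d y + ?G c (D b d) y) x"
      by (rule act_cong[OF anc a x act_smooth[OF anc b metric_smooth[OF g mvb c d]]]) (rule mpD[OF b c d])
    also have "\<dots> = act \<rho> a (?G (D b c) d) x + act \<rho> a (?G c (D b d)) x"
      by (intro act_add[OF anc a x] metric_smooth[OF g mvb] in_D b c d)
    also have "\<dots> = ?G (D a (D b c)) d x + ?G (D b c) (D a d) x + (?G (D a c) (D b d) x + ?G c (D a (D b d)) x)"
      by (simp only: mpD[OF a in_D[OF b c] d x] mpD[OF a c in_D[OF b d] x])
    finally show ?thesis .
  qed
  have f: "s \<in> sections M A \<Longrightarrow> s x \<in> fib A x" for s using sectionsD(1) x by blast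
  note s = subspace_diff[OF vbD(1)[OF mvb x]]
  have 2: "?G (curvature D a b c) d x = ?G (D a (D b c)) d x - ?G (D b (D a c)) d x - ?G (D (bracket_of D a b) c) d x"
    unfolding curvature_def minus_apply
    by (simp only: metric_diff[OF s[OF f f] f f x] metric_diff[OF f f f x] in_D a b c d bracket_of_in[OF anc rap])
  have 3: "?G c (curvature D a b d) x = ?G c (D a (D b d)) x - ?G c (D b (D a d)) x - ?G c (D (bracket_of D a b) d) x"
    unfolding curvature_def minus_apply
    by (simp only: metric_diff[OF s[OF f f] f f x] metric_diff[OF f f f x] in_D a b c d bracket_of_in[OF anc rap])
  show ?thesis
    unfolding anchor_defect_def 1[OF a b] 1[OF b a] 2 3 mpD[OF bracket_of_in[OF anc rap a b] c d x] by simp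
qed

text \<open>Applying flatness to both \<open>c\<close> and \<open>\<langle>d, c\<rangle> c\<close> shows that the anchor preserves the bracket as
  far as the function \<open>\<langle>d, c\<rangle>\<close> is concerned, wherever \<open>c\<close> does not vanish.\<close>

lemma curvature_orthogonal:
  assumes a: "a \<in> sections M A" and b: "b \<in> sections M A" and c: "c \<in> sections M A" and d: "d \<in> sections M A"
    and x: "x \<in> pts M"
    and flat: "curvature D a b c = 0" "curvature D a b ((\<lambda>y. g y (d y) (c y)) \<odot> c) = 0"
  shows "g x (curvature D a b d x) (c x) = 0"
proof -
  let ?f = "\<lambda>y. g y (d y) (c y)"
  have z: "g x u 0 = 0" if "u \<in> fib A x" for u
    by (rule lin_on_zero[OF pseudo_metricD(1)[OF g x that] vbD(1)[OF mvb x]])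
  have Rd: "curvature D a b d x \<in> fib A x" by (rule sectionsD(1)[OF curvature_in[OF anc rap a b d] x])
  have "?f \<odot> 0 + anchor_defect \<rho> (bracket_of D) a b ?f \<odot> c = 0"
    using curvature_fmult[OF anc rap a b c metric_smooth[OF g mvb d c]] flat by simp
  from fun_cong[OF this, of x] have "anchor_defect \<rho> (bracket_of D) a b ?f x = 0 \<or> c x = 0" by simp
  then show ?thesis
  proof
    assume "anchor_defect \<rho> (bracket_of D) a b ?f x = 0"
    then show ?thesis
      using curvature_metric[OF a b d c x] flat(1) z[OF sectionsD(1)[OF d x]] by simp
  next
    assume "c x = 0"
    then show ?thesis using z[OF Rd] by simp
  qed
qed

end

end

section \<open>The para-Kaehler structure of a Lie-extendible pair\<close>

lemma fst_join [simp]: "fst \<circ> join X \<alpha> = X"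
  and snd_join [simp]: "snd \<circ> join X \<alpha> = \<alpha>"
  by (auto simp: join_def)

lemma join_apply [simp]: "join X \<alpha> x = (X x, \<alpha> x)"
  by (simp add: join_def)

lemma join_fst_snd [simp]: "join (fst \<circ> s) (snd \<circ> s) = s"
  by (auto simp: join_def)

lemma join_eq_iff [simp]: "join X \<alpha> = join Y \<beta> \<longleftrightarrow> X = Y \<and> \<alpha> = \<beta>"
  by (metis fst_join snd_join)

lemma fst_add [simp]: "fst \<circ> (s + t) = (fst \<circ> s) + (fst \<circ> t)"
  and snd_add [simp]: "snd \<circ> (s + t) = (snd \<circ> s) + (snd \<circ> t)"
  and fst_fmult [simp]: "fst \<circ> (f \<odot> s) = f \<odot> (fst \<circ> s)"
  and snd_fmult [simp]: "snd \<circ> (f \<odot> s) = f \<odot> (snd \<circ> s)"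
  by (auto simp: fmult_def)

lemma join_add: "join X \<alpha> + join Y \<beta> = join (X + Y) (\<alpha> + \<beta>)"
  and join_diff: "join X \<alpha> - join Y \<beta> = join (X - Y) (\<alpha> - \<beta>)"
  and join_fmult: "f \<odot> join X \<alpha> = join (f \<odot> X) (f \<odot> \<alpha>)"
  and join_zero: "join 0 0 = 0"
  by (auto simp: fmult_def join_def fun_eq_iff zero_prod_def)

lemma fmult_zero [simp]: "f \<odot> 0 = 0"
  by (auto simp: fmult_def)

text \<open>This is the torsion-freeness of the sum connection; it gives access to the Bianchi
  identity.\<close>

lemma phi_bracket_eq: "phi_bracket M B \<rho>\<^sub>0 S \<rho>\<^sub>1 T = bracket_of (phi_connection M B \<rho>\<^sub>0 S \<rho>\<^sub>1 T)"
  by (intro ext) (simp add: phi_bracket_def bracket_of_def phi_connection_def Let_def join_diff algebra_simps)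

lemma act_phi_anchor: "act (phi_anchor \<rho>\<^sub>0 \<rho>\<^sub>1) s f = (\<lambda>x. act \<rho>\<^sub>0 (fst \<circ> s) f x + act \<rho>\<^sub>1 (snd \<circ> s) f x)"
  by (auto simp: act_def phi_anchor_def split_beta)

lemma phi_metric_eq: "phi_metric x p q = snd p (fst q) + snd q (fst p)"
  by (simp add: phi_metric_def split_beta)

context manifold
begin

text \<open>A covector is linear on its fibre only, so the functions to be differentiated agree just
  on M and \<open>act_cong\<close> is called for. In the left argument, treated next, the
  corresponding identities hold for functions on the whole type.\<close>

lemma act_pairing_right:
  assumes vb: "vector_bundle M B" and anc: "anchored_bundle M A \<rho>" and a: "a \<in> sections M A" and x: "x \<in> pts M"
    and b: "\<beta> \<in> sections M (dual_bundle B)" and Y: "Y \<in> sections M B"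
  shows act_pairing_add_right: "Z \<in> sections M B \<Longrightarrow>
      act \<rho> a (pairing \<beta> (Y + Z)) x = act \<rho> a (pairing \<beta> Y) x + act \<rho> a (pairing \<beta> Z) x"
    and act_pairing_fmult_right: "smooth_fun M f \<Longrightarrow>
      act \<rho> a (pairing \<beta> (f \<odot> Y)) x = f x * act \<rho> a (pairing \<beta> Y) x + act \<rho> a f x * pairing \<beta> Y x"
proof -
  note pre = prebundle_vb[OF vb] and ps = pairing_smooth[OF vb b]
  assume Z: "Z \<in> sections M B"
  have "act \<rho> a (pairing \<beta> (Y + Z)) x = act \<rho> a (\<lambda>y. pairing \<beta> Y y + pairing \<beta> Z y) x"
    by (rule act_cong[OF anc a x ps[OF sections_add[OF pre Y Z]]]) (rule pairing_add_right[OF vb b _ Y Z])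
  also have "\<dots> = act \<rho> a (pairing \<beta> Y) x + act \<rho> a (pairing \<beta> Z) x"
    by (rule act_add[OF anc a x ps[OF Y] ps[OF Z]])
  finally show "act \<rho> a (pairing \<beta> (Y + Z)) x = act \<rho> a (pairing \<beta> Y) x + act \<rho> a (pairing \<beta> Z) x" .
next
  note pre = prebundle_vb[OF vb] and ps = pairing_smooth[OF vb b]
  assume f: "smooth_fun M f"
  have "act \<rho> a (pairing \<beta> (f \<odot> Y)) x = act \<rho> a (\<lambda>y. f y * pairing \<beta> Y y) x"
    by (rule act_cong[OF anc a x ps[OF sections_fmult[OF pre Y f]]]) (rule pairing_fmult_right[OF vb b _ Y])
  also have "\<dots> = f x * act \<rho> a (pairing \<beta> Y) x + act \<rho> a f x * pairing \<beta> Y x"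
    by (rule act_mult[OF anc a x f ps[OF Y]])
  finally show "act \<rho> a (pairing \<beta> (f \<odot> Y)) x = f x * act \<rho> a (pairing \<beta> Y) x + act \<rho> a f x * pairing \<beta> Y x" .
qed

lemma act_pairing_left:
  assumes vb: "vector_bundle M B" and anc: "anchored_bundle M A \<rho>" and a: "a \<in> sections M A" and x: "x \<in> pts M"
    and b: "\<beta> \<in> sections M (dual_bundle B)" and Y: "Y \<in> sections M B"
  shows act_pairing_add_left: "\<gamma> \<in> sections M (dual_bundle B) \<Longrightarrow>
      act \<rho> a (pairing (\<beta> + \<gamma>) Y) x = act \<rho> a (pairing \<beta> Y) x + act \<rho> a (pairing \<gamma> Y) x"
    and act_pairing_fmult_left: "smooth_fun M f \<Longrightarrow>
      act \<rho> a (pairing (f \<odot> \<beta>) Y) x = f x * act \<rho> a (pairing \<beta> Y) x + act \<rho> a f x * pairing \<beta> Y x"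
  unfolding pairing_add_left pairing_fmult_left
  by (intro act_add[OF anc a x] act_mult[OF anc a x] pairing_smooth[OF vb] b Y; assumption)+

section \<open>Existence and module laws of the dual products\<close>

context
  fixes B :: "('m, 'v::real_vector) vbundle" and \<rho>\<^sub>0 S \<rho>\<^sub>1 T
  assumes ancS: "anchored_bundle M B \<rho>\<^sub>0" and rapS: "right_anchored_product M B \<rho>\<^sub>0 S"
    and ancT: "anchored_bundle M (dual_bundle B) \<rho>\<^sub>1" and rapT: "right_anchored_product M (dual_bundle B) \<rho>\<^sub>1 T"
begin

private abbreviation "\<Gamma> \<equiv> sections M B"
private abbreviation "\<Gamma>' \<equiv> sections M (dual_bundle B)"
private abbreviation "dl \<equiv> dual_left M B \<rho>\<^sub>0 S"
private abbreviation "dr \<equiv> dual_right M B \<rho>\<^sub>1 T"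
private abbreviation "D \<equiv> phi_connection M B \<rho>\<^sub>0 S \<rho>\<^sub>1 T"

lemma bundle_B: "vector_bundle M B"
  using anchoredD(1)[OF ancS] .

lemma bundle_B_dual: "vector_bundle M (dual_bundle B)"
  using vector_bundle_dual[OF bundle_B] .

text \<open>Replacing Y by f Y produces the term rho_0(X)(f) <beta, Y> in both summands with
  opposite signs, so the functional is function-linear.\<close>

lemma dual_left_exists:
  assumes X: "X \<in> \<Gamma>" and b: "\<beta> \<in> \<Gamma>'"
  shows "\<exists>\<gamma>\<in>\<Gamma>'. \<forall>Y\<in>\<Gamma>. \<forall>x\<in>pts M. pairing \<gamma> Y x = act \<rho>\<^sub>0 X (pairing \<beta> Y) x - pairing \<beta> (S X Y) x"
proof (rule tensorial_representation[OF bundle_B])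
  show "tensorial B (\<lambda>Y x. act \<rho>\<^sub>0 X (pairing \<beta> Y) x - pairing \<beta> (S X Y) x)"
    unfolding tensorial_def
  proof (intro conjI ballI allI impI)
    fix Y assume Y: "Y \<in> \<Gamma>"
    show "smooth_fun M (\<lambda>x. act \<rho>\<^sub>0 X (pairing \<beta> Y) x - pairing \<beta> (S X Y) x)"
      by (intro smooth_fun_diff act_smooth[OF ancS X] pairing_smooth[OF bundle_B b] Y rap_in[OF rapS X])
  next
    fix Y Z x assume Y: "Y \<in> \<Gamma>" and Z: "Z \<in> \<Gamma>" and x: "x \<in> pts M"
    show "act \<rho>\<^sub>0 X (pairing \<beta> (Y + Z)) x - pairing \<beta> (S X (Y + Z)) x =
       act \<rho>\<^sub>0 X (pairing \<beta> Y) x - pairing \<beta> (S X Y) x + (act \<rho>\<^sub>0 X (pairing \<beta> Z) x - pairing \<beta> (S X Z) x)"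
      by (simp add: act_pairing_add_right[OF bundle_B ancS X x b Y Z] lin_on_add[OF rap_lin_right[OF rapS X] Y Z]
          pairing_add_right[OF bundle_B b x rap_in[OF rapS X Y] rap_in[OF rapS X Z]])
  next
    fix f Y x assume Y: "Y \<in> \<Gamma>" and x: "x \<in> pts M" and f: "smooth_fun M f"
    note in1 = sections_fmult[OF prebundle_vb[OF bundle_B] rap_in[OF rapS X Y] f]
      and in2 = sections_fmult[OF prebundle_vb[OF bundle_B] Y act_smooth[OF ancS X f]]
    show "act \<rho>\<^sub>0 X (pairing \<beta> (f \<odot> Y)) x - pairing \<beta> (S X (f \<odot> Y)) x =
       f x * (act \<rho>\<^sub>0 X (pairing \<beta> Y) x - pairing \<beta> (S X Y) x)"
      by (simp add: act_pairing_fmult_right[OF bundle_B ancS X x b Y f] rap_fmult_right[OF rapS X Y f]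
          pairing_add_right[OF bundle_B b x in1 in2] pairing_fmult_right[OF bundle_B b x rap_in[OF rapS X Y]]
          pairing_fmult_right[OF bundle_B b x Y] algebra_simps)
  qed
qed

text \<open>Sections of B pass through every vector of a fibre, so the pairings determine the
  section and the definite description in \<open>dual_left\<close> denotes.\<close>

lemma dual_left:
  assumes X: "X \<in> \<Gamma>" and b: "\<beta> \<in> \<Gamma>'"
  shows dual_left_in: "dl X \<beta> \<in> \<Gamma>'"
    and dual_left_pairing: "Y \<in> \<Gamma> \<Longrightarrow> x \<in> pts M \<Longrightarrow>
      pairing (dl X \<beta>) Y x = act \<rho>\<^sub>0 X (pairing \<beta> Y) x - pairing \<beta> (S X Y) x"
proof -
  have "\<exists>!\<gamma>. \<gamma> \<in> \<Gamma>' \<and> (\<forall>Y\<in>\<Gamma>. \<forall>x\<in>pts M. pairing \<gamma> Y x = act \<rho>\<^sub>0 X (pairing \<beta> Y) x - pairing \<beta> (S X Y) x)"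
  proof (rule ex_ex1I)
    show "\<exists>\<gamma>. \<gamma> \<in> \<Gamma>' \<and> (\<forall>Y\<in>\<Gamma>. \<forall>x\<in>pts M. pairing \<gamma> Y x = act \<rho>\<^sub>0 X (pairing \<beta> Y) x - pairing \<beta> (S X Y) x)"
      using dual_left_exists[OF X b] by (simp only: Bex_def)
  next
    fix \<gamma> \<delta>
    assume 1: "\<gamma> \<in> \<Gamma>' \<and> (\<forall>Y\<in>\<Gamma>. \<forall>x\<in>pts M. pairing \<gamma> Y x = act \<rho>\<^sub>0 X (pairing \<beta> Y) x - pairing \<beta> (S X Y) x)"
      and 2: "\<delta> \<in> \<Gamma>' \<and> (\<forall>Y\<in>\<Gamma>. \<forall>x\<in>pts M. pairing \<delta> Y x = act \<rho>\<^sub>0 X (pairing \<beta> Y) x - pairing \<beta> (S X Y) x)"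
    show "\<gamma> = \<delta>"
      by (rule dual_section_eqI[OF bundle_B conjunct1[OF 1] conjunct1[OF 2]]) (use 1 2 in simp)
  qed
  from theI'[OF this] have *: "dl X \<beta> \<in> \<Gamma>' \<and> (\<forall>Y\<in>\<Gamma>. \<forall>x\<in>pts M.
      pairing (dl X \<beta>) Y x = act \<rho>\<^sub>0 X (pairing \<beta> Y) x - pairing \<beta> (S X Y) x)"
    unfolding dual_left_def .
  show "dl X \<beta> \<in> \<Gamma>'" using * by (rule conjunct1)
  show "Y \<in> \<Gamma> \<Longrightarrow> x \<in> pts M \<Longrightarrow> pairing (dl X \<beta>) Y x = act \<rho>\<^sub>0 X (pairing \<beta> Y) x - pairing \<beta> (S X Y) x"
    using conjunct2[OF *] by simp
qed

text \<open>The cancellation is the same as for S, but the functional lives on the dual; reflexivity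
  turns its representative into a section of B.\<close>

lemma dual_right_exists:
  assumes a: "\<alpha> \<in> \<Gamma>'" and X: "X \<in> \<Gamma>"
  shows "\<exists>Z\<in>\<Gamma>. \<forall>\<beta>\<in>\<Gamma>'. \<forall>x\<in>pts M. pairing \<beta> Z x = act \<rho>\<^sub>1 \<alpha> (pairing \<beta> X) x - pairing (T \<alpha> \<beta>) X x"
proof (rule tensorial_representation_dual[OF bundle_B])
  show "tensorial (dual_bundle B) (\<lambda>\<beta> x. act \<rho>\<^sub>1 \<alpha> (pairing \<beta> X) x - pairing (T \<alpha> \<beta>) X x)"
    unfolding tensorial_def
  proof (intro conjI ballI allI impI)
    fix \<beta> assume b: "\<beta> \<in> \<Gamma>'"
    show "smooth_fun M (\<lambda>x. act \<rho>\<^sub>1 \<alpha> (pairing \<beta> X) x - pairing (T \<alpha> \<beta>) X x)"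
      by (intro smooth_fun_diff act_smooth[OF ancT a] pairing_smooth[OF bundle_B _ X] b rap_in[OF rapT a])
  next
    fix \<beta> \<gamma> x assume b: "\<beta> \<in> \<Gamma>'" and c: "\<gamma> \<in> \<Gamma>'" and x: "x \<in> pts M"
    show "act \<rho>\<^sub>1 \<alpha> (pairing (\<beta> + \<gamma>) X) x - pairing (T \<alpha> (\<beta> + \<gamma>)) X x =
       act \<rho>\<^sub>1 \<alpha> (pairing \<beta> X) x - pairing (T \<alpha> \<beta>) X x + (act \<rho>\<^sub>1 \<alpha> (pairing \<gamma> X) x - pairing (T \<alpha> \<gamma>) X x)"
      by (simp add: act_add[OF ancT a x pairing_smooth[OF bundle_B b X] pairing_smooth[OF bundle_B c X]]
          lin_on_add[OF rap_lin_right[OF rapT a] b c] pairing_add_left)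
  next
    fix f \<beta> x assume b: "\<beta> \<in> \<Gamma>'" and x: "x \<in> pts M" and f: "smooth_fun M f"
    show "act \<rho>\<^sub>1 \<alpha> (pairing (f \<odot> \<beta>) X) x - pairing (T \<alpha> (f \<odot> \<beta>)) X x =
       f x * (act \<rho>\<^sub>1 \<alpha> (pairing \<beta> X) x - pairing (T \<alpha> \<beta>) X x)"
      by (simp add: act_mult[OF ancT a x f pairing_smooth[OF bundle_B b X]] rap_fmult_right[OF rapT a b f]
          pairing_add_left pairing_fmult_left algebra_simps)
  qed
qed

lemma dual_right:
  assumes a: "\<alpha> \<in> \<Gamma>'" and X: "X \<in> \<Gamma>"
  shows dual_right_in: "dr \<alpha> X \<in> \<Gamma>"
    and dual_right_pairing: "\<beta> \<in> \<Gamma>' \<Longrightarrow> x \<in> pts M \<Longrightarrow>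
      pairing \<beta> (dr \<alpha> X) x = act \<rho>\<^sub>1 \<alpha> (pairing \<beta> X) x - pairing (T \<alpha> \<beta>) X x"
proof -
  have "\<exists>!Z. Z \<in> \<Gamma> \<and> (\<forall>\<beta>\<in>\<Gamma>'. \<forall>x\<in>pts M. pairing \<beta> Z x = act \<rho>\<^sub>1 \<alpha> (pairing \<beta> X) x - pairing (T \<alpha> \<beta>) X x)"
  proof (rule ex_ex1I)
    show "\<exists>Z. Z \<in> \<Gamma> \<and> (\<forall>\<beta>\<in>\<Gamma>'. \<forall>x\<in>pts M. pairing \<beta> Z x = act \<rho>\<^sub>1 \<alpha> (pairing \<beta> X) x - pairing (T \<alpha> \<beta>) X x)"
      using dual_right_exists[OF a X] by (simp only: Bex_def)
  next
    fix Y Z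
    assume 1: "Y \<in> \<Gamma> \<and> (\<forall>\<beta>\<in>\<Gamma>'. \<forall>x\<in>pts M. pairing \<beta> Y x = act \<rho>\<^sub>1 \<alpha> (pairing \<beta> X) x - pairing (T \<alpha> \<beta>) X x)"
      and 2: "Z \<in> \<Gamma> \<and> (\<forall>\<beta>\<in>\<Gamma>'. \<forall>x\<in>pts M. pairing \<beta> Z x = act \<rho>\<^sub>1 \<alpha> (pairing \<beta> X) x - pairing (T \<alpha> \<beta>) X x)"
    show "Y = Z"
      by (rule section_eq_pairingI[OF bundle_B conjunct1[OF 1] conjunct1[OF 2]]) (use 1 2 in simp)
  qed
  from theI'[OF this] have *: "dr \<alpha> X \<in> \<Gamma> \<and> (\<forall>\<beta>\<in>\<Gamma>'. \<forall>x\<in>pts M.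
      pairing \<beta> (dr \<alpha> X) x = act \<rho>\<^sub>1 \<alpha> (pairing \<beta> X) x - pairing (T \<alpha> \<beta>) X x)"
    unfolding dual_right_def .
  show "dr \<alpha> X \<in> \<Gamma>" using * by (rule conjunct1)
  show "\<beta> \<in> \<Gamma>' \<Longrightarrow> x \<in> pts M \<Longrightarrow> pairing \<beta> (dr \<alpha> X) x = act \<rho>\<^sub>1 \<alpha> (pairing \<beta> X) x - pairing (T \<alpha> \<beta>) X x"
    using conjunct2[OF *] by simp
qed

private lemmas pB = prebundle_vb[OF bundle_B]
private lemmas pB' = prebundle_vb[OF bundle_B_dual]

text \<open>This law and the next ones are tested by pairing with all sections of the other bundle,
  where the defining equation of the dual product reduces them to laws of S, T and the
  anchors.\<close>

lemma dual_left_add_left: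
  assumes X: "X \<in> \<Gamma>" "X' \<in> \<Gamma>" and b: "\<beta> \<in> \<Gamma>'"
  shows "dl (X + X') \<beta> = dl X \<beta> + dl X' \<beta>"
proof (rule dual_section_eqI[OF bundle_B dual_left_in[OF sections_add[OF pB X] b]
      sections_add[OF pB' dual_left_in[OF X(1) b] dual_left_in[OF X(2) b]]])
  fix Y x assume Y: "Y \<in> \<Gamma>" and x: "x \<in> pts M"
  show "pairing (dl (X + X') \<beta>) Y x = pairing (dl X \<beta> + dl X' \<beta>) Y x"
    by (simp add: pairing_add_left dual_left_pairing[OF sections_add[OF pB X] b Y x]
        dual_left_pairing[OF X(1) b Y x] dual_left_pairing[OF X(2) b Y x] act_add_section[OF ancS X x]
        lin_on_add[OF rap_lin_left[OF rapS Y] X]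
        pairing_add_right[OF bundle_B b x rap_in[OF rapS X(1) Y] rap_in[OF rapS X(2) Y]])
qed

lemma dual_left_fmult_left:
  assumes X: "X \<in> \<Gamma>" and b: "\<beta> \<in> \<Gamma>'" and f: "smooth_fun M f"
  shows "dl (f \<odot> X) \<beta> = f \<odot> dl X \<beta>"
proof (rule dual_section_eqI[OF bundle_B dual_left_in[OF sections_fmult[OF pB X f] b]
      sections_fmult[OF pB' dual_left_in[OF X b] f]])
  fix Y x assume Y: "Y \<in> \<Gamma>" and x: "x \<in> pts M"
  show "pairing (dl (f \<odot> X) \<beta>) Y x = pairing (f \<odot> dl X \<beta>) Y x"
    by (simp add: pairing_fmult_left dual_left_pairing[OF sections_fmult[OF pB X f] b Y x]
        dual_left_pairing[OF X b Y x] act_fmult_section[OF ancS X x] rap_fmult_left[OF rapS X Y f]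
        pairing_fmult_right[OF bundle_B b x rap_in[OF rapS X Y]] algebra_simps)
qed

lemma dual_left_add_right:
  assumes X: "X \<in> \<Gamma>" and b: "\<beta> \<in> \<Gamma>'" "\<gamma> \<in> \<Gamma>'"
  shows "dl X (\<beta> + \<gamma>) = dl X \<beta> + dl X \<gamma>"
proof (rule dual_section_eqI[OF bundle_B dual_left_in[OF X sections_add[OF pB' b]]
      sections_add[OF pB' dual_left_in[OF X b(1)] dual_left_in[OF X b(2)]]])
  fix Y x assume Y: "Y \<in> \<Gamma>" and x: "x \<in> pts M"
  show "pairing (dl X (\<beta> + \<gamma>)) Y x = pairing (dl X \<beta> + dl X \<gamma>) Y x"
    by (simp add: dual_left_pairing[OF X sections_add[OF pB' b] Y x] act_pairing_add_left[OF bundle_B ancS X x b(1) Y b(2)])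
      (simp add: pairing_add_left dual_left_pairing[OF X b(1) Y x] dual_left_pairing[OF X b(2) Y x])
qed

text \<open>The extra term comes from differentiating <f beta, Y> along the anchor: the dual of a
  right-anchored product has the same anchor.\<close>

lemma dual_left_fmult_right:
  assumes X: "X \<in> \<Gamma>" and b: "\<beta> \<in> \<Gamma>'" and f: "smooth_fun M f"
  shows "dl X (f \<odot> \<beta>) = f \<odot> dl X \<beta> + act \<rho>\<^sub>0 X f \<odot> \<beta>"
proof (rule dual_section_eqI[OF bundle_B dual_left_in[OF X sections_fmult[OF pB' b f]]
      sections_add[OF pB' sections_fmult[OF pB' dual_left_in[OF X b] f]
        sections_fmult[OF pB' b act_smooth[OF ancS X f]]]])
  fix Y x assume Y: "Y \<in> \<Gamma>" and x: "x \<in> pts M"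
  show "pairing (dl X (f \<odot> \<beta>)) Y x = pairing (f \<odot> dl X \<beta> + act \<rho>\<^sub>0 X f \<odot> \<beta>) Y x"
    by (simp add: dual_left_pairing[OF X sections_fmult[OF pB' b f] Y x] act_pairing_fmult_left[OF bundle_B ancS X x b Y f])
      (simp add: pairing_add_left pairing_fmult_left dual_left_pairing[OF X b Y x] algebra_simps)
qed

lemma dual_right_add_left:
  assumes a: "\<alpha> \<in> \<Gamma>'" "\<alpha>' \<in> \<Gamma>'" and X: "X \<in> \<Gamma>"
  shows "dr (\<alpha> + \<alpha>') X = dr \<alpha> X + dr \<alpha>' X"
proof (rule section_eq_pairingI[OF bundle_B dual_right_in[OF sections_add[OF pB' a] X]
      sections_add[OF pB dual_right_in[OF a(1) X] dual_right_in[OF a(2) X]]])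
  fix \<beta> x assume b: "\<beta> \<in> \<Gamma>'" and x: "x \<in> pts M"
  show "pairing \<beta> (dr (\<alpha> + \<alpha>') X) x = pairing \<beta> (dr \<alpha> X + dr \<alpha>' X) x"
    by (simp add: pairing_add_right[OF bundle_B b x dual_right_in[OF a(1) X] dual_right_in[OF a(2) X]]
        dual_right_pairing[OF sections_add[OF pB' a] X b x]
        dual_right_pairing[OF a(1) X b x] dual_right_pairing[OF a(2) X b x] act_add_section[OF ancT a x]
        lin_on_add[OF rap_lin_left[OF rapT b] a] pairing_add_left)
qed

lemma dual_right_fmult_left:
  assumes a: "\<alpha> \<in> \<Gamma>'" and X: "X \<in> \<Gamma>" and f: "smooth_fun M f"
  shows "dr (f \<odot> \<alpha>) X = f \<odot> dr \<alpha> X"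
proof (rule section_eq_pairingI[OF bundle_B dual_right_in[OF sections_fmult[OF pB' a f] X]
      sections_fmult[OF pB dual_right_in[OF a X] f]])
  fix \<beta> x assume b: "\<beta> \<in> \<Gamma>'" and x: "x \<in> pts M"
  show "pairing \<beta> (dr (f \<odot> \<alpha>) X) x = pairing \<beta> (f \<odot> dr \<alpha> X) x"
    by (simp add: pairing_fmult_right[OF bundle_B b x dual_right_in[OF a X]]
        dual_right_pairing[OF sections_fmult[OF pB' a f] X b x]
        dual_right_pairing[OF a X b x] act_fmult_section[OF ancT a x] rap_fmult_left[OF rapT a b f]
        pairing_fmult_left algebra_simps)
qed

lemma dual_right_add_right:
  assumes a: "\<alpha> \<in> \<Gamma>'" and X: "X \<in> \<Gamma>" "Y \<in> \<Gamma>"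
  shows "dr \<alpha> (X + Y) = dr \<alpha> X + dr \<alpha> Y"
proof (rule section_eq_pairingI[OF bundle_B dual_right_in[OF a sections_add[OF pB X]]
      sections_add[OF pB dual_right_in[OF a X(1)] dual_right_in[OF a X(2)]]])
  fix \<beta> x assume b: "\<beta> \<in> \<Gamma>'" and x: "x \<in> pts M"
  show "pairing \<beta> (dr \<alpha> (X + Y)) x = pairing \<beta> (dr \<alpha> X + dr \<alpha> Y) x"
    by (simp add: pairing_add_right[OF bundle_B b x dual_right_in[OF a X(1)] dual_right_in[OF a X(2)]]
        dual_right_pairing[OF a sections_add[OF pB X] b x]
        dual_right_pairing[OF a X(1) b x] dual_right_pairing[OF a X(2) b x]
        act_pairing_add_right[OF bundle_B ancT a x b X] pairing_add_right[OF bundle_B rap_in[OF rapT a b] x X])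
qed

lemma dual_right_fmult_right:
  assumes a: "\<alpha> \<in> \<Gamma>'" and X: "X \<in> \<Gamma>" and f: "smooth_fun M f"
  shows "dr \<alpha> (f \<odot> X) = f \<odot> dr \<alpha> X + act \<rho>\<^sub>1 \<alpha> f \<odot> X"
proof -
  note 1 = sections_fmult[OF pB dual_right_in[OF a X] f] and 2 = sections_fmult[OF pB X act_smooth[OF ancT a f]]
  show ?thesis
  proof (rule section_eq_pairingI[OF bundle_B dual_right_in[OF a sections_fmult[OF pB X f]] sections_add[OF pB 1 2]])
    fix \<beta> x assume b: "\<beta> \<in> \<Gamma>'" and x: "x \<in> pts M"
    show "pairing \<beta> (dr \<alpha> (f \<odot> X)) x = pairing \<beta> (f \<odot> dr \<alpha> X + act \<rho>\<^sub>1 \<alpha> f \<odot> X) x"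
      by (simp add: pairing_add_right[OF bundle_B b x 1 2] pairing_fmult_right[OF bundle_B b x dual_right_in[OF a X]]
          pairing_fmult_right[OF bundle_B b x X] dual_right_pairing[OF a sections_fmult[OF pB X f] b x]
          dual_right_pairing[OF a X b x] act_pairing_fmult_right[OF bundle_B ancT a x b X f]
          pairing_fmult_right[OF bundle_B rap_in[OF rapT a b] x X] right_diff_distrib)
  qed
qed

subsection \<open>The sum connection\<close>

private abbreviation "\<Phi> \<equiv> sections M (phi_bundle B)"
private abbreviation "\<rho> \<equiv> phi_anchor \<rho>\<^sub>0 \<rho>\<^sub>1"

lemma phi_sections_iff: "s \<in> \<Phi> \<longleftrightarrow> fst \<circ> s \<in> \<Gamma> \<and> snd \<circ> s \<in> \<Gamma>'"
  unfolding phi_bundle_def by (rule sections_sum_iff[OF bundle_B bundle_B_dual])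

lemma phi_sectionsD: "s \<in> \<Phi> \<Longrightarrow> fst \<circ> s \<in> \<Gamma>" "s \<in> \<Phi> \<Longrightarrow> snd \<circ> s \<in> \<Gamma>'"
  by (simp_all add: phi_sections_iff)

lemma phi_join_in: "X \<in> \<Gamma> \<Longrightarrow> \<alpha> \<in> \<Gamma>' \<Longrightarrow> join X \<alpha> \<in> \<Phi>"
  by (simp add: phi_sections_iff)

lemma phi_vb: "vector_bundle M (phi_bundle B)"
  unfolding phi_bundle_def by (rule vector_bundle_sum[OF bundle_B bundle_B_dual])

lemma phi_fib: "fib (phi_bundle B) x = fib B x \<times> fib (dual_bundle B) x"
  by (simp add: phi_bundle_def)

lemma phi_anchored: "anchored_bundle M (phi_bundle B) \<rho>"
  unfolding anchored_bundle_def
proof (rule conjI[OF phi_vb bundle_mapI[OF phi_vb prebundle_tangent]])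
  note m0 = anchoredD(2)[OF ancS] and m1 = anchoredD(2)[OF ancT]
  fix x assume x: "x \<in> pts M"
  show "lin_on (fib (phi_bundle B) x) (\<rho> x)"
    unfolding phi_fib
    by (rule lin_onI)
      (auto simp: phi_anchor_def lin_on_add[OF bundle_mapD(1)[OF m0 x]] lin_on_add[OF bundle_mapD(1)[OF m1 x]]
        lin_on_scale[OF bundle_mapD(1)[OF m0 x]] lin_on_scale[OF bundle_mapD(1)[OF m1 x]] scaleR_add_right)
  fix v assume "v \<in> fib (phi_bundle B) x"
  then show "\<rho> x v \<in> fib (tangent_bundle M) x"
    using bundle_mapD(2)[OF m0 x] bundle_mapD(2)[OF m1 x] tangent_subspace[OF x]
    by (auto simp: phi_fib phi_anchor_def subspace_add)
next
  note m0 = anchoredD(2)[OF ancS] and m1 = anchoredD(2)[OF ancT]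
  fix s assume s: "s \<in> \<Phi>"
  have "on_sections M \<rho> s = on_sections M \<rho>\<^sub>0 (fst \<circ> s) + on_sections M \<rho>\<^sub>1 (snd \<circ> s)"
    by (rule ext) (simp add: on_sections_def phi_anchor_def split_beta)
  then show "on_sections M \<rho> s \<in> sections M (tangent_bundle M)"
    using sections_add[OF prebundle_tangent bundle_map_sections[OF bundle_B prebundle_tangent m0 phi_sectionsD(1)[OF s]]
        bundle_map_sections[OF bundle_B_dual prebundle_tangent m1 phi_sectionsD(2)[OF s]]] by simp
qed

lemma phi_connection_eq: "D s t = join (S (fst \<circ> s) (fst \<circ> t) + dr (snd \<circ> s) (fst \<circ> t))
    (dl (fst \<circ> s) (snd \<circ> t) + T (snd \<circ> s) (snd \<circ> t))"
  by (simp add: phi_connection_def Let_def)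

lemma phi_connection_rap: "right_anchored_product M (phi_bundle B) \<rho> D"
proof (rule right_anchored_productI[OF phi_anchored])
  fix s t assume s: "s \<in> \<Phi>" and t: "t \<in> \<Phi>"
  note s = phi_sectionsD[OF s] and t = phi_sectionsD[OF t]
  show "D s t \<in> \<Phi>"
    unfolding phi_connection_eq
    by (intro phi_join_in sections_add pB pB' rap_in[OF rapS] rap_in[OF rapT] dual_left_in dual_right_in s t)
next
  fix s s' t assume s: "s \<in> \<Phi>" and s': "s' \<in> \<Phi>" and t: "t \<in> \<Phi>"
  note s = phi_sectionsD[OF s] and t = phi_sectionsD[OF t] and s' = phi_sectionsD[OF s']
  show "D (s + s') t = D s t + D s' t"
    unfolding phi_connection_eq join_add
    by (simp add: lin_on_add[OF rap_lin_left[OF rapS t(1)] s(1) s'(1)] lin_on_add[OF rap_lin_left[OF rapT t(2)] s(2) s'(2)]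
        dual_left_add_left[OF s(1) s'(1) t(2)] dual_right_add_left[OF s(2) s'(2) t(1)])
next
  fix s t t' assume s: "s \<in> \<Phi>" and t: "t \<in> \<Phi>" and t': "t' \<in> \<Phi>"
  note s = phi_sectionsD[OF s] and t = phi_sectionsD[OF t] and t' = phi_sectionsD[OF t']
  show "D s (t + t') = D s t + D s t'"
    unfolding phi_connection_eq join_add
    by (simp add: lin_on_add[OF rap_lin_right[OF rapS s(1)] t(1) t'(1)] lin_on_add[OF rap_lin_right[OF rapT s(2)] t(2) t'(2)]
        dual_left_add_right[OF s(1) t(2) t'(2)] dual_right_add_right[OF s(2) t(1) t'(1)])
next
  fix s t f assume s: "s \<in> \<Phi>" and t: "t \<in> \<Phi>" and f: "smooth_fun M f"
  note s = phi_sectionsD[OF s] and t = phi_sectionsD[OF t]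
  show "D (f \<odot> s) t = f \<odot> D s t"
    unfolding phi_connection_eq join_fmult fst_fmult snd_fmult rap_fmult_left[OF rapS s(1) t(1) f]
      rap_fmult_left[OF rapT s(2) t(2) f] dual_left_fmult_left[OF s(1) t(2) f] dual_right_fmult_left[OF s(2) t(1) f]
    by (simp add: fun_eq_iff scaleR_add_right)
  show "D s (f \<odot> t) = f \<odot> D s t + act \<rho> s f \<odot> t"
    unfolding phi_connection_eq join_fmult fst_fmult snd_fmult rap_fmult_right[OF rapS s(1) t(1) f]
      rap_fmult_right[OF rapT s(2) t(2) f] dual_left_fmult_right[OF s(1) t(2) f] dual_right_fmult_right[OF s(2) t(1) f]
    by (rule ext) (simp add: act_phi_anchor scaleR_add_right scaleR_add_left prod_eq_iff scaleR_fun_def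
        fun_eq_iff algebra_simps)
qed

section \<open>The neutral metric and the endomorphism of the sum\<close>

lemma phi_pseudo_metric: "pseudo_metric M (phi_bundle B) phi_metric"
proof -
  have 1: "lin_on (fib (phi_bundle B) x) (phi_metric x u)" if "x \<in> pts M" "u \<in> fib (phi_bundle B) x" for x u
    using that lin_on_add[OF dual_fibD(1)] lin_on_scale[OF dual_fibD(1)]
    by (intro lin_onI) (auto simp: phi_fib phi_metric_eq scaleR_fun_def algebra_simps)
  have 2: "phi_metric x u v = phi_metric x v u" for x and u v :: "'v \<times> ('v \<Rightarrow> real)"
    by (simp add: phi_metric_eq)
  have 3: "u = 0" if x: "x \<in> pts M" and u: "u \<in> fib (phi_bundle B) x"
    and z: "\<forall>v\<in>fib (phi_bundle B) x. phi_metric x u v = 0" for x u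
  proof (rule prod_eqI)
    note s = vbD(1)[OF bundle_B x] and s' = vbD(1)[OF bundle_B_dual x]
    have f: "fst u \<in> fib B x" and f': "snd u \<in> fib (dual_bundle B) x" using u by (auto simp: phi_fib)
    have "fst u = 0"
    proof (rule fib_eqI[OF bundle_B x f subspace_0[OF s]])
      fix \<beta> assume b: "\<beta> \<in> fib (dual_bundle B) x"
      then have "(0, \<beta>) \<in> fib (phi_bundle B) x" using subspace_0[OF s] by (simp add: phi_fib)
      from bspec[OF z this] show "\<beta> (fst u) = \<beta> 0"
        using lin_on_zero[OF dual_fibD(1)[OF f'] s] lin_on_zero[OF dual_fibD(1)[OF b] s] by (simp add: phi_metric_eq)
    qed
    then show "fst u = fst 0" by simp
    have "snd u = 0"
    proof (rule dual_fib_eqI[OF f' subspace_0[OF s']])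
      fix v assume v: "v \<in> fib B x"
      then have "(v, 0) \<in> fib (phi_bundle B) x" using subspace_0[OF s'] by (simp add: phi_fib)
      from bspec[OF z this] show "snd u v = 0 v" by (simp add: phi_metric_eq)
    qed
    then show "snd u = snd 0" by simp
  qed
  have 4: "smooth_fun_on M W (\<lambda>x. phi_metric x (frame (phi_bundle B) \<tau> i x) (frame (phi_bundle B) \<tau> j x))"
    if W: "(W, \<tau>) \<in> trivs (phi_bundle B)" and ij: "i < vrank (phi_bundle B)" "j < vrank (phi_bundle B)" for W \<tau> i j
  proof (rule smooth_fun_on_near[OF vbD(3)[OF phi_vb W]])
    fix x assume x: "x \<in> W"
    \<comment> \<open>Global sections in place of the frame turn the metric coefficients near x into
      pairings, whose smoothness is known.\<close>
    obtain s N where s: "\<forall>j<vrank (phi_bundle B). s j \<in> sections M (phi_bundle B)"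
      "\<forall>j<vrank (phi_bundle B). \<forall>y\<in>N. s j y = frame (phi_bundle B) \<tau> j y"
      and N: "openin (mtop M) N" "x \<in> N" "N \<subseteq> W"
      using frame_extend[OF phi_vb W x] by (elim exE conjE)
    have si: "s i \<in> \<Phi>" and sj: "s j \<in> \<Phi>" using s(1) ij by auto
    let ?h = "\<lambda>y. pairing (snd \<circ> s i) (fst \<circ> s j) y + pairing (snd \<circ> s j) (fst \<circ> s i) y"
    have "smooth_fun M ?h"
      by (intro smooth_fun_add pairing_smooth[OF bundle_B] phi_sectionsD si sj)
    then have "smooth_fun_on M N ?h" by (rule smooth_fun_imp_on[OF _ openin_subset[OF N(1)]])
    then show "\<exists>N h. openin (mtop M) N \<and> x \<in> N \<and> smooth_fun_on M N h \<and>
        (\<forall>y\<in>N. phi_metric y (frame (phi_bundle B) \<tau> i y) (frame (phi_bundle B) \<tau> j y) = h y)"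
      using N s(2) ij by (intro exI[of _ N] exI[of _ ?h]) (auto simp: phi_metric_eq pairing_def simp flip: s(2)[rule_format])
  qed
  let ?r = "vrank B"
  have 5: "\<exists>e. (\<forall>i<vrank (phi_bundle B). e i \<in> fib (phi_bundle B) x) \<and>
      (\<forall>i<vrank (phi_bundle B). \<forall>j<vrank (phi_bundle B).
         phi_metric x (e i) (e j) = (if i \<noteq> j then 0 else if i < ?r then 1 else - 1))" if x: "x \<in> pts M" for x
  proof -
    obtain U \<phi> where U: "(U, \<phi>) \<in> trivs B" "x \<in> U" using vbD(2)[OF bundle_B x] by blast
    define k where "k i = (if i < ?r then i else i - ?r)" for i
    define \<epsilon> :: "nat \<Rightarrow> real" where "\<epsilon> i = (if i < ?r then 1 else - 1)" for i
    \<comment> \<open>For a frame f_k with dual f^k the vectors f_k + f^k and f_k - f^k have squares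
      2 and - 2 and are orthogonal, hence the factor 1 / sqrt 2. The first r indices carry the sign
      +, so the signature is (r, r).\<close>
    define h :: real where "h = 1 / sqrt 2"
    have h2: "h * h = 1 / 2" by (simp add: h_def)
    define e where "e i = (h *\<^sub>R frame B \<phi> (k i) x, (h * \<epsilon> i) *\<^sub>R coframe B \<phi> (k i) x)" for i
    have k: "k i < ?r" if "i < 2 * ?r" for i using that by (auto simp: k_def)
    note s = vbD(1)[OF bundle_B x] and s' = vbD(1)[OF bundle_B_dual x]
    have "e i \<in> fib (phi_bundle B) x" if "i < 2 * ?r" for i
      by (simp add: e_def phi_fib subspace_scale[OF s] subspace_scale[OF s'] frame_in[OF bundle_B U k[OF that]]
          coframe_in[OF bundle_B U])
    moreover have "phi_metric x (e i) (e j) = (if i \<noteq> j then 0 else if i < ?r then 1 else - 1)"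
      if i: "i < 2 * ?r" and j: "j < 2 * ?r" for i j
    proof -
      have c: "coframe B \<phi> (k i) x (h *\<^sub>R frame B \<phi> (k j) x) = h * (if k i = k j then 1 else 0)"
        if i: "i < 2 * ?r" and j: "j < 2 * ?r" for i j
        using lin_on_scale[OF dual_fibD(1)[OF coframe_in[OF bundle_B U, of "k i"]] frame_in[OF bundle_B U k[OF j]], of h]
          coframe_frame[OF bundle_B U k[OF j], of "k i"] by auto
      have "phi_metric x (e i) (e j) = h * \<epsilon> i * (h * (if k i = k j then 1 else 0)) +
          h * \<epsilon> j * (h * (if k j = k i then 1 else 0))"
        by (simp only: phi_metric_eq e_def fst_conv snd_conv scaleR_fun_def c[OF i j] c[OF j i] real_scaleR_def)
      also have "\<dots> = (h * h) * (if k i = k j then \<epsilon> i + \<epsilon> j else 0)" by (simp add: algebra_simps)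
      also have "\<dots> = (if i \<noteq> j then 0 else if i < ?r then 1 else - 1)"
        unfolding h2 using i j by (auto simp: k_def \<epsilon>_def split: if_splits)
      finally show ?thesis .
    qed
    ultimately show ?thesis by (intro exI[of _ e]) (simp add: phi_bundle_def mult_2)
  qed
  have 6: "\<exists>p\<le>vrank (phi_bundle B). \<forall>x\<in>pts M. \<exists>e. (\<forall>i<vrank (phi_bundle B). e i \<in> fib (phi_bundle B) x) \<and>
      (\<forall>i<vrank (phi_bundle B). \<forall>j<vrank (phi_bundle B).
         phi_metric x (e i) (e j) = (if i \<noteq> j then 0 else if i < p then 1 else - 1))"
    by (rule exI[of _ ?r], rule conjI, simp add: phi_bundle_def, rule ballI, rule 5)
  have "\<forall>x\<in>pts M. (\<forall>u\<in>fib (phi_bundle B) x. lin_on (fib (phi_bundle B) x) (phi_metric x u)) \<and>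
      (\<forall>u\<in>fib (phi_bundle B) x. \<forall>v\<in>fib (phi_bundle B) x. phi_metric x u v = phi_metric x v u) \<and>
      (\<forall>u\<in>fib (phi_bundle B) x. (\<forall>v\<in>fib (phi_bundle B) x. phi_metric x u v = 0) \<longrightarrow> u = 0)"
    by (intro ballI conjI impI) (rule 1 2 3; assumption)+
  moreover have "\<forall>(U, \<phi>)\<in>trivs (phi_bundle B). \<forall>i<vrank (phi_bundle B). \<forall>j<vrank (phi_bundle B).
      smooth_fun_on M U (\<lambda>x. phi_metric x (frame (phi_bundle B) \<phi> i x) (frame (phi_bundle B) \<phi> j x))"
    using 4 by auto
  ultimately show ?thesis
    unfolding pseudo_metric_def by (intro conjI 6)
qed

text \<open>The dual product is made so that rho_0(X) <beta, Y> = <S*_X beta, Y> + <beta, S_X Y>,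
  and likewise for T. Summing this over the two mixed pairings that make up the metric is the whole
  content.\<close>

lemma phi_metric_product: "metric_product (phi_bundle B) \<rho> D phi_metric"
  unfolding metric_product_def
proof (intro ballI)
  fix s t u x assume s: "s \<in> \<Phi>" and t: "t \<in> \<Phi>" and u: "u \<in> \<Phi>" and x: "x \<in> pts M"
  note s' = phi_sectionsD[OF s] and t' = phi_sectionsD[OF t] and u' = phi_sectionsD[OF u]
  have m: "phi_metric y (t y) (u y) = pairing (snd \<circ> t) (fst \<circ> u) y + pairing (snd \<circ> u) (fst \<circ> t) y" for t u and y
    by (simp add: phi_metric_eq pairing_def)
  have p1: "pairing (snd \<circ> D s t) (fst \<circ> u) x = act \<rho>\<^sub>0 (fst \<circ> s) (pairing (snd \<circ> t) (fst \<circ> u)) x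
      - pairing (snd \<circ> t) (S (fst \<circ> s) (fst \<circ> u)) x + pairing (T (snd \<circ> s) (snd \<circ> t)) (fst \<circ> u) x"
    if t: "t \<in> \<Phi>" and u: "u \<in> \<Phi>" for t u
    by (simp add: phi_connection_eq pairing_add_left
        dual_left_pairing[OF s'(1) phi_sectionsD(2)[OF t] phi_sectionsD(1)[OF u] x])
  have p2: "pairing (snd \<circ> u) (fst \<circ> D s t) x = pairing (snd \<circ> u) (S (fst \<circ> s) (fst \<circ> t)) x
      + (act \<rho>\<^sub>1 (snd \<circ> s) (pairing (snd \<circ> u) (fst \<circ> t)) x - pairing (T (snd \<circ> s) (snd \<circ> u)) (fst \<circ> t) x)"
    if t: "t \<in> \<Phi>" and u: "u \<in> \<Phi>" for t u
    by (simp add: phi_connection_eq dual_right_pairing[OF s'(2) phi_sectionsD(1)[OF t] phi_sectionsD(2)[OF u] x]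
        pairing_add_right[OF bundle_B phi_sectionsD(2)[OF u] x rap_in[OF rapS s'(1) phi_sectionsD(1)[OF t]]
          dual_right_in[OF s'(2) phi_sectionsD(1)[OF t]]])
  note sm = pairing_smooth[OF bundle_B t'(2) u'(1)] pairing_smooth[OF bundle_B u'(2) t'(1)]
  have "act \<rho> s (\<lambda>y. phi_metric y (t y) (u y)) x =
      act \<rho>\<^sub>0 (fst \<circ> s) (pairing (snd \<circ> t) (fst \<circ> u)) x + act \<rho>\<^sub>0 (fst \<circ> s) (pairing (snd \<circ> u) (fst \<circ> t)) x +
      (act \<rho>\<^sub>1 (snd \<circ> s) (pairing (snd \<circ> t) (fst \<circ> u)) x + act \<rho>\<^sub>1 (snd \<circ> s) (pairing (snd \<circ> u) (fst \<circ> t)) x)"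
    unfolding act_phi_anchor m by (simp only: act_add[OF ancS s'(1) x sm] act_add[OF ancT s'(2) x sm])
  then show "act \<rho> s (\<lambda>y. phi_metric y (t y) (u y)) x = phi_metric x (D s t x) (u x) + phi_metric x (t x) (D s u x)"
    unfolding m[of x "D s t" u] m[of x t "D s u"] p1[OF t u] p1[OF u t] p2[OF t u] p2[OF u t] by simp
qed

lemma phi_K_sections: "s \<in> \<Phi> \<Longrightarrow> on_sections M phi_K s = join (fst \<circ> s) (- (snd \<circ> s))"
  by (rule ext) (auto simp: on_sections_def phi_K_def split_beta sectionsD(2) zero_prod_def fun_eq_iff)

lemma phi_K_in: "s \<in> \<Phi> \<Longrightarrow> on_sections M phi_K s \<in> \<Phi>"
  by (simp add: phi_K_sections phi_sections_iff sections_minus[OF pB'])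

lemma phi_K_iso: "bundle_iso M (phi_bundle B) (phi_bundle B) phi_K"
proof -
  have "bundle_map M (phi_bundle B) (phi_bundle B) phi_K"
  proof (rule bundle_mapI[OF phi_vb prebundle_vb[OF phi_vb] _ _ phi_K_in])
    fix x assume x: "x \<in> pts M"
    show "lin_on (fib (phi_bundle B) x) (phi_K x)"
      by (rule lin_onI) (auto simp: phi_K_def split_beta)
    show "v \<in> fib (phi_bundle B) x \<Longrightarrow> phi_K x v \<in> fib (phi_bundle B) x" for v
      by (auto simp: phi_K_def phi_fib subspace_neg[OF vbD(1)[OF bundle_B_dual x]])
  qed
  then show ?thesis
    unfolding bundle_iso_def by (intro conjI exI[of _ phi_K] ballI) (auto simp: phi_K_def split_beta)
qed

text \<open>Each component of the derivative depends on the same component of t alone, so it is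
  enough that the two maps into the second component are odd.\<close>

lemma phi_K_parallel:
  assumes s: "s \<in> \<Phi>" and t: "t \<in> \<Phi>"
  shows "D s (on_sections M phi_K t) = on_sections M phi_K (D s t)"
proof -
  note s' = phi_sectionsD[OF s] and t' = phi_sectionsD[OF t]
  have m: "f (- a) = - f a" if l: "\<And>a b. a \<in> \<Gamma>' \<Longrightarrow> b \<in> \<Gamma>' \<Longrightarrow> f (a + b) = f a + f b" and a: "a \<in> \<Gamma>'"
    for f :: "('m \<Rightarrow> 'v \<Rightarrow> real) \<Rightarrow> 'm \<Rightarrow> 'v \<Rightarrow> real" and a
  proof -
    have "f 0 = 0" using l[OF sections_zero[OF pB'] sections_zero[OF pB']] by simp
    then show ?thesis using l[OF a sections_minus[OF pB' a]] by (simp add: eq_neg_iff_add_eq_0 add.commute)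
  qed
  have "dl (fst \<circ> s) (- (snd \<circ> t)) = - dl (fst \<circ> s) (snd \<circ> t)"
    by (rule m[OF dual_left_add_right[OF s'(1)] t'(2)])
  moreover have "T (snd \<circ> s) (- (snd \<circ> t)) = - T (snd \<circ> s) (snd \<circ> t)"
    by (rule lin_on_minus[OF rap_lin_right[OF rapT s'(2)] t'(2)])
  ultimately show ?thesis
    unfolding phi_K_sections[OF t] phi_K_sections[OF rap_in[OF phi_connection_rap s t]]
    by (simp add: phi_connection_eq)
qed

end

section \<open>The Jacobi identity and the Lie algebroid\<close>

lemma lie_algebroid_bracket_of:
  assumes anc: "anchored_bundle M A \<rho>" and rap: "right_anchored_product M A \<rho> D"
    and jac: "\<And>a b c. a \<in> sections M A \<Longrightarrow> b \<in> sections M A \<Longrightarrow> c \<in> sections M A \<Longrightarrow>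
      bracket_of D a (bracket_of D b c) + bracket_of D b (bracket_of D c a) + bracket_of D c (bracket_of D a b) = 0"
  shows "lie_algebroid M A \<rho> (bracket_of D)"
  unfolding lie_algebroid_def
proof (intro conjI ballI allI impI anc jac)
  show "bilinear_product M A (bracket_of D)"
    by (rule bilinear_bracket_of[OF prebundle_vb[OF anchoredD(1)[OF anc]]])
      (use rap in \<open>simp add: right_anchored_product_def\<close>)
  show "bracket_of D a a = 0" for a by (simp add: bracket_of_def)
  fix a b f assume a: "a \<in> sections M A" and b: "b \<in> sections M A" and f: "smooth_fun M f"
  show "bracket_of D a (f \<odot> b) = f \<odot> bracket_of D a b + act \<rho> a f \<odot> b"
    unfolding bracket_of_def rap_fmult_right[OF rap a b f] rap_fmult_left[OF rap b a f]
    by (rule ext) (simp add: algebra_simps)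
qed

text \<open>The Jacobi identity is trilinear and cyclic, so it suffices to check it on sections of the two
  summands, of which at least two lie in the same summand. There it is the Bianchi identity: the
  curvature vanishes on two arguments in the same summand, and the remaining two terms cancel by
  compatibility.\<close>

lemma phi_jacobi:
  fixes B :: "('m, 'v::real_vector) vbundle"
  assumes ext: "lie_extendible M B \<rho>\<^sub>0 S \<rho>\<^sub>1 T"
    and abc: "a \<in> sections M (phi_bundle B)" "b \<in> sections M (phi_bundle B)" "c \<in> sections M (phi_bundle B)"
  defines "br \<equiv> bracket_of (phi_connection M B \<rho>\<^sub>0 S \<rho>\<^sub>1 T)"
  shows "br a (br b c) + br b (br c a) + br c (br a b) = 0"
proof -
  let ?\<Gamma> = "sections M B" and ?\<Gamma>' = "sections M (dual_bundle B)" and ?\<Phi> = "sections M (phi_bundle B)"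
  define D where "D = phi_connection M B \<rho>\<^sub>0 S \<rho>\<^sub>1 T"
  note e = ext[unfolded lie_extendible_def Let_def left_symmetric_algebroid_def, folded D_def]
  have ancS: "anchored_bundle M B \<rho>\<^sub>0" and rapS: "right_anchored_product M B \<rho>\<^sub>0 S"
    and flatS: "\<And>X Y Z. X \<in> ?\<Gamma> \<Longrightarrow> Y \<in> ?\<Gamma> \<Longrightarrow> Z \<in> ?\<Gamma> \<Longrightarrow> curvature S X Y Z = 0"
    and ancT: "anchored_bundle M (dual_bundle B) \<rho>\<^sub>1" and rapT: "right_anchored_product M (dual_bundle B) \<rho>\<^sub>1 T"
    and flatT: "\<And>\<alpha> \<beta> \<gamma>. \<alpha> \<in> ?\<Gamma>' \<Longrightarrow> \<beta> \<in> ?\<Gamma>' \<Longrightarrow> \<gamma> \<in> ?\<Gamma>' \<Longrightarrow> curvature T \<alpha> \<beta> \<gamma> = 0"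
    and comp1: "\<And>X Y \<alpha>. X \<in> ?\<Gamma> \<Longrightarrow> Y \<in> ?\<Gamma> \<Longrightarrow> \<alpha> \<in> ?\<Gamma>' \<Longrightarrow>
      curvature D (join X 0) (join 0 \<alpha>) (join Y 0) = curvature D (join Y 0) (join 0 \<alpha>) (join X 0)"
    and comp2: "\<And>X \<alpha> \<beta>. X \<in> ?\<Gamma> \<Longrightarrow> \<alpha> \<in> ?\<Gamma>' \<Longrightarrow> \<beta> \<in> ?\<Gamma>' \<Longrightarrow>
      curvature D (join 0 \<alpha>) (join X 0) (join 0 \<beta>) = curvature D (join 0 \<beta>) (join X 0) (join 0 \<alpha>)"
    using e by simp_all
  note ctx = ancS rapS ancT rapT
  note vb = anchoredD(1)[OF ancS] and vbd = anchoredD(1)[OF ancT]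
  note anc = phi_anchored[OF ctx] and rap = phi_connection_rap[OF ctx, folded D_def]
    and met = phi_pseudo_metric[OF ctx] and mp = phi_metric_product[OF ctx, folded D_def]
  note zB = sections_zero[OF prebundle_vb[OF vb]] and zB' = sections_zero[OF prebundle_vb[OF vbd]]
  have in1: "join X 0 \<in> ?\<Phi>" if "X \<in> ?\<Gamma>" for X using phi_join_in[OF ctx that zB'] .
  have in2: "join 0 \<alpha> \<in> ?\<Phi>" if "\<alpha> \<in> ?\<Gamma>'" for \<alpha> using phi_join_in[OF ctx zB that] .
  have dl0: "dual_left M B \<rho>\<^sub>0 S X 0 = 0" if "X \<in> ?\<Gamma>" for X
    using dual_left_add_right[OF ctx that zB' zB'] by simp
  have dl0': "dual_left M B \<rho>\<^sub>0 S 0 \<beta> = 0" if "\<beta> \<in> ?\<Gamma>'" for \<beta>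
    using dual_left_add_left[OF ctx zB zB that] by simp
  have dr0: "dual_right M B \<rho>\<^sub>1 T \<alpha> 0 = 0" if "\<alpha> \<in> ?\<Gamma>'" for \<alpha>
    using dual_right_add_right[OF ctx that zB zB] by simp
  have dr0': "dual_right M B \<rho>\<^sub>1 T 0 X = 0" if "X \<in> ?\<Gamma>" for X
    using dual_right_add_left[OF ctx zB' zB' that] by simp
  note zero = dl0 dl0' dr0 dr0' rap_zero[OF ancS rapS] rap_zero[OF ancT rapT] zB zB'
  have D11: "D (join X 0) (join Y 0) = join (S X Y) 0" if "X \<in> ?\<Gamma>" "Y \<in> ?\<Gamma>" for X Y
    using that by (simp add: D_def phi_connection_eq[OF ctx] zero)
  have D12: "D (join X 0) (join 0 \<beta>) = join 0 (dual_left M B \<rho>\<^sub>0 S X \<beta>)" if "X \<in> ?\<Gamma>" "\<beta> \<in> ?\<Gamma>'" for X \<beta>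
    using that by (simp add: D_def phi_connection_eq[OF ctx] zero)
  have D21: "D (join 0 \<alpha>) (join Y 0) = join (dual_right M B \<rho>\<^sub>1 T \<alpha> Y) 0" if "\<alpha> \<in> ?\<Gamma>'" "Y \<in> ?\<Gamma>" for \<alpha> Y
    using that by (simp add: D_def phi_connection_eq[OF ctx] zero)
  have D22: "D (join 0 \<alpha>) (join 0 \<beta>) = join 0 (T \<alpha> \<beta>)" if "\<alpha> \<in> ?\<Gamma>'" "\<beta> \<in> ?\<Gamma>'" for \<alpha> \<beta>
    using that by (simp add: D_def phi_connection_eq[OF ctx] zero)
  note S_in = rap_in[OF rapS] and T_in = rap_in[OF rapT] and dl_in = dual_left_in[OF ctx]
    and dr_in = dual_right_in[OF ctx]
  have brS: "bracket_of S X Y \<in> ?\<Gamma>" if "X \<in> ?\<Gamma>" "Y \<in> ?\<Gamma>" for X Y by (rule bracket_of_in[OF ancS rapS that])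
  have brT: "bracket_of T \<alpha> \<beta> \<in> ?\<Gamma>'" if "\<alpha> \<in> ?\<Gamma>'" "\<beta> \<in> ?\<Gamma>'" for \<alpha> \<beta> by (rule bracket_of_in[OF ancT rapT that])
  have br11: "bracket_of D (join X 0) (join Y 0) = join (bracket_of S X Y) 0" if "X \<in> ?\<Gamma>" "Y \<in> ?\<Gamma>" for X Y
    using that by (simp add: bracket_of_def D11 join_diff)
  have br22: "bracket_of D (join 0 \<alpha>) (join 0 \<beta>) = join 0 (bracket_of T \<alpha> \<beta>)" if "\<alpha> \<in> ?\<Gamma>'" "\<beta> \<in> ?\<Gamma>'" for \<alpha> \<beta>
    using that by (simp add: bracket_of_def D22 join_diff)
  have R111: "curvature D (join X 0) (join Y 0) (join Z 0) = 0" if "X \<in> ?\<Gamma>" "Y \<in> ?\<Gamma>" "Z \<in> ?\<Gamma>" for X Y Z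
    using flatS[OF that] that
    by (simp add: curvature_def br11 D11 S_in brS join_diff join_zero)
  have R222: "curvature D (join 0 \<alpha>) (join 0 \<beta>) (join 0 \<gamma>) = 0" if "\<alpha> \<in> ?\<Gamma>'" "\<beta> \<in> ?\<Gamma>'" "\<gamma> \<in> ?\<Gamma>'" for \<alpha> \<beta> \<gamma>
    using flatT[OF that] that
    by (simp add: curvature_def br22 D22 T_in brT join_diff join_zero)
  have R112: "curvature D (join X 0) (join Y 0) (join 0 \<gamma>) = 0" if X: "X \<in> ?\<Gamma>" and Y: "Y \<in> ?\<Gamma>" and c: "\<gamma> \<in> ?\<Gamma>'" for X Y \<gamma>
  proof -
    let ?R = "curvature D (join X 0) (join Y 0) (join 0 \<gamma>)"
    have eq: "?R = join 0 (snd \<circ> ?R)"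
      using X Y c by (simp add: curvature_def br11 D12 dl_in brS join_diff)
    have "?R \<in> ?\<Phi>" by (rule curvature_in[OF anc rap in1[OF X] in1[OF Y] in2[OF c]])
    then have R: "snd \<circ> ?R \<in> ?\<Gamma>'" by (rule phi_sectionsD[OF ctx])
    \<comment> \<open>The dual of a flat product is flat: R(X, Y) kills Z and also f Z, which is
      again a section of B, and these are the two flatness hypotheses of
      \<open>curvature_orthogonal\<close>.\<close>
    have "snd \<circ> ?R = 0"
    proof (rule dual_section_eqI[OF vb R zB'])
      fix Z x assume Z: "Z \<in> ?\<Gamma>" and x: "x \<in> pts M"
      let ?f = "\<lambda>y. phi_metric y (join 0 \<gamma> y) (join Z 0 y)"
      have f: "smooth_fun M ?f"
        using pairing_smooth[OF vb c Z] by (simp add: phi_metric_eq pairing_def)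
      have "phi_metric x (?R x) (join Z 0 x) = 0"
      proof (rule curvature_orthogonal[OF anc rap met mp in1[OF X] in1[OF Y] in1[OF Z] in2[OF c] x R111[OF X Y Z]])
        show "curvature D (join X 0) (join Y 0) (?f \<odot> join Z 0) = 0"
          using R111[OF X Y sections_fmult[OF prebundle_vb[OF vb] Z f]] by (simp add: join_fmult)
      qed
      then show "pairing (snd \<circ> ?R) Z x = pairing 0 Z x" by (simp add: phi_metric_eq pairing_def)
    qed
    then show ?thesis using eq by (simp add: join_zero)
  qed
  have R221: "curvature D (join 0 \<alpha>) (join 0 \<beta>) (join Z 0) = 0" if a: "\<alpha> \<in> ?\<Gamma>'" and b: "\<beta> \<in> ?\<Gamma>'" and Z: "Z \<in> ?\<Gamma>" for \<alpha> \<beta> Z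
  proof -
    let ?R = "curvature D (join 0 \<alpha>) (join 0 \<beta>) (join Z 0)"
    have eq: "?R = join (fst \<circ> ?R) 0"
      using a b Z by (simp add: curvature_def br22 D21 dr_in brT join_diff)
    have "?R \<in> ?\<Phi>" by (rule curvature_in[OF anc rap in2[OF a] in2[OF b] in1[OF Z]])
    then have R: "fst \<circ> ?R \<in> ?\<Gamma>" by (rule phi_sectionsD[OF ctx])
    have "fst \<circ> ?R = 0"
    proof (rule section_eq_pairingI[OF vb R zB])
      fix \<gamma> x assume c: "\<gamma> \<in> ?\<Gamma>'" and x: "x \<in> pts M"
      let ?f = "\<lambda>y. phi_metric y (join Z 0 y) (join 0 \<gamma> y)"
      have f: "smooth_fun M ?f"
        using pairing_smooth[OF vb c Z] by (simp add: phi_metric_eq pairing_def)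
      have "phi_metric x (?R x) (join 0 \<gamma> x) = 0"
      proof (rule curvature_orthogonal[OF anc rap met mp in2[OF a] in2[OF b] in2[OF c] in1[OF Z] x R222[OF a b c]])
        show "curvature D (join 0 \<alpha>) (join 0 \<beta>) (?f \<odot> join 0 \<gamma>) = 0"
          using R222[OF a b sections_fmult[OF prebundle_vb[OF vbd] c f]] by (simp add: join_fmult)
      qed
      moreover have "snd (?R x) = 0" using fun_cong[OF eq, of x] by (simp add: prod_eq_iff)
      moreover have "\<gamma> x 0 = 0"
        by (rule lin_on_zero[OF dual_fibD(1)[OF sectionsD(1)[OF c x]] vbD(1)[OF vb x]])
      ultimately show "pairing \<gamma> (fst \<circ> ?R) x = pairing \<gamma> 0 x" by (simp add: phi_metric_eq pairing_def)
    qed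
    then show ?thesis using eq by (simp add: join_zero)
  qed
  define J where "J a b c = br a (br b c) + br b (br c a) + br c (br a b)" for a b c
  have br: "br = bracket_of D" by (simp add: br_def D_def)
  have bil: "bilinear_product M (phi_bundle B) br"
    unfolding br by (rule bilinear_bracket_of[OF prebundle_vb[OF anchoredD(1)[OF anc]]])
      (use rap in \<open>simp add: right_anchored_product_def\<close>)
  then have br_in: "br s t \<in> ?\<Phi>" if "s \<in> ?\<Phi>" "t \<in> ?\<Phi>" for s t
    using that unfolding bilinear_product_def by simp
  have lr: "lin_on ?\<Phi> (br s)" and ll: "lin_on ?\<Phi> (\<lambda>t. br t s)" if "s \<in> ?\<Phi>" for s
    using bil that unfolding bilinear_product_def by simp_all
  have cyc: "J s t u = J t u s" for s t u by (simp add: J_def algebra_simps)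
  have Jadd: "J (s + s') t u = J s t u + J s' t u" if "s \<in> ?\<Phi>" "s' \<in> ?\<Phi>" "t \<in> ?\<Phi>" "u \<in> ?\<Phi>" for s s' t u
    unfolding J_def
    by (simp add: lin_on_add[OF lr[OF that(3)] that(1,2)] lin_on_add[OF ll[OF that(3)] that(1,2)]
        lin_on_add[OF lr[OF that(4)] that(1,2)] lin_on_add[OF ll[OF that(4)] that(1,2)]
        lin_on_add[OF lr[OF that(3)]] lin_on_add[OF lr[OF that(4)]] lin_on_add[OF ll[OF br_in[OF that(3,4)]] that(1,2)]
        br_in that)
  have JR: "J s t u = curvature D s t u + curvature D t u s + curvature D u s t"
    if "s \<in> ?\<Phi>" "t \<in> ?\<Phi>" "u \<in> ?\<Phi>" for s t u
    unfolding J_def br by (rule bianchi[OF anc rap that, symmetric])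
  have J111: "J (join X 0) (join Y 0) (join Z 0) = 0" if "X \<in> ?\<Gamma>" "Y \<in> ?\<Gamma>" "Z \<in> ?\<Gamma>" for X Y Z
    using that by (simp add: JR in1 R111)
  have J222: "J (join 0 \<alpha>) (join 0 \<beta>) (join 0 \<gamma>) = 0" if "\<alpha> \<in> ?\<Gamma>'" "\<beta> \<in> ?\<Gamma>'" "\<gamma> \<in> ?\<Gamma>'" for \<alpha> \<beta> \<gamma>
    using that by (simp add: JR in2 R222)
  \<comment> \<open>The summand R(X, Y) gamma vanishes by \<open>R112\<close>. By skew-symmetry the
    other two are R(Y, gamma) X - R(X, gamma) Y, which is zero by compatibility.\<close>
  have J112: "J (join X 0) (join Y 0) (join 0 \<gamma>) = 0" if "X \<in> ?\<Gamma>" "Y \<in> ?\<Gamma>" "\<gamma> \<in> ?\<Gamma>'" for X Y \<gamma>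
    using that curvature_skew[OF anc rap in1[OF that(1)] in2[OF that(3)] in1[OF that(2)]] comp1[OF that]
    by (simp add: JR in1 in2 R112)
  have J221: "J (join 0 \<alpha>) (join 0 \<beta>) (join Z 0) = 0" if "\<alpha> \<in> ?\<Gamma>'" "\<beta> \<in> ?\<Gamma>'" "Z \<in> ?\<Gamma>" for \<alpha> \<beta> Z
    using that curvature_skew[OF anc rap in2[OF that(1)] in1[OF that(3)] in2[OF that(2)]] comp2[OF that(3,1,2)]
    by (simp add: JR in1 in2 R221)
  have split: "s = join (fst \<circ> s) 0 + join 0 (snd \<circ> s)" for s :: "'m \<Rightarrow> 'v \<times> ('v \<Rightarrow> real)"
    by (simp add: join_add)
  have J1: "J s t u = 0"
    if "J (join (fst \<circ> s) 0) t u = 0" "J (join 0 (snd \<circ> s)) t u = 0" "s \<in> ?\<Phi>" "t \<in> ?\<Phi>" "u \<in> ?\<Phi>" for s t u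
    using Jadd[of "join (fst \<circ> s) 0" "join 0 (snd \<circ> s)" t u] that in1 in2 phi_sectionsD[OF ctx]
    by (simp flip: split)
  note ps = phi_sectionsD[OF ctx]
  let ?a1 = "fst \<circ> a" and ?a2 = "snd \<circ> a" and ?b1 = "fst \<circ> b" and ?b2 = "snd \<circ> b" and ?c1 = "fst \<circ> c" and ?c2 = "snd \<circ> c"
  note p = ps[OF abc(1)] ps[OF abc(2)] ps[OF abc(3)]
  \<comment> \<open>Two arguments lie in a summand, the third is still the given \<open>c\<close>.
    Since \<open>J1\<close> splits the first slot only, \<open>c\<close> is rotated there and back
    by \<open>cyc\<close>; the eight resulting patterns are cyclic rotations of the four cases
    above.\<close>
  have pure: "J (join X 0) (join Y 0) c = 0" "J (join 0 \<alpha>) (join 0 \<beta>) c = 0"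
    "J (join X 0) (join 0 \<beta>) c = 0" "J (join 0 \<alpha>) (join Y 0) c = 0"
    if "X \<in> ?\<Gamma>" "Y \<in> ?\<Gamma>" "\<alpha> \<in> ?\<Gamma>'" "\<beta> \<in> ?\<Gamma>'" for X Y \<alpha> \<beta>
  proof -
    have "J c s t = 0" if "J (join ?c1 0) s t = 0" "J (join 0 ?c2) s t = 0" "s \<in> ?\<Phi>" "t \<in> ?\<Phi>" for s t
      by (rule J1[OF that(1,2) abc(3) that(3,4)])
    moreover have "J (join ?c1 0) (join X 0) (join Y 0) = 0" "J (join 0 ?c2) (join 0 \<alpha>) (join 0 \<beta>) = 0"
      using J111[OF p(5) that(1,2)] J222[OF p(6) that(3,4)] .
    moreover have "J (join 0 ?c2) (join X 0) (join Y 0) = 0" "J (join ?c1 0) (join 0 \<alpha>) (join 0 \<beta>) = 0"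
      using J112[OF that(1,2) p(6)] J221[OF that(3,4) p(5)] cyc by metis+
    moreover have "J (join ?c1 0) (join X 0) (join 0 \<beta>) = 0" "J (join 0 ?c2) (join X 0) (join 0 \<beta>) = 0"
      using J112[OF p(5) that(1,4)] J221[OF that(4) p(6) that(1)] cyc by metis+
    moreover have "J (join ?c1 0) (join 0 \<alpha>) (join Y 0) = 0" "J (join 0 ?c2) (join 0 \<alpha>) (join Y 0) = 0"
      using J112[OF that(2) p(5) that(3)] J221[OF p(6) that(3,2)] cyc by metis+
    moreover note i = in1[OF that(1)] in1[OF that(2)] in2[OF that(3)] in2[OF that(4)]
    ultimately have "J c (join X 0) (join Y 0) = 0" "J c (join 0 \<alpha>) (join 0 \<beta>) = 0"
      "J c (join X 0) (join 0 \<beta>) = 0" "J c (join 0 \<alpha>) (join Y 0) = 0" by simp_all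
    then show "J (join X 0) (join Y 0) c = 0" "J (join 0 \<alpha>) (join 0 \<beta>) c = 0"
      "J (join X 0) (join 0 \<beta>) c = 0" "J (join 0 \<alpha>) (join Y 0) c = 0"
      by (simp_all only: cyc[of c])
  qed
  have "J b c s = 0" if "s \<in> ?\<Phi>" "s = join ?a1 0 \<or> s = join 0 ?a2" for s
  proof (rule J1[OF _ _ abc(2,3) that(1)])
    show "J (join ?b1 0) c s = 0" "J (join 0 ?b2) c s = 0"
      using that(2) pure[OF p(1,3,2,4)] cyc by metis+
  qed
  then have "J (join ?a1 0) b c = 0" "J (join 0 ?a2) b c = 0"
    using in1[OF p(1)] in2[OF p(2)] by (simp_all add: cyc[of _ b c])
  then have "J a b c = 0" by (rule J1[OF _ _ abc])
  then show ?thesis by (simp add: J_def)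
qed

theorem lie_extendible_para_kaehler:
  fixes B :: "('m, 'v::real_vector) vbundle"
  assumes ext: "lie_extendible M B \<rho>\<^sub>0 S \<rho>\<^sub>1 T"
  shows "para_kaehler M (phi_bundle B) (phi_anchor \<rho>\<^sub>0 \<rho>\<^sub>1) (phi_bracket M B \<rho>\<^sub>0 S \<rho>\<^sub>1 T) phi_metric phi_K"
proof -
  have ctx: "anchored_bundle M B \<rho>\<^sub>0" "right_anchored_product M B \<rho>\<^sub>0 S"
    "anchored_bundle M (dual_bundle B) \<rho>\<^sub>1" "right_anchored_product M (dual_bundle B) \<rho>\<^sub>1 T"
    using ext unfolding lie_extendible_def left_symmetric_algebroid_def by simp_all
  let ?D = "phi_connection M B \<rho>\<^sub>0 S \<rho>\<^sub>1 T"
  note rap = phi_connection_rap[OF ctx] and anc = phi_anchored[OF ctx]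
  have lc: "levi_civita M (phi_bundle B) (phi_anchor \<rho>\<^sub>0 \<rho>\<^sub>1) (bracket_of ?D) phi_metric ?D"
    unfolding levi_civita_def using rap phi_metric_product[OF ctx] by (simp add: metric_product_def)
  have K: "\<forall>x\<in>pts M. (\<forall>u\<in>fib (phi_bundle B) x. phi_K x (phi_K x u) = u) \<and>
      (\<forall>u\<in>fib (phi_bundle B) x. \<forall>v\<in>fib (phi_bundle B) x. phi_metric x (phi_K x u) v = - phi_metric x u (phi_K x v))"
  proof (intro ballI conjI)
    fix x u v assume x: "x \<in> pts M" and u: "u \<in> fib (phi_bundle B) x" and v: "v \<in> fib (phi_bundle B) x"
    show "phi_metric x (phi_K x u) v = - phi_metric x u (phi_K x v)"
      by (simp add: phi_metric_eq phi_K_def split_beta)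
  qed (simp add: phi_K_def split_beta)
  show ?thesis
    unfolding para_kaehler_def phi_bracket_eq
    using lie_algebroid_bracket_of[OF anc rap phi_jacobi[OF ext]] phi_pseudo_metric[OF ctx]
      phi_K_iso[OF ctx] K lc phi_K_parallel[OF ctx] by blast
qed

end

section \<open>Splitting a para-Kaehler Lie algebroid\<close>

definition family_independent :: "(nat \<Rightarrow> 'v::real_vector) \<Rightarrow> nat \<Rightarrow> bool"
  where "family_independent v m \<longleftrightarrow> (\<forall>c. (\<Sum>i<m. c i *\<^sub>R v i) = 0 \<longrightarrow> (\<forall>i<m. c i = 0))"

text \<open>The exchange bound is about sets, so repetitions have to be excluded before the
  cardinality of the image counts the indices.\<close>

lemma family_independent_le:
  assumes ind: "family_independent v m" and span: "\<And>i. i < m \<Longrightarrow> v i \<in> span (w ` {..<k})"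
  shows "m \<le> k"
proof -
  have inj: "inj_on v {..<m}"
  proof (rule inj_onI, rule ccontr)
    fix i j assume ij: "i \<in> {..<m}" "j \<in> {..<m}" "v i = v j" "i \<noteq> j"
    \<comment> \<open>If v i = v j, the coefficients 1 at i and - 1 at j form a nontrivial relation.
      Writing them as a sum lets the sum over l be split in two.\<close>
    let ?c = "\<lambda>l. (if l = i then 1 else 0) + (if l = j then - 1 else 0 :: real)"
    have "(\<Sum>l<m. ?c l *\<^sub>R v l) = (\<Sum>l<m. if l = i then v i else 0) + (\<Sum>l<m. if l = j then - v j else 0)"
      unfolding sum.distrib[symmetric] by (rule sum.cong) (auto simp: scaleR_add_left)
    also have "\<dots> = 0" using ij by simp
    finally have "(\<Sum>l<m. ?c l *\<^sub>R v l) = 0" .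
    then have "?c i = 0"
      by (rule ind[unfolded family_independent_def, rule_format]) (use ij(1) in simp)
    then show False using ij(4) by simp
  qed
  have "independent (v ` {..<m})"
  proof
    assume "dependent (v ` {..<m})"
    then obtain u where u: "\<exists>y\<in>v ` {..<m}. u y \<noteq> 0" "(\<Sum>y\<in>v ` {..<m}. u y *\<^sub>R y) = 0"
      using dependent_finite[of "v ` {..<m}"] by auto
    then have "(\<Sum>i<m. u (v i) *\<^sub>R v i) = 0" by (simp add: sum.reindex[OF inj])
    then have "\<forall>i<m. u (v i) = 0"
      using ind[unfolded family_independent_def, rule_format, of "\<lambda>i. u (v i)"] by blast
    then show False using u(1) by auto
  qed
  then have "card (v ` {..<m}) \<le> card (w ` {..<k})"
    using independent_span_bound[of "w ` {..<k}" "v ` {..<m}"] span by auto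
  then show ?thesis
    using card_image[OF inj] card_image_le[of "{..<k}" w] by simp
qed

text \<open>The connection is a parameter because \<open>para_kaehler\<close> provides it through an
  existential. It is controlled on sections of A only, so every later use keeps track of membership
  in \<open>sections M A\<close>.\<close>

locale para_kaehler_connection = manifold M for M :: "('m, 'e::real_inner) mfd" +
  fixes A :: "('m, 'w::real_vector) vbundle" and \<rho> br g K D
  assumes lie: "lie_algebroid M A \<rho> br" and metric: "pseudo_metric M A g"
    and K_map: "bundle_map M A A K"
    and K_square: "\<And>x u. x \<in> pts M \<Longrightarrow> u \<in> fib A x \<Longrightarrow> K x (K x u) = u"
    and K_skew: "\<And>x u v. x \<in> pts M \<Longrightarrow> u \<in> fib A x \<Longrightarrow> v \<in> fib A x \<Longrightarrow> g x (K x u) v = - g x u (K x v)"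
    and levi_civita_D: "levi_civita M A \<rho> br g D"
    and parallel: "\<And>a b. a \<in> sections M A \<Longrightarrow> b \<in> sections M A \<Longrightarrow>
      D a (on_sections M K b) = on_sections M K (D a b)"
begin

lemma anchored_A: "anchored_bundle M A \<rho>"
  using lie unfolding lie_algebroid_def by (rule conjunct1)

lemma bundle_A: "vector_bundle M A"
  using anchoredD(1)[OF anchored_A] .

lemma prebundle_A: "prebundle A"
  using prebundle_vb[OF bundle_A] .

lemma connection_D: "right_anchored_product M A \<rho> D"
  using levi_civita_D unfolding levi_civita_def by (rule conjunct1)

lemma metric_compatible: "metric_product A \<rho> D g"
  using levi_civita_D unfolding levi_civita_def metric_product_def by simp

lemma torsion_free: "a \<in> sections M A \<Longrightarrow> b \<in> sections M A \<Longrightarrow> bracket_of D a b = br a b"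
  using levi_civita_D unfolding levi_civita_def by simp

section \<open>The eigenspaces of K in a fibre and their pairing\<close>

definition fib_plus :: "'m \<Rightarrow> 'w set" where "fib_plus x = {u \<in> fib A x. K x u = u}"
definition fib_minus :: "'m \<Rightarrow> 'w set" where "fib_minus x = {u \<in> fib A x. K x u = - u}"
definition proj_plus :: "'m \<Rightarrow> 'w \<Rightarrow> 'w" where "proj_plus x u = (1 / 2) *\<^sub>R (u + K x u)"
definition proj_minus :: "'m \<Rightarrow> 'w \<Rightarrow> 'w" where "proj_minus x u = (1 / 2) *\<^sub>R (u - K x u)"

definition sec_plus :: "('m \<Rightarrow> 'w) set"
  where "sec_plus = {s \<in> sections M A. \<forall>x\<in>pts M. s x \<in> fib_plus x}"
definition sec_minus :: "('m \<Rightarrow> 'w) set"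
  where "sec_minus = {s \<in> sections M A. \<forall>x\<in>pts M. s x \<in> fib_minus x}"

context
  fixes x assumes x: "x \<in> pts M"
begin

lemma K_in: "u \<in> fib A x \<Longrightarrow> K x u \<in> fib A x"
  using bundle_mapD(2)[OF K_map x] .

lemma K_lin: "lin_on (fib A x) (K x)"
  using bundle_mapD(1)[OF K_map x] .

lemma fib_subspace: "subspace (fib A x)"
  using vbD(1)[OF bundle_A x] .

lemma proj_plus_in: assumes "u \<in> fib A x" shows "proj_plus x u \<in> fib_plus x"
  unfolding fib_plus_def proj_plus_def
  using lin_on_scale[OF K_lin subspace_add[OF fib_subspace assms K_in[OF assms]]]
    lin_on_add[OF K_lin assms K_in[OF assms]] K_square[OF x assms]
  by (simp add: subspace_scale[OF fib_subspace] subspace_add[OF fib_subspace] assms K_in add.commute)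

lemma proj_minus_in: assumes "u \<in> fib A x" shows "proj_minus x u \<in> fib_minus x"
  unfolding fib_minus_def proj_minus_def
  using lin_on_scale[OF K_lin subspace_diff[OF fib_subspace assms K_in[OF assms]]]
    lin_on_diff[OF K_lin fib_subspace assms K_in[OF assms]] K_square[OF x assms]
  by (simp add: subspace_scale[OF fib_subspace] subspace_diff[OF fib_subspace] assms K_in flip: scaleR_minus_right)

lemma proj_sum: "proj_plus x u + proj_minus x u = u"
  by (simp add: proj_plus_def proj_minus_def flip: scaleR_add_right)

lemma fib_plusD: "u \<in> fib_plus x \<Longrightarrow> u \<in> fib A x" and fib_minusD: "u \<in> fib_minus x \<Longrightarrow> u \<in> fib A x"
  by (simp_all add: fib_plus_def fib_minus_def)

lemma subspace_fib_plus: "subspace (fib_plus x)"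
  unfolding fib_plus_def
  by (rule subspaceI)
    (auto simp: subspace_0[OF fib_subspace] lin_on_zero[OF K_lin fib_subspace] subspace_add[OF fib_subspace]
      lin_on_add[OF K_lin] lin_on_scale[OF K_lin] subspace_scale[OF fib_subspace])

lemma subspace_fib_minus: "subspace (fib_minus x)"
  unfolding fib_minus_def
  by (rule subspaceI)
    (auto simp: subspace_0[OF fib_subspace] lin_on_zero[OF K_lin fib_subspace] subspace_add[OF fib_subspace]
      lin_on_add[OF K_lin] lin_on_scale[OF K_lin] subspace_scale[OF fib_subspace])

lemma metric_lin:
  assumes "w \<in> fib A x"
  shows g_add_left: "u \<in> fib A x \<Longrightarrow> v \<in> fib A x \<Longrightarrow> g x (u + v) w = g x u w + g x v w"
    and g_diff_left: "u \<in> fib A x \<Longrightarrow> v \<in> fib A x \<Longrightarrow> g x (u - v) w = g x u w - g x v w"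
    and g_add_right: "u \<in> fib A x \<Longrightarrow> v \<in> fib A x \<Longrightarrow> g x w (u + v) = g x w u + g x w v"
    and g_diff_right: "u \<in> fib A x \<Longrightarrow> v \<in> fib A x \<Longrightarrow> g x w (u - v) = g x w u - g x w v"
    and g_scale_left: "u \<in> fib A x \<Longrightarrow> g x (c *\<^sub>R u) w = c * g x u w"
    and g_scale_right: "u \<in> fib A x \<Longrightarrow> g x w (c *\<^sub>R u) = c * g x w u"
    and g_sum_left: "(\<And>i. i \<in> I \<Longrightarrow> f i \<in> fib A x) \<Longrightarrow> g x (\<Sum>i\<in>I. k i *\<^sub>R f i) w = (\<Sum>i\<in>I. k i * g x (f i) w)"
    and g_sum_right: "(\<And>i. i \<in> I \<Longrightarrow> f i \<in> fib A x) \<Longrightarrow> g x w (\<Sum>i\<in>I. k i *\<^sub>R f i) = (\<Sum>i\<in>I. k i * g x w (f i))"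
    and g_zero_left: "g x 0 w = 0" and g_zero_right: "g x w 0 = 0"
  using lin_on_add[OF metric_lin_left[OF metric bundle_A x assms]] lin_on_add[OF pseudo_metricD(1)[OF metric x assms]]
    lin_on_diff[OF metric_lin_left[OF metric bundle_A x assms] fib_subspace]
    lin_on_diff[OF pseudo_metricD(1)[OF metric x assms] fib_subspace]
    lin_on_scale[OF metric_lin_left[OF metric bundle_A x assms]] lin_on_scale[OF pseudo_metricD(1)[OF metric x assms]]
    lin_on_sum[OF metric_lin_left[OF metric bundle_A x assms] fib_subspace, of I f k]
    lin_on_sum[OF pseudo_metricD(1)[OF metric x assms] fib_subspace, of I f k]
    lin_on_zero[OF metric_lin_left[OF metric bundle_A x assms] fib_subspace]
    lin_on_zero[OF pseudo_metricD(1)[OF metric x assms] fib_subspace]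
  by simp_all

lemma g_sym: "u \<in> fib A x \<Longrightarrow> v \<in> fib A x \<Longrightarrow> g x u v = g x v u"
  by (rule pseudo_metricD(2)[OF metric x])

text \<open>g(u, v) = g(K u, v) = - g(u, K v) = - g(u, v).\<close>

lemma isotropic_plus: assumes "u \<in> fib_plus x" "v \<in> fib_plus x" shows "g x u v = 0"
  using K_skew[OF x, of u v] assms by (simp add: fib_plus_def)

lemma isotropic_minus: assumes "u \<in> fib_minus x" "v \<in> fib_minus x" shows "g x u v = 0"
proof -
  have u: "u \<in> fib A x" and v: "v \<in> fib A x" using assms by (auto simp: fib_minus_def)
  have "g x (- u) v = - g x u (- v)" using K_skew[OF x u v] assms by (simp add: fib_minus_def)
  then show ?thesis using g_scale_left[OF v u, of "-1"] g_scale_right[OF u v, of "-1"] by simp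
qed

text \<open>By isotropy a vector of B pairs with the C-component of any v only, so the nondegeneracy
  of g on the fibre becomes one of the pairing between B and C.\<close>

lemma nondegenerate_plus:
  assumes u: "u \<in> fib_plus x" and z: "\<And>w. w \<in> fib_minus x \<Longrightarrow> g x u w = 0" shows "u = 0"
proof (rule pseudo_metricD(3)[OF metric x fib_plusD[OF u]])
  fix v assume v: "v \<in> fib A x"
  have "g x u v = g x u (proj_plus x v + proj_minus x v)" by (simp only: proj_sum)
  also have "\<dots> = g x u (proj_plus x v) + g x u (proj_minus x v)"
    by (rule g_add_right[OF fib_plusD[OF u] fib_plusD[OF proj_plus_in[OF v]] fib_minusD[OF proj_minus_in[OF v]]])
  finally show "g x u v = 0"
    by (simp add: isotropic_plus[OF u proj_plus_in[OF v]] z[OF proj_minus_in[OF v]])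
qed

lemma nondegenerate_minus:
  assumes u: "u \<in> fib_minus x" and z: "\<And>w. w \<in> fib_plus x \<Longrightarrow> g x w u = 0" shows "u = 0"
proof (rule pseudo_metricD(3)[OF metric x fib_minusD[OF u]])
  fix v assume v: "v \<in> fib A x"
  note f = fib_minusD[OF u]
  have "g x u v = g x u (proj_plus x v + proj_minus x v)" by (simp only: proj_sum)
  also have "\<dots> = g x u (proj_plus x v) + g x u (proj_minus x v)"
    by (rule g_add_right[OF f fib_plusD[OF proj_plus_in[OF v]] fib_minusD[OF proj_minus_in[OF v]]])
  finally show "g x u v = 0"
    using z[OF proj_plus_in[OF v]] g_sym[OF f fib_plusD[OF proj_plus_in[OF v]]]
    by (simp add: isotropic_minus[OF u proj_minus_in[OF v]])
qed

subsection \<open>Biorthogonal systems\<close>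

text \<open>A partial basis of one eigenspace together with dual vectors in the other. Growing both
  families at once computes the two dimensions simultaneously and provides coordinates by
  pairing.\<close>

definition biorthogonal :: "nat \<Rightarrow> (nat \<Rightarrow> 'w) \<Rightarrow> (nat \<Rightarrow> 'w) \<Rightarrow> bool" where
  "biorthogonal k s t \<longleftrightarrow> (\<forall>i<k. s i \<in> fib_plus x \<and> t i \<in> fib_minus x) \<and>
     (\<forall>i<k. \<forall>j<k. g x (s i) (t j) = (if i = j then 1 else 0))"

lemma biorthogonalD:
  assumes "biorthogonal k s t" "i < k"
  shows "s i \<in> fib_plus x" and "t i \<in> fib_minus x" and "s i \<in> fib A x" and "t i \<in> fib A x"
    and "j < k \<Longrightarrow> g x (s i) (t j) = (if i = j then 1 else 0)"
  using assms unfolding biorthogonal_def fib_plus_def fib_minus_def by auto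

lemma biorthogonal_sum:
  assumes bo: "biorthogonal k s t" and j: "j < k"
  shows "g x (\<Sum>i<k. c i *\<^sub>R s i) (t j) = c j" and "g x (s j) (\<Sum>i<k. c i *\<^sub>R t i) = c j"
proof -
  have "g x (\<Sum>i<k. c i *\<^sub>R s i) (t j) = (\<Sum>i<k. c i * g x (s i) (t j))"
    by (rule g_sum_left[OF biorthogonalD(4)[OF bo j]]) (use biorthogonalD(3)[OF bo] in auto)
  also have "\<dots> = (\<Sum>i<k. if i = j then c j else 0)"
    by (rule sum.cong) (use biorthogonalD(5)[OF bo _ j] in auto)
  finally show "g x (\<Sum>i<k. c i *\<^sub>R s i) (t j) = c j" using j by simp
  have "g x (s j) (\<Sum>i<k. c i *\<^sub>R t i) = (\<Sum>i<k. c i * g x (s j) (t i))"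
    by (rule g_sum_right[OF biorthogonalD(3)[OF bo j]]) (use biorthogonalD(4)[OF bo] in auto)
  also have "\<dots> = (\<Sum>i<k. if i = j then c j else 0)"
    by (rule sum.cong) (use biorthogonalD(5)[OF bo j] in auto)
  finally show "g x (s j) (\<Sum>i<k. c i *\<^sub>R t i) = c j" using j by simp
qed

lemma biorthogonal_sum_in:
  assumes bo: "biorthogonal k s t"
  shows "(\<Sum>i<k. c i *\<^sub>R s i) \<in> fib_plus x" and "(\<Sum>i<k. c i *\<^sub>R t i) \<in> fib_minus x"
  by (intro subspace_sum subspace_scale subspace_fib_plus subspace_fib_minus;
      use biorthogonalD(1,2)[OF bo] in auto)+

lemma frames_span:
  "\<exists>f. (\<forall>j<vrank A. f j \<in> fib A x) \<and> fib A x \<subseteq> span (f ` {..<vrank A}) \<and>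
    family_independent f (vrank A)"
proof -
  obtain U \<phi> where U: "(U, \<phi>) \<in> trivs A" "x \<in> U" using vbD(2)[OF bundle_A x] by blast
  let ?f = "\<lambda>j. frame A \<phi> j x"
  have "fib A x \<subseteq> span (?f ` {..<vrank A})"
  proof
    fix v assume v: "v \<in> fib A x"
    have "(\<Sum>j<vrank A. \<phi> x v j *\<^sub>R ?f j) \<in> span (?f ` {..<vrank A})"
      by (intro span_sum span_scale span_base) auto
    then show "v \<in> span (?f ` {..<vrank A})" by (simp only: triv_expand[OF bundle_A U v])
  qed
  moreover have "family_independent ?f (vrank A)"
    unfolding family_independent_def
  proof (intro allI impI)
    fix c i assume z: "(\<Sum>j<vrank A. c j *\<^sub>R ?f j) = 0" and i: "i < vrank A"
    let ?c = "\<lambda>j. if j < vrank A then c j else 0"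
    have "(\<Sum>j<vrank A. ?c j *\<^sub>R ?f j) = 0" using z by simp
    then have "(\<Sum>j<vrank A. ?c j *\<^sub>R unit_coord j) = 0"
      using triv_sum_frame[OF bundle_A U, of ?c] lin_on_zero[OF vbD(4)[OF bundle_A U] fib_subspace] by simp
    moreover have "(\<Sum>j<vrank A. ?c j *\<^sub>R unit_coord j) = ?c"
      by (rule coord_expand) (simp add: coord_space_def)
    ultimately have "?c = 0" by simp
    from fun_cong[OF this, of i] show "c i = 0" using i by simp
  qed
  ultimately show ?thesis using frame_in[OF bundle_A U] by (intro exI[of _ ?f]) simp
qed

text \<open>The 2 k vectors are independent: in a linear relation, pairing with \<open>t j\<close>
  isolates the coefficient of \<open>s j\<close> and pairing with \<open>s j\<close> that of
  \<open>t j\<close>, as the remaining terms vanish by isotropy or duality.\<close>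

lemma biorthogonal_bound:
  assumes bo: "biorthogonal k s t" shows "2 * k \<le> vrank A"
proof -
  define e where "e i = (if i < k then s i else t (i - k))" for i
  have split: "(\<Sum>i<2 * k. c i *\<^sub>R e i) = (\<Sum>i<k. c i *\<^sub>R s i) + (\<Sum>i<k. c (i + k) *\<^sub>R t i)" for c
  proof -
    have "(\<Sum>i<2 * k. c i *\<^sub>R e i) = (\<Sum>i<k. c i *\<^sub>R e i) + (\<Sum>i=k..<k + k. c i *\<^sub>R e i)"
      using sum.atLeastLessThan_concat[of 0 k "k + k" "\<lambda>i. c i *\<^sub>R e i"] by (simp add: mult_2 lessThan_atLeast0)
    also have "(\<Sum>i=k..<k + k. c i *\<^sub>R e i) = (\<Sum>i=0..<k. c (i + k) *\<^sub>R e (i + k))"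
      using sum.shift_bounds_nat_ivl[of "\<lambda>i. c i *\<^sub>R e i" 0 k k] by simp
    finally show ?thesis by (simp add: e_def lessThan_atLeast0)
  qed
  have ind: "family_independent e (2 * k)"
    unfolding family_independent_def
  proof (intro allI impI)
    fix c i assume z: "(\<Sum>i<2 * k. c i *\<^sub>R e i) = 0" and i: "i < 2 * k"
    let ?u = "\<Sum>i<k. c i *\<^sub>R s i" and ?w = "\<Sum>i<k. c (i + k) *\<^sub>R t i"
    have uw: "?u + ?w = 0" using z split by simp
    note u = biorthogonal_sum_in(1)[OF bo, of c] and w = biorthogonal_sum_in(2)[OF bo, of "\<lambda>i. c (i + k)"]
    have j1: "c j = 0" if j: "j < k" for j
    proof -
      have "g x (?u + ?w) (t j) = g x ?u (t j) + g x ?w (t j)"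
        by (rule g_add_left[OF biorthogonalD(4)[OF bo j] fib_plusD[OF u] fib_minusD[OF w]])
      then show ?thesis
        using uw biorthogonal_sum(1)[OF bo j, of c] isotropic_minus[OF w biorthogonalD(2)[OF bo j]]
          g_zero_left[OF biorthogonalD(4)[OF bo j]] by simp
    qed
    have j2: "c (j + k) = 0" if j: "j < k" for j
    proof -
      have "g x (s j) (?u + ?w) = g x (s j) ?u + g x (s j) ?w"
        by (rule g_add_right[OF biorthogonalD(3)[OF bo j] fib_plusD[OF u] fib_minusD[OF w]])
      then show ?thesis
        using uw biorthogonal_sum(2)[OF bo j, of "\<lambda>i. c (i + k)"] isotropic_plus[OF biorthogonalD(1)[OF bo j] u]
          g_zero_right[OF biorthogonalD(3)[OF bo j]] by simp
    qed
    show "c i = 0" using j1[of i] j2[of "i - k"] i by (cases "i < k") auto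
  qed
  obtain f where f: "fib A x \<subseteq> span (f ` {..<vrank A})" using frames_span by (elim exE conjE)
  have "e i \<in> fib A x" if "i < 2 * k" for i
    using biorthogonalD(3)[OF bo, of i] biorthogonalD(4)[OF bo, of "i - k"] that by (auto simp: e_def)
  then show ?thesis using f by (intro family_independent_le[OF ind, of f]) auto
qed

text \<open>Two-sided Gram-Schmidt. The part of v not reached by s pairs nontrivially with some w in
  C; removing from w its t-part and rescaling gives the new dual pair.\<close>

lemma biorthogonal_extend:
  assumes bo: "biorthogonal k s t" and v: "v \<in> fib_plus x" and ne: "v \<noteq> (\<Sum>i<k. g x v (t i) *\<^sub>R s i)"
  shows "\<exists>s t. biorthogonal (Suc k) s t"
proof -
  let ?v = "v - (\<Sum>i<k. g x v (t i) *\<^sub>R s i)"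
  have v': "?v \<in> fib_plus x" by (intro subspace_diff subspace_fib_plus v biorthogonal_sum_in(1)[OF bo])
  obtain w where w: "w \<in> fib_minus x" "g x ?v w \<noteq> 0" using nondegenerate_plus[OF v'] ne by auto
  \<comment> \<open>The remainder \<open>?v\<close> is orthogonal to all t i, so the subtraction
    leaves its pairing with w unchanged, and the factor normalises that pairing to 1.\<close>
  define w' where "w' = (1 / g x ?v w) *\<^sub>R (w - (\<Sum>i<k. g x (s i) w *\<^sub>R t i))"
  have d: "w - (\<Sum>i<k. g x (s i) w *\<^sub>R t i) \<in> fib_minus x"
    by (intro subspace_diff subspace_fib_minus w biorthogonal_sum_in(2)[OF bo])
  have w': "w' \<in> fib_minus x" unfolding w'_def by (intro subspace_scale subspace_fib_minus d)
  have vt: "g x ?v (t j) = 0" if j: "j < k" for j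
    using g_diff_left[OF biorthogonalD(4)[OF bo j] fib_plusD[OF v] fib_plusD[OF biorthogonal_sum_in(1)[OF bo]]]
      biorthogonal_sum(1)[OF bo j] by simp
  have sw: "g x (s j) w' = 0" if j: "j < k" for j
    unfolding w'_def g_scale_right[OF biorthogonalD(3)[OF bo j] fib_minusD[OF d]]
    using g_diff_right[OF biorthogonalD(3)[OF bo j] fib_minusD[OF w(1)] fib_minusD[OF biorthogonal_sum_in(2)[OF bo]]]
      biorthogonal_sum(2)[OF bo j] by simp
  have "g x ?v (\<Sum>i<k. g x (s i) w *\<^sub>R t i) = 0"
    using g_sum_right[OF fib_plusD[OF v'], of "{..<k}" t] biorthogonalD(4)[OF bo] vt by simp
  then have vw: "g x ?v w' = 1"
    unfolding w'_def g_scale_right[OF fib_plusD[OF v'] fib_minusD[OF d]]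
      g_diff_right[OF fib_plusD[OF v'] fib_minusD[OF w(1)] fib_minusD[OF biorthogonal_sum_in(2)[OF bo]]]
    using w(2) by simp
  have "biorthogonal (Suc k) (s(k := ?v)) (t(k := w'))"
    unfolding biorthogonal_def
    using v' w' vt sw vw biorthogonalD[OF bo] by (auto simp: less_Suc_eq)
  then show ?thesis by blast
qed

text \<open>What remains of w pairs to zero with every \<open>s i\<close>, hence with all of B if s
  spans it, and so it is 0 by nondegeneracy. Completeness passes from s to t.\<close>

lemma biorthogonal_expand_minus:
  assumes bo: "biorthogonal k s t" and w: "w \<in> fib_minus x"
    and ex: "\<And>v. v \<in> fib_plus x \<Longrightarrow> v = (\<Sum>i<k. g x v (t i) *\<^sub>R s i)"
  shows "w = (\<Sum>i<k. g x (s i) w *\<^sub>R t i)"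
proof -
  let ?w = "w - (\<Sum>i<k. g x (s i) w *\<^sub>R t i)"
  have w': "?w \<in> fib_minus x" by (intro subspace_diff subspace_fib_minus w biorthogonal_sum_in(2)[OF bo])
  have sw: "g x (s j) ?w = 0" if j: "j < k" for j
    using g_diff_right[OF biorthogonalD(3)[OF bo j] fib_minusD[OF w] fib_minusD[OF biorthogonal_sum_in(2)[OF bo]]]
      biorthogonal_sum(2)[OF bo j] by simp
  have "?w = 0"
  proof (rule nondegenerate_minus[OF w'])
    fix v assume v: "v \<in> fib_plus x"
    have "g x v ?w = g x (\<Sum>i<k. g x v (t i) *\<^sub>R s i) ?w" using arg_cong[OF ex[OF v], of "\<lambda>v. g x v ?w"] .
    also have "\<dots> = (\<Sum>i<k. g x v (t i) * g x (s i) ?w)"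
      by (rule g_sum_left[OF fib_minusD[OF w']]) (use biorthogonalD(3)[OF bo] in auto)
    finally show "g x v ?w = 0" using sw by simp
  qed
  then show ?thesis by simp
qed

text \<open>A system of maximal length exists by \<open>biorthogonal_bound\<close>. It cannot be
  extended, so its s span B and its t span C at x; then 2 k vectors span the fibre and k is half its
  rank. The value depends on the rank of A alone, so the eigenspaces have the same dimension over
  all components of M.\<close>

lemma biorthogonal_half_rank: "\<exists>k s t. biorthogonal k s t \<and> 2 * k = vrank A"
proof -
  have "biorthogonal 0 (\<lambda>_. 0) (\<lambda>_. 0)" by (simp add: biorthogonal_def)
  then have P0: "\<exists>s t. biorthogonal 0 s t" by blast
  have bnd: "\<forall>k. (\<exists>s t. biorthogonal k s t) \<longrightarrow> k \<le> vrank A" using biorthogonal_bound by fastforce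
  obtain k where k: "\<exists>s t. biorthogonal k s t" and mx: "\<forall>l. (\<exists>s t. biorthogonal l s t) \<longrightarrow> l \<le> k"
    using Nat.ex_has_greatest_nat[of "\<lambda>k. \<exists>s t. biorthogonal k s t" 0 "vrank A", OF P0 bnd] by blast
  obtain s t where bo: "biorthogonal k s t" using k by blast
  have nS: "\<not> (\<exists>s t. biorthogonal (Suc k) s t)"
  proof
    assume "\<exists>s t. biorthogonal (Suc k) s t"
    from spec[OF mx, THEN mp, OF this] show False by simp
  qed
  have ex: "v = (\<Sum>i<k. g x v (t i) *\<^sub>R s i)" if v: "v \<in> fib_plus x" for v
    by (rule ccontr) (erule notE[OF nS biorthogonal_extend[OF bo v]])
  define e where "e i = (if i < k then s i else t (i - k))" for i
  have es: "s i \<in> span (e ` {..<2 * k})" "t i \<in> span (e ` {..<2 * k})" if "i < k" for i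
  proof -
    have "e i = s i" "e (i + k) = t i" using that by (auto simp: e_def)
    moreover have "e i \<in> span (e ` {..<2 * k})" "e (i + k) \<in> span (e ` {..<2 * k})"
      by (rule span_base, rule imageI, use that in simp)+
    ultimately show "s i \<in> span (e ` {..<2 * k})" "t i \<in> span (e ` {..<2 * k})" by simp_all
  qed
  have V: "u \<in> span (e ` {..<2 * k})" if u: "u \<in> fib A x" for u
  proof -
    have "(\<Sum>i<k. g x (proj_plus x u) (t i) *\<^sub>R s i) \<in> span (e ` {..<2 * k})"
      by (intro span_sum span_scale es) auto
    then have 1: "proj_plus x u \<in> span (e ` {..<2 * k})" by (simp only: ex[OF proj_plus_in[OF u], symmetric])
    have "(\<Sum>i<k. g x (s i) (proj_minus x u) *\<^sub>R t i) \<in> span (e ` {..<2 * k})"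
      by (intro span_sum span_scale es) auto
    then have 2: "proj_minus x u \<in> span (e ` {..<2 * k})"
      by (simp only: biorthogonal_expand_minus[OF bo proj_minus_in[OF u] ex, symmetric])
    from span_add[OF 1 2] show ?thesis by (simp only: proj_sum)
  qed
  obtain f where f: "\<forall>j<vrank A. f j \<in> fib A x" "family_independent f (vrank A)"
    using frames_span by (elim exE conjE)
  have "vrank A \<le> 2 * k"
    by (rule family_independent_le[OF f(2)], rule V) (use f(1) in simp)
  then show ?thesis using bo biorthogonal_bound[OF bo] by (intro exI[of _ k] exI[of _ s] exI[of _ t]) simp
qed

lemma vrank_even: "2 * (vrank A div 2) = vrank A"
  using biorthogonal_half_rank by (metis dvd_triv_left dvd_mult_div_cancel)

lemma biorthogonal_exists: "\<exists>s t. biorthogonal (vrank A div 2) s t"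
proof -
  obtain k s t where "biorthogonal k s t" "2 * k = vrank A" using biorthogonal_half_rank by (elim exE conjE)
  then have "vrank A div 2 = k" by linarith
  then show ?thesis using \<open>biorthogonal k s t\<close> by blast
qed

text \<open>Any system of half the rank is complete: a vector missed by s would extend it beyond
  \<open>biorthogonal_bound\<close>.\<close>

lemma biorthogonal_expand:
  assumes bo: "biorthogonal (vrank A div 2) s t"
  shows "v \<in> fib_plus x \<Longrightarrow> v = (\<Sum>i<vrank A div 2. g x v (t i) *\<^sub>R s i)"
    and "w \<in> fib_minus x \<Longrightarrow> w = (\<Sum>i<vrank A div 2. g x (s i) w *\<^sub>R t i)"
proof -
  have ex: "v = (\<Sum>i<vrank A div 2. g x v (t i) *\<^sub>R s i)" if v: "v \<in> fib_plus x" for v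
  proof (rule ccontr)
    assume "v \<noteq> (\<Sum>i<vrank A div 2. g x v (t i) *\<^sub>R s i)"
    from biorthogonal_extend[OF bo v this] obtain s' t' where "biorthogonal (Suc (vrank A div 2)) s' t'"
      by (elim exE)
    from biorthogonal_bound[OF this] vrank_even show False by presburger
  qed
  show "v \<in> fib_plus x \<Longrightarrow> v = (\<Sum>i<vrank A div 2. g x v (t i) *\<^sub>R s i)" by (rule ex)
  show "w \<in> fib_minus x \<Longrightarrow> w = (\<Sum>i<vrank A div 2. g x (s i) w *\<^sub>R t i)"
    by (rule biorthogonal_expand_minus[OF bo _ ex])
qed

end

section \<open>Sections with values in the eigenspaces\<close>

lemma smooth_fun_nonzero_open:
  assumes f: "smooth_fun M f" shows "openin (mtop M) {x \<in> pts M. f x \<noteq> 0}"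
proof (subst openin_subopen, intro ballI)
  fix x assume x: "x \<in> {x \<in> pts M. f x \<noteq> 0}"
  then obtain U \<phi> where c: "(U, \<phi>) \<in> atlas M" "x \<in> U" using chart_cover by blast
  have "smooth_on (\<phi> ` (U \<inter> pts M)) (f \<circ> inv_into U \<phi>)"
    using f smooth_fun_onD[OF _ c(1)] unfolding smooth_fun_def by blast
  then have "Ck_on 0 (\<phi> ` U) (f \<circ> inv_into U \<phi>)"
    using chart_subset[OF c(1)] by (simp add: smooth_on_def inf.absorb1 del: Ck_on.simps)
  then have "continuous_on (\<phi> ` U) (f \<circ> inv_into U \<phi>)" by (simp only: Ck_on.simps)
  then have "open (\<phi> ` U \<inter> (f \<circ> inv_into U \<phi>) -` (- {0}))"
    by (rule continuous_open_preimage[OF _ chart_open[OF c(1)]]) auto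
  from chart_open_preimage[OF c(1) this]
  show "\<exists>T. openin (mtop M) T \<and> x \<in> T \<and> T \<subseteq> {x \<in> pts M. f x \<noteq> 0}"
    using c x chart_subset[OF c(1)]
    by (intro exI[of _ "{x \<in> U. \<phi> x \<in> \<phi> ` U \<inter> (f \<circ> inv_into U \<phi>) -` (- {0})}"])
      (auto dest: inj_onD[OF chart_inj[OF c(1)]])
qed

abbreviation proj_plus_section ("P\<^sub>+") where "P\<^sub>+ \<equiv> on_sections M proj_plus"
abbreviation proj_minus_section ("P\<^sub>-") where "P\<^sub>- \<equiv> on_sections M proj_minus"

lemma sec_plusD: "s \<in> sec_plus \<Longrightarrow> s \<in> sections M A" "s \<in> sec_plus \<Longrightarrow> x \<in> pts M \<Longrightarrow> s x \<in> fib_plus x"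
  and sec_minusD: "s \<in> sec_minus \<Longrightarrow> s \<in> sections M A" "s \<in> sec_minus \<Longrightarrow> x \<in> pts M \<Longrightarrow> s x \<in> fib_minus x"
  by (simp_all add: sec_plus_def sec_minus_def)

lemma sec_plusI: "s \<in> sections M A \<Longrightarrow> (\<And>x. x \<in> pts M \<Longrightarrow> s x \<in> fib_plus x) \<Longrightarrow> s \<in> sec_plus"
  and sec_minusI: "s \<in> sections M A \<Longrightarrow> (\<And>x. x \<in> pts M \<Longrightarrow> s x \<in> fib_minus x) \<Longrightarrow> s \<in> sec_minus"
  by (simp_all add: sec_plus_def sec_minus_def)

lemma K_sections: "s \<in> sections M A \<Longrightarrow> on_sections M K s \<in> sections M A"
  by (rule bundle_map_sections[OF bundle_A prebundle_A K_map])

lemma proj_section_eq: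
  assumes s: "s \<in> sections M A"
  shows "P\<^sub>+ s = (1 / 2) *\<^sub>R (s + on_sections M K s)" and "P\<^sub>- s = (1 / 2) *\<^sub>R (s - on_sections M K s)"
proof -
  have "P\<^sub>+ s x = ((1 / 2) *\<^sub>R (s + on_sections M K s)) x \<and> P\<^sub>- s x = ((1 / 2) *\<^sub>R (s - on_sections M K s)) x" for x
    using sectionsD(2)[OF s, of x]
    by (cases "x \<in> pts M") (simp_all add: on_sections_def proj_plus_def proj_minus_def scaleR_fun_def)
  then show "P\<^sub>+ s = (1 / 2) *\<^sub>R (s + on_sections M K s)" "P\<^sub>- s = (1 / 2) *\<^sub>R (s - on_sections M K s)" by auto
qed

lemma proj_plus_sections: assumes s: "s \<in> sections M A" shows "P\<^sub>+ s \<in> sec_plus"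
proof (rule sec_plusI)
  show "P\<^sub>+ s \<in> sections M A"
    unfolding proj_section_eq[OF s] by (intro sections_scaleR sections_add prebundle_A s K_sections)
qed (simp add: proj_plus_in sectionsD(1)[OF s])

lemma proj_minus_sections: assumes s: "s \<in> sections M A" shows "P\<^sub>- s \<in> sec_minus"
proof (rule sec_minusI)
  show "P\<^sub>- s \<in> sections M A"
    unfolding proj_section_eq[OF s] by (intro sections_scaleR sections_diff prebundle_A s K_sections)
qed (simp add: proj_minus_in sectionsD(1)[OF s])

lemma proj_sections_sum:
  assumes s: "s \<in> sections M A" shows "P\<^sub>+ s + P\<^sub>- s = s"
proof
  fix x show "(P\<^sub>+ s + P\<^sub>- s) x = s x"
    using sectionsD(2)[OF s, of x] by (cases "x \<in> pts M") (simp_all add: on_sections_def proj_sum)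
qed

lemma proj_plus_id: "u \<in> fib_plus x \<Longrightarrow> proj_plus x u = u" "u \<in> fib_plus x \<Longrightarrow> proj_minus x u = 0"
  by (simp_all add: fib_plus_def proj_plus_def proj_minus_def flip: scaleR_2)

lemma proj_minus_id: "u \<in> fib_minus x \<Longrightarrow> proj_minus x u = u" "u \<in> fib_minus x \<Longrightarrow> proj_plus x u = 0"
  by (simp_all add: fib_minus_def proj_plus_def proj_minus_def flip: scaleR_2)

lemma proj_section_id:
  "s \<in> sec_plus \<Longrightarrow> P\<^sub>+ s = s" "s \<in> sec_minus \<Longrightarrow> P\<^sub>- s = s"
  by (rule ext, auto simp: on_sections_def proj_plus_id sec_plusD(2) sectionsD(2)[OF sec_plusD(1)],
      rule ext, auto simp: on_sections_def proj_minus_id sec_minusD(2) sectionsD(2)[OF sec_minusD(1)])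

lemma subspace_sec_plus: "subspace sec_plus"
proof (rule subspaceI)
  show "0 \<in> sec_plus" by (auto intro!: sec_plusI sections_zero prebundle_A subspace_0[OF subspace_fib_plus])
  show "s + t \<in> sec_plus" if "s \<in> sec_plus" "t \<in> sec_plus" for s t
    using that by (auto intro!: sec_plusI sections_add prebundle_A subspace_add[OF subspace_fib_plus] dest: sec_plusD)
  show "c *\<^sub>R s \<in> sec_plus" if "s \<in> sec_plus" for c s
    by (rule sec_plusI[OF sections_scaleR[OF prebundle_A sec_plusD(1)[OF that]]])
      (simp add: scaleR_fun_def subspace_scale[OF subspace_fib_plus] sec_plusD(2)[OF that])
qed

lemma subspace_sec_minus: "subspace sec_minus"
proof (rule subspaceI)
  show "0 \<in> sec_minus" by (auto intro!: sec_minusI sections_zero prebundle_A subspace_0[OF subspace_fib_minus])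
  show "s + t \<in> sec_minus" if "s \<in> sec_minus" "t \<in> sec_minus" for s t
    using that by (auto intro!: sec_minusI sections_add prebundle_A subspace_add[OF subspace_fib_minus] dest: sec_minusD)
  show "c *\<^sub>R s \<in> sec_minus" if "s \<in> sec_minus" for c s
    by (rule sec_minusI[OF sections_scaleR[OF prebundle_A sec_minusD(1)[OF that]]])
      (simp add: scaleR_fun_def subspace_scale[OF subspace_fib_minus] sec_minusD(2)[OF that])
qed

lemma sec_plus_fmult: "smooth_fun M f \<Longrightarrow> s \<in> sec_plus \<Longrightarrow> f \<odot> s \<in> sec_plus"
  by (auto intro!: sec_plusI sections_fmult prebundle_A subspace_scale[OF subspace_fib_plus] dest: sec_plusD)

lemma sec_minus_fmult: "smooth_fun M f \<Longrightarrow> s \<in> sec_minus \<Longrightarrow> f \<odot> s \<in> sec_minus"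
  by (auto intro!: sec_minusI sections_fmult prebundle_A subspace_scale[OF subspace_fib_minus] dest: sec_minusD)

lemma section_through_plus:
  assumes x: "x \<in> pts M" and u: "u \<in> fib_plus x" shows "\<exists>s. s \<in> sec_plus \<and> s x = u"
proof -
  obtain s where s: "s \<in> sections M A" "s x = u" using section_through[OF bundle_A x fib_plusD[OF x u]] by (elim bexE)
  then show ?thesis using proj_plus_sections[OF s(1)] x proj_plus_id(1)[OF u] by (intro exI[of _ "P\<^sub>+ s"]) simp
qed

lemma section_through_minus:
  assumes x: "x \<in> pts M" and u: "u \<in> fib_minus x" shows "\<exists>s. s \<in> sec_minus \<and> s x = u"
proof -
  obtain s where s: "s \<in> sections M A" "s x = u" using section_through[OF bundle_A x fib_minusD[OF x u]] by (elim bexE)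
  then show ?thesis using proj_minus_sections[OF s(1)] x proj_minus_id(1)[OF u] by (intro exI[of _ "P\<^sub>- s"]) simp
qed

lemma g_smooth: "a \<in> sections M A \<Longrightarrow> b \<in> sections M A \<Longrightarrow> smooth_fun M (\<lambda>x. g x (a x) (b x))"
  by (rule metric_smooth[OF metric bundle_A])

subsection \<open>Adapted local frames\<close>

text \<open>Biorthogonalisation extends a biorthogonal system at a point to sections that stay biorthogonal
  nearby; the only division is by a function with value \<open>1\<close> at the point.\<close>

lemma biorthogonal_sections_near:
  assumes x0: "x0 \<in> pts M" and bo: "biorthogonal x0 k u w"
  shows "\<exists>s t N. (\<forall>i<k. s i \<in> sec_plus \<and> t i \<in> sec_minus \<and> s i x0 = u i \<and> t i x0 = w i) \<and>
    openin (mtop M) N \<and> x0 \<in> N \<and> (\<forall>x\<in>N. biorthogonal x k (\<lambda>i. s i x) (\<lambda>i. t i x))"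
  using bo
proof (induction k)
  case 0
  have "\<forall>x\<in>pts M. biorthogonal x 0 (\<lambda>i. 0) (\<lambda>i. 0)" by (simp add: biorthogonal_def)
  then show ?case using x0 by (intro exI[of _ "\<lambda>_ _. 0"] exI[of _ "pts M"]) auto
next
  case (Suc k)
  note bS = biorthogonalD[OF x0 Suc.prems]
  have bk: "biorthogonal x0 k u w" using Suc.prems x0 by (auto simp: biorthogonal_def)
  from Suc.IH[OF bk] obtain s t N where
    st0: "\<forall>i<k. s i \<in> sec_plus \<and> t i \<in> sec_minus \<and> s i x0 = u i \<and> t i x0 = w i"
    and N: "openin (mtop M) N" "x0 \<in> N" and bN: "\<forall>x\<in>N. biorthogonal x k (\<lambda>i. s i x) (\<lambda>i. t i x)"
    by (elim exE conjE)
  have s: "s i \<in> sec_plus" and t: "t i \<in> sec_minus" and s0: "s i x0 = u i" and t0: "t i x0 = w i" if "i < k" for i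
    using st0 that by auto
  obtain a where a: "a \<in> sec_plus" "a x0 = u k" using section_through_plus[OF x0 bS(1)[of k]] by auto
  obtain b where b: "b \<in> sec_minus" "b x0 = w k" using section_through_minus[OF x0 bS(2)[of k]] by auto
  \<comment> \<open>Away from \<open>x0\<close> the section \<open>a\<close> need not be orthogonal
    to the earlier t i. The correction vanishes at \<open>x0\<close>, where \<open>a\<close> has the
    value \<open>u k\<close>, so the prescribed value is kept.\<close>
  define a' where "a' = a - (\<Sum>i<k. (\<lambda>x. g x (a x) (t i x)) \<odot> s i)"
  define b' where "b' = b - (\<Sum>i<k. (\<lambda>x. g x (s i x) (b x)) \<odot> t i)"
  have a': "a' \<in> sec_plus"
    unfolding a'_def
    by (intro subspace_diff subspace_sum subspace_sec_plus sec_plus_fmult g_smooth sec_plusD(1) sec_minusD(1))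
      (use a s t in auto)
  have b': "b' \<in> sec_minus"
    unfolding b'_def
    by (intro subspace_diff subspace_sum subspace_sec_minus sec_minus_fmult g_smooth sec_plusD(1) sec_minusD(1))
      (use b s t in auto)
  have a'x: "a' x = a x - (\<Sum>i<k. g x (a x) (t i x) *\<^sub>R s i x)" for x by (simp add: a'_def sum_fun_apply)
  have b'x: "b' x = b x - (\<Sum>i<k. g x (s i x) (b x) *\<^sub>R t i x)" for x by (simp add: b'_def sum_fun_apply)
  have "(\<Sum>i<k. g x0 (a x0) (t i x0) *\<^sub>R s i x0) = 0"
    by (rule sum.neutral) (use bS(5)[of k] a(2) t0 in auto)
  then have a0: "a' x0 = u k" using a(2) by (simp add: a'x)
  have "(\<Sum>i<k. g x0 (s i x0) (b x0) *\<^sub>R t i x0) = 0"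
    by (rule sum.neutral) (use bS(5)[of _ k] b(2) s0 in auto)
  then have b0: "b' x0 = w k" using b(2) by (simp add: b'x)
  define f where "f x = g x (a' x) (b' x)" for x
  have f: "smooth_fun M f" unfolding f_def by (rule g_smooth[OF sec_plusD(1)[OF a'] sec_minusD(1)[OF b']])
  have f0: "f x0 = 1" using bS(5)[of k k] by (simp add: f_def a0 b0)
  let ?N1 = "{x \<in> pts M. f x \<noteq> 0}"
  have N1: "openin (mtop M) ?N1" "x0 \<in> ?N1" using smooth_fun_nonzero_open[OF f] x0 f0 by auto
  have "smooth_fun_on M ?N1 (\<lambda>x. inverse (f x))"
    by (rule smooth_fun_on_inverse[OF N1(1) smooth_fun_imp_on[OF f]]) auto
  \<comment> \<open>The reciprocal of f is smooth only where f is nonzero. Rescaling a global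
    section takes a global function that coincides with it near \<open>x0\<close>.\<close>
  from smooth_fun_extend[OF N1 this] obtain h N2 where h: "smooth_fun M h"
    and N2: "openin (mtop M) N2" "x0 \<in> N2" "N2 \<subseteq> ?N1" and hN: "\<And>x. x \<in> N2 \<Longrightarrow> h x = inverse (f x)" by blast
  have hb: "h \<odot> b' \<in> sec_minus" by (rule sec_minus_fmult[OF h b'])
  have h0: "(h \<odot> b') x0 = w k" using hN[OF N2(2)] f0 b0 by simp
  have new: "biorthogonal x (Suc k) (\<lambda>i. (s(k := a')) i x) (\<lambda>i. (t(k := h \<odot> b')) i x)" if xN: "x \<in> N \<inter> N2" for x
  proof -
    have x: "x \<in> pts M" using xN openin_subset[OF N(1)] by auto
    have bx: "biorthogonal x k (\<lambda>i. s i x) (\<lambda>i. t i x)" using bN xN by simp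
    note bD = biorthogonalD[OF x bx]
    have ax: "a x \<in> fib_plus x" and bbx: "b x \<in> fib_minus x" using sec_plusD(2)[OF a(1) x] sec_minusD(2)[OF b(1) x] .
    have a'p: "a' x \<in> fib_plus x" and b'm: "b' x \<in> fib_minus x" using sec_plusD(2)[OF a' x] sec_minusD(2)[OF b' x] .
    have at: "g x (a' x) (t j x) = 0" if j: "j < k" for j
      unfolding a'x
      using g_diff_left[OF x bD(4)[OF j] fib_plusD[OF x ax] fib_plusD[OF x biorthogonal_sum_in(1)[OF x bx]]]
        biorthogonal_sum(1)[OF x bx j] by simp
    have sb: "g x (s j x) (b' x) = 0" if j: "j < k" for j
      unfolding b'x
      using g_diff_right[OF x bD(3)[OF j] fib_minusD[OF x bbx] fib_minusD[OF x biorthogonal_sum_in(2)[OF x bx]]]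
        biorthogonal_sum(2)[OF x bx j] by simp
    have sh: "g x (s j x) (h x *\<^sub>R b' x) = 0" if j: "j < k" for j
      using g_scale_right[OF x bD(3)[OF j] fib_minusD[OF x b'm], of "h x"] sb[OF j] by simp
    have "f x \<noteq> 0" using xN N2(3) by auto
    then have ah: "g x (a' x) (h x *\<^sub>R b' x) = 1"
      using g_scale_right[OF x fib_plusD[OF x a'p] fib_minusD[OF x b'm], of "h x"] hN xN by (simp add: f_def)
    show ?thesis
      unfolding biorthogonal_def[OF x]
      using a'p subspace_scale[OF subspace_fib_minus[OF x] b'm] at sh ah bD by (auto simp: less_Suc_eq)
  qed
  have op: "openin (mtop M) (N \<inter> N2)" "x0 \<in> N \<inter> N2" using N N2 by auto
  show ?case
  proof (intro exI conjI)
    show "\<forall>i<Suc k. (s(k := a')) i \<in> sec_plus \<and> (t(k := h \<odot> b')) i \<in> sec_minus \<and>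
        (s(k := a')) i x0 = u i \<and> (t(k := h \<odot> b')) i x0 = w i"
      using s t s0 t0 a' hb a0 h0 by (simp add: less_Suc_eq del: fmult_apply)
    show "\<forall>x\<in>N \<inter> N2. biorthogonal x (Suc k) (\<lambda>i. (s(k := a')) i x) (\<lambda>i. (t(k := h \<odot> b')) i x)"
      by (rule ballI) (rule new)
  qed (rule op)+
qed

text \<open>At any point of M this is exactly half the rank, by \<open>vrank_even\<close>. Over an
  empty M the rank of A may be odd and the quotient is rounded down.\<close>

definition half_rank :: nat where "half_rank = vrank A div 2"

text \<open>The sections are global and only their duality is confined to \<open>U\<close>, so the
  coordinates obtained by pairing with them are restrictions of globally smooth functions.\<close>

definition adapted :: "'m set \<Rightarrow> (nat \<Rightarrow> 'm \<Rightarrow> 'w) \<Rightarrow> (nat \<Rightarrow> 'm \<Rightarrow> 'w) \<Rightarrow> bool" where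
  "adapted U s t \<longleftrightarrow> openin (mtop M) U \<and> (\<forall>i<half_rank. s i \<in> sec_plus \<and> t i \<in> sec_minus) \<and>
     (\<forall>x\<in>U. biorthogonal x half_rank (\<lambda>i. s i x) (\<lambda>i. t i x))"

lemma adaptedD:
  assumes "adapted U s t"
  shows "openin (mtop M) U" and "i < half_rank \<Longrightarrow> s i \<in> sec_plus" and "i < half_rank \<Longrightarrow> t i \<in> sec_minus"
    and "x \<in> U \<Longrightarrow> biorthogonal x half_rank (\<lambda>i. s i x) (\<lambda>i. t i x)" and "x \<in> U \<Longrightarrow> x \<in> pts M"
  using assms openin_subset[of "mtop M" U] unfolding adapted_def by auto

lemma adapted_near: assumes x: "x \<in> pts M" shows "\<exists>U s t. adapted U s t \<and> x \<in> U"
proof -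
  obtain u w where "biorthogonal x half_rank u w"
    using biorthogonal_exists[OF x] unfolding half_rank_def by (elim exE)
  from biorthogonal_sections_near[OF x this] obtain s t N where
    "\<forall>i<half_rank. s i \<in> sec_plus \<and> t i \<in> sec_minus \<and> s i x = u i \<and> t i x = w i"
    "openin (mtop M) N" "x \<in> N" "\<forall>x\<in>N. biorthogonal x half_rank (\<lambda>i. s i x) (\<lambda>i. t i x)"
    by (elim exE conjE)
  then show ?thesis by (intro exI[of _ N] exI[of _ s] exI[of _ t]) (simp add: adapted_def)
qed

text \<open>An adapted frame \<open>(s, t)\<close> trivialises the bundle of the \<open>1\<close>-eigenspaces of \<open>K\<close> by pairing
  with \<open>t\<close>. The transition functions \<open>g (s j) (t' i)\<close> are then restrictions of global smooth functions,
  and no matrix has to be inverted.\<close>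

definition plus_triv :: "(nat \<Rightarrow> 'm \<Rightarrow> 'w) \<Rightarrow> 'm \<Rightarrow> 'w \<Rightarrow> nat \<Rightarrow> real"
  where "plus_triv t x v i = (if i < half_rank then g x v (t i x) else 0)"

definition plus_bundle :: "('m, 'w) vbundle" where
  "plus_bundle = \<lparr> vrank = half_rank, fib = fib_plus, trivs = {(U, plus_triv t) | U s t. adapted U s t} \<rparr>"

lemma plus_bundle_simps [simp]: "vrank plus_bundle = half_rank" "fib plus_bundle = fib_plus"
  by (simp_all add: plus_bundle_def)

lemma plus_trivsE:
  assumes "(U, \<phi>) \<in> trivs plus_bundle"
  obtains s t where "adapted U s t" "\<phi> = plus_triv t"
  using assms unfolding plus_bundle_def by auto

lemma plus_trivsI: "adapted U s t \<Longrightarrow> (U, plus_triv t) \<in> trivs plus_bundle"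
  unfolding plus_bundle_def by auto

context
  fixes U s t x assumes ad: "adapted U s t" and xU: "x \<in> U"
begin

private lemma x: "x \<in> pts M" using adaptedD(5)[OF ad xU] .
private lemma bo: "biorthogonal x half_rank (\<lambda>i. s i x) (\<lambda>i. t i x)" using adaptedD(4)[OF ad xU] .

lemma plus_expand: "v \<in> fib_plus x \<Longrightarrow> v = (\<Sum>i<half_rank. g x v (t i x) *\<^sub>R s i x)"
  using biorthogonal_expand(1)[OF x] bo unfolding half_rank_def by blast

lemma plus_triv_lin: "lin_on (fib_plus x) (plus_triv t x)"
proof (rule lin_onI)
  fix u v assume uv: "u \<in> fib_plus x" "v \<in> fib_plus x"
  show "plus_triv t x (u + v) = plus_triv t x u + plus_triv t x v"
    using g_add_left[OF x biorthogonalD(4)[OF x bo] fib_plusD[OF x uv(1)] fib_plusD[OF x uv(2)]]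
    by (auto simp: plus_triv_def fun_eq_iff)
next
  fix c u assume u: "u \<in> fib_plus x"
  show "plus_triv t x (c *\<^sub>R u) = c *\<^sub>R plus_triv t x u"
    using g_scale_left[OF x biorthogonalD(4)[OF x bo] fib_plusD[OF x u]]
    by (auto simp: plus_triv_def fun_eq_iff scaleR_fun_def)
qed

lemma plus_triv_bij: "bij_betw (plus_triv t x) (fib_plus x) (coord_space half_rank)"
proof (rule bij_betwI')
  fix u v assume u: "u \<in> fib_plus x" and v: "v \<in> fib_plus x"
  show "(plus_triv t x u = plus_triv t x v) = (u = v)"
  proof
    assume eq: "plus_triv t x u = plus_triv t x v"
    have "g x u (t i x) = g x v (t i x)" if "i < half_rank" for i
      using fun_cong[OF eq, of i] that by (simp add: plus_triv_def)
    then have "(\<Sum>i<half_rank. g x u (t i x) *\<^sub>R s i x) = (\<Sum>i<half_rank. g x v (t i x) *\<^sub>R s i x)"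
      by simp
    then show "u = v" by (simp only: plus_expand[OF u, symmetric] plus_expand[OF v, symmetric])
  next
    assume "u = v" then show "plus_triv t x u = plus_triv t x v" by (rule arg_cong)
  qed
next
  fix u show "plus_triv t x u \<in> coord_space half_rank" by (simp add: plus_triv_def coord_space_def)
next
  fix c assume c: "c \<in> coord_space half_rank"
  let ?v = "\<Sum>i<half_rank. c i *\<^sub>R s i x"
  have "plus_triv t x ?v = c"
  proof
    fix i show "plus_triv t x ?v i = c i"
      using biorthogonal_sum(1)[OF x bo, of i c] c by (cases "i < half_rank") (auto simp: plus_triv_def coord_space_def)
  qed
  then show "\<exists>v\<in>fib_plus x. c = plus_triv t x v"
    by (intro bexI[of _ ?v]) (simp_all add: biorthogonal_sum_in(1)[OF x bo])
qed

lemma plus_frame: "j < half_rank \<Longrightarrow> frame plus_bundle (plus_triv t) j x = s j x"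
  unfolding frame_def
proof (rule inv_into_f_eq)
  assume j: "j < half_rank"
  show "inj_on (plus_triv t x) (fib plus_bundle x)" using plus_triv_bij by (simp add: bij_betw_def)
  show "s j x \<in> fib plus_bundle x" using biorthogonalD(1)[OF x bo j] by simp
  show "plus_triv t x (s j x) = unit_coord j"
    using biorthogonalD(5)[OF x bo j] j by (auto simp: plus_triv_def unit_coord_def fun_eq_iff)
qed

end

lemma vector_bundle_plus: "vector_bundle M plus_bundle"
proof -
  have 1: "\<forall>x\<in>pts M. subspace (fib plus_bundle x)" using subspace_fib_plus by simp
  have 2: "(\<Union>(U, \<phi>)\<in>trivs plus_bundle. U) = pts M"
  proof (intro equalityI subsetI)
    fix x assume "x \<in> (\<Union>(U, \<phi>)\<in>trivs plus_bundle. U)"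
    then obtain U \<phi> where U: "(U, \<phi>) \<in> trivs plus_bundle" "x \<in> U" by auto
    obtain s t where "adapted U s t" "\<phi> = plus_triv t" using plus_trivsE[OF U(1)] .
    then show "x \<in> pts M" using adaptedD(5) U(2) by simp
  next
    fix x assume x: "x \<in> pts M"
    obtain U s t where "adapted U s t" "x \<in> U" using adapted_near[OF x] by (elim exE conjE)
    then show "x \<in> (\<Union>(U, \<phi>)\<in>trivs plus_bundle. U)" using plus_trivsI by (intro UN_I[of "(U, plus_triv t)"]) auto
  qed
  have 3: "openin (mtop M) U \<and> (\<forall>x\<in>U. lin_on (fib plus_bundle x) (\<phi> x) \<and>
      bij_betw (\<phi> x) (fib plus_bundle x) (coord_space (vrank plus_bundle)))"
    if "(U, \<phi>) \<in> trivs plus_bundle" for U \<phi>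
  proof -
    obtain s t where ad: "adapted U s t" and "\<phi> = plus_triv t"
      using plus_trivsE[OF \<open>(U, \<phi>) \<in> trivs plus_bundle\<close>] .
    then show ?thesis using adaptedD(1)[OF ad] plus_triv_lin[OF ad] plus_triv_bij[OF ad] by simp
  qed
  have 4: "smooth_fun_on M (U \<inter> V) (\<lambda>x. \<psi> x (frame plus_bundle \<phi> j x) i)"
    if U: "(U, \<phi>) \<in> trivs plus_bundle" and V: "(V, \<psi>) \<in> trivs plus_bundle"
      and ij: "i < half_rank" "j < half_rank" for U \<phi> V \<psi> i j
  proof -
    obtain s t where ad: "adapted U s t" and \<phi>: "\<phi> = plus_triv t" using plus_trivsE[OF U] .
    obtain s' t' where ad': "adapted V s' t'" and \<psi>: "\<psi> = plus_triv t'" using plus_trivsE[OF V] .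
    have op: "openin (mtop M) (U \<inter> V)" using adaptedD(1)[OF ad] adaptedD(1)[OF ad'] by (rule openin_Int)
    have "smooth_fun M (\<lambda>x. g x (s j x) (t' i x))"
      by (rule g_smooth[OF sec_plusD(1)[OF adaptedD(2)[OF ad ij(2)]] sec_minusD(1)[OF adaptedD(3)[OF ad' ij(1)]]])
    then have "smooth_fun_on M (U \<inter> V) (\<lambda>x. g x (s j x) (t' i x))"
      by (rule smooth_fun_imp_on[OF _ openin_subset[OF op]])
    then show ?thesis
      by (rule smooth_fun_on_cong[OF op, rotated]) (use plus_frame[OF ad] ij in \<open>simp add: \<phi> \<psi> plus_triv_def\<close>)
  qed
  show ?thesis unfolding vector_bundle_def using 1 2 3 4 by auto
qed

text \<open>One side refers to adapted trivialisations, the other to those of A. The coordinates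
  g(a, t i) link them: they are smooth for every section of A, and conversely, near each point, a is
  the combination of the global sections s i with these coordinates extended to M.\<close>

lemma sections_plus: "sections M plus_bundle = sec_plus"
proof (intro equalityI subsetI)
  fix a assume a: "a \<in> sections M plus_bundle"
  have ap: "a x \<in> fib_plus x" if "x \<in> pts M" for x using sectionsD(1)[OF a that] by simp
  have "a \<in> sections M A"
  proof (rule sections_near[OF prebundle_A])
    fix x assume x: "x \<in> pts M"
    then show "a x \<in> fib A x" using ap fib_plusD by blast
    obtain U s t where ad: "adapted U s t" and xU: "x \<in> U" using adapted_near[OF x] by (elim exE conjE)
    have "\<forall>i\<in>{..<half_rank}. \<exists>c N. smooth_fun M c \<and> openin (mtop M) N \<and> x \<in> N \<and> (\<forall>y\<in>N. c y = g y (a y) (t i y))"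
    proof
      fix i assume i: "i \<in> {..<half_rank}"
      have "smooth_fun_on M U (\<lambda>y. g y (a y) (t i y))"
        using sectionsD(3)[OF a plus_trivsI[OF ad], of i] i by (simp add: plus_triv_def)
      from smooth_fun_extend[OF adaptedD(1)[OF ad] xU this] obtain c N where
        "smooth_fun M c" "openin (mtop M) N" "x \<in> N" "N \<subseteq> U" "\<And>y. y \<in> N \<Longrightarrow> c y = g y (a y) (t i y)" by blast
      then show "\<exists>c N. smooth_fun M c \<and> openin (mtop M) N \<and> x \<in> N \<and> (\<forall>y\<in>N. c y = g y (a y) (t i y))"
        by (intro exI[of _ c] exI[of _ N]) auto
    qed
    from bchoice[OF this] obtain c where "\<forall>i\<in>{..<half_rank}. \<exists>N. smooth_fun M (c i) \<and> openin (mtop M) N \<and>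
        x \<in> N \<and> (\<forall>y\<in>N. c i y = g y (a y) (t i y))"
      by (elim exE)
    from bchoice[OF this] obtain N where c: "\<forall>i\<in>{..<half_rank}. smooth_fun M (c i) \<and> openin (mtop M) (N i) \<and>
        x \<in> N i \<and> (\<forall>y\<in>N i. c i y = g y (a y) (t i y))"
      by (elim exE)
    define W where "W = U \<inter> ((\<Inter>i\<in>{..<half_rank}. N i) \<inter> pts M)"
    have W: "openin (mtop M) W" "x \<in> W"
      using adaptedD(1)[OF ad] xU c x by (auto simp: W_def intro!: openin_Int openin_INT)
    let ?Z = "\<Sum>i<half_rank. c i \<odot> s i"
    have Z: "?Z \<in> sections M A"
      by (intro sections_sum sections_fmult prebundle_A) (use c adaptedD(2)[OF ad] sec_plusD(1) in auto)
    have "a y = ?Z y" if y: "y \<in> W" for y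
    proof -
      have yU: "y \<in> U" and yM: "y \<in> pts M" using y by (auto simp: W_def)
      have "?Z y = (\<Sum>i<half_rank. g y (a y) (t i y) *\<^sub>R s i y)"
        unfolding sum_fun_apply by (rule sum.cong) (use y c in \<open>auto simp: W_def\<close>)
      also have "\<dots> = a y" by (rule plus_expand[OF ad yU ap[OF yM], symmetric])
      finally show ?thesis by simp
    qed
    then show "\<exists>N t. openin (mtop M) N \<and> x \<in> N \<and> t \<in> sections M A \<and> (\<forall>y\<in>N. a y = t y)"
      using W Z by (intro exI[of _ W] exI[of _ ?Z]) auto
  qed (use sectionsD(2)[OF a] in simp)
  then show "a \<in> sec_plus" using ap by (rule sec_plusI)
next
  fix a assume a: "a \<in> sec_plus"
  show "a \<in> sections M plus_bundle"
  proof (rule sectionsI)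
    fix U \<phi> i assume U: "(U, \<phi>) \<in> trivs plus_bundle" and i: "i < vrank plus_bundle"
    obtain s t where ad: "adapted U s t" and \<phi>: "\<phi> = plus_triv t" using plus_trivsE[OF U] .
    have "smooth_fun M (\<lambda>x. g x (a x) (t i x))"
      using g_smooth[OF sec_plusD(1)[OF a] sec_minusD(1)[OF adaptedD(3)[OF ad]]] i by simp
    then have "smooth_fun_on M U (\<lambda>x. g x (a x) (t i x))"
      by (rule smooth_fun_imp_on[OF _ openin_subset[OF adaptedD(1)[OF ad]]])
    then show "smooth_fun_on M U (\<lambda>x. \<phi> x (a x) i)" using i by (simp add: \<phi> plus_triv_def)
  qed (use sec_plusD(2)[OF a] sectionsD(2)[OF sec_plusD(1)[OF a]] in auto)
qed

subsection \<open>The dual of the plus bundle\<close>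

text \<open>Lowering the index with the metric and restricting to B. By isotropy it is 0 on B, and
  on C it is the isomorphism onto the dual of B.\<close>

definition flat :: "'m \<Rightarrow> 'w \<Rightarrow> 'w \<Rightarrow> real"
  where "flat x u v = (if v \<in> fib_plus x then g x u v else 0)"

text \<open>The inverse of \<open>flat\<close> on C. A definite description keeps it independent of
  the adapted frame used to compute it.\<close>

definition sharp :: "'m \<Rightarrow> ('w \<Rightarrow> real) \<Rightarrow> 'w"
  where "sharp x b = (THE w. w \<in> fib_minus x \<and> (\<forall>v\<in>fib_plus x. g x w v = b v))"

abbreviation flat_section ("F") where "F \<equiv> on_sections M flat"
abbreviation sharp_section ("G") where "G \<equiv> on_sections M sharp"
abbreviation dual_sections ("\<Gamma>*") where "\<Gamma>* \<equiv> sections M (dual_bundle plus_bundle)"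

lemmas vb_plus = vector_bundle_plus and vb_dual = vector_bundle_dual[OF vector_bundle_plus]

context
  fixes x assumes x: "x \<in> pts M"
begin

lemma flat_in: assumes u: "u \<in> fib A x" shows "flat x u \<in> fib (dual_bundle plus_bundle) x"
  unfolding fib_dual plus_bundle_simps
proof (intro CollectI conjI lin_onI)
  fix v w assume vw: "v \<in> fib_plus x" "w \<in> fib_plus x"
  then show "flat x u (v + w) = flat x u v + flat x u w"
    using g_add_right[OF x u fib_plusD[OF x vw(1)] fib_plusD[OF x vw(2)]] subspace_add[OF subspace_fib_plus[OF x] vw]
    by (simp add: flat_def)
next
  fix c v assume v: "v \<in> fib_plus x"
  then show "flat x u (c *\<^sub>R v) = c *\<^sub>R flat x u v"
    using g_scale_right[OF x u fib_plusD[OF x v]] subspace_scale[OF subspace_fib_plus[OF x] v]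
    by (simp add: flat_def)
qed (simp add: flat_def)

lemma flat_lin: "lin_on (fib A x) (flat x)"
proof (rule lin_onI)
  fix u v assume u: "u \<in> fib A x" "v \<in> fib A x"
  show "flat x (u + v) = flat x u + flat x v"
    using g_add_left[OF x fib_plusD[OF x] u] by (auto simp: flat_def fun_eq_iff)
next
  fix c u assume u: "u \<in> fib A x"
  show "flat x (c *\<^sub>R u) = c *\<^sub>R flat x u"
    using g_scale_left[OF x fib_plusD[OF x] u] by (auto simp: flat_def fun_eq_iff scaleR_fun_def)
qed

lemma flat_plus: "u \<in> fib_plus x \<Longrightarrow> flat x u = 0"
  using isotropic_plus[OF x] by (auto simp: flat_def fun_eq_iff)

lemma sharp_unique:
  assumes w: "w \<in> fib_minus x" "\<And>v. v \<in> fib_plus x \<Longrightarrow> g x w v = b v"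
    and w': "w' \<in> fib_minus x" "\<And>v. v \<in> fib_plus x \<Longrightarrow> g x w' v = b v"
  shows "w = w'"
proof -
  have d: "w - w' \<in> fib_minus x" by (rule subspace_diff[OF subspace_fib_minus[OF x] w(1) w'(1)])
  have "w - w' = 0"
  proof (rule nondegenerate_minus[OF x d])
    fix v assume v: "v \<in> fib_plus x"
    have "g x (w - w') v = 0"
      using g_diff_left[OF x fib_plusD[OF x v] fib_minusD[OF x w(1)] fib_minusD[OF x w'(1)]] w(2)[OF v] w'(2)[OF v] by simp
    then show "g x v (w - w') = 0" using g_sym[OF x fib_plusD[OF x v] fib_minusD[OF x d]] by simp
  qed
  then show ?thesis by simp
qed

lemma sharp_eqI:
  assumes w: "w \<in> fib_minus x" "\<And>v. v \<in> fib_plus x \<Longrightarrow> g x w v = b v" shows "sharp x b = w"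
  unfolding sharp_def
proof (rule the_equality)
  show "w \<in> fib_minus x \<and> (\<forall>v\<in>fib_plus x. g x w v = b v)" using w by simp
  fix w' assume "w' \<in> fib_minus x \<and> (\<forall>v\<in>fib_plus x. g x w' v = b v)"
  then show "w' = w" using sharp_unique[OF _ _ w] by simp
qed

text \<open>The preimage of b has the coordinates b (s i) in the basis t dual to s. The existence
  behind the description in \<open>sharp\<close> and the smoothness of \<open>G\<close> are both
  read off from this formula.\<close>

lemma sharp_formula:
  assumes b: "b \<in> fib (dual_bundle plus_bundle) x" and ad: "adapted U s t" "x \<in> U"
  shows "sharp x b = (\<Sum>i<half_rank. b (s i x) *\<^sub>R t i x)"
proof (rule sharp_eqI)
  note bo = adaptedD(4)[OF ad]
  note bD = biorthogonalD[OF x bo]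
  show "(\<Sum>i<half_rank. b (s i x) *\<^sub>R t i x) \<in> fib_minus x" by (rule biorthogonal_sum_in(2)[OF x bo])
  fix v assume v: "v \<in> fib_plus x"
  have bl: "lin_on (fib_plus x) b" using dual_fibD(1)[OF b] by simp
  have "b v = b (\<Sum>i<half_rank. g x v (t i x) *\<^sub>R s i x)" by (rule arg_cong[OF plus_expand[OF ad v]])
  also have "\<dots> = (\<Sum>i<half_rank. g x v (t i x) * b (s i x))"
    using lin_on_sum[OF bl subspace_fib_plus[OF x], where I = "{..<half_rank}" and v = "\<lambda>i. s i x"] bD(1) by simp
  finally have bv: "b v = (\<Sum>i<half_rank. g x v (t i x) * b (s i x))" .
  have "g x (\<Sum>i<half_rank. b (s i x) *\<^sub>R t i x) v = (\<Sum>i<half_rank. b (s i x) * g x (t i x) v)"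
    by (rule g_sum_left[OF x fib_plusD[OF x v]]) (use bD(4) in auto)
  also have "\<dots> = (\<Sum>i<half_rank. g x v (t i x) * b (s i x))"
    by (rule sum.cong) (use g_sym[OF x fib_plusD[OF x v] bD(4)] in \<open>auto simp: mult.commute\<close>)
  finally show "g x (\<Sum>i<half_rank. b (s i x) *\<^sub>R t i x) v = b v" using bv by simp
qed

lemma sharp:
  assumes b: "b \<in> fib (dual_bundle plus_bundle) x"
  shows sharp_in: "sharp x b \<in> fib_minus x" and flat_sharp: "flat x (sharp x b) = b"
proof -
  obtain U s t where ad: "adapted U s t" "x \<in> U" using adapted_near[OF x] by (elim exE conjE)
  note bo = adaptedD(4)[OF ad]
  note bD = biorthogonalD[OF x bo]
  show in_minus: "sharp x b \<in> fib_minus x"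
    unfolding sharp_formula[OF b ad] by (rule biorthogonal_sum_in(2)[OF x bo])
  show "flat x (sharp x b) = b"
  proof (rule dual_fib_eqI[OF flat_in[OF fib_minusD[OF x in_minus]] b])
    fix v assume "v \<in> fib plus_bundle x"
    then have v: "v \<in> fib_plus x" by simp
    have bl: "lin_on (fib_plus x) b" using dual_fibD(1)[OF b] by simp
    have "b v = b (\<Sum>i<half_rank. g x v (t i x) *\<^sub>R s i x)" by (rule arg_cong[OF plus_expand[OF ad v]])
    also have "\<dots> = (\<Sum>i<half_rank. g x v (t i x) * b (s i x))"
      using lin_on_sum[OF bl subspace_fib_plus[OF x], where I = "{..<half_rank}" and v = "\<lambda>i. s i x"] bD(1) by simp
    also have "\<dots> = (\<Sum>i<half_rank. b (s i x) * g x v (t i x))" by (simp add: mult.commute)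
    also have "\<dots> = g x v (\<Sum>i<half_rank. b (s i x) *\<^sub>R t i x)"
      by (rule g_sum_right[OF x fib_plusD[OF x v], symmetric]) (use bD(4) in auto)
    also have "\<dots> = g x (sharp x b) v"
      unfolding sharp_formula[OF b ad, symmetric] by (rule g_sym[OF x fib_plusD[OF x v] fib_minusD[OF x in_minus]])
    finally show "flat x (sharp x b) v = b v" using v by (simp add: flat_def)
  qed
qed

text \<open>Restricting g(u, .) to B forgets the B-component of u, by isotropy.\<close>

lemma sharp_flat: assumes u: "u \<in> fib A x" shows "sharp x (flat x u) = proj_minus x u"
proof (rule sharp_eqI[OF proj_minus_in[OF x u]])
  fix v assume v: "v \<in> fib_plus x"
  have "g x u v = g x (proj_plus x u + proj_minus x u) v" by (simp only: proj_sum[OF x])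
  also have "\<dots> = g x (proj_plus x u) v + g x (proj_minus x u) v"
    by (rule g_add_left[OF x fib_plusD[OF x v] fib_plusD[OF x proj_plus_in[OF x u]] fib_minusD[OF x proj_minus_in[OF x u]]])
  finally show "g x (proj_minus x u) v = flat x u v"
    using v isotropic_plus[OF x proj_plus_in[OF x u] v] by (simp add: flat_def)
qed

text \<open>The inverse of a linear bijection is linear: \<open>flat\<close> is applied to the
  claimed identity and then undone on C.\<close>

lemma sharp_lin: "lin_on (fib (dual_bundle plus_bundle) x) (sharp x)"
proof -
  have inv: "sharp x (flat x u) = u" if "u \<in> fib_minus x" for u
    using sharp_flat[OF fib_minusD[OF x that]] proj_minus_id(1)[OF that] by simp
  show ?thesis
  proof (rule lin_onI)
    fix b c assume b: "b \<in> fib (dual_bundle plus_bundle) x" and c: "c \<in> fib (dual_bundle plus_bundle) x"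
    have "b + c = flat x (sharp x b + sharp x c)"
      using lin_on_add[OF flat_lin fib_minusD[OF x sharp_in[OF b]] fib_minusD[OF x sharp_in[OF c]]]
      by (simp only: flat_sharp[OF b] flat_sharp[OF c])
    then show "sharp x (b + c) = sharp x b + sharp x c"
      using inv[OF subspace_add[OF subspace_fib_minus[OF x] sharp_in[OF b] sharp_in[OF c]]] by simp
  next
    fix k b assume b: "b \<in> fib (dual_bundle plus_bundle) x"
    have "k *\<^sub>R b = flat x (k *\<^sub>R sharp x b)"
      using lin_on_scale[OF flat_lin fib_minusD[OF x sharp_in[OF b]], of k] by (simp only: flat_sharp[OF b])
    then show "sharp x (k *\<^sub>R b) = k *\<^sub>R sharp x b"
      using inv[OF subspace_scale[OF subspace_fib_minus[OF x] sharp_in[OF b]]] by simp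
  qed
qed

end

lemma flat_sections: assumes a: "a \<in> sections M A" shows "F a \<in> \<Gamma>*"
proof (rule sectionsI)
  fix U \<tau> i assume U: "(U, \<tau>) \<in> trivs (dual_bundle plus_bundle)" and i: "i < vrank (dual_bundle plus_bundle)"
  obtain \<phi> where U: "(U, \<phi>) \<in> trivs plus_bundle"
    and \<tau>: "\<tau> = (\<lambda>x \<beta> i. if i < vrank plus_bundle then \<beta> (frame plus_bundle \<phi> i x) else 0)"
    using trivs_dualE[OF U] .
  obtain s t where ad: "adapted U s t" and \<phi>: "\<phi> = plus_triv t" using plus_trivsE[OF U] .
  have i: "i < half_rank" using i by simp
  have "smooth_fun M (\<lambda>x. g x (a x) (s i x))"
    by (rule g_smooth[OF a sec_plusD(1)[OF adaptedD(2)[OF ad i]]])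
  then have "smooth_fun_on M U (\<lambda>x. g x (a x) (s i x))"
    by (rule smooth_fun_imp_on[OF _ openin_subset[OF adaptedD(1)[OF ad]]])
  then show "smooth_fun_on M U (\<lambda>x. \<tau> x (F a x) i)"
  proof (rule smooth_fun_on_cong[OF adaptedD(1)[OF ad], rotated])
    fix x assume x: "x \<in> U"
    then show "g x (a x) (s i x) = \<tau> x (F a x) i"
      using plus_frame[OF ad x i] sec_plusD(2)[OF adaptedD(2)[OF ad i] adaptedD(5)[OF ad x]] adaptedD(5)[OF ad x] i
      by (simp add: \<tau> \<phi> flat_def)
  qed
qed (auto simp: on_sections_def flat_in sectionsD(1)[OF a])

lemma sharp_sections: assumes b: "\<beta> \<in> \<Gamma>*" shows "G \<beta> \<in> sec_minus"
proof (rule sec_minusI)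
  show "G \<beta> \<in> sections M A"
  proof (rule sections_near[OF prebundle_A])
    fix x assume x: "x \<in> pts M"
    show "G \<beta> x \<in> fib A x" using fib_minusD[OF x sharp_in[OF x sectionsD(1)[OF b x]]] x by simp
    obtain U s t where ad: "adapted U s t" and xU: "x \<in> U" using adapted_near[OF x] by (elim exE conjE)
    let ?Z = "\<Sum>i<half_rank. pairing \<beta> (s i) \<odot> t i"
    have "?Z \<in> sections M A"
      by (intro sections_sum sections_fmult prebundle_A pairing_smooth[OF vb_plus b])
        (use adaptedD(2,3)[OF ad] sec_minusD(1) in \<open>auto simp: sections_plus\<close>)
    moreover have "\<forall>y\<in>U. G \<beta> y = ?Z y"
    proof
      fix y assume y: "y \<in> U"
      note yM = adaptedD(5)[OF ad y]
      show "G \<beta> y = ?Z y"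
        using sharp_formula[OF yM sectionsD(1)[OF b yM] ad y] yM by (simp add: sum_fun_apply pairing_def)
    qed
    ultimately show "\<exists>N t. openin (mtop M) N \<and> x \<in> N \<and> t \<in> sections M A \<and> (\<forall>y\<in>N. G \<beta> y = t y)"
      using adaptedD(1)[OF ad] xU by (intro exI[of _ U] exI[of _ ?Z]) simp
  qed (simp add: on_sections_def)
  show "G \<beta> x \<in> fib_minus x" if "x \<in> pts M" for x using sharp_in[OF that sectionsD(1)[OF b that]] that by simp
qed

lemma F_G: assumes b: "\<beta> \<in> \<Gamma>*" shows "F (G \<beta>) = \<beta>"
proof
  fix x show "F (G \<beta>) x = \<beta> x"
    using flat_sharp[OF _ sectionsD(1)[OF b]] sectionsD(2)[OF b, of x] by (cases "x \<in> pts M") (auto simp: on_sections_def)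
qed

lemma G_F: assumes a: "a \<in> sections M A" shows "G (F a) = P\<^sub>- a"
proof
  fix x show "G (F a) x = P\<^sub>- a x"
    using sharp_flat[OF _ sectionsD(1)[OF a]] by (cases "x \<in> pts M") (auto simp: on_sections_def)
qed

lemma G_F_minus: "a \<in> sec_minus \<Longrightarrow> G (F a) = a"
  using G_F[OF sec_minusD(1)] proj_section_id(2) by simp

lemma F_plus: assumes a: "a \<in> sec_plus" shows "F a = 0"
proof
  fix x show "F a x = 0 x"
    using flat_plus[OF _ sec_plusD(2)[OF a]] by (cases "x \<in> pts M") (auto simp: on_sections_def)
qed

lemma on_sections_lin:
  assumes "\<And>x. x \<in> pts M \<Longrightarrow> lin_on (fib E x) (h x)" and s: "s \<in> sections M E"
  shows "t \<in> sections M E \<Longrightarrow> on_sections M h (s + t) = on_sections M h s + on_sections M h t"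
    and "on_sections M h (f \<odot> s) = f \<odot> on_sections M h s"
  by (rule ext, use lin_on_add[OF assms(1) sectionsD(1)[OF s] sectionsD(1)] in \<open>simp add: on_sections_def\<close>)
    (rule ext, use lin_on_scale[OF assms(1) sectionsD(1)[OF s]] in \<open>simp add: on_sections_def\<close>)

lemma F_add: "a \<in> sections M A \<Longrightarrow> b \<in> sections M A \<Longrightarrow> F (a + b) = F a + F b"
  and F_fmult: "a \<in> sections M A \<Longrightarrow> F (f \<odot> a) = f \<odot> F a"
  by (rule on_sections_lin(1)[OF flat_lin], assumption+, rule on_sections_lin(2)[OF flat_lin], assumption+)

lemma G_add: "\<beta> \<in> \<Gamma>* \<Longrightarrow> \<gamma> \<in> \<Gamma>* \<Longrightarrow> G (\<beta> + \<gamma>) = G \<beta> + G \<gamma>"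
  and G_fmult: "\<beta> \<in> \<Gamma>* \<Longrightarrow> G (f \<odot> \<beta>) = f \<odot> G \<beta>"
  by (rule on_sections_lin(1)[OF sharp_lin], assumption+, rule on_sections_lin(2)[OF sharp_lin], assumption+)

lemma pairing_F:
  "a \<in> sections M A \<Longrightarrow> Y \<in> sec_plus \<Longrightarrow> x \<in> pts M \<Longrightarrow> pairing (F a) Y x = g x (a x) (Y x)"
  using sec_plusD(2) by (simp add: pairing_def flat_def)

subsection \<open>Curvature of the Levi-Civita connection\<close>

lemmas D_in = rap_in[OF connection_D]

lemma K_minus_section: assumes "b \<in> sections M A" shows "b \<in> sec_minus \<longleftrightarrow> on_sections M K b = - b"
proof
  assume "b \<in> sec_minus"
  then show "on_sections M K b = - b"
    using sec_minusD(2) sectionsD(2)[OF assms] by (auto simp: on_sections_def fib_minus_def fun_eq_iff)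
next
  assume eq: "on_sections M K b = - b"
  show "b \<in> sec_minus"
  proof (rule sec_minusI[OF assms])
    fix x assume x: "x \<in> pts M"
    show "b x \<in> fib_minus x"
      using fun_cong[OF eq, of x] sectionsD(1)[OF assms x] x by (simp add: fib_minus_def)
  qed
qed

lemma K_plus_section: assumes "b \<in> sections M A" shows "b \<in> sec_plus \<longleftrightarrow> on_sections M K b = b"
proof
  assume "b \<in> sec_plus"
  then show "on_sections M K b = b"
    using sec_plusD(2) sectionsD(2)[OF assms] by (auto simp: on_sections_def fib_plus_def fun_eq_iff)
next
  assume eq: "on_sections M K b = b"
  show "b \<in> sec_plus"
  proof (rule sec_plusI[OF assms])
    fix x assume x: "x \<in> pts M"
    show "b x \<in> fib_plus x"
      using fun_cong[OF eq, of x] sectionsD(1)[OF assms x] x by (simp add: fib_plus_def)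
  qed
qed

lemma D_plus: assumes a: "a \<in> sections M A" and b: "b \<in> sec_plus" shows "D a b \<in> sec_plus"
  using parallel[OF a sec_plusD(1)[OF b]] K_plus_section[OF sec_plusD(1)[OF b]] b
    K_plus_section[OF D_in[OF a sec_plusD(1)[OF b]]] by simp

lemma D_minus: assumes a: "a \<in> sections M A" and b: "b \<in> sec_minus" shows "D a b \<in> sec_minus"
  using parallel[OF a sec_minusD(1)[OF b]] K_minus_section[OF sec_minusD(1)[OF b]] b
    K_minus_section[OF D_in[OF a sec_minusD(1)[OF b]]] lin_on_minus[OF rap_lin_right[OF connection_D a] sec_minusD(1)[OF b]] by simp

lemma curvature_plus: "a \<in> sections M A \<Longrightarrow> b \<in> sections M A \<Longrightarrow> c \<in> sec_plus \<Longrightarrow> curvature D a b c \<in> sec_plus"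
  unfolding curvature_def by (intro subspace_diff subspace_sec_plus D_plus bracket_of_in[OF anchored_A connection_D])

lemma curvature_minus: "a \<in> sections M A \<Longrightarrow> b \<in> sections M A \<Longrightarrow> c \<in> sec_minus \<Longrightarrow> curvature D a b c \<in> sec_minus"
  unfolding curvature_def by (intro subspace_diff subspace_sec_minus D_minus bracket_of_in[OF anchored_A connection_D])

lemma plus_minus_zero:
  assumes s: "s \<in> sec_plus" and t: "t \<in> sec_minus" and z: "s + t = 0" shows "s = 0" "t = 0"
proof -
  have "s x = 0" for x
  proof (cases "x \<in> pts M")
    case True
    have eq: "t x = - s x" using fun_cong[OF z, of x] by (simp add: eq_neg_iff_add_eq_0 add.commute)
    have "- s x \<in> fib_minus x" using sec_minusD(2)[OF t True] eq by simp
    then have "s x \<in> fib_minus x" using subspace_neg[OF subspace_fib_minus[OF True]] by force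
    then show ?thesis using sec_plusD(2)[OF s True] proj_plus_id(1) proj_minus_id(2) by metis
  qed (rule sectionsD(2)[OF sec_plusD(1)[OF s]])
  then show "s = 0" by auto
  then show "t = 0" using z by simp
qed

lemma bianchi_zero:
  assumes "a \<in> sections M A" "b \<in> sections M A" "c \<in> sections M A"
  shows "curvature D a b c + curvature D b c a + curvature D c a b = 0"
proof -
  have "br a (br b c) + br b (br c a) + br c (br a b) = 0"
    using lie assms unfolding lie_algebroid_def by simp
  then show ?thesis
    using bianchi[OF anchored_A connection_D assms] assms by (simp add: torsion_free bracket_of_in[OF anchored_A connection_D] flip: torsion_free)
qed

lemma curvature_plus_plus_minus:
  assumes X: "X \<in> sec_plus" and Y: "Y \<in> sec_plus" and a: "a \<in> sec_minus"
  shows "curvature D X Y a = 0" and "curvature D X a Y = curvature D Y a X"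
proof -
  note i = sec_plusD(1)[OF X] sec_plusD(1)[OF Y] sec_minusD(1)[OF a]
  have "curvature D Y a X + curvature D a X Y + curvature D X Y a = 0"
    using bianchi_zero[OF i] by (simp add: algebra_simps)
  from plus_minus_zero[OF _ _ this]
  have "curvature D Y a X + curvature D a X Y = 0" and *: "curvature D X Y a = 0"
    using subspace_add[OF subspace_sec_plus curvature_plus[OF i(2,3) X] curvature_plus[OF i(3,1) Y]]
      curvature_minus[OF i(1,2) a] by blast+
  then show "curvature D X a Y = curvature D Y a X"
    using curvature_skew[OF anchored_A connection_D i(3,1,2)] by (metis eq_neg_iff_add_eq_0)
  show "curvature D X Y a = 0" by (rule *)
qed

lemma curvature_minus_minus_plus:
  assumes a: "a \<in> sec_minus" and b: "b \<in> sec_minus" and X: "X \<in> sec_plus"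
  shows "curvature D a b X = 0" and "curvature D a X b = curvature D b X a"
proof -
  note i = sec_minusD(1)[OF a] sec_minusD(1)[OF b] sec_plusD(1)[OF X]
  have "curvature D a b X + (curvature D b X a + curvature D X a b) = 0"
    using bianchi_zero[OF i] by (simp add: algebra_simps)
  from plus_minus_zero[OF _ _ this]
  have *: "curvature D a b X = 0" and "curvature D b X a + curvature D X a b = 0"
    using subspace_add[OF subspace_sec_minus curvature_minus[OF i(2,3) a] curvature_minus[OF i(3,1) b]]
      curvature_plus[OF i(1,2) X] by blast+
  then show "curvature D a X b = curvature D b X a"
    using curvature_skew[OF anchored_A connection_D i(3,1,2)] by (metis eq_neg_iff_add_eq_0)
  show "curvature D a b X = 0" by (rule *)
qed

text \<open>The Jacobi identity and the Leibniz rule make the anchor compatible with brackets.\<close>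

lemma anchor_defect_zero:
  assumes a: "a \<in> sections M A" and b: "b \<in> sections M A" and c: "c \<in> sections M A" and f: "smooth_fun M f"
  shows "anchor_defect \<rho> (bracket_of D) a b f \<odot> c = 0"
proof -
  have leib: "br a (f \<odot> b) = f \<odot> br a b + act \<rho> a f \<odot> b"
    if "a \<in> sections M A" "b \<in> sections M A" "smooth_fun M f" for a b f
    using lie that unfolding lie_algebroid_def by simp
  have jac: "br a (br b c) + br b (br c a) + br c (br a b) = 0"
    if "a \<in> sections M A" "b \<in> sections M A" "c \<in> sections M A" for a b c
    using lie that unfolding lie_algebroid_def by simp
  have bil: "bilinear_product M A br" using lie unfolding lie_algebroid_def by simp
  have br_in: "br a b \<in> sections M A" and lin: "lin_on (sections M A) (br a)"
    if "a \<in> sections M A" "b \<in> sections M A" for a b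
    using bil that unfolding bilinear_product_def by simp_all
  have skew: "br b a = - br a b" if "a \<in> sections M A" "b \<in> sections M A" for a b
    using torsion_free[OF that] torsion_free[OF that(2,1)] unfolding bracket_of_def by (metis minus_diff_eq)
  have R0: "br a (br b c) - br b (br a c) - br (br a b) c = 0" if c: "c \<in> sections M A" for c
    using jac[OF a b c] skew[OF a c] skew[OF br_in[OF a b] c] lin_on_minus[OF lin[OF b b] br_in[OF a c]]
    by simp
  have 1: "br a (br b (f \<odot> c)) = f \<odot> br a (br b c) + act \<rho> a f \<odot> br b c + act \<rho> b f \<odot> br a c + act \<rho> a (act \<rho> b f) \<odot> c"
    if a: "a \<in> sections M A" and b: "b \<in> sections M A" for a b
  proof -
    have "br a (br b (f \<odot> c)) = br a (f \<odot> br b c) + br a (act \<rho> b f \<odot> c)"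
      unfolding leib[OF b c f]
      by (rule lin_on_add[OF lin[OF a a]]) (intro sections_fmult prebundle_A br_in act_smooth[OF anchored_A] a b c f)+
    also have "\<dots> = f \<odot> br a (br b c) + act \<rho> a f \<odot> br b c + (act \<rho> b f \<odot> br a c + act \<rho> a (act \<rho> b f) \<odot> c)"
      by (simp only: leib[OF a br_in[OF b c] f] leib[OF a c act_smooth[OF anchored_A b f]])
    finally show ?thesis by (simp add: add.assoc)
  qed
  have 2: "br a (br b (f \<odot> c)) - br b (br a (f \<odot> c)) - br (br a b) (f \<odot> c) =
      f \<odot> (br a (br b c) - br b (br a c) - br (br a b) c) + anchor_defect \<rho> br a b f \<odot> c"
    unfolding 1[OF a b] 1[OF b a] leib[OF br_in[OF a b] c f]
    by (rule ext) (simp add: anchor_defect_def algebra_simps)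
  have "anchor_defect \<rho> br a b f \<odot> c = 0"
    using 2 R0[OF c] R0[OF sections_fmult[OF prebundle_A c f]] by simp
  moreover have "anchor_defect \<rho> (bracket_of D) a b f = anchor_defect \<rho> br a b f"
    by (rule ext) (simp add: anchor_defect_def torsion_free[OF a b])
  ultimately show ?thesis by simp
qed

text \<open>The vanishing of the defect is known only after multiplication by a section. Where c or
  d is nonzero at x the defect itself is zero there; where both vanish, so do both terms of the
  sum.\<close>

lemma curvature_skew_metric:
  assumes a: "a \<in> sections M A" and b: "b \<in> sections M A" and c: "c \<in> sections M A" and d: "d \<in> sections M A"
    and x: "x \<in> pts M"
  shows "g x (curvature D a b c x) (d x) + g x (c x) (curvature D a b d x) = 0"
proof -
  let ?f = "\<lambda>y. g y (c y) (d y)"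
  have f: "smooth_fun M ?f" by (rule g_smooth[OF c d])
  have "anchor_defect \<rho> (bracket_of D) a b ?f x = 0 \<or> c x = 0" "anchor_defect \<rho> (bracket_of D) a b ?f x = 0 \<or> d x = 0"
    using fun_cong[OF anchor_defect_zero[OF a b c f], of x] fun_cong[OF anchor_defect_zero[OF a b d f], of x] by simp_all
  then consider "anchor_defect \<rho> (bracket_of D) a b ?f x = 0" | "c x = 0" "d x = 0" by blast
  then show ?thesis
  proof cases
    case 1
    then show ?thesis using curvature_metric[OF anchored_A connection_D metric metric_compatible a b c d x] by simp
  next
    case 2
    then show ?thesis
      using g_zero_left[OF x sectionsD(1)[OF curvature_in[OF anchored_A connection_D a b d] x]]
        g_zero_right[OF x sectionsD(1)[OF curvature_in[OF anchored_A connection_D a b c] x]] by simp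
  qed
qed

lemma curvature_plus_plus_plus:
  assumes X: "X \<in> sec_plus" and Y: "Y \<in> sec_plus" and Z: "Z \<in> sec_plus" shows "curvature D X Y Z = 0"
proof
  note i = sec_plusD(1)[OF X] sec_plusD(1)[OF Y] sec_plusD(1)[OF Z]
  have R: "curvature D X Y Z \<in> sec_plus" by (rule curvature_plus[OF i(1,2) Z])
  fix x show "curvature D X Y Z x = 0 x"
  proof (cases "x \<in> pts M")
    case x: True
    have "curvature D X Y Z x = 0"
    proof (rule nondegenerate_plus[OF x sec_plusD(2)[OF R x]])
      fix w assume "w \<in> fib_minus x"
      then obtain a where a: "a \<in> sec_minus" "a x = w" using section_through_minus[OF x] by blast
      have "g x (Z x) 0 = 0" by (rule g_zero_right[OF x sectionsD(1)[OF i(3) x]])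
      then show "g x (curvature D X Y Z x) w = 0"
        using curvature_skew_metric[OF i sec_minusD(1)[OF a(1)] x] curvature_plus_plus_minus(1)[OF X Y a(1)] a(2) by simp
    qed
    then show ?thesis by simp
  qed (simp add: sectionsD(2)[OF sec_plusD(1)[OF R]])
qed

lemma curvature_minus_minus_minus:
  assumes a: "a \<in> sec_minus" and b: "b \<in> sec_minus" and c: "c \<in> sec_minus" shows "curvature D a b c = 0"
proof
  note i = sec_minusD(1)[OF a] sec_minusD(1)[OF b] sec_minusD(1)[OF c]
  have R: "curvature D a b c \<in> sec_minus" by (rule curvature_minus[OF i(1,2) c])
  fix x show "curvature D a b c x = 0 x"
  proof (cases "x \<in> pts M")
    case x: True
    have "curvature D a b c x = 0"
    proof (rule nondegenerate_minus[OF x sec_minusD(2)[OF R x]])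
      fix w assume "w \<in> fib_plus x"
      then obtain X where X: "X \<in> sec_plus" "X x = w" using section_through_plus[OF x] by blast
      have "g x 0 (c x) = 0" by (rule g_zero_left[OF x sectionsD(1)[OF i(3) x]])
      then show "g x w (curvature D a b c x) = 0"
        using curvature_skew_metric[OF i(1,2) sec_plusD(1)[OF X(1)] i(3) x] curvature_minus_minus_plus(1)[OF a b X(1)] X(2) by simp
    qed
    then show ?thesis by simp
  qed (simp add: sectionsD(2)[OF sec_minusD(1)[OF R]])
qed

subsection \<open>The two left symmetric algebroids\<close>

definition dual_anchor :: "('m, 'w \<Rightarrow> real) anchor"
  where "dual_anchor x b = \<rho> x (sharp x b)"

text \<open>The restriction of \<open>D\<close> to sections of C, transported along the
  identification with the dual of B; \<open>F\<close> and \<open>G\<close> are mutually inverse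
  between the two modules of sections.\<close>

definition dual_product :: "('m, 'w \<Rightarrow> real) product"
  where "dual_product \<beta> \<gamma> = F (D (G \<beta>) (G \<gamma>))"

lemmas \<rho>_map = anchoredD(2)[OF anchored_A]

lemma anchored_plus: "anchored_bundle M plus_bundle \<rho>"
  unfolding anchored_bundle_def
proof (rule conjI[OF vb_plus bundle_mapI[OF vb_plus prebundle_tangent]])
  fix x assume x: "x \<in> pts M"
  show "lin_on (fib plus_bundle x) (\<rho> x)"
    using bundle_mapD(1)[OF \<rho>_map x] fib_plusD[OF x] by (simp add: lin_on_def)
  show "v \<in> fib plus_bundle x \<Longrightarrow> \<rho> x v \<in> fib (tangent_bundle M) x" for v
    using bundle_mapD(2)[OF \<rho>_map x] fib_plusD[OF x] by simp
next
  fix s assume "s \<in> sections M plus_bundle"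
  then show "on_sections M \<rho> s \<in> sections M (tangent_bundle M)"
    using bundle_map_sections[OF bundle_A prebundle_tangent \<rho>_map sec_plusD(1)] by (simp add: sections_plus)
qed

lemma anchored_dual: "anchored_bundle M (dual_bundle plus_bundle) dual_anchor"
  unfolding anchored_bundle_def
proof (rule conjI[OF vb_dual bundle_mapI[OF vb_dual prebundle_tangent]])
  fix x assume x: "x \<in> pts M"
  have s: "sharp x b \<in> fib A x" if "b \<in> fib (dual_bundle plus_bundle) x" for b
    using fib_minusD[OF x sharp_in[OF x that]] .
  show "lin_on (fib (dual_bundle plus_bundle) x) (dual_anchor x)"
    by (rule lin_onI)
      (simp_all add: dual_anchor_def lin_on_add[OF sharp_lin[OF x]] lin_on_scale[OF sharp_lin[OF x]]
        lin_on_add[OF bundle_mapD(1)[OF \<rho>_map x]] lin_on_scale[OF bundle_mapD(1)[OF \<rho>_map x]] s)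
  show "b \<in> fib (dual_bundle plus_bundle) x \<Longrightarrow> dual_anchor x b \<in> fib (tangent_bundle M) x" for b
    unfolding dual_anchor_def by (rule bundle_mapD(2)[OF \<rho>_map x s])
next
  fix \<beta> assume b: "\<beta> \<in> \<Gamma>*"
  have "on_sections M dual_anchor \<beta> = on_sections M \<rho> (G \<beta>)"
    by (rule ext) (simp add: on_sections_def dual_anchor_def)
  then show "on_sections M dual_anchor \<beta> \<in> sections M (tangent_bundle M)"
    using bundle_map_sections[OF bundle_A prebundle_tangent \<rho>_map sec_minusD(1)[OF sharp_sections[OF b]]] by simp
qed

lemma act_dual_anchor: "x \<in> pts M \<Longrightarrow> act dual_anchor \<beta> f x = act \<rho> (G \<beta>) f x"
  by (simp add: act_def dual_anchor_def)

lemma G_in: "\<beta> \<in> \<Gamma>* \<Longrightarrow> G \<beta> \<in> sections M A"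
  by (rule sec_minusD(1)[OF sharp_sections])

lemma right_anchored_plus: "right_anchored_product M plus_bundle \<rho> D"
  by (rule right_anchored_productI[OF anchored_plus], unfold sections_plus)
    (auto intro: D_plus sec_plusD(1) lin_on_add[OF rap_lin_left[OF connection_D]] lin_on_add[OF rap_lin_right[OF connection_D]]
      rap_fmult_left[OF connection_D] rap_fmult_right[OF connection_D])

lemma right_anchored_dual: "right_anchored_product M (dual_bundle plus_bundle) dual_anchor dual_product"
proof (rule right_anchored_productI[OF anchored_dual], unfold dual_product_def)
  fix \<beta> \<gamma> assume b: "\<beta> \<in> \<Gamma>*" and c: "\<gamma> \<in> \<Gamma>*"
  note bc = G_in[OF b] G_in[OF c]
  show "F (D (G \<beta>) (G \<gamma>)) \<in> \<Gamma>*" by (intro flat_sections D_in bc)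
  fix f assume f: "smooth_fun M f"
  show "F (D (G (f \<odot> \<beta>)) (G \<gamma>)) = f \<odot> F (D (G \<beta>) (G \<gamma>))"
    unfolding G_fmult[OF b] rap_fmult_left[OF connection_D bc f] F_fmult[OF D_in[OF bc]] ..
  have "D (G \<beta>) (G (f \<odot> \<gamma>)) = f \<odot> D (G \<beta>) (G \<gamma>) + act \<rho> (G \<beta>) f \<odot> G \<gamma>"
    unfolding G_fmult[OF c] by (rule rap_fmult_right[OF connection_D bc f])
  then have "F (D (G \<beta>) (G (f \<odot> \<gamma>))) = F (f \<odot> D (G \<beta>) (G \<gamma>)) + F (act \<rho> (G \<beta>) f \<odot> G \<gamma>)"
    using F_add[OF sections_fmult[OF prebundle_A D_in[OF bc] f] sections_fmult[OF prebundle_A bc(2) act_smooth[OF anchored_A bc(1) f]]] by simp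
  also have "\<dots> = f \<odot> F (D (G \<beta>) (G \<gamma>)) + act \<rho> (G \<beta>) f \<odot> \<gamma>"
    by (simp add: F_fmult[OF D_in[OF bc]] F_fmult[OF bc(2)] F_G[OF c])
  also have "act \<rho> (G \<beta>) f \<odot> \<gamma> = act dual_anchor \<beta> f \<odot> \<gamma>"
  proof
    fix x show "(act \<rho> (G \<beta>) f \<odot> \<gamma>) x = (act dual_anchor \<beta> f \<odot> \<gamma>) x"
      using sectionsD(2)[OF c, of x] by (cases "x \<in> pts M") (simp_all add: act_dual_anchor)
  qed
  finally show "F (D (G \<beta>) (G (f \<odot> \<gamma>))) = f \<odot> F (D (G \<beta>) (G \<gamma>)) + act dual_anchor \<beta> f \<odot> \<gamma>" .
next
  fix \<beta> \<beta>' \<gamma> assume b: "\<beta> \<in> \<Gamma>*" "\<beta>' \<in> \<Gamma>*" and c: "\<gamma> \<in> \<Gamma>*"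
  note bc = G_in[OF b(1)] G_in[OF b(2)] G_in[OF c]
  show "F (D (G (\<beta> + \<beta>')) (G \<gamma>)) = F (D (G \<beta>) (G \<gamma>)) + F (D (G \<beta>') (G \<gamma>))"
    by (simp add: G_add[OF b] lin_on_add[OF rap_lin_left[OF connection_D bc(3)] bc(1,2)]
        F_add[OF D_in[OF bc(1,3)] D_in[OF bc(2,3)]])
  show "F (D (G \<gamma>) (G (\<beta> + \<beta>'))) = F (D (G \<gamma>) (G \<beta>)) + F (D (G \<gamma>) (G \<beta>'))"
    by (simp add: G_add[OF b] lin_on_add[OF rap_lin_right[OF connection_D bc(3)] bc(1,2)]
        F_add[OF D_in[OF bc(3,1)] D_in[OF bc(3,2)]])
qed

lemma F_diff:
  assumes "a \<in> sections M A" "b \<in> sections M A" shows "F (a - b) = F a - F b"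
proof
  fix x show "F (a - b) x = (F a - F b) x"
  proof (cases "x \<in> pts M")
    case True
    then show ?thesis
      using lin_on_diff[OF flat_lin[OF True] vbD(1)[OF bundle_A True] sectionsD(1)[OF assms(1) True] sectionsD(1)[OF assms(2) True]]
      by simp
  qed (simp add: on_sections_def)
qed

lemma left_symmetric_plus: "left_symmetric_algebroid M plus_bundle \<rho> D"
  unfolding left_symmetric_algebroid_def sections_plus
  using anchored_plus right_anchored_plus curvature_plus_plus_plus by blast

lemma left_symmetric_dual: "left_symmetric_algebroid M (dual_bundle plus_bundle) dual_anchor dual_product"
  unfolding left_symmetric_algebroid_def
proof (intro conjI ballI anchored_dual right_anchored_dual)
  fix \<alpha> \<beta> \<gamma> assume abc: "\<alpha> \<in> \<Gamma>*" "\<beta> \<in> \<Gamma>*" "\<gamma> \<in> \<Gamma>*"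
  note i = G_in[OF abc(1)] G_in[OF abc(2)] G_in[OF abc(3)]
  note m = sharp_sections[OF abc(1)] sharp_sections[OF abc(2)] sharp_sections[OF abc(3)]
  \<comment> \<open>\<open>D\<close> preserves sections of C, so the \<open>G\<close> after the
    inner \<open>F\<close> cancels it. The same remark about the bracket makes the whole curvature
    transport.\<close>
  have 1: "dual_product a (dual_product b \<gamma>) = F (D (G a) (D (G b) (G \<gamma>)))" if "b \<in> \<Gamma>*" for a b
    by (simp add: dual_product_def G_F_minus[OF D_minus[OF G_in[OF that] m(3)]])
  have "bracket_of dual_product \<alpha> \<beta> = F (bracket_of D (G \<alpha>) (G \<beta>))"
    by (simp add: bracket_of_def dual_product_def F_diff D_in i)
  moreover have "bracket_of D (G \<alpha>) (G \<beta>) \<in> sec_minus"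
    unfolding bracket_of_def by (intro subspace_diff subspace_sec_minus D_minus i m)
  ultimately have 2: "dual_product (bracket_of dual_product \<alpha> \<beta>) \<gamma> = F (D (bracket_of D (G \<alpha>) (G \<beta>)) (G \<gamma>))"
    by (simp add: dual_product_def G_F_minus)
  have "curvature dual_product \<alpha> \<beta> \<gamma> = F (curvature D (G \<alpha>) (G \<beta>) (G \<gamma>))"
    unfolding curvature_def 1[OF abc(2)] 1[OF abc(1)] 2
    by (simp add: F_diff sections_diff[OF prebundle_A] D_in bracket_of_in[OF anchored_A connection_D] i)
  also have "\<dots> = 0"
    unfolding curvature_minus_minus_minus[OF m] by (rule F_plus[OF subspace_0[OF subspace_sec_plus]])
  finally show "curvature dual_product \<alpha> \<beta> \<gamma> = 0" .
qed

subsection \<open>The isomorphism\<close>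

text \<open>The second component needs no projection onto C, since \<open>flat\<close> annihilates
  B.\<close>

definition split_map :: "'m \<Rightarrow> 'w \<Rightarrow> 'w \<times> ('w \<Rightarrow> real)"
  where "split_map x u = (proj_plus x u, flat x u)"

definition merge_map :: "'m \<Rightarrow> 'w \<times> ('w \<Rightarrow> real) \<Rightarrow> 'w"
  where "merge_map x p = fst p + sharp x (snd p)"

abbreviation split_section ("H") where "H \<equiv> on_sections M split_map"
abbreviation sum_connection ("\<nabla>") where "\<nabla> \<equiv> phi_connection M plus_bundle \<rho> D dual_anchor dual_product"

lemmas split_pair = anchored_plus right_anchored_plus anchored_dual right_anchored_dual

lemma H_join: "H a = join (P\<^sub>+ a) (F a)"
  by (rule ext) (simp add: on_sections_def split_map_def zero_prod_def)

lemma proj_plus_lin: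
  assumes x: "x \<in> pts M" shows "lin_on (fib A x) (proj_plus x)"
  by (rule lin_onI)
    (simp_all add: proj_plus_def lin_on_add[OF K_lin[OF x]] lin_on_scale[OF K_lin[OF x]] algebra_simps)

lemma split_map_lin:
  assumes x: "x \<in> pts M" shows "lin_on (fib A x) (split_map x)"
  by (rule lin_onI)
    (simp_all add: split_map_def lin_on_add[OF proj_plus_lin[OF x]] lin_on_scale[OF proj_plus_lin[OF x]]
      lin_on_add[OF flat_lin[OF x]] lin_on_scale[OF flat_lin[OF x]])

lemma H_in: "a \<in> sections M A \<Longrightarrow> H a \<in> sections M (phi_bundle plus_bundle)"
  unfolding H_join by (rule phi_join_in[OF split_pair]) (simp_all add: sections_plus proj_plus_sections flat_sections)

lemma H_diff:
  assumes "a \<in> sections M A" "b \<in> sections M A" shows "H (a - b) = H a - H b"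
proof
  fix x show "H (a - b) x = (H a - H b) x"
  proof (cases "x \<in> pts M")
    case True
    then show ?thesis
      using lin_on_diff[OF split_map_lin[OF True] vbD(1)[OF bundle_A True] sectionsD(1)[OF assms(1) True] sectionsD(1)[OF assms(2) True]]
      by simp
  qed (simp add: on_sections_def)
qed

lemma H_plus: "X \<in> sec_plus \<Longrightarrow> H X = join X 0"
  by (simp add: H_join proj_section_id F_plus)

lemma H_minus:
  assumes a: "a \<in> sec_minus" shows "H a = join 0 (F a)"
proof -
  have "P\<^sub>+ a = 0"
    by (rule ext) (use sec_minusD(2)[OF a] in \<open>auto simp: on_sections_def proj_minus_id(2)\<close>)
  then show ?thesis by (simp add: H_join)
qed

lemma bundle_iso_split: "bundle_iso M A (phi_bundle plus_bundle) split_map"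
  unfolding bundle_iso_def
proof (intro conjI exI[of _ merge_map] ballI)
  note pvb = phi_vb[OF split_pair] and pf = phi_fib[OF split_pair]
  show "bundle_map M A (phi_bundle plus_bundle) split_map"
  proof (rule bundle_mapI[OF bundle_A prebundle_vb[OF pvb] split_map_lin _ H_in])
    fix x v assume "x \<in> pts M" "v \<in> fib A x"
    then show "split_map x v \<in> fib (phi_bundle plus_bundle) x"
      by (simp add: pf split_map_def proj_plus_in flat_in)
  qed
  show "bundle_map M (phi_bundle plus_bundle) A merge_map"
  proof (rule bundle_mapI[OF pvb prebundle_A])
    fix x assume x: "x \<in> pts M"
    show "lin_on (fib (phi_bundle plus_bundle) x) (merge_map x)"
      unfolding pf
      by (rule lin_onI)
        (auto simp: merge_map_def lin_on_add[OF sharp_lin[OF x]] lin_on_scale[OF sharp_lin[OF x]] scaleR_add_right)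
    fix v assume "v \<in> fib (phi_bundle plus_bundle) x"
    then show "merge_map x v \<in> fib A x"
      using subspace_add[OF fib_subspace[OF x] fib_plusD[OF x] fib_minusD[OF x sharp_in[OF x]]]
      by (auto simp: pf merge_map_def)
  next
    fix s assume s: "s \<in> sections M (phi_bundle plus_bundle)"
    note s' = phi_sectionsD[OF split_pair s]
    have "on_sections M merge_map s = (fst \<circ> s) + G (snd \<circ> s)"
      by (rule ext) (use sectionsD(2)[OF s] in \<open>auto simp: on_sections_def merge_map_def\<close>)
    then show "on_sections M merge_map s \<in> sections M A"
      using sections_add[OF prebundle_A sec_plusD(1) G_in[OF s'(2)], of "fst \<circ> s"] s'(1) by (simp add: sections_plus)
  qed
  fix x assume x: "x \<in> pts M"
  show "merge_map x (split_map x u) = u" if "u \<in> fib A x" for u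
    using proj_sum[OF x, of u] sharp_flat[OF x that] by (simp add: merge_map_def split_map_def)
  show "split_map x (merge_map x p) = p" if p: "p \<in> fib (phi_bundle plus_bundle) x" for p
  proof -
    have v: "fst p \<in> fib_plus x" and b: "snd p \<in> fib (dual_bundle plus_bundle) x" using p by (auto simp: pf)
    note w = sharp_in[OF x b]
    show ?thesis
      using lin_on_add[OF proj_plus_lin[OF x] fib_plusD[OF x v] fib_minusD[OF x w]]
        lin_on_add[OF flat_lin[OF x] fib_plusD[OF x v] fib_minusD[OF x w]]
      by (simp add: split_map_def merge_map_def proj_plus_id(1)[OF v] proj_minus_id(2)[OF w]
          flat_plus[OF x v] flat_sharp[OF x b])
  qed
qed

text \<open>Pairing with beta is the metric with \<open>G\<close> beta. For one section in C and one
  in B the compatibility of \<open>D\<close> with the metric is therefore literally the equation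
  that defines the dual product.\<close>

lemma dual_right_eq:
  assumes a: "a \<in> sec_minus" and Y: "Y \<in> sec_plus"
  shows "dual_right M plus_bundle dual_anchor dual_product (F a) Y = D a Y"
proof -
  note ai = sec_minusD(1)[OF a] and Yi = sec_plusD(1)[OF Y]
  have Fa: "F a \<in> \<Gamma>*" by (rule flat_sections[OF ai])
  have Y': "Y \<in> sections M plus_bundle" using Y by (simp add: sections_plus)
  have DY: "D a Y \<in> sections M plus_bundle" using D_plus[OF ai Y] by (simp add: sections_plus)
  show ?thesis
  proof (rule section_eq_pairingI[OF vb_plus dual_right_in[OF split_pair Fa Y'] DY])
    fix \<beta> x assume b: "\<beta> \<in> \<Gamma>*" and x: "x \<in> pts M"
    let ?c = "G \<beta>"
    have c: "?c \<in> sec_minus" by (rule sharp_sections[OF b])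
    note ci = sec_minusD(1)[OF c]
    have p: "pairing \<beta> Z y = g y (?c y) (Z y)" if "Z \<in> sec_plus" "y \<in> pts M" for Z y
      using pairing_F[OF ci that] by (simp only: F_G[OF b])
    have "act dual_anchor (F a) (pairing \<beta> Y) x = act \<rho> a (pairing \<beta> Y) x"
      by (simp add: act_dual_anchor[OF x] G_F_minus[OF a])
    also have "\<dots> = act \<rho> a (\<lambda>y. g y (?c y) (Y y)) x"
      by (rule act_cong[OF anchored_A ai x pairing_smooth[OF vb_plus b Y']]) (rule p[OF Y])
    also have "\<dots> = g x (D a ?c x) (Y x) + g x (?c x) (D a Y x)"
      using metric_compatible ai ci Yi x unfolding metric_product_def by simp
    also have "g x (D a ?c x) (Y x) = pairing (dual_product (F a) \<beta>) Y x"
      by (simp only: dual_product_def G_F_minus[OF a] pairing_F[OF D_in[OF ai ci] Y x])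
    also have "g x (?c x) (D a Y x) = pairing \<beta> (D a Y) x"
      by (rule p[OF D_plus[OF ai Y] x, symmetric])
    finally show "pairing \<beta> (dual_right M plus_bundle dual_anchor dual_product (F a) Y) x = pairing \<beta> (D a Y) x"
      using dual_right_pairing[OF split_pair Fa Y' b x] by simp
  qed
qed

text \<open>The same reading of metric compatibility, for derivatives along B. It holds for b in all
  of A because \<open>F\<close> kills the B-component of b and also that of its derivative.\<close>

lemma dual_left_eq:
  assumes X: "X \<in> sec_plus" and b: "b \<in> sections M A"
  shows "dual_left M plus_bundle \<rho> D X (F b) = F (D X b)"
proof -
  note Xi = sec_plusD(1)[OF X]
  have X': "X \<in> sections M plus_bundle" using X by (simp add: sections_plus)
  have Fb: "F b \<in> \<Gamma>*" by (rule flat_sections[OF b])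
  show ?thesis
  proof (rule dual_section_eqI[OF vb_plus dual_left_in[OF split_pair X' Fb] flat_sections[OF D_in[OF Xi b]]])
    fix Y x assume Y': "Y \<in> sections M plus_bundle" and x: "x \<in> pts M"
    then have Y: "Y \<in> sec_plus" by (simp add: sections_plus)
    note Yi = sec_plusD(1)[OF Y]
    have "act \<rho> X (pairing (F b) Y) x = act \<rho> X (\<lambda>y. g y (b y) (Y y)) x"
      by (rule act_cong[OF anchored_A Xi x pairing_smooth[OF vb_plus Fb Y']]) (rule pairing_F[OF b Y])
    also have "\<dots> = g x (D X b x) (Y x) + g x (b x) (D X Y x)"
      using metric_compatible Xi b Yi x unfolding metric_product_def by simp
    finally show "pairing (dual_left M plus_bundle \<rho> D X (F b)) Y x = pairing (F (D X b)) Y x"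
      using dual_left_pairing[OF split_pair X' Fb Y' x] pairing_F[OF D_in[OF Xi b] Y x] pairing_F[OF b D_plus[OF Xi Y] x]
      by simp
  qed
qed

text \<open>Decomposing both arguments, the pure blocks of the sum connection are the two
  restrictions of \<open>D\<close>, and \<open>dual_right_eq\<close> and \<open>dual_left_eq\<close>
  identify the mixed ones. Brackets and curvatures are expressions in the connection and follow
  along.\<close>

lemma connection_transport:
  assumes a: "a \<in> sections M A" and b: "b \<in> sections M A" shows "\<nabla> (H a) (H b) = H (D a b)"
proof -
  note ap = proj_plus_sections[OF a] and am = proj_minus_sections[OF a] and bp = proj_plus_sections[OF b]
    and bm = proj_minus_sections[OF b]
  note i = sec_plusD(1)[OF ap] sec_minusD(1)[OF am] sec_plusD(1)[OF bp] sec_minusD(1)[OF bm]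
  have Fm: "F c = F (P\<^sub>- c)" if c: "c \<in> sections M A" for c
    using F_G[OF flat_sections[OF c]] by (simp only: G_F[OF c])
  have split_b: "D c b = D c (P\<^sub>+ b) + D c (P\<^sub>- b)" if "c \<in> sections M A" for c
    using lin_on_add[OF rap_lin_right[OF connection_D that] i(3,4)] by (simp only: proj_sections_sum[OF b])
  have split_a: "D a c = D (P\<^sub>+ a) c + D (P\<^sub>- a) c" if "c \<in> sections M A" for c
    using lin_on_add[OF rap_lin_left[OF connection_D that] i(1,2)] by (simp only: proj_sections_sum[OF a])
  have "dual_right M plus_bundle dual_anchor dual_product (F a) (P\<^sub>+ b) = D (P\<^sub>- a) (P\<^sub>+ b)"
    using dual_right_eq[OF am bp] by (simp only: Fm[OF a, symmetric])
  then have 1: "D (P\<^sub>+ a) (P\<^sub>+ b) + dual_right M plus_bundle dual_anchor dual_product (F a) (P\<^sub>+ b) = D a (P\<^sub>+ b)"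
    using split_a[OF i(3)] by simp
  have "dual_product (F a) (F b) = F (D (P\<^sub>- a) (P\<^sub>- b))"
    by (simp only: dual_product_def G_F[OF a] G_F[OF b])
  moreover have "dual_left M plus_bundle \<rho> D (P\<^sub>+ a) (F b) = F (D (P\<^sub>+ a) (P\<^sub>- b))"
    using dual_left_eq[OF ap i(4)] by (simp only: Fm[OF b, symmetric])
  ultimately have 2: "dual_left M plus_bundle \<rho> D (P\<^sub>+ a) (F b) + dual_product (F a) (F b) = F (D a (P\<^sub>- b))"
    using F_add[OF D_in[OF i(1,4)] D_in[OF i(2,4)]] split_a[OF i(4)] by simp
  have Dp: "D a (P\<^sub>+ b) \<in> sec_plus" and Dm: "D a (P\<^sub>- b) \<in> sec_minus" by (rule D_plus[OF a bp], rule D_minus[OF a bm])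
  have "H (D a b) = H (D a (P\<^sub>+ b)) + H (D a (P\<^sub>- b))"
    unfolding split_b[OF a]
    by (rule on_sections_lin(1)[where E = A, OF split_map_lin sec_plusD(1)[OF Dp] sec_minusD(1)[OF Dm]])
  also have "\<dots> = join (D a (P\<^sub>+ b)) (F (D a (P\<^sub>- b)))"
    by (simp add: H_plus[OF Dp] H_minus[OF Dm] join_add)
  finally show ?thesis
    by (simp add: phi_connection_eq[OF split_pair] H_join[of a] H_join[of b] 1 2)
qed

lemma bracket_transport:
  assumes "a \<in> sections M A" "b \<in> sections M A"
  shows "bracket_of \<nabla> (H a) (H b) = H (bracket_of D a b)"
  by (simp add: bracket_of_def connection_transport assms H_diff D_in)

lemma curvature_transport:
  assumes abc: "a \<in> sections M A" "b \<in> sections M A" "c \<in> sections M A"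
  shows "curvature \<nabla> (H a) (H b) (H c) = H (curvature D a b c)"
  by (simp add: curvature_def connection_transport bracket_transport abc H_diff D_in
      sections_diff[OF prebundle_A] bracket_of_in[OF anchored_A connection_D])

lemma lie_extendible_split: "lie_extendible M plus_bundle \<rho> D dual_anchor dual_product"
  unfolding lie_extendible_def Let_def sections_plus
proof (intro conjI ballI left_symmetric_plus left_symmetric_dual)
  fix X Y \<alpha> assume X: "X \<in> sec_plus" and Y: "Y \<in> sec_plus" and a: "\<alpha> \<in> \<Gamma>*"
  note m = sharp_sections[OF a]
  \<comment> \<open>Sections of either summand are images under \<open>H\<close>, so the condition
    is the transported symmetry of the curvature of \<open>D\<close>.\<close>
  have j: "join 0 \<alpha> = H (G \<alpha>)" by (simp add: H_minus[OF m] F_G[OF a])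
  show "curvature \<nabla> (join X 0) (join 0 \<alpha>) (join Y 0) = curvature \<nabla> (join Y 0) (join 0 \<alpha>) (join X 0)"
    unfolding j H_plus[OF X, symmetric] H_plus[OF Y, symmetric]
    by (simp only: curvature_transport[OF sec_plusD(1)[OF X] sec_minusD(1)[OF m] sec_plusD(1)[OF Y]]
        curvature_transport[OF sec_plusD(1)[OF Y] sec_minusD(1)[OF m] sec_plusD(1)[OF X]]
        curvature_plus_plus_minus(2)[OF X Y m])
next
  fix X \<alpha> \<beta> assume X: "X \<in> sec_plus" and a: "\<alpha> \<in> \<Gamma>*" and b: "\<beta> \<in> \<Gamma>*"
  note m = sharp_sections[OF a] and n = sharp_sections[OF b]
  have j: "join 0 \<alpha> = H (G \<alpha>)" "join 0 \<beta> = H (G \<beta>)" by (simp_all add: H_minus[OF m] H_minus[OF n] F_G[OF a] F_G[OF b])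
  show "curvature \<nabla> (join 0 \<alpha>) (join X 0) (join 0 \<beta>) = curvature \<nabla> (join 0 \<beta>) (join X 0) (join 0 \<alpha>)"
    unfolding j H_plus[OF X, symmetric]
    by (simp only: curvature_transport[OF sec_minusD(1)[OF m] sec_plusD(1)[OF X] sec_minusD(1)[OF n]]
        curvature_transport[OF sec_minusD(1)[OF n] sec_plusD(1)[OF X] sec_minusD(1)[OF m]]
        curvature_minus_minus_plus(2)[OF m n X])
qed

lemma para_kaehler_iso_split:
  "para_kaehler_iso M A \<rho> br g K (phi_bundle plus_bundle) (phi_anchor \<rho> dual_anchor)
     (phi_bracket M plus_bundle \<rho> D dual_anchor dual_product) phi_metric phi_K split_map"
  unfolding para_kaehler_iso_def
proof (intro conjI ballI bundle_iso_split)
  fix x u assume x: "x \<in> pts M" and u: "u \<in> fib A x"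
  note p = proj_plus_in[OF x u] and q = proj_minus_in[OF x u]
  show "phi_anchor \<rho> dual_anchor x (split_map x u) = \<rho> x u"
    using lin_on_add[OF bundle_mapD(1)[OF \<rho>_map x] fib_plusD[OF x p] fib_minusD[OF x q]]
    by (simp add: phi_anchor_def split_map_def dual_anchor_def sharp_flat[OF x u] proj_sum[OF x])
  have Ku: "K x u \<in> fib A x" by (rule K_in[OF x u])
  have "proj_plus x (K x u) = proj_plus x u"
    by (simp add: proj_plus_def K_square[OF x u] add.commute)
  \<comment> \<open>On B the operator K is the identity, so skew-symmetry reads g(K u, v) = - g(u,
    v) there.\<close>
  moreover have "flat x (K x u) = - flat x u"
    using K_skew[OF x u fib_plusD[OF x]] by (auto simp: flat_def fun_eq_iff fib_plus_def)
  ultimately show "split_map x (K x u) = phi_K x (split_map x u)"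
    by (simp add: split_map_def phi_K_def)
next
  fix a b assume a: "a \<in> sections M A" and b: "b \<in> sections M A"
  show "H (br a b) = phi_bracket M plus_bundle \<rho> D dual_anchor dual_product (H a) (H b)"
    by (simp add: phi_bracket_eq bracket_transport[OF a b] torsion_free[OF a b])
next
  fix x u v assume x: "x \<in> pts M" and u: "u \<in> fib A x" and v: "v \<in> fib A x"
  note pu = proj_plus_in[OF x u] and qu = proj_minus_in[OF x u] and pv = proj_plus_in[OF x v] and qv = proj_minus_in[OF x v]
  note pu' = fib_plusD[OF x pu] and qu' = fib_minusD[OF x qu] and pv' = fib_plusD[OF x pv] and qv' = fib_minusD[OF x qv]
  have eu: "g x u w = g x (proj_plus x u) w + g x (proj_minus x u) w" if "w \<in> fib A x" for w
    using g_add_left[OF x that pu' qu'] by (simp only: proj_sum[OF x])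
  have ev: "g x w v = g x w (proj_plus x v) + g x w (proj_minus x v)" if "w \<in> fib A x" for w
    using g_add_right[OF x that pv' qv'] by (simp only: proj_sum[OF x])
  \<comment> \<open>Each of the two terms picks one of the mixed products of the components of u and
    v; by isotropy these make up all of g(u, v).\<close>
  have "phi_metric x (split_map x u) (split_map x v) = g x u (proj_plus x v) + g x v (proj_plus x u)"
    using pu pv by (simp add: phi_metric_eq split_map_def flat_def)
  also have "\<dots> = g x (proj_minus x u) (proj_plus x v) + g x (proj_plus x u) (proj_minus x v)"
    using eu[OF pv'] ev[OF pu'] g_sym[OF x v pu'] isotropic_plus[OF x pu pv] by simp
  also have "\<dots> = g x u v"
    using eu[OF v] ev[OF pu'] ev[OF qu'] isotropic_plus[OF x pu pv] isotropic_minus[OF x qu qv] by simp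
  finally show "phi_metric x (split_map x u) (split_map x v) = g x u v" .
qed

end

theorem theorem3p1:
  fixes M :: "('m, 'e::real_inner) mfd"
  assumes "smooth_manifold M"
  shows
    "(\<forall>(B :: ('m, 'v::real_vector) vbundle) \<rho>\<^sub>0 S \<rho>\<^sub>1 T.
        lie_extendible M B \<rho>\<^sub>0 S \<rho>\<^sub>1 T \<longrightarrow>
        para_kaehler M (phi_bundle B) (phi_anchor \<rho>\<^sub>0 \<rho>\<^sub>1) (phi_bracket M B \<rho>\<^sub>0 S \<rho>\<^sub>1 T)
          phi_metric phi_K) \<and>
     (\<forall>(A :: ('m, 'w::real_vector) vbundle) \<rho> br g K.
        para_kaehler M A \<rho> br g K \<longrightarrow>
        (\<exists>(B :: ('m, 'w) vbundle) \<rho>\<^sub>0 S \<rho>\<^sub>1 T h.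
           lie_extendible M B \<rho>\<^sub>0 S \<rho>\<^sub>1 T \<and>
           para_kaehler_iso M A \<rho> br g K
             (phi_bundle B) (phi_anchor \<rho>\<^sub>0 \<rho>\<^sub>1) (phi_bracket M B \<rho>\<^sub>0 S \<rho>\<^sub>1 T)
             phi_metric phi_K h))"
proof (intro conjI allI impI)
  interpret manifold M by (rule manifold.intro[OF assms])
  show "para_kaehler M (phi_bundle B) (phi_anchor \<rho>\<^sub>0 \<rho>\<^sub>1) (phi_bracket M B \<rho>\<^sub>0 S \<rho>\<^sub>1 T) phi_metric phi_K"
    if "lie_extendible M B \<rho>\<^sub>0 S \<rho>\<^sub>1 T" for B :: "('m, 'v) vbundle" and \<rho>\<^sub>0 S \<rho>\<^sub>1 T
    using that by (rule lie_extendible_para_kaehler)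
next
  fix A :: "('m, 'w) vbundle" and \<rho> br g K
  assume pk: "para_kaehler M A \<rho> br g K"
  then obtain D where "levi_civita M A \<rho> br g D" and
    "\<forall>a\<in>sections M A. \<forall>b\<in>sections M A. D a (on_sections M K b) = on_sections M K (D a b)"
    unfolding para_kaehler_def by (elim exE conjE)
  with pk interpret para_kaehler_connection M A \<rho> br g K D
    using assms
    by unfold_locales (simp_all add: para_kaehler_def bundle_iso_def)
  show "\<exists>(B :: ('m, 'w) vbundle) \<rho>\<^sub>0 S \<rho>\<^sub>1 T h. lie_extendible M B \<rho>\<^sub>0 S \<rho>\<^sub>1 T \<and>
      para_kaehler_iso M A \<rho> br g K (phi_bundle B) (phi_anchor \<rho>\<^sub>0 \<rho>\<^sub>1) (phi_bracket M B \<rho>\<^sub>0 S \<rho>\<^sub>1 T)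
        phi_metric phi_K h"
    by ((rule exI)+, rule conjI[OF lie_extendible_split para_kaehler_iso_split])
qed

end
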